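(* Let $n\ge 1$, let $g \in H(\mathbb D^n)$, $g(z) = \sum_{k \in \mathbb Z_+^n} c_k z^k$. Let $\alpha>0$, $\beta>0$ and let $p,q,s,t$ be positive real numbers such that $t\leq 1$, $\frac{t}{2}< s \leq t < \infty$, $0 < \max(p,q) \leq s <\infty$, and $\beta+\frac{1}{t}<\alpha + \frac{1}{p} < \frac{2}{t}$. Let $m \in \mathbb N$ with $m > \frac{2}{t}-1$. Then: $1^\circ$. $\{ c_k \}_{k \in \mathbb Z_+^n} \in M_T(F^{p,q}_\alpha (\mathbb D^n), F^{t,s}_\beta(\mathbb D^n))$ if and only if $$\sup_{r \in I^n} M_t(D^mg, r)(1-r)^{m+1 - \frac{1}{p} + \beta - \alpha} < \infty.$$ $2^\circ$. $\{ c_k \}_{k \in \mathbb Z_+^n} \in M_T(A^{p,q}_\alpha (\mathbb D^n), F^{t,s}_\beta(\mathbb D^n))$ if and only if $$\sup_{r \in I^n} M_t(D^mg, r)(1-r)^{m+1 - \frac{1}{p} + \beta - \alpha} < \infty.$$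
   Context: Notation. $\mathbb D=\{z\in\mathbb C:|z|<1\}$, $\mathbb T=\partial\mathbb D$, $\mathbb D^n$ is the unit polydisc in $\mathbb C^n$, $\mathbb T^n$ its distinguished boundary with normalized Lebesgue measure $d\xi$, $I=[0,1)$, $\mathbb Z_+=\{0,1,2,\dots\}$, and $dR=dR_1\cdots dR_n$ is Lebesgue measure on $I^n$. $H(\mathbb D^n)$ is the space of holomorphic functions on $\mathbb D^n$. For $k\in\mathbb Z_+^n$ and $z\in\mathbb C^n$, $z^k=z_1^{k_1}\cdots z_n^{k_n}$. For $r\in I^n$ and $\gamma\in\mathbb R$, $(1-r)^\gamma=\prod_{j=1}^n(1-r_j)^\gamma$; for $r\in I^n$, $\xi\in\mathbb T^n$, $r\xi=(r_1\xi_1,\dots,r_n\xi_n)$. Fractional derivative: for $\beta>-1$ and $f(z)=\sum_{k\in\mathbb Z_+^n}a_kz^k\in H(\mathbb D^n)$, $$D^\beta f(z)=\sum_{k\in\mathbb Z_+^n}\left(\prod_{j=1}^n\frac{\Gamma(k_j+\beta+1)}{\Gamma(\beta+1)\Gamma(k_j+1)}\right)a_kz^k .$$ Integral means: for $0<p<\infty$, $r\in I^n$, $M_p(f,r)=\left(\int_{\mathbb T^n}|f(r\xi)|^p\,d\xi\right)^{1/p}$. Spaces, for $0<p,q<\infty$ and $\alpha>0$: $A^{p,q}_\alpha(\mathbb D^n)$ is the space of $f\in H(\mathbb D^n)$ with $$\|f\|_{A^{p,q}_\alpha}^q=\int_{I^n}M_p^q(f,R)(1-R)^{\alpha q-1}\,dR<\infty,$$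 and $F^{p,q}_\alpha(\mathbb D^n)$ is the space of $f\in H(\mathbb D^n)$ with $$\|f\|_{F^{p,q}_\alpha}^p=\int_{\mathbb T^n}\left(\int_{I^n}|f(R\xi)|^q(1-R)^{\alpha q-1}\,dR\right)^{p/q}d\xi<\infty.$$ Coefficient multipliers: for quasi-normed subspaces $X,Y$ of $H(\mathbb D^n)$, $M_T(X,Y)$ is the set of all sequences $c=\{c_k\}_{k\in\mathbb Z_+^n}$ such that for every $f(z)=\sum_k a_kz^k$ in $X$ the function $h(z)=\sum_k c_ka_kz^k$ belongs to $Y$. *)

theory Defs
  imports "HOL-Analysis.Analysis"
begin

section \<open>Holomorphic functions on the polydisc\<close>

definition polydisc :: "(complex ^ 'n) set" where
  "polydisc = {z. \<forall>j. norm (z $ j) < 1}"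

text \<open>
  Functions are total on \<open>complex ^ 'n\<close>; only their values on the polydisc matter.  Holomorphic
  means Frechet differentiable with complex-linear derivative (\<open>has_derivative\<close> alone only
  provides real linearity).
\<close>

definition hol_polydisc :: "(complex ^ 'n \<Rightarrow> complex) set" where
  "hol_polydisc =
     {f. \<forall>z\<in>polydisc. \<exists>f'. (f has_derivative f') (at z) \<and> (\<forall>c v. f' (c *s v) = c * f' v)}"

definition vmonom :: "('n::finite \<Rightarrow> nat) \<Rightarrow> complex ^ 'n \<Rightarrow> complex" where
  "vmonom k z = (\<Prod>j\<in>UNIV. (z $ j) ^ k j)"

text \<open>\<open>f(z) = \<Sum>\<^sub>k a\<^sub>k z\<^sup>k\<close> on the polydisc, with unordered (equivalently, absolute) convergence.\<close>

definition has_expansion :: "(complex ^ 'n \<Rightarrow> complex) \<Rightarrow> (('n::finite \<Rightarrow> nat) \<Rightarrow> complex) \<Rightarrow> bool" where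
  "has_expansion f a \<longleftrightarrow> (\<forall>z\<in>polydisc. ((\<lambda>k. a k * vmonom k z) has_sum f z) UNIV)"

definition taylor_coeff :: "(complex ^ 'n \<Rightarrow> complex) \<Rightarrow> ('n::finite \<Rightarrow> nat) \<Rightarrow> complex" where
  "taylor_coeff f = (THE a. has_expansion f a)"

definition frac_deriv :: "real \<Rightarrow> (complex ^ 'n::finite \<Rightarrow> complex) \<Rightarrow> complex ^ 'n \<Rightarrow> complex" where
  "frac_deriv \<beta> f z =
     (\<Sum>\<^sub>\<infinity>k. of_real (\<Prod>j\<in>UNIV. Gamma (real (k j) + \<beta> + 1) / (Gamma (\<beta> + 1) * Gamma (real (k j) + 1)))
            * taylor_coeff f k * vmonom k z)"


section \<open>Integration over the unit cube and the torus\<close>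

definition unit_cube :: "(real ^ 'n) set" where
  "unit_cube = {r. \<forall>j. 0 \<le> r $ j \<and> r $ j < 1}"

definition torus :: "(complex ^ 'n) set" where
  "torus = {\<xi>. \<forall>j. norm (\<xi> $ j) = 1}"

text \<open>Normalized Lebesgue measure on the torus, as the image of Lebesgue measure on the cube.\<close>

definition torus_param :: "real ^ 'n \<Rightarrow> complex ^ 'n" where
  "torus_param \<theta> = (\<chi> j. cis (2 * pi * \<theta> $ j))"

definition torus_measure :: "(complex ^ 'n::finite) measure" where
  "torus_measure = distr (restrict_space lborel unit_cube) (restrict_space borel torus) torus_param"

lemma torus_param_measurable:
  "torus_param \<in> restrict_space lborel unit_cube \<rightarrow>\<^sub>M restrict_space borel (torus :: (complex ^ 'n::finite) set)"
proof -
  have "continuous_on UNIV (torus_param :: real ^ 'n \<Rightarrow> complex ^ 'n)"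
    unfolding torus_param_def by (intro continuous_intros)
  then have "torus_param \<in> borel_measurable (borel :: (real ^ 'n) measure)"
    by (rule borel_measurable_continuous_onI)
  then have "torus_param \<in> restrict_space lborel unit_cube \<rightarrow>\<^sub>M (borel :: (complex ^ 'n) measure)"
    by (intro measurable_restrict_space1) simp
  then show ?thesis
    by (rule measurable_restrict_space2[rotated]) (auto simp: torus_def torus_param_def)
qed

lemma sets_unit_cube: "unit_cube \<in> sets (lborel :: (real ^ 'n::finite) measure)"
proof -
  have "unit_cube = (\<Inter>j. {r :: real ^ 'n. 0 \<le> r $ j \<and> r $ j < 1})"
    by (auto simp: unit_cube_def)
  also have "\<dots> \<in> sets borel"
    by (intro sets.finite_INT) (auto intro!: borel_measurable_continuous_onI continuous_intros)
  finally show ?thesis by simp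
qed

lemma emeasure_unit_cube: "emeasure lborel (unit_cube :: (real ^ 'n::finite) set) = 1"
proof (rule antisym)
  have 1: "\<And>b. b \<in> Basis \<Longrightarrow> (0::real^'n) \<bullet> b \<le> (\<chi> j. 1) \<bullet> b"
    "(\<Prod>b\<in>Basis. ((\<chi> j. 1) - (0::real^'n)) \<bullet> b) = 1"
    by (auto simp: Basis_vec_def inner_axis intro!: prod.neutral)
  have "emeasure lborel (unit_cube :: (real ^ 'n) set) \<le> emeasure lborel (cbox (0::real^'n) (\<chi> j. 1))"
    by (rule emeasure_mono) (auto simp: unit_cube_def mem_box_cart less_imp_le)
  also have "\<dots> = 1" using 1 by (subst emeasure_lborel_cbox) auto
  finally show "emeasure lborel (unit_cube :: (real ^ 'n) set) \<le> 1" .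
  have "1 = emeasure lborel (box (0::real^'n) (\<chi> j. 1))"
    using 1 by (subst emeasure_lborel_box) auto
  also have "\<dots> \<le> emeasure lborel (unit_cube :: (real ^ 'n) set)"
    by (rule emeasure_mono[OF _ sets_unit_cube]) (auto simp: unit_cube_def mem_box_cart less_imp_le)
  finally show "1 \<le> emeasure lborel (unit_cube :: (real ^ 'n) set)" .
qed

lemma emeasure_torus: "emeasure torus_measure (torus :: (complex ^ 'n::finite) set) = 1"
proof -
  have "torus_param -` (torus :: (complex ^ 'n) set) = UNIV"
    by (auto simp: torus_def torus_param_def)
  moreover have "emeasure (restrict_space lborel unit_cube) (unit_cube :: (real ^ 'n) set) = 1"
    using sets_unit_cube by (subst emeasure_restrict_space) (auto simp: emeasure_unit_cube)
  moreover have "(torus :: (complex ^ 'n) set) \<in> sets (restrict_space borel torus)"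
    by (auto simp: sets_restrict_space intro!: image_eqI[of _ _ UNIV])
  ultimately show ?thesis
    unfolding torus_measure_def
    by (simp add: emeasure_distr[OF torus_param_measurable] space_restrict_space)
qed

text \<open>The power \<open>x\<^sup>a\<close> on \<open>[0,\<infinity>]\<close> for \<open>a > 0\<close>.\<close>

definition ennpowr :: "ennreal \<Rightarrow> real \<Rightarrow> ennreal" where
  "ennpowr x a = (if x = \<infinity> then \<infinity> else ennreal (enn2real x powr a))"

text \<open>The product \<open>(1 - r)\<^sup>\<gamma>\<close> over all coordinates.\<close>

definition cube_weight :: "real ^ 'n::finite \<Rightarrow> real \<Rightarrow> real" where
  "cube_weight r \<gamma> = (\<Prod>j\<in>UNIV. (1 - r $ j) powr \<gamma>)"

definition rmult :: "real ^ 'n \<Rightarrow> complex ^ 'n \<Rightarrow> complex ^ 'n" where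
  "rmult r \<xi> = (\<chi> j. of_real (r $ j) * \<xi> $ j)"

definition int_mean :: "real \<Rightarrow> (complex ^ 'n::finite \<Rightarrow> complex) \<Rightarrow> real ^ 'n \<Rightarrow> ennreal" where
  "int_mean p f r = ennpowr (\<integral>\<^sup>+\<xi>. ennreal (norm (f (rmult r \<xi>)) powr p) \<partial>torus_measure) (1 / p)"


section \<open>Mixed norm spaces and coefficient multipliers\<close>

text \<open>
  The first functional is the \<open>q\<close>-th power of the \<open>A\<close> quasi-norm, the second is the \<open>p\<close>-th power
  of the \<open>F\<close> quasi-norm.
\<close>

definition A_norm_pow :: "real \<Rightarrow> real \<Rightarrow> real \<Rightarrow> (complex ^ 'n::finite \<Rightarrow> complex) \<Rightarrow> ennreal" where
  "A_norm_pow p q \<alpha> f =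
     (\<integral>\<^sup>+R\<in>unit_cube. (ennpowr (int_mean p f R) q * ennreal (cube_weight R (\<alpha> * q - 1))) \<partial>lborel)"

definition A_space :: "real \<Rightarrow> real \<Rightarrow> real \<Rightarrow> (complex ^ 'n::finite \<Rightarrow> complex) set" where
  "A_space p q \<alpha> = {f \<in> hol_polydisc. A_norm_pow p q \<alpha> f < \<infinity>}"

definition F_norm_pow :: "real \<Rightarrow> real \<Rightarrow> real \<Rightarrow> (complex ^ 'n::finite \<Rightarrow> complex) \<Rightarrow> ennreal" where
  "F_norm_pow p q \<alpha> f =
     (\<integral>\<^sup>+\<xi>. ennpowr
        (\<integral>\<^sup>+R\<in>unit_cube. ennreal (norm (f (rmult R \<xi>)) powr q * cube_weight R (\<alpha> * q - 1)) \<partial>lborel)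
        (p / q) \<partial>torus_measure)"

definition F_space :: "real \<Rightarrow> real \<Rightarrow> real \<Rightarrow> (complex ^ 'n::finite \<Rightarrow> complex) set" where
  "F_space p q \<alpha> = {f \<in> hol_polydisc. F_norm_pow p q \<alpha> f < \<infinity>}"

definition coeff_multipliers ::
    "(complex ^ 'n::finite \<Rightarrow> complex) set \<Rightarrow> (complex ^ 'n \<Rightarrow> complex) set \<Rightarrow> (('n \<Rightarrow> nat) \<Rightarrow> complex) set" where
  "coeff_multipliers X Y =
     {c. \<forall>f\<in>X. \<forall>a. has_expansion f a \<longrightarrow> (\<exists>h\<in>Y. has_expansion h (\<lambda>k. c k * a k))}"

end

theory Submission
  imports Defs "HOL-Complex_Analysis.Complex_Analysis" "HOL-Computational_Algebra.Fundamental_Theorem_Algebra"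
begin

text \<open>
  Separately holomorphic functions satisfy \<open>|f|\<^sup>p \<le> P[|f|\<^sup>p]\<close> for every \<open>p > 0\<close>, which yields monotone
  integral means, pointwise bounds, and control of \<open>M\<^sub>p(f, r)\<close> by an integral over a Whitney box at
  \<open>r\<close>.

  Sufficiency: \<open>D\<^sup>m h(r\<^sup>2 \<xi>)\<close> is the average of \<open>\<zeta> \<mapsto> f(r \<zeta>) D\<^sup>m g(r \<xi> \<zeta>\<inverse>)\<close>. Since \<open>t \<le> 1\<close> the pointwise bound turns
  this into a product estimate for \<open>M\<^sub>t\<close>, and integrating back \<open>m\<close> times gives a dyadic convolution inequality
  which puts \<open>h\<close> in \<open>A\<^sup>t\<^sup>,\<^sup>s\<^sub>\<beta>\<close>. Minkowski's inequality embeds this space in \<open>F\<^sup>t\<^sup>,\<^sup>s\<^sub>\<beta>\<close>.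

  Necessity: if the supremum is infinite, a gliding hump \<open>f = \<Sum>\<^sub>i \<delta>\<^sub>i \<Prod>\<^sub>j (1 - \<rho>\<^sub>i\<^sub>j z\<^sub>j)\<^bsup>-(m+1)\<^esup>\<close> lies in the source space,
  while its image \<open>h(z) = \<Sum>\<^sub>i \<delta>\<^sub>i D\<^sup>m g(\<rho>\<^sub>i z)\<close> violates the bound on \<open>M\<^sub>t(h, \<rho>\<^sub>i)\<close> that holds in
  \<open>F\<^sup>t\<^sup>,\<^sup>s\<^sub>\<beta>\<close>. This construction avoids any closed graph argument in the quasi-normed spaces.
\<close>

text \<open>Exponents below 1 leave neither a triangle inequality nor duality, so every bound rests
  on one fact: \<open>|f|^p\<close> lies below its own Poisson integral. Being linear in
  \<open>|f|^p\<close>, it can be integrated over angles, averaged over radii and combined with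
  Jensen; this is how the \<open>F\<close> norm, with its radial integral inside a power, becomes
  comparable with integral means.

  The hypothesis \<open>m > 2/t - 1\<close> enters twice. It gives
  \<open>m + 1 > 2/t > \<alpha> + 1/p\<close>, so that the norm of a test function is governed by
  its singularity; and it gives \<open>m + 1 - 1/t > 0\<close>, so that the loss
  \<open>2^((1/t - 1)|k|)\<close> of the pointwise bound is beaten by the factor
  \<open>2^(-m|k|)\<close> gained from integrating back. In what remains, the integration index
  \<open>k\<close> and the target index \<open>l\<close> meet only in their coordinatewise minimum.

  Each direction treats both source spaces by one argument: sufficiency needs only a dyadic sum of
  means of \<open>f\<close>, necessity only a countable quasi-triangle inequality and the size of
  the test functions.\<close>

no_notation fps_nth (infixl \<open>$\<close> 75)

section \<open>The Poisson kernel in one variable\<close>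

abbreviation unit_exp :: "real \<Rightarrow> complex" where
  "unit_exp x \<equiv> cis (2 * pi * x)"

text \<open>A density on the whole line rather than a restricted space: \<open>sets uni\<close> is
  then the full Borel algebra and \<open>space uni\<close> is \<open>UNIV\<close>, so products of
  \<open>uni\<close> need no side conditions on domains.\<close>

definition uni :: "real measure" where
  "uni = density lborel (indicator {0..<1})"

lemma sets_uni [measurable_cong, simp]: "sets uni = sets borel"
  by (simp add: uni_def)

lemma space_uni [simp]: "space uni = UNIV"
  by (simp add: uni_def)

lemma emeasure_uni_space: "emeasure uni UNIV = 1"
  by (simp add: uni_def emeasure_density)

lemma finite_measure_uni: "finite_measure uni"
  by (rule finite_measureI) (simp add: emeasure_uni_space)

interpretation uni: finite_measure uni
  by (rule finite_measure_uni)

interpretation uni_prod: product_sigma_finite "\<lambda>_. uni"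
  by standard

lemma nn_integral_uni:
  assumes [measurable]: "f \<in> borel_measurable borel"
  shows "(\<integral>\<^sup>+x. f x \<partial>uni) = (\<integral>\<^sup>+x\<in>{0..1}. f x \<partial>lborel)"
proof -
  have "(\<integral>\<^sup>+x. f x \<partial>uni) = (\<integral>\<^sup>+x. f x * indicator {0..<1} x \<partial>lborel)"
    unfolding uni_def by (subst nn_integral_density) (auto simp: mult.commute)
  also have "\<dots> = (\<integral>\<^sup>+x. f x * indicator {0..1} x \<partial>lborel)"
  proof (rule nn_integral_cong_AE)
    have "AE x in lborel. x \<noteq> (1::real)"
      by (rule AE_lborel_singleton)
    then show "AE x in lborel. f x * indicator {0..<1} x = f x * indicator {0..1} x"
      by eventually_elim (auto simp: indicator_def)
  qed
  finally show ?thesis .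
qed

lemma measurable_unit_exp [measurable]: "unit_exp \<in> borel_measurable borel"
  by (intro borel_measurable_continuous_onI continuous_intros)

definition poisson :: "complex \<Rightarrow> complex \<Rightarrow> real" where
  "poisson z w = (1 - (norm z)\<^sup>2) / (norm (w - z))\<^sup>2"



lemma poisson_measurable' [measurable]: "poisson z \<in> borel_measurable borel"
  unfolding poisson_def by measurable

lemma poisson_nonneg: "norm z \<le> 1 \<Longrightarrow> poisson z w \<ge> 0"
  by (simp add: poisson_def power_le_one)

lemma poisson_le:
  assumes "norm z < 1" "norm w = 1"
  shows "poisson z w \<le> 2 / (1 - norm z)"
proof -
  have "1 - norm z \<le> norm (w - z)"
    using norm_triangle_ineq2[of w z] assms by simp
  then have "(1 - norm z)\<^sup>2 \<le> (norm (w - z))\<^sup>2"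
    using assms by (intro power_mono) auto
  moreover have pos: "(1 - norm z)\<^sup>2 > 0" using assms by simp
  moreover have "0 \<le> 1 - (norm z)\<^sup>2" using assms by (simp add: power_le_one)
  ultimately have "poisson z w \<le> (1 - (norm z)\<^sup>2) / (1 - norm z)\<^sup>2"
    unfolding poisson_def by (intro divide_left_mono mult_pos_pos) (use pos in linarith)+
  also have "\<dots> = (1 + norm z) / (1 - norm z)"
    using assms by (simp add: power2_eq_square divide_simps) (simp add: algebra_simps)
  also have "\<dots> \<le> 2 / (1 - norm z)"
    using assms by (intro divide_right_mono) auto
  finally show ?thesis .
qed

text \<open>Cauchy's formula at \<open>z\<close> for
  \<open>u(w) (1 - |z|^2) / (1 - cnj z * w)\<close>: the extra factor is holomorphic on the closed
  disc, equals 1 at \<open>z\<close>, and turns the Cauchy kernel on the circle into the Poisson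
  kernel.\<close>

lemma poisson_formula:
  assumes hol: "u holomorphic_on cball 0 1" and z: "norm z < 1"
  shows "((\<lambda>x. of_real (poisson z (unit_exp x)) * u (unit_exp x)) has_integral u z) {0..1}"
proof -
  define F where "F = (\<lambda>w. u w * of_real (1 - (norm z)\<^sup>2) / (1 - cnj z * w))"
  have nz: "1 - cnj z * w \<noteq> 0" if "norm w \<le> 1" for w
  proof
    assume "1 - cnj z * w = 0"
    then have "norm (cnj z * w) = 1" by simp
    moreover have "norm (cnj z * w) \<le> norm z * 1"
      unfolding norm_mult using that by (intro mult_mono) auto
    ultimately show False using z by simp
  qed
  have "F holomorphic_on cball 0 1"
    unfolding F_def by (intro holomorphic_intros hol) (use nz in auto)
  then have "((\<lambda>w. F w / (w - z)) has_contour_integral (2 * of_real pi * \<i> * F z)) (circlepath 0 1)"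
    by (rule Cauchy_integral_circlepath_simple) (use z in auto)
  moreover have "F z = u z"
  proof -
    have "1 - cnj z * z = of_real (1 - (norm z)\<^sup>2)"
      using complex_norm_square[of z] by (simp add: mult.commute)
    then show ?thesis using nz[of z] z unfolding F_def by simp
  qed
  ultimately have "((\<lambda>x. F (circlepath 0 1 x) / (circlepath 0 1 x - z) *
      vector_derivative (circlepath 0 1) (at x within {0..1})) has_integral (2 * of_real pi * \<i> * u z)) {0..1}"
    by (simp add: has_contour_integral_def)
  then have "((\<lambda>x. F (circlepath 0 1 x) / (circlepath 0 1 x - z) *
      vector_derivative (circlepath 0 1) (at x within {0..1}) * (1 / (2 * of_real pi * \<i>))) has_integral
      (2 * of_real pi * \<i> * u z * (1 / (2 * of_real pi * \<i>)))) {0..1}"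
    by (rule has_integral_mult_left)
  then have *: "((\<lambda>x. F (circlepath 0 1 x) / (circlepath 0 1 x - z) *
      vector_derivative (circlepath 0 1) (at x within {0..1}) * (1 / (2 * of_real pi * \<i>))) has_integral u z) {0..1}"
    by simp
  show ?thesis
  proof (rule has_integral_eq[OF _ *])
    fix x :: real assume x: "x \<in> {0..1}"
    define w where "w = unit_exp x"
    have cw: "circlepath 0 1 x = w"
      by (simp add: circlepath w_def cis_conv_exp mult_ac)
    have nw: "norm w = 1" by (simp add: w_def)
    have vd: "vector_derivative (circlepath 0 1) (at x within {0..1}) = 2 * of_real pi * \<i> * w"
      using x by (subst vector_derivative_circlepath01) (auto simp: w_def cis_conv_exp mult_ac)
    have wne: "w \<noteq> z" "w \<noteq> 0" using nw z by auto
    \<comment> \<open>Here \<open>|w| = 1\<close> turns the combined denominator into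
      \<open>w * |w - z|^2\<close>.\<close>
    have "w * cnj w = 1" using complex_norm_square[of w] nw by simp
    then have "(1 - cnj z * w) * (w - z) = w * ((w - z) * cnj (w - z))"
      by (simp add: algebra_simps)
    also have "\<dots> = w * of_real ((norm (w - z))\<^sup>2)"
      by (simp only: complex_norm_square)
    finally have e: "(1 - cnj z * w) * (w - z) = w * of_real ((norm (w - z))\<^sup>2)" .
    have "F w / (w - z) * (2 * of_real pi * \<i> * w) * (1 / (2 * of_real pi * \<i>))
        = u w * of_real (1 - (norm z)\<^sup>2) * w / ((1 - cnj z * w) * (w - z))"
      unfolding F_def by simp
    also have "\<dots> = of_real (poisson z w) * u w"
      unfolding e using wne by (simp add: poisson_def)
    finally show "F (circlepath 0 1 x) / (circlepath 0 1 x - z) *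
      vector_derivative (circlepath 0 1) (at x within {0..1}) * (1 / (2 * of_real pi * \<i>)) =
      of_real (poisson z (unit_exp x)) * u (unit_exp x)"
      unfolding cw vd w_def[symmetric] .
  qed
qed

lemma nn_integral_poisson:
  assumes z: "norm z < 1"
  shows "(\<integral>\<^sup>+x. ennreal (poisson z (unit_exp x)) \<partial>uni) = 1"
proof -
  have "((\<lambda>x. of_real (poisson z (unit_exp x)) * 1) has_integral (1::complex)) {0..1}"
    using poisson_formula[of "\<lambda>_. 1" z] z by simp
  then have "((\<lambda>x. Re (of_real (poisson z (unit_exp x)) * 1)) has_integral Re 1) {0..1}"
    by (rule has_integral_Re)
  then have "((\<lambda>x. poisson z (unit_exp x)) has_integral 1) {0..1}"
    by simp
  then have "(\<integral>\<^sup>+x\<in>{0..1}. ennreal (poisson z (unit_exp x)) \<partial>lborel) = ennreal 1"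
    using z by (intro nn_integral_has_integral_lebesgue') (auto intro!: poisson_nonneg)
  then show ?thesis by (subst nn_integral_uni) auto
qed

text \<open>\<open>u\<close> is controlled only on the closed disc and need not be Borel elsewhere,
  so its modulus on the circle is passed as a separate Borel function \<open>V\<close>.\<close>

lemma poisson_norm_le:
  assumes hol: "u holomorphic_on cball 0 1" and z: "norm z < 1"
    and [measurable]: "V \<in> borel_measurable borel"
    and V: "\<And>w. norm w = 1 \<Longrightarrow> V w = norm (u w)"
  shows "ennreal (norm (u z)) \<le> (\<integral>\<^sup>+x. ennreal (poisson z (unit_exp x) * V (unit_exp x)) \<partial>uni)"
proof -
  let ?f = "\<lambda>x. of_real (poisson z (unit_exp x)) * u (unit_exp x)"
  have f: "(?f has_integral u z) {0..1}"
    by (rule poisson_formula[OF hol z])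
  have "unit_exp x \<noteq> z" for x using z by auto
  then have "continuous_on {0..1} ?f"
    unfolding poisson_def
    by (intro continuous_intros continuous_on_compose2[OF holomorphic_on_imp_continuous_on[OF hol]]) auto
  then have "continuous_on {0..1} (\<lambda>x. norm (?f x))"
    by (rule continuous_on_norm)
  then have int: "(\<lambda>x. norm (?f x)) integrable_on {0..1}"
    by (rule integrable_continuous_real)
  have eq: "norm (?f x) = poisson z (unit_exp x) * V (unit_exp x)" for x
    using z poisson_nonneg[of z] by (simp add: norm_mult V)
  have "norm (u z) \<le> integral {0..1} (\<lambda>x. norm (?f x))"
    using integral_norm_bound_integral[OF has_integral_integrable[OF f] int] integral_unique[OF f] by auto
  then have "ennreal (norm (u z)) \<le> ennreal (integral {0..1} (\<lambda>x. norm (?f x)))"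
    by (rule ennreal_leI)
  also have "\<dots> = (\<integral>\<^sup>+x\<in>{0..1}. ennreal (norm (?f x)) \<partial>lborel)"
    by (rule nn_integral_has_integral_lebesgue'[symmetric, OF _ integrable_integral[OF int]]) auto
  also have "\<dots> = (\<integral>\<^sup>+x. ennreal (poisson z (unit_exp x) * V (unit_exp x)) \<partial>uni)"
    unfolding eq by (subst nn_integral_uni) auto
  finally show ?thesis .
qed

text \<open>Bounded pointwise convergence on the circle suffices because the Poisson kernel at a
  fixed \<open>z\<close> is bounded. Used once for dilations towards the circle and once for Taylor
  polynomials.\<close>

lemma poisson_limit:
  assumes z: "norm z < 1"
    and [measurable]: "\<And>n. V n \<in> borel_measurable borel" "W \<in> borel_measurable borel"
    and bd: "\<And>n w. norm w = 1 \<Longrightarrow> 0 \<le> V n w \<and> V n w \<le> B"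
    and lim: "\<And>w. norm w = 1 \<Longrightarrow> (\<lambda>n. V n w) \<longlonglongrightarrow> W w"
    and le: "\<And>n. ennreal (A n) \<le> (\<integral>\<^sup>+x. ennreal (poisson z (unit_exp x) * V n (unit_exp x)) \<partial>uni)"
    and A: "A \<longlonglongrightarrow> a"
  shows "ennreal a \<le> (\<integral>\<^sup>+x. ennreal (poisson z (unit_exp x) * W (unit_exp x)) \<partial>uni)"
proof (rule LIMSEQ_le)
  show "(\<lambda>n. ennreal (A n)) \<longlonglongrightarrow> ennreal a"
    using A by (rule tendsto_ennrealI)
  show "(\<lambda>n. \<integral>\<^sup>+x. ennreal (poisson z (unit_exp x) * V n (unit_exp x)) \<partial>uni)
      \<longlonglongrightarrow> (\<integral>\<^sup>+x. ennreal (poisson z (unit_exp x) * W (unit_exp x)) \<partial>uni)"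
  proof (rule nn_integral_dominated_convergence[where w = "\<lambda>_. ennreal (2 / (1 - norm z) * B)"])
    show "(\<integral>\<^sup>+x. ennreal (2 / (1 - norm z) * B) \<partial>uni) < \<infinity>"
      by (simp add: emeasure_uni_space)
    show "AE x in uni. ennreal (poisson z (unit_exp x) * V n (unit_exp x)) \<le> ennreal (2 / (1 - norm z) * B)" for n
    proof (rule AE_I2)
      fix x :: real
      have "poisson z (unit_exp x) * V n (unit_exp x) \<le> 2 / (1 - norm z) * B"
        using bd[of "unit_exp x" n] poisson_nonneg[of z "unit_exp x"] z
        by (intro mult_mono poisson_le) auto
      then show "ennreal (poisson z (unit_exp x) * V n (unit_exp x)) \<le> ennreal (2 / (1 - norm z) * B)"
        by (rule ennreal_leI)
    qed
    show "AE x in uni. (\<lambda>n. ennreal (poisson z (unit_exp x) * V n (unit_exp x)))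
        \<longlonglongrightarrow> ennreal (poisson z (unit_exp x) * W (unit_exp x))"
      by (intro AE_I2 tendsto_ennrealI tendsto_mult tendsto_const lim) auto
  qed measurable
  show "\<exists>N. \<forall>n\<ge>N. ennreal (A n) \<le> (\<integral>\<^sup>+x. ennreal (poisson z (unit_exp x) * V n (unit_exp x)) \<partial>uni)"
    using le by blast
qed

section \<open>Powers \<open>|f|^q\<close> below their Poisson integrals, from products to
  polynomials to holomorphic functions\<close>

lemma prod_mset_norm_nonneg: "(\<Prod>b\<in>#B. norm (f b)) \<ge> 0"
  by (induction B) auto

text \<open>Each factor \<open>1 - b * w\<close> has positive real part in the open disc, so its
  principal power is holomorphic there and \<open>V\<close> is the modulus of a holomorphic
  function. A factor with \<open>|b| = 1\<close> vanishes on the circle, so the inequality is proved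
  for the dilations by \<open>\<rho> n < 1\<close> and passed to the limit.\<close>

lemma sub_poisson_prod:
  fixes B :: "complex multiset"
  assumes z: "norm z < 1" and q: "q > 0" and B: "\<And>b. b \<in># B \<Longrightarrow> norm b \<le> 1"
  defines "V \<equiv> \<lambda>w. (\<Prod>b\<in>#B. norm (1 - b * w)) powr q"
  shows "ennreal (V z) \<le> (\<integral>\<^sup>+x. ennreal (poisson z (unit_exp x) * V (unit_exp x)) \<partial>uni)"
proof -
  define u where "u = (\<lambda>w. \<Prod>b\<in>#B. (1 - b * w) powr of_real q)"
  have re: "1 - b * w \<notin> \<real>\<^sub>\<le>\<^sub>0" if "norm b \<le> 1" "norm w < 1" for b w :: complex
  proof -
    have "Re (b * w) \<le> norm (b * w)" by (rule complex_Re_le_cmod)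
    also have "\<dots> \<le> 1 * norm w" unfolding norm_mult using that by (intro mult_mono) auto
    finally have "Re (1 - b * w) > 0" using that by simp
    then show ?thesis by (simp add: complex_nonpos_Reals_iff)
  qed
  have hol: "(\<lambda>w. \<Prod>b\<in>#C. (1 - b * w) powr of_real q) holomorphic_on ball 0 1" if "\<forall>b\<in>#C. norm b \<le> 1" for C
    using that
  proof (induction C)
    case (add b C)
    have "(\<lambda>w. (1 - b * w) powr of_real q) holomorphic_on ball 0 1"
      by (intro holomorphic_intros re) (use add.prems in auto)
    moreover have "(\<lambda>w. \<Prod>b\<in>#C. (1 - b * w) powr of_real q) holomorphic_on ball 0 1"
      using add by simp
    ultimately show ?case by (simp add: holomorphic_on_mult)
  qed auto
  have nu: "norm (\<Prod>b\<in>#C. (1 - b * w) powr of_real q) = (\<Prod>b\<in>#C. norm (1 - b * w)) powr q" for w and C :: "complex multiset"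
    by (induction C) (auto simp: norm_mult norm_powr_real_powr' powr_mult prod_mset_norm_nonneg)
  have contp: "continuous_on UNIV (\<lambda>w. \<Prod>b\<in>#C. norm (1 - b * w))" for C :: "complex multiset"
    by (induction C) (auto intro!: continuous_intros)
  have contV: "continuous_on UNIV V"
    unfolding V_def using q
    by (intro continuous_on_powr' contp continuous_on_const) (auto intro!: prod_mset_norm_nonneg)
  have [measurable]: "V \<in> borel_measurable borel"
    using contV by (rule borel_measurable_continuous_onI)
  have isoV: "isCont V w" for w using contV by (simp add: continuous_on_eq_continuous_at)
  define \<rho> where "\<rho> = (\<lambda>n::nat. 1 + - inverse (real (Suc n)))"
  have \<rho>: "0 \<le> \<rho> n" "\<rho> n < 1" for n by (auto simp: \<rho>_def field_simps)
  have \<rho>lim: "\<rho> \<longlonglongrightarrow> 1"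
    unfolding \<rho>_def by (rule LIMSEQ_inverse_real_of_nat_add_minus)
  have lim: "(\<lambda>n. V (of_real (\<rho> n) * w)) \<longlonglongrightarrow> V w" for w
  proof -
    have "(\<lambda>n. of_real (\<rho> n) * w) \<longlonglongrightarrow> of_real 1 * w"
      by (intro tendsto_intros \<rho>lim)
    then show ?thesis using isCont_tendsto_compose[OF isoV[of w]] by simp
  qed
  have "compact (V ` cball 0 1)"
    by (intro compact_continuous_image continuous_on_subset[OF contV]) auto
  then obtain K where K: "\<And>w. norm w \<le> 1 \<Longrightarrow> V w \<le> K"
    by (meson bounded_imp_bdd_above compact_imp_bounded bdd_above.unfold imageI mem_cball_0)
  show ?thesis
  proof (rule poisson_limit[OF z, where V = "\<lambda>n w. V (of_real (\<rho> n) * w)" and B = K and A = "\<lambda>n. V (of_real (\<rho> n) * z)"])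
    show "0 \<le> V (of_real (\<rho> n) * w) \<and> V (of_real (\<rho> n) * w) \<le> K" if "norm w = 1" for n w
      using \<rho>[of n] that by (auto simp: V_def[symmetric] norm_mult intro!: K) (simp add: V_def)
    show "ennreal (V (of_real (\<rho> n) * z)) \<le> (\<integral>\<^sup>+x. ennreal (poisson z (unit_exp x) * V (of_real (\<rho> n) * unit_exp x)) \<partial>uni)" for n
    proof -
      have less: "norm (of_real (\<rho> n) * w) < 1" if "norm w \<le> 1" for w :: complex
      proof -
        have "norm (of_real (\<rho> n) * w) \<le> \<rho> n * 1"
          unfolding norm_mult using \<rho>[of n] that by (intro mult_mono) auto
        then show ?thesis using \<rho>[of n] by linarith
      qed
      have "u holomorphic_on ball 0 1"
        unfolding u_def using B by (intro hol) simp
      then have "(u \<circ> (\<lambda>w. of_real (\<rho> n) * w)) holomorphic_on cball 0 1"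
        by (rule holomorphic_on_compose_gen[rotated]) (auto intro!: holomorphic_intros less simp del: norm_mult)
      then have "(\<lambda>w. u (of_real (\<rho> n) * w)) holomorphic_on cball 0 1" by (simp add: o_def)
      moreover have uV: "norm (u w) = V w" for w
        unfolding u_def V_def by (rule nu)
      ultimately show ?thesis
        using poisson_norm_le[of "\<lambda>w. u (of_real (\<rho> n) * w)" z "\<lambda>w. V (of_real (\<rho> n) * w)"] z
        by (simp only: uV) auto
    qed
  qed (use lim in \<open>auto\<close>)
qed

text \<open>In the disc \<open>|p|\<close> is dominated by a product without zeros there, which has
  the same modulus on the circle; the inequality for that product therefore gives the one for
  \<open>p\<close>. This takes the place of Blaschke products and of the subharmonicity of
  \<open>log |p|\<close>.\<close>

lemma sub_poisson_poly:
  assumes z: "norm z < 1" and q: "q > 0"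
  shows "ennreal (norm (poly p z) powr q)
    \<le> (\<integral>\<^sup>+x. ennreal (poisson z (unit_exp x) * norm (poly p (unit_exp x)) powr q) \<partial>uni)"
proof (cases "p = 0")
  case False
  obtain A where "size A = degree p \<and> p = smult (lead_coeff p) (\<Prod>x\<in>#A. [:-x, 1:])"
    using alg_closed_imp_factorization[OF False] by (rule exE)
  then have A: "p = smult (lead_coeff p) (\<Prod>x\<in>#A. [:-x, 1:])" ..
  \<comment> \<open>Reflecting the zeros inside the disc across the circle makes the polynomial zero-free.\<close>
  have "\<exists>c B. 0 \<le> c \<and> (\<forall>b\<in>#B. norm b \<le> 1) \<and>
     (\<forall>w. norm w \<le> 1 \<longrightarrow> norm (poly (\<Prod>x\<in>#A. [:-x, 1:]) w) \<le> c * (\<Prod>b\<in>#B. norm (1 - b * w))) \<and>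
     (\<forall>w. norm w = 1 \<longrightarrow> norm (poly (\<Prod>x\<in>#A. [:-x, 1:]) w) = c * (\<Prod>b\<in>#B. norm (1 - b * w)))"
  proof (induction A)
    case empty
    show ?case by (intro exI[of _ 1] exI[of _ "{#}"]) auto
  next
    case (add a A)
    then obtain c B where c: "0 \<le> c" and B: "\<forall>b\<in>#B. norm b \<le> 1"
      and le: "\<And>w. norm w \<le> 1 \<Longrightarrow> norm (poly (\<Prod>x\<in>#A. [:-x, 1:]) w) \<le> c * (\<Prod>b\<in>#B. norm (1 - b * w))"
      and eq: "\<And>w. norm w = 1 \<Longrightarrow> norm (poly (\<Prod>x\<in>#A. [:-x, 1:]) w) = c * (\<Prod>b\<in>#B. norm (1 - b * w))"
      by blast
    have "\<exists>d b. 0 \<le> d \<and> norm b \<le> 1 \<and> (\<forall>w. norm w \<le> 1 \<longrightarrow> norm (w - a) \<le> d * norm (1 - b * w))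
      \<and> (\<forall>w. norm w = 1 \<longrightarrow> norm (w - a) = d * norm (1 - b * w))"
    proof (cases "norm a < 1")
      case True
      \<comment> \<open>Reflecting an inner zero thus increases the modulus inside the disc and
        keeps it on the circle.\<close>
      have sq: "(norm (1 - cnj a * w))\<^sup>2 - (norm (w - a))\<^sup>2 = (1 - (norm a)\<^sup>2) * (1 - (norm w)\<^sup>2)" for w
        unfolding cmod_power2 by (simp add: algebra_simps power2_eq_square)
      have "norm (w - a) \<le> norm (1 - cnj a * w)" if "norm w \<le> 1" for w
      proof -
        have "(1 - (norm a)\<^sup>2) * (1 - (norm w)\<^sup>2) \<ge> 0"
          using that True by (intro mult_nonneg_nonneg) (auto simp: power_le_one)
        then have "(norm (w - a))\<^sup>2 \<le> (norm (1 - cnj a * w))\<^sup>2" using sq[of w] by linarith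
        then show ?thesis by (rule power2_le_imp_le) simp
      qed
      moreover have "norm (w - a) = norm (1 - cnj a * w)" if "norm w = 1" for w
        by (rule power2_eq_imp_eq) (use sq[of w] that in auto)
      ultimately show ?thesis using True by (intro exI[of _ 1] exI[of _ "cnj a"]) auto
    next
      case False
      \<comment> \<open>A zero outside the open disc needs no reflection: \<open>w - a\<close> is
        \<open>-a\<close> times \<open>1 - w / a\<close>, and
        \<open>|1 / a| \<le> 1\<close>.\<close>
      then have "a \<noteq> 0" by auto
      have "norm (w - a) = norm a * norm (1 - (1 / a) * w)" for w
      proof -
        have "w - a = - (a * (1 - (1 / a) * w))"
          using \<open>a \<noteq> 0\<close> by (simp add: field_simps)
        then show ?thesis by (simp only: norm_mult norm_minus_cancel)
      qed
      then show ?thesis using False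
        by (intro exI[of _ "norm a"] exI[of _ "1 / a"]) (auto simp: norm_divide divide_simps)
    qed
    then obtain d b where d: "0 \<le> d" "norm b \<le> 1"
      and dle: "\<And>w. norm w \<le> 1 \<Longrightarrow> norm (w - a) \<le> d * norm (1 - b * w)"
      and deq: "\<And>w. norm w = 1 \<Longrightarrow> norm (w - a) = d * norm (1 - b * w)" by blast

    have P: "norm (poly (\<Prod>x\<in>#add_mset a A. [:-x, 1:]) w) = norm (w - a) * norm (poly (\<Prod>x\<in>#A. [:-x, 1:]) w)" for w
    proof -
      have "poly (\<Prod>x\<in>#add_mset a A. [:-x, 1:]) w = (w - a) * poly (\<Prod>x\<in>#A. [:-x, 1:]) w"
        by (simp add: algebra_simps)
      then show ?thesis by (simp only: norm_mult)
    qed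
    show ?case
    proof (intro exI[of _ "d * c"] exI[of _ "add_mset b B"] conjI allI impI)
      fix w :: complex assume w: "norm w \<le> 1"
      have "norm (w - a) * norm (poly (\<Prod>x\<in>#A. [:-x, 1:]) w) \<le> (d * norm (1 - b * w)) * (c * (\<Prod>b\<in>#B. norm (1 - b * w)))"
        using d by (intro mult_mono dle le w) auto
      then show "norm (poly (\<Prod>x\<in>#add_mset a A. [:-x, 1:]) w) \<le> d * c * (\<Prod>b\<in>#add_mset b B. norm (1 - b * w))"
        unfolding P by (simp add: mult_ac)
    next
      fix w :: complex assume w: "norm w = 1"
      show "norm (poly (\<Prod>x\<in>#add_mset a A. [:-x, 1:]) w) = d * c * (\<Prod>b\<in>#add_mset b B. norm (1 - b * w))"
        unfolding P deq[OF w] eq[OF w] by (simp add: mult_ac)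
    qed (use c B d in auto)
  qed
  then obtain c B where c: "0 \<le> c" and B: "\<forall>b\<in>#B. norm b \<le> 1"
      and le: "\<And>w. norm w \<le> 1 \<Longrightarrow> norm (poly (\<Prod>x\<in>#A. [:-x, 1:]) w) \<le> c * (\<Prod>b\<in>#B. norm (1 - b * w))"
      and eq: "\<And>w. norm w = 1 \<Longrightarrow> norm (poly (\<Prod>x\<in>#A. [:-x, 1:]) w) = c * (\<Prod>b\<in>#B. norm (1 - b * w))"
      by blast
  define C where "C = (norm (lead_coeff p) * c) powr q"
  define V where "V = (\<lambda>w. (\<Prod>b\<in>#B. norm (1 - b * w)) powr q)"
  have np: "norm (poly p w) = norm (lead_coeff p) * norm (poly (\<Prod>x\<in>#A. [:-x, 1:]) w)" for w
    by (subst A) (simp add: norm_mult)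
  have nn: "(\<Prod>b\<in>#B. norm (1 - b * w)) \<ge> 0" for w by (rule prod_mset_norm_nonneg)
  have CV: "C * V w = (norm (lead_coeff p) * (c * (\<Prod>b\<in>#B. norm (1 - b * w)))) powr q" for w
    unfolding C_def V_def using c nn[of w] by (simp add: powr_mult)
  have "continuous_on UNIV (\<lambda>w. \<Prod>b\<in>#C. norm (1 - b * w))" for C :: "complex multiset"
    by (induction C) (auto intro!: continuous_intros)
  then have "(\<lambda>w. \<Prod>b\<in>#B. norm (1 - b * w)) \<in> borel_measurable borel"
    by (rule borel_measurable_continuous_onI)
  then have [measurable]: "V \<in> borel_measurable borel" unfolding V_def by measurable
  have "norm (poly p z) powr q \<le> C * V z"
    unfolding CV np using z q by (intro powr_mono2 mult_left_mono le) auto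
  then have "ennreal (norm (poly p z) powr q) \<le> ennreal (C * V z)"
    by (rule ennreal_leI)
  also have "\<dots> = ennreal C * ennreal (V z)" by (simp add: ennreal_mult'' V_def)
  also have "\<dots> \<le> ennreal C * (\<integral>\<^sup>+x. ennreal (poisson z (unit_exp x) * V (unit_exp x)) \<partial>uni)"
    unfolding V_def using B by (intro mult_left_mono sub_poisson_prod z q) auto
  also have "\<dots> = (\<integral>\<^sup>+x. ennreal C * ennreal (poisson z (unit_exp x) * V (unit_exp x)) \<partial>uni)"
    by (rule nn_integral_cmult[symmetric]) measurable
  also have "\<dots> = (\<integral>\<^sup>+x. ennreal (poisson z (unit_exp x) * norm (poly p (unit_exp x)) powr q) \<partial>uni)"
  proof (rule nn_integral_cong)
    fix x
    have "norm (poly p (unit_exp x)) powr q = C * V (unit_exp x)"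
      unfolding CV np by (subst eq) auto
    then show "ennreal C * ennreal (poisson z (unit_exp x) * V (unit_exp x)) =
        ennreal (poisson z (unit_exp x) * norm (poly p (unit_exp x)) powr q)"
      using poisson_nonneg[of z "unit_exp x"] z
      by (simp add: ennreal_mult[symmetric] C_def V_def mult_ac)
  qed
  finally show ?thesis .
qed auto

text \<open>Holomorphy beyond the closed disc makes the Taylor series absolutely convergent on the
  circle, so its partial sums converge there boundedly and the polynomial case passes to the
  limit.\<close>

lemma sub_poisson:
  assumes hol: "f holomorphic_on ball 0 R" and R: "R > 1" and z: "norm z < 1" and q: "q > 0"
    and [measurable]: "f \<in> borel_measurable borel"
  shows "ennreal (norm (f z) powr q)
    \<le> (\<integral>\<^sup>+x. ennreal (poisson z (unit_exp x) * norm (f (unit_exp x)) powr q) \<partial>uni)"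
proof -
  define c where "c = (\<lambda>n. (deriv ^^ n) f 0 / fact n)"
  have sums: "(\<lambda>n. c n * w ^ n) sums f w" if "norm w < R" for w
    using holomorphic_power_series[OF hol, of w] that by (simp add: c_def)
  obtain r where r: "1 < r" "r < R" using R dense by blast
  have "summable (\<lambda>n. c n * of_real r ^ n)"
    using sums[of "of_real r"] r by (auto simp: sums_iff)
  then have sm: "summable (\<lambda>n. norm (c n * 1 ^ n))"
    by (rule powser_insidea) (use r in auto)
  define p where "p = (\<lambda>N. \<Sum>n<N. monom (c n) n)"
  have p: "poly (p N) w = (\<Sum>n<N. c n * w ^ n)" for N w
    by (simp add: p_def poly_sum poly_monom)
  have plim: "(\<lambda>N. poly (p N) w) \<longlonglongrightarrow> f w" if "norm w \<le> 1" for w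
    unfolding p using sums[of w] that R by (simp add: sums_def)
  define B where "B = (\<Sum>n. norm (c n))"
  have pb: "norm (poly (p N) w) \<le> B" if "norm w = 1" for N w
  proof -
    have "norm (poly (p N) w) \<le> (\<Sum>n<N. norm (c n))"
      unfolding p by (rule sum_norm_le) (simp add: norm_mult norm_power that)
    also have "\<dots> \<le> B" unfolding B_def using sm by (intro sum_le_suminf) auto
    finally show ?thesis .
  qed
  have lim: "(\<lambda>N. norm (poly (p N) w) powr q) \<longlonglongrightarrow> norm (f w) powr q" if "norm w \<le> 1" for w
    using q by (intro tendsto_powr' tendsto_norm plim that tendsto_const) auto
  have [measurable]: "poly (p N) \<in> borel_measurable borel" for N
    by (intro borel_measurable_continuous_onI continuous_intros)
  show ?thesis
  proof (rule poisson_limit[OF z, where V = "\<lambda>N w. norm (poly (p N) w) powr q" and B = "B powr q"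
        and A = "\<lambda>N. norm (poly (p N) z) powr q"])
    show "0 \<le> norm (poly (p n) w) powr q \<and> norm (poly (p n) w) powr q \<le> B powr q" if "norm w = 1" for n w
      using pb[OF that] q by (auto intro!: powr_mono2)
  qed (use lim z q in \<open>auto intro!: sub_poisson_poly\<close>)
qed

section \<open>Powers and Minkowski's inequality on the extended half-line\<close>

lemma ennpowr_ennreal: "0 \<le> x \<Longrightarrow> ennpowr (ennreal x) a = ennreal (x powr a)"
  by (simp add: ennpowr_def)

lemma ennpowr_top [simp]: "ennpowr top a = top"
  by (simp add: ennpowr_def)

lemma ennpowr_0 [simp]: "ennpowr 0 a = 0"
  by (simp add: ennpowr_def)

lemma ennpowr_1 [simp]: "ennpowr 1 a = 1"
  by (simp add: ennpowr_def)

lemma ennpowr_one [simp]: "ennpowr x 1 = x"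
  by (cases x) (auto simp: ennpowr_ennreal)

lemma ennpowr_mono: "x \<le> y \<Longrightarrow> 0 \<le> a \<Longrightarrow> ennpowr x a \<le> ennpowr y a"
  by (cases x; cases y) (auto simp: ennpowr_ennreal top_unique intro!: ennreal_leI powr_mono2)

lemma ennpowr_eq_top_iff [simp]: "ennpowr x a = top \<longleftrightarrow> x = top"
  by (simp add: ennpowr_def)

lemma ennpowr_less_top_iff [simp]: "ennpowr x a < top \<longleftrightarrow> x < top"
  by (simp add: less_top[symmetric])

lemma ennpowr_mult: "ennpowr (x * y) a = ennpowr x a * ennpowr y a"
proof (cases x; cases y)
  fix r s assume "x = ennreal r" "y = ennreal s" "0 \<le> r" "0 \<le> s"
  then show ?thesis by (simp add: ennreal_mult[symmetric] ennpowr_ennreal powr_mult)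
qed (auto simp: ennpowr_ennreal ennreal_top_mult ennreal_mult_top)

lemma ennpowr_ennpowr: "ennpowr (ennpowr x a) b = ennpowr x (a * b)"
  by (cases x) (auto simp: ennpowr_ennreal powr_powr)

lemma ennpowr_add: "0 < a \<Longrightarrow> 0 < b \<Longrightarrow> ennpowr x (a + b) = ennpowr x a * ennpowr x b"
  by (cases x) (auto simp: ennpowr_ennreal powr_add ennreal_mult)

lemma measurable_ennpowr [measurable (raw)]:
  assumes [measurable]: "f \<in> borel_measurable M"
  shows "(\<lambda>x. ennpowr (f x) a) \<in> borel_measurable M"
  unfolding ennpowr_def infinity_ennreal_def by measurable

text \<open>With \<open>S\<close> the sum, every \<open>x k\<close> is at most \<open>S\<close>, so
  \<open>x k ^ b \<le> S ^ (b - 1) * x k\<close>; summing gives \<open>S ^ b\<close>.\<close>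

lemma nn_integral_ennpowr_sum_le:
  assumes b: "b \<ge> 1"
  shows "(\<integral>\<^sup>+k. ennpowr (x k) b \<partial>count_space A) \<le> ennpowr (\<integral>\<^sup>+k. x k \<partial>count_space A) b"
proof (cases "b = 1")
  case False
  then have b: "b - 1 > 0" using b by simp
  define S where "S = (\<integral>\<^sup>+k. x k \<partial>count_space A)"
  have "ennpowr (x k) b \<le> ennpowr S (b - 1) * x k" if "k \<in> A" for k
  proof -
    have "x k \<le> S"
      unfolding S_def using that by (rule nn_integral_ge_point)
    moreover have "ennpowr (x k) b = ennpowr (x k) (b - 1) * x k"
      using ennpowr_add[OF b zero_less_one, of "x k"] by simp
    ultimately show ?thesis
      using b by (auto intro!: mult_right_mono ennpowr_mono)
  qed
  then have "(\<integral>\<^sup>+k. ennpowr (x k) b \<partial>count_space A) \<le> (\<integral>\<^sup>+k. ennpowr S (b - 1) * x k \<partial>count_space A)"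
    by (intro nn_integral_mono) simp
  also have "\<dots> = ennpowr S (b - 1) * S"
    unfolding S_def by (rule nn_integral_cmult) simp
  also have "\<dots> = ennpowr S b"
    using ennpowr_add[OF b zero_less_one, of S] by simp
  finally show ?thesis by (simp add: S_def)
qed simp

text \<open>The preceding inequality for the family \<open>x k ^ a\<close> with exponent
  \<open>1 / a\<close>.\<close>

lemma ennpowr_nn_integral_count_space_le:
  assumes a: "0 < a" "a \<le> 1"
  shows "ennpowr (\<integral>\<^sup>+k. x k \<partial>count_space A) a \<le> (\<integral>\<^sup>+k. ennpowr (x k) a \<partial>count_space A)"
proof -
  have "(\<integral>\<^sup>+k. ennpowr (ennpowr (x k) a) (1 / a) \<partial>count_space A)
      \<le> ennpowr (\<integral>\<^sup>+k. ennpowr (x k) a \<partial>count_space A) (1 / a)"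
    using a by (intro nn_integral_ennpowr_sum_le) simp
  then have "ennpowr (\<integral>\<^sup>+k. x k \<partial>count_space A) a
      \<le> ennpowr (ennpowr (\<integral>\<^sup>+k. ennpowr (x k) a \<partial>count_space A) (1 / a)) a"
    using a by (intro ennpowr_mono) (simp_all add: ennpowr_ennpowr)
  then show ?thesis using a by (simp add: ennpowr_ennpowr)
qed

lemma ennpowr_add_le:
  assumes a: "0 < a" "a \<le> 1"
  shows "ennpowr (x + y) a \<le> ennpowr x a + ennpowr y a"
proof -
  have "ennpowr (\<integral>\<^sup>+b. (if b then x else y) \<partial>count_space UNIV) a
      \<le> (\<integral>\<^sup>+b. ennpowr (if b then x else y) a \<partial>count_space UNIV)"
    by (rule ennpowr_nn_integral_count_space_le[OF a])
  then show ?thesis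
    by (simp add: nn_integral_count_space_finite UNIV_bool add.commute)
qed

text \<open>Convexity: right side minus left side is the gap between \<open>y ^ a\<close> and its
  tangent at \<open>l\<close>. After scaling it is Young's inequality for \<open>y / l\<close> and
  1.\<close>

lemma powr_tangent:
  fixes a l y :: real
  assumes a: "a \<ge> 1" and l: "l > 0" and y: "y \<ge> 0"
  shows "a * l powr (a - 1) * y \<le> y powr a + (a - 1) * l powr a"
proof (cases "a = 1")
  case False
  then have a: "a > 1" using a by (simp only: less_le) auto
  define u where "u = y / l"
  have u: "u \<ge> 0" using l y by (simp add: u_def)
  have "u * 1 \<le> u powr a / a + 1 powr (a / (a - 1)) / (a / (a - 1))"
    by (rule Youngs_inequality) (use a u in \<open>auto simp: field_simps\<close>)
  then have "u \<le> u powr a / a + (a - 1) / a" by simp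
  then have "a * u \<le> a * (u powr a / a + (a - 1) / a)"
    using a by (intro mult_left_mono) auto
  then have "a * u \<le> u powr a + (a - 1)"
    using a by (simp add: distrib_left)
  then have "l powr a * (a * u) \<le> l powr a * (u powr a + (a - 1))"
    by (rule mult_left_mono) simp
  moreover have "l powr a * u powr a = y powr a"
    using l y by (simp add: u_def powr_divide)
  moreover have "l powr a * (a * u) = a * l powr (a - 1) * y"
    using l by (simp add: u_def powr_diff)
  ultimately show ?thesis by (simp only: distrib_left mult.commute[of "l powr a" "a - 1"])
qed (use l y in auto)

text \<open>Integrate the tangent inequality at the mean \<open>I\<close> against the probability
  density \<open>w\<close>. No integrability is assumed, so \<open>I = \<infinity>\<close> needs its
  own argument: \<open>g \<le> 1 + g ^ a\<close> makes the right side infinite as well.\<close>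

lemma jensen_ennpowr:
  assumes a: "a \<ge> 1" and [measurable]: "w \<in> borel_measurable M" "g \<in> borel_measurable M"
    and w: "(\<integral>\<^sup>+x. w x \<partial>M) = 1"
  shows "ennpowr (\<integral>\<^sup>+x. w x * g x \<partial>M) a \<le> (\<integral>\<^sup>+x. w x * ennpowr (g x) a \<partial>M)"
proof -
  define I where "I = (\<integral>\<^sup>+x. w x * g x \<partial>M)"
  define B where "B = (\<integral>\<^sup>+x. w x * ennpowr (g x) a \<partial>M)"
  consider "I = 0" | "I = top" | r where "I = ennreal r" "r > 0"
    by (cases I) (auto simp: le_less)
  then have "ennpowr I a \<le> B"
  proof cases
    case 2
    have "g x \<le> 1 + ennpowr (g x) a" for x
    proof (cases "g x")
      case (real r)
      have "r \<le> 1 + r powr a"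
      proof (cases "r \<le> 1")
        case True then show ?thesis using real by (intro add_increasing2) auto
      next
        case False
        then have "r powr 1 \<le> r powr a" using a by (intro powr_mono) auto
        then show ?thesis using False by simp
      qed
      then have "ennreal r \<le> ennreal (1 + r powr a)" by (rule ennreal_leI)
      then show ?thesis using real by (simp add: ennpowr_ennreal)
    qed simp
    then have "I \<le> (\<integral>\<^sup>+x. w x * (1 + ennpowr (g x) a) \<partial>M)"
      unfolding I_def by (intro nn_integral_mono mult_left_mono) auto
    also have "\<dots> = 1 + B"
      unfolding distrib_left B_def by (subst nn_integral_add) (auto simp: w)
    finally have "B = top" using 2 by (simp add: top_unique ennreal_add_eq_top)
    then show ?thesis by simp
  next
    case (3 r)
    define c where "c = a * r powr (a - 1)"
    have c: "c \<ge> 0" using a 3 by (simp add: c_def)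
    have tang: "ennreal c * g x \<le> ennpowr (g x) a + ennreal ((a - 1) * r powr a)" for x
    proof (cases "g x")
      case (real y)
      have "ennreal (c * y) \<le> ennreal (y powr a + (a - 1) * r powr a)"
        unfolding c_def using powr_tangent[of a r y] a 3 real by (intro ennreal_leI) auto
      then show ?thesis using real a c by (simp add: ennpowr_ennreal ennreal_mult)
    qed simp
    have "ennreal c * I = (\<integral>\<^sup>+x. w x * (ennreal c * g x) \<partial>M)"
      unfolding I_def by (subst nn_integral_cmult[symmetric]) (auto simp: mult_ac)
    also have "\<dots> \<le> (\<integral>\<^sup>+x. w x * (ennpowr (g x) a + ennreal ((a - 1) * r powr a)) \<partial>M)"
      by (intro nn_integral_mono mult_left_mono tang) auto
    also have "\<dots> = B + ennreal ((a - 1) * r powr a)"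
      unfolding distrib_left B_def
      by (subst nn_integral_add) (auto simp: w nn_integral_multc)
    finally have le: "ennreal c * I \<le> B + ennreal ((a - 1) * r powr a)" .
    have "c * r = r powr a + (a - 1) * r powr a"
    proof -
      have "r powr (a - 1) * r = r powr a"
        using 3 by (simp add: powr_diff)
      then show ?thesis by (simp add: c_def algebra_simps)
    qed
    then have "ennreal c * I = ennreal (r powr a) + ennreal ((a - 1) * r powr a)"
      using 3 a c by (simp add: ennreal_mult[symmetric])
    with le have "ennreal (r powr a) \<le> B"
      by (simp add: add.commute[of _ "ennreal ((a - 1) * r powr a)"] ennreal_add_left_cancel_le)
    then show ?thesis using 3 by (simp add: ennpowr_ennreal)
  qed simp
  then show ?thesis by (simp add: I_def B_def)
qed

text \<open>The proof is Jensen's inequality for the probability weight proportional to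
  \<open>n x = \<parallel>F x \<cdot>\<parallel>\<close>, perturbed by \<open>\<epsilon>\<close> since \<open>n\<close> may vanish.\<close>

lemma minkowski_integral:
  assumes "sigma_finite_measure M" "sigma_finite_measure N"
    and M1: "emeasure M (space M) = 1" and a: "a \<ge> 1"
    and [measurable]: "(\<lambda>(x, y). F x y) \<in> borel_measurable (M \<Otimes>\<^sub>M N)"
  shows "(\<integral>\<^sup>+y. ennpowr (\<integral>\<^sup>+x. F x y \<partial>M) a \<partial>N)
    \<le> ennpowr (\<integral>\<^sup>+x. ennpowr (\<integral>\<^sup>+y. ennpowr (F x y) a \<partial>N) (1 / a) \<partial>M) a"
proof -
  interpret M: sigma_finite_measure M by fact
  interpret N: sigma_finite_measure N by fact
  interpret pair_sigma_finite M N ..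
  define n where "n = (\<lambda>x. ennpowr (\<integral>\<^sup>+y. ennpowr (F x y) a \<partial>N) (1 / a))"
  have [measurable]: "(\<lambda>x. F x y) \<in> borel_measurable M" if "y \<in> space N" for y
    using that by measurable
  have [measurable]: "n \<in> borel_measurable M" unfolding n_def by measurable
  define L where "L = (\<integral>\<^sup>+y. ennpowr (\<integral>\<^sup>+x. F x y \<partial>M) a \<partial>N)"
  show ?thesis
  proof (cases "(\<integral>\<^sup>+x. n x \<partial>M)")
    case (real N0)
    have le: "L \<le> ennreal ((N0 + e) powr a)" if e: "e > 0" for e :: real
    proof -
      define k where "k = (\<lambda>x. n x + ennreal e)"
      define K where "K = ennreal (N0 + e)"
      have [measurable]: "k \<in> borel_measurable M" unfolding k_def by measurable
      have K0: "K \<noteq> 0" "K \<noteq> top" using e real by (auto simp: K_def ennreal_plus[symmetric] simp del: ennreal_plus)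
      have kK: "(\<integral>\<^sup>+x. k x \<partial>M) = K"
        unfolding k_def K_def using real e M1 by (subst nn_integral_add) auto
      have w1: "(\<integral>\<^sup>+x. inverse K * k x \<partial>M) = 1"
        using K0 ennreal_divide_self[of K]
        by (subst nn_integral_cmult) (auto simp: kK mult.commute[of "inverse K"] divide_ennreal_def less_top)
      have nfin: "AE x in M. n x \<noteq> top"
        using nn_integral_PInf_AE[of n M] real by (simp add: top_neq_ennreal)
      have inv: "z * inverse z = 1" if "z \<noteq> 0" "z \<noteq> top" for z :: ennreal
        using that ennreal_divide_self[of z] by (simp add: divide_ennreal_def less_top)
      have kpos: "k x \<noteq> 0" for x using e by (simp add: k_def)
      have one: "ennpowr (\<integral>\<^sup>+x. F x y \<partial>M) a
          \<le> (\<integral>\<^sup>+x. (inverse K * k x) * ennpowr (K * inverse (k x) * F x y) a \<partial>M)" if y: "y \<in> space N" for y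
      proof -
        \<comment> \<open>Multiplying and dividing by the weight \<open>k / K\<close>, positive and
          almost everywhere finite, puts the inner integral into the form that Jensen needs.\<close>
        have "(\<integral>\<^sup>+x. F x y \<partial>M) = (\<integral>\<^sup>+x. (inverse K * k x) * (K * inverse (k x) * F x y) \<partial>M)"
        proof (rule nn_integral_cong_AE)
          show "AE x in M. F x y = inverse K * k x * (K * inverse (k x) * F x y)"
            using nfin
          proof eventually_elim
            case (elim x)
            then have "k x \<noteq> top" by (simp add: k_def)
            then have "(K * inverse K) * (k x * inverse (k x)) = 1" using K0 kpos by (simp add: inv)
            then have "F x y = ((K * inverse K) * (k x * inverse (k x))) * F x y" by simp
            then show ?case by (simp only: mult_ac)
          qed
        qed
        then show ?thesis
          using y by (simp only:) (rule jensen_ennpowr[OF a _ _ w1]; measurable)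
      qed
      have "L \<le> (\<integral>\<^sup>+y. \<integral>\<^sup>+x. (inverse K * k x) * ennpowr (K * inverse (k x) * F x y) a \<partial>M \<partial>N)"
        unfolding L_def by (intro nn_integral_mono one)
      also have "\<dots> = (\<integral>\<^sup>+x. \<integral>\<^sup>+y. (inverse K * k x) * ennpowr (K * inverse (k x) * F x y) a \<partial>N \<partial>M)"
        by (rule Fubini') measurable
      also have "\<dots> \<le> (\<integral>\<^sup>+x. (inverse K * k x) * ennpowr K a \<partial>M)"
      proof (rule nn_integral_mono)
        fix x assume x: "x \<in> space M"
        have [measurable]: "(\<lambda>y. F x y) \<in> borel_measurable N" using x by measurable
        have "(\<integral>\<^sup>+y. (inverse K * k x) * ennpowr (K * inverse (k x) * F x y) a \<partial>N)
          = (\<integral>\<^sup>+y. ((inverse K * k x) * ennpowr (K * inverse (k x)) a) * ennpowr (F x y) a \<partial>N)"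
          by (simp only: ennpowr_mult mult_ac)
        also have "\<dots> = ((inverse K * k x) * ennpowr (K * inverse (k x)) a) * ennpowr (n x) a"
          unfolding n_def using a by (subst nn_integral_cmult) (auto simp: ennpowr_ennpowr)
        also have "\<dots> = (inverse K * k x) * ennpowr K a * ennpowr (n x * inverse (k x)) a"
          by (simp only: ennpowr_mult mult_ac)
        also have "\<dots> \<le> (inverse K * k x) * ennpowr K a * ennpowr 1 a"
        proof (intro mult_left_mono ennpowr_mono)
          \<comment> \<open>After the exchange of integrals the inner one is \<open>n x ^ a\<close>,
            which the weight cancels up to \<open>(n / k) ^ a \<le> 1\<close>; only
            \<open>K ^ a\<close> survives.\<close>
          have "n x * inverse (k x) \<le> k x * inverse (k x)"
            by (intro mult_right_mono) (auto simp: k_def)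
          also have "\<dots> \<le> 1" using kpos by (cases "k x = top") (auto simp: inv)
          finally show "n x * inverse (k x) \<le> 1" .
        qed (use a in auto)
        finally show "(\<integral>\<^sup>+y. (inverse K * k x) * ennpowr (K * inverse (k x) * F x y) a \<partial>N)
            \<le> (inverse K * k x) * ennpowr K a" by simp
      qed
      also have "\<dots> = ennpowr K a"
        by (subst nn_integral_multc) (auto simp: w1)
      also have "\<dots> = ennreal ((N0 + e) powr a)"
        unfolding K_def using real e by (subst ennpowr_ennreal) auto
      finally show ?thesis .
    qed
    have "(\<lambda>i. ennreal ((N0 + inverse (real (Suc i))) powr a)) \<longlonglongrightarrow> ennreal (N0 powr a)"
      using a real by (intro tendsto_ennrealI tendsto_powr' LIMSEQ_inverse_real_of_nat_add tendsto_const)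
        (auto intro!: always_eventually)
    then have "L \<le> ennreal (N0 powr a)"
      by (rule LIMSEQ_le_const) (auto intro!: le)
    then show ?thesis using real by (simp add: L_def n_def ennpowr_ennreal)
  qed (simp add: n_def)
qed

section \<open>The Poisson inequality on the polydisc\<close>

lemma measurable_vec_lambda [measurable (raw)]:
  fixes f :: "'a \<Rightarrow> 'n::finite \<Rightarrow> 'b::euclidean_space"
  assumes [measurable]: "\<And>i. (\<lambda>x. f x i) \<in> borel_measurable M"
  shows "(\<lambda>x. \<chi> i. f x i) \<in> borel_measurable M"
proof (subst borel_measurable_euclidean_space, intro ballI)
  fix b :: "'b ^ 'n" assume "b \<in> Basis"
  then obtain u i where b: "b = axis i u" "u \<in> Basis" by (auto simp: Basis_vec_def)
  then show "(\<lambda>x. (\<chi> i. f x i) \<bullet> b) \<in> borel_measurable M"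
    by (simp add: inner_axis)
qed

lemma measurable_vec_nth [measurable (raw)]:
  fixes f :: "'a \<Rightarrow> 'b::euclidean_space ^ 'n::finite"
  assumes [measurable]: "f \<in> borel_measurable M"
  shows "(\<lambda>x. f x $ i) \<in> borel_measurable M"
proof -
  have "(\<lambda>v :: 'b ^ 'n. v $ i) \<in> borel_measurable borel"
    by (intro borel_measurable_continuous_onI continuous_intros)
  from measurable_compose[OF assms this] show ?thesis .
qed

text \<open>The torus in angle coordinates. A product measure on functions gives Tonelli and product
  formulas coordinate by coordinate; \<open>nn_integral_torus\<close> links it to
  \<open>torus_measure\<close>.\<close>

definition TM :: "('n::finite \<Rightarrow> real) measure" where
  "TM = PiM UNIV (\<lambda>_. uni)"

definition tor :: "('n::finite \<Rightarrow> real) \<Rightarrow> complex ^ 'n" where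
  "tor a = (\<chi> j. unit_exp (a j))"

lemma space_TM [simp]: "space TM = UNIV"
  by (auto simp: TM_def space_PiM)

lemma measurable_TM_component: "(\<lambda>x. x i) \<in> borel_measurable TM"
  unfolding TM_def using measurable_component_singleton[of i UNIV "\<lambda>_. uni"]
  by (simp add: measurable_cong_sets[OF refl sets_uni])

lemma measurable_TM_component':
  "f \<in> M \<rightarrow>\<^sub>M TM \<Longrightarrow> (\<lambda>x. f x i) \<in> borel_measurable M"
  by (rule measurable_compose[OF _ measurable_TM_component])

lemma emeasure_TM_space: "emeasure (TM :: ('n::finite \<Rightarrow> real) measure) UNIV = 1"
proof -
  have "emeasure (TM :: ('n \<Rightarrow> real) measure) (PiE UNIV (\<lambda>_. UNIV)) = (\<Prod>i\<in>(UNIV :: 'n set). emeasure uni UNIV)"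
    unfolding TM_def by (rule uni_prod.emeasure_PiM) auto
  moreover have "PiE UNIV (\<lambda>_. UNIV) = (UNIV :: ('n \<Rightarrow> real) set)" by auto
  ultimately show ?thesis by (simp add: emeasure_uni_space)
qed

lemma sigma_finite_TM: "sigma_finite_measure TM"
  unfolding TM_def by (rule uni_prod.sigma_finite) auto

lemma measurable_unit_exp' [measurable (raw)]:
  assumes "f \<in> borel_measurable M"
  shows "(\<lambda>x. unit_exp (f x)) \<in> borel_measurable M"
  using measurable_compose[OF assms measurable_unit_exp] .

lemma measurable_tor [measurable (raw)]:
  assumes [measurable]: "f \<in> M \<rightarrow>\<^sub>M TM"
  shows "(\<lambda>x. tor (f x)) \<in> borel_measurable M"
  unfolding tor_def using measurable_TM_component'[OF assms] by measurable

lemma measurable_rmult [measurable (raw)]: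
  assumes [measurable]: "r \<in> borel_measurable M" "f \<in> borel_measurable M"
  shows "(\<lambda>x. rmult (r x) (f x)) \<in> borel_measurable M"
  unfolding rmult_def by measurable

text \<open>Separate holomorphy and measurability are all that the Poisson inequality needs, and pass
  at once to products and reflections.\<close>

definition sep_hol :: "(complex ^ 'n::finite \<Rightarrow> complex) \<Rightarrow> bool" where
  "sep_hol f \<longleftrightarrow> f \<in> borel_measurable borel \<and>
     (\<forall>z\<in>polydisc. \<forall>j. (\<lambda>w. f (\<chi> i. if i = j then w else z $ i)) holomorphic_on ball 0 1)"

lemma sep_hol_measurable: "sep_hol f \<Longrightarrow> f \<in> borel_measurable borel"
  by (simp add: sep_hol_def)

text \<open>The dilation \<open>w \<mapsto> y * w\<close> makes the slice holomorphic on a disc of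
  radius \<open>1 / y > 1\<close>, as \<open>sub_poisson\<close> demands.\<close>

lemma sub_poisson_coordinate:
  assumes f: "sep_hol f" and z: "z \<in> polydisc" "z $ j = of_real y * v" and y: "0 < y" "y < 1"
    and v: "norm v < 1" and q: "q > 0"
  shows "ennreal (norm (f z) powr q) \<le> (\<integral>\<^sup>+x. ennreal (poisson v (unit_exp x) *
     norm (f (\<chi> i. if i = j then of_real y * unit_exp x else z $ i)) powr q) \<partial>uni)"
proof -
  have [measurable]: "f \<in> borel_measurable borel" using f by (rule sep_hol_measurable)
  define F where "F = (\<lambda>w. f (\<chi> i. if i = j then w else z $ i))"
  have "F holomorphic_on ball 0 1"
    using f z unfolding sep_hol_def F_def by blast
  then have "(F \<circ> (\<lambda>w. of_real y * w)) holomorphic_on ball 0 (1 / y)"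
    using y by (intro holomorphic_on_compose_gen[where t = "ball 0 1"] holomorphic_intros)
      (auto simp: norm_mult field_simps)
  then have "(\<lambda>w. F (of_real y * w)) holomorphic_on ball 0 (1 / y)" by (simp add: o_def)
  moreover have "(\<lambda>w. F (of_real y * w)) \<in> borel_measurable borel"
    unfolding F_def by measurable
  ultimately have "ennreal (norm (F (of_real y * v)) powr q) \<le>
     (\<integral>\<^sup>+x. ennreal (poisson v (unit_exp x) * norm (F (of_real y * unit_exp x)) powr q) \<partial>uni)"
    using y by (intro sub_poisson[of "\<lambda>w. F (of_real y * w)", OF _ _ v q]) auto
  moreover have "(\<chi> i. if i = j then of_real y * v else z $ i) = z"
    using z by (auto simp: vec_eq_iff)
  ultimately show ?thesis by (simp add: F_def)
qed

text \<open>Coordinates are pushed to their circles one at a time; the intermediate point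
  \<open>Z J x\<close> stays in the polydisc because every \<open>y i < 1\<close>.\<close>

lemma sub_poisson_finite:
  fixes f :: "complex ^ 'n::finite \<Rightarrow> complex" and J :: "'n set"
  assumes f: "sep_hol f" and q: "q > 0" and y: "\<And>j. 0 < y j" "\<And>j. y j < 1" and v: "\<And>j. norm (v j) < 1"
    and z: "z \<in> polydisc" "\<And>j. z $ j = of_real (y j) * v j"
  shows "ennreal (norm (f z) powr q) \<le> (\<integral>\<^sup>+x. ennreal ((\<Prod>j\<in>J. poisson (v j) (unit_exp (x j))) *
     norm (f (\<chi> i. if i \<in> J then of_real (y i) * unit_exp (x i) else z $ i)) powr q) \<partial>PiM J (\<lambda>_. uni))"
  using finite[of J]
proof (induction J rule: finite_induct)
  case empty
  have "(\<chi> i. z $ i) = z" by (simp add: vec_eq_iff)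
  then show ?case by (simp add: PiM_empty nn_integral_count_space_finite)
next
  case (insert i J)
  have [measurable]: "f \<in> borel_measurable borel" using f by (rule sep_hol_measurable)
  define Z where "Z = (\<lambda>J x. \<chi> i. if i \<in> J then of_real (y i) * unit_exp (x i) else z $ i)"
  have comp: "(\<lambda>x. x j) \<in> borel_measurable (PiM K (\<lambda>_. uni))" if "j \<in> K" for j and K :: "'n set"
    using measurable_component_singleton[OF that, of "\<lambda>_. uni"]
    by (simp add: measurable_cong_sets[OF refl sets_uni])
  have Zm: "Z K \<in> borel_measurable (PiM K (\<lambda>_. uni))" for K
    unfolding Z_def
  proof (intro measurable_vec_lambda)
    fix j show "(\<lambda>x. if j \<in> K then of_real (y j) * unit_exp (x j) else z $ j) \<in> borel_measurable (PiM K (\<lambda>_. uni))"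
      by (cases "j \<in> K") (auto intro!: borel_measurable_times measurable_unit_exp' comp)
  qed
  have Pm: "(\<lambda>x. \<Prod>j\<in>K. poisson (v j) (unit_exp (x j))) \<in> borel_measurable (PiM K (\<lambda>_. uni))" for K
    by (intro borel_measurable_prod measurable_compose[OF _ poisson_measurable'] measurable_unit_exp' comp)
  have nn: "0 \<le> (\<Prod>j\<in>K. poisson (v j) (unit_exp (x j)))" for K x
    by (intro prod_nonneg poisson_nonneg ballI) (use v in \<open>auto intro: less_imp_le\<close>)
  have [measurable]: "Z K \<in> borel_measurable (PiM K (\<lambda>_. uni))" for K by (rule Zm)
  have [measurable]: "(\<lambda>x. \<Prod>j\<in>K. poisson (v j) (unit_exp (x j))) \<in> borel_measurable (PiM K (\<lambda>_. uni))" for K by (rule Pm)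
  have Zp: "Z J x \<in> polydisc" for x
  proof -
    have "norm (Z J x $ j) < 1" for j
      using y[of j] z(1) by (auto simp: Z_def norm_mult polydisc_def)
    then show ?thesis by (auto simp: polydisc_def)
  qed
  have "ennreal (norm (f z) powr q) \<le> (\<integral>\<^sup>+x. ennreal ((\<Prod>j\<in>J. poisson (v j) (unit_exp (x j))) * norm (f (Z J x)) powr q) \<partial>PiM J (\<lambda>_. uni))"
    using insert.IH by (simp add: Z_def)
  also have "\<dots> \<le> (\<integral>\<^sup>+x. \<integral>\<^sup>+w. ennreal ((\<Prod>j\<in>insert i J. poisson (v j) (unit_exp ((x(i := w)) j))) *
      norm (f (Z (insert i J) (x(i := w)))) powr q) \<partial>uni \<partial>PiM J (\<lambda>_. uni))"
  proof (rule nn_integral_mono)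
    fix x assume "x \<in> space (PiM J (\<lambda>_. uni))"
    have Zu: "(\<chi> k. if k = i then of_real (y i) * unit_exp w else Z J x $ k) = Z (insert i J) (x(i := w))" for w
      using insert.hyps by (auto simp: Z_def vec_eq_iff)
    have "Z J x $ i = of_real (y i) * v i" using insert.hyps z by (simp add: Z_def)
    from sub_poisson_coordinate[OF f Zp this y v q]
    have step: "ennreal (norm (f (Z J x)) powr q) \<le> (\<integral>\<^sup>+w. ennreal (poisson (v i) (unit_exp w) *
      norm (f (Z (insert i J) (x(i := w)))) powr q) \<partial>uni)" by (simp only: Zu)
    have [measurable]: "(\<lambda>w. f (Z (insert i J) (x(i := w)))) \<in> borel_measurable uni"
      unfolding Zu[symmetric] by measurable
    define P where "P = (\<Prod>j\<in>J. poisson (v j) (unit_exp (x j)))"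
    have P: "(\<Prod>j\<in>insert i J. poisson (v j) (unit_exp ((x(i := w)) j))) = P * poisson (v i) (unit_exp w)" for w
    proof -
      have "(\<Prod>j\<in>J. poisson (v j) (unit_exp ((x(i := w)) j))) = P"
        unfolding P_def using insert.hyps by (intro prod.cong) auto
      then show ?thesis using insert.hyps by simp
    qed
    have P0: "0 \<le> P" unfolding P_def by (rule nn)
    have "ennreal (P * norm (f (Z J x)) powr q) \<le> ennreal P * (\<integral>\<^sup>+w. ennreal (poisson (v i) (unit_exp w) *
      norm (f (Z (insert i J) (x(i := w)))) powr q) \<partial>uni)"
      using P0 by (simp add: ennreal_mult step mult_left_mono)
    also have "\<dots> = (\<integral>\<^sup>+w. ennreal P * ennreal (poisson (v i) (unit_exp w) *
      norm (f (Z (insert i J) (x(i := w)))) powr q) \<partial>uni)"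
      by (rule nn_integral_cmult[symmetric]) measurable
    also have "\<dots> = (\<integral>\<^sup>+w. ennreal (P * poisson (v i) (unit_exp w) *
      norm (f (Z (insert i J) (x(i := w)))) powr q) \<partial>uni)"
      using P0 poisson_nonneg[OF less_imp_le[OF v]] by (simp add: ennreal_mult[symmetric] mult.assoc)
    finally show "ennreal ((\<Prod>j\<in>J. poisson (v j) (unit_exp (x j))) * norm (f (Z J x)) powr q) \<le>
      (\<integral>\<^sup>+w. ennreal ((\<Prod>j\<in>insert i J. poisson (v j) (unit_exp ((x(i := w)) j))) *
      norm (f (Z (insert i J) (x(i := w)))) powr q) \<partial>uni)"
      unfolding P by (simp add: P_def)
  qed
  also have "\<dots> = (\<integral>\<^sup>+x. ennreal ((\<Prod>j\<in>insert i J. poisson (v j) (unit_exp (x j))) *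
      norm (f (Z (insert i J) x)) powr q) \<partial>PiM (insert i J) (\<lambda>_. uni))"
    by (rule uni_prod.product_nn_integral_insert[OF insert.hyps, symmetric]) measurable
  finally show ?case by (simp only: Z_def)
qed

text \<open>The product Poisson kernel in angle coordinates: evaluation point
  \<open>rmult \<rho> (tor a)\<close>, boundary point \<open>tor b\<close>.\<close>

definition PK :: "real ^ 'n::finite \<Rightarrow> ('n \<Rightarrow> real) \<Rightarrow> ('n \<Rightarrow> real) \<Rightarrow> real" where
  "PK \<rho> a b = (\<Prod>j\<in>UNIV. poisson (of_real (\<rho> $ j) * unit_exp (a j)) (unit_exp (b j)))"

lemma norm_rho: "\<rho> \<in> unit_cube \<Longrightarrow> norm (of_real (\<rho> $ j) * unit_exp x) < 1"
  by (simp add: unit_cube_def norm_mult)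

lemma poisson_rho_nonneg: "\<rho> \<in> unit_cube \<Longrightarrow> 0 \<le> poisson (of_real (\<rho> $ j) * unit_exp x) w"
  by (rule poisson_nonneg[OF less_imp_le[OF norm_rho]])

lemma PK_nonneg: "\<rho> \<in> unit_cube \<Longrightarrow> PK \<rho> a b \<ge> 0"
  unfolding PK_def by (intro prod_nonneg ballI poisson_rho_nonneg)

text \<open>Exchanging two points of the circle keeps the distance \<open>|e(y) - r e(x)|\<close>.
  This is what lets the kernel be integrated to 1 in either angle.\<close>

lemma PK_commute: "PK \<rho> a b = PK \<rho> b a"
  unfolding PK_def
proof (rule prod.cong)
  fix j
  have *: "norm (unit_exp y - of_real r * unit_exp x) = norm (unit_exp x - of_real r * unit_exp y)" for r x y :: real
  proof (rule power2_eq_imp_eq)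
    show "(norm (unit_exp y - of_real r * unit_exp x))\<^sup>2 = (norm (unit_exp x - of_real r * unit_exp y))\<^sup>2"
    proof -
      have "(cos y - r * cos x)\<^sup>2 + (sin y - r * sin x)\<^sup>2 = 1 + r\<^sup>2 - 2 * r * (cos x * cos y + sin x * sin y)" for x y :: real
        using sin_cos_squared_add[of x] sin_cos_squared_add[of y] by algebra
      from this[of "2 * pi * y" "2 * pi * x"] this[of "2 * pi * x" "2 * pi * y"]
      show ?thesis by (simp add: cmod_power2 algebra_simps)
    qed
  qed auto
  show "poisson (of_real (\<rho> $ j) * unit_exp (a j)) (unit_exp (b j)) = poisson (of_real (\<rho> $ j) * unit_exp (b j)) (unit_exp (a j))"
    unfolding poisson_def by (simp add: norm_mult *)
qed auto

lemma measurable_PK [measurable]: "(\<lambda>(a, b). PK \<rho> a b) \<in> borel_measurable (TM \<Otimes>\<^sub>M TM)"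
  using measurable_TM_component'[OF measurable_fst[of TM TM]] measurable_TM_component'[OF measurable_snd[of TM TM]]
  unfolding PK_def poisson_def by measurable

lemma measurable_PK' [measurable]: "(\<lambda>b. PK \<rho> a b) \<in> borel_measurable TM"
  using measurable_TM_component unfolding PK_def poisson_def by measurable

lemma nn_integral_PK:
  assumes "\<rho> \<in> unit_cube"
  shows "(\<integral>\<^sup>+b. ennreal (PK \<rho> a b) \<partial>TM) = 1"
proof -
  have "(\<integral>\<^sup>+b. ennreal (PK \<rho> a b) \<partial>TM)
    = (\<integral>\<^sup>+b. (\<Prod>j\<in>UNIV. ennreal (poisson (of_real (\<rho> $ j) * unit_exp (a j)) (unit_exp (b j)))) \<partial>TM)"
    unfolding PK_def using assms by (subst prod_ennreal) (auto intro!: poisson_rho_nonneg)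
  also have "\<dots> = (\<Prod>j\<in>UNIV. \<integral>\<^sup>+x. ennreal (poisson (of_real (\<rho> $ j) * unit_exp (a j)) (unit_exp x)) \<partial>uni)"
    unfolding TM_def by (rule uni_prod.product_nn_integral_prod) (simp, measurable)
  also have "\<dots> = 1" using assms by (simp add: nn_integral_poisson norm_rho)
  finally show ?thesis .
qed

lemma nn_integral_PK': "\<rho> \<in> unit_cube \<Longrightarrow> (\<integral>\<^sup>+a. ennreal (PK \<rho> a b) \<partial>TM) = 1"
  by (subst PK_commute) (rule nn_integral_PK)

lemma PK_le:
  assumes "\<rho> \<in> unit_cube"
  shows "PK \<rho> a b \<le> (\<Prod>j\<in>UNIV. 2 / (1 - \<rho> $ j))"
  unfolding PK_def
proof (rule prod_mono, intro conjI)
  fix j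
  have "norm (of_real (\<rho> $ j) * unit_exp (a j)) = \<rho> $ j"
    using assms by (simp add: unit_cube_def norm_mult)
  then show "poisson (of_real (\<rho> $ j) * unit_exp (a j)) (unit_exp (b j)) \<le> 2 / (1 - \<rho> $ j)"
    using poisson_le[OF norm_rho[OF assms, of j "a j"], of "unit_exp (b j)"] by simp
qed (use assms in \<open>auto intro!: poisson_rho_nonneg\<close>)

definition vless :: "real ^ 'n \<Rightarrow> real ^ 'n \<Rightarrow> bool" where
  "vless r x \<longleftrightarrow> (\<forall>j. r $ j < x $ j)"

definition vdiv :: "real ^ 'n \<Rightarrow> real ^ 'n \<Rightarrow> real ^ 'n" where
  "vdiv r x = (\<chi> j. r $ j / x $ j)"

lemma vdiv_cube: "r \<in> unit_cube \<Longrightarrow> vless r x \<Longrightarrow> vdiv r x \<in> unit_cube"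
  unfolding unit_cube_def vless_def vdiv_def
  by (auto intro!: divide_nonneg_nonneg simp: divide_less_eq_1) (metis le_less_trans less_imp_le, metis le_less_trans)

text \<open>Relative to the outer torus of radii \<open>x\<close>, a point with radii
  \<open>r\<close> sits at radii \<open>r / x\<close>; hence the kernel
  \<open>PK (vdiv r x)\<close>.\<close>

lemma sub_poisson_polydisc:
  assumes f: "sep_hol f" and q: "q > 0" and r: "r \<in> unit_cube" and x: "x \<in> unit_cube" and rx: "vless r x"
  shows "ennreal (norm (f (rmult r (tor a))) powr q) \<le>
    (\<integral>\<^sup>+b. ennreal (PK (vdiv r x) a b * norm (f (rmult x (tor b))) powr q) \<partial>TM)"
proof -
  have xp: "0 < x $ j" "x $ j < 1" for j
    using r x rx unfolding unit_cube_def vless_def by (auto intro: le_less_trans)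
  have "ennreal (norm (f (rmult r (tor a))) powr q) \<le> (\<integral>\<^sup>+b. ennreal ((\<Prod>j\<in>UNIV. poisson (of_real (vdiv r x $ j) * unit_exp (a j)) (unit_exp (b j))) *
     norm (f (\<chi> i. if i \<in> UNIV then of_real (x $ i) * unit_exp (b i) else rmult r (tor a) $ i)) powr q) \<partial>PiM UNIV (\<lambda>_. uni))"
  proof (rule sub_poisson_finite[OF f q])
    show "norm (of_real (vdiv r x $ j) * unit_exp (a j)) < 1" for j
      by (rule norm_rho[OF vdiv_cube[OF r rx]])
    show "rmult r (tor a) \<in> polydisc"
      using r by (auto simp: polydisc_def rmult_def tor_def norm_mult unit_cube_def)
    show "rmult r (tor a) $ j = of_real (x $ j) * (of_real (vdiv r x $ j) * unit_exp (a j))" for j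
      using xp[of j] by (simp add: rmult_def tor_def vdiv_def)
  qed (use xp in auto)
  then show ?thesis by (simp add: PK_def TM_def rmult_def tor_def)
qed

section \<open>Integral means\<close>

text \<open>The \<open>p\<close>-th power of the integral mean, left without the root because the
  estimates are linear in \<open>|f|^p\<close>.\<close>

definition Jm :: "real \<Rightarrow> (complex ^ 'n::finite \<Rightarrow> complex) \<Rightarrow> real ^ 'n \<Rightarrow> ennreal" where
  "Jm p f r = (\<integral>\<^sup>+a. ennreal (norm (f (rmult r (tor a))) powr p) \<partial>TM)"

text \<open>Integrate the Poisson inequality over the inner angle; by symmetry the kernel has
  integral 1 in that angle.\<close>

lemma Jm_mono:
  fixes f :: "complex ^ 'n::finite \<Rightarrow> complex"
  assumes f: "sep_hol f" and q: "p > 0" and r: "r \<in> unit_cube" and x: "x \<in> unit_cube" and rx: "vless r x"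
  shows "Jm p f r \<le> Jm p f x"
proof -
  interpret T: sigma_finite_measure TM by (rule sigma_finite_TM)
  interpret TT: pair_sigma_finite TM TM ..
  have [measurable]: "f \<in> borel_measurable borel" using f by (rule sep_hol_measurable)
  note \<rho> = vdiv_cube[OF r rx]
  have "Jm p f r \<le> (\<integral>\<^sup>+a. \<integral>\<^sup>+b. ennreal (PK (vdiv r x) a b * norm (f (rmult x (tor b))) powr p) \<partial>TM \<partial>TM)"
    unfolding Jm_def by (intro nn_integral_mono sub_poisson_polydisc assms)
  also have "\<dots> = (\<integral>\<^sup>+b. \<integral>\<^sup>+a. ennreal (PK (vdiv r x) a b * norm (f (rmult x (tor b))) powr p) \<partial>TM \<partial>TM)"
    by (rule TT.Fubini'[symmetric]) measurable
  also have "\<dots> = (\<integral>\<^sup>+b. (\<integral>\<^sup>+a. ennreal (PK (vdiv r x) a b) \<partial>TM) * ennreal (norm (f (rmult x (tor b))) powr p) \<partial>TM)"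
    by (subst nn_integral_multc[symmetric]) (auto simp: ennreal_mult PK_nonneg[OF \<rho>])
  also have "\<dots> = Jm p f x" by (simp add: nn_integral_PK'[OF \<rho>] Jm_def)
  finally show ?thesis .
qed

lemma norm_le_Jm:
  assumes f: "sep_hol f" and q: "p > 0" and r: "r \<in> unit_cube" and x: "x \<in> unit_cube" and rx: "vless r x"
  shows "ennreal (norm (f (rmult r (tor a))) powr p) \<le> ennreal (\<Prod>j\<in>UNIV. 2 / (1 - r $ j / x $ j)) * Jm p f x"
proof -
  have [measurable]: "f \<in> borel_measurable borel" using f by (rule sep_hol_measurable)
  note \<rho> = vdiv_cube[OF r rx]
  have "ennreal (norm (f (rmult r (tor a))) powr p) \<le> (\<integral>\<^sup>+b. ennreal (PK (vdiv r x) a b * norm (f (rmult x (tor b))) powr p) \<partial>TM)"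
    by (intro sub_poisson_polydisc assms)
  also have "\<dots> \<le> (\<integral>\<^sup>+b. ennreal (\<Prod>j\<in>UNIV. 2 / (1 - r $ j / x $ j)) * ennreal (norm (f (rmult x (tor b))) powr p) \<partial>TM)"
    using PK_le[OF \<rho>, of a] PK_nonneg[OF \<rho>, of a]
    by (intro nn_integral_mono) (auto simp: ennreal_mult vdiv_def intro!: mult_right_mono ennreal_leI)
  also have "\<dots> = ennreal (\<Prod>j\<in>UNIV. 2 / (1 - r $ j / x $ j)) * Jm p f x"
    unfolding Jm_def by (rule nn_integral_cmult) measurable
  finally show ?thesis .
qed

lemma one_le_ennpowr_0: "0 < x \<Longrightarrow> 1 \<le> ennpowr (ennreal x) 0"
  by (simp add: ennpowr_ennreal)

text \<open>Write \<open>|f|^t = (|f|^p)^(t/p - 1) * |f|^p\<close>; bound the first factor pointwise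
  by the mean over the outer torus and integrate the second.\<close>

lemma Jm_le_Jm:
  assumes f: "sep_hol f" and p: "0 < p" "p \<le> t" and r: "r \<in> unit_cube" and x: "x \<in> unit_cube" and rx: "vless r x"
  shows "Jm t f r \<le> ennpowr (ennreal (\<Prod>j\<in>UNIV. 2 / (1 - r $ j / x $ j))) (t / p - 1) * ennpowr (Jm p f x) (t / p)"
proof (cases "p = t")
  case True
  \<comment> \<open>For \<open>p = t\<close> the constant is a zeroth power, which is 1 because the
    product is positive.\<close>
  have "1 - r $ j / x $ j > 0" for j
    using vdiv_cube[OF r rx] by (simp add: unit_cube_def vdiv_def)
  then have "(\<Prod>j\<in>UNIV. 2 / (1 - r $ j / x $ j)) > 0"
    by (intro prod_pos divide_pos_pos) auto
  then have "1 \<le> ennpowr (ennreal (\<Prod>j\<in>UNIV. 2 / (1 - r $ j / x $ j))) 0"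
    by (rule one_le_ennpowr_0)
  then have "1 * Jm t f x \<le> ennpowr (ennreal (\<Prod>j\<in>UNIV. 2 / (1 - r $ j / x $ j))) 0 * Jm t f x"
    by (rule mult_right_mono) simp
  then show ?thesis using True p Jm_mono[OF f _ r x rx, of t] by simp
next
  case False
  then have pt: "p < t" using p by simp
  then have e: "t / p - 1 > 0" using p by simp
  have [measurable]: "f \<in> borel_measurable borel" using f by (rule sep_hol_measurable)
  define D where "D = ennreal (\<Prod>j\<in>UNIV. 2 / (1 - r $ j / x $ j))"
  have "ennreal (norm (f (rmult r (tor a))) powr t) \<le>
      ennpowr (D * Jm p f x) (t / p - 1) * ennreal (norm (f (rmult r (tor a))) powr p)" for a
  proof -
    let ?N = "norm (f (rmult r (tor a)))"
    have "?N powr t = (?N powr p) powr (t / p - 1) * ?N powr p"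
      using p by (simp add: powr_powr powr_add[symmetric] field_simps)
    then have "ennreal (?N powr t) = ennpowr (ennreal (?N powr p)) (t / p - 1) * ennreal (?N powr p)"
      by (simp add: ennpowr_ennreal ennreal_mult)
    also have "\<dots> \<le> ennpowr (D * Jm p f x) (t / p - 1) * ennreal (?N powr p)"
      unfolding D_def using e by (intro mult_right_mono ennpowr_mono norm_le_Jm[OF f p(1) r x rx]) auto
    finally show ?thesis .
  qed
  then have "Jm t f r \<le> (\<integral>\<^sup>+a. ennpowr (D * Jm p f x) (t / p - 1) * ennreal (norm (f (rmult r (tor a))) powr p) \<partial>TM)"
    unfolding Jm_def by (intro nn_integral_mono)
  also have "\<dots> = ennpowr (D * Jm p f x) (t / p - 1) * Jm p f r"
    unfolding Jm_def by (rule nn_integral_cmult) measurable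
  also have "\<dots> \<le> ennpowr (D * Jm p f x) (t / p - 1) * Jm p f x"
    by (intro mult_left_mono Jm_mono[OF f p(1) r x rx]) auto
  also have "\<dots> = ennpowr D (t / p - 1) * ennpowr (Jm p f x) (t / p)"
    using ennpowr_add[OF e zero_less_one, of "Jm p f x"] by (simp add: ennpowr_mult mult.assoc)
  finally show ?thesis by (simp add: D_def)
qed

section \<open>The measure on the torus\<close>

interpretation lb_prod: product_sigma_finite "\<lambda>_. lborel"
  by standard

lemma measurable_vec_lambda_PiM:
  "(vec_lambda :: ('n::finite \<Rightarrow> real) \<Rightarrow> real ^ 'n) \<in> borel_measurable (PiM UNIV (\<lambda>_. lborel))"
proof -
  have "(\<lambda>x. x i) \<in> borel_measurable (PiM (UNIV :: 'n set) (\<lambda>_. lborel :: real measure))" for i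
    using measurable_component_singleton[of i "UNIV :: 'n set" "\<lambda>_. lborel :: real measure"] by simp
  then have "(\<lambda>x. \<chi> i. x i) \<in> borel_measurable (PiM (UNIV :: 'n set) (\<lambda>_. lborel :: real measure))"
    by (rule measurable_vec_lambda)
  then show ?thesis by simp
qed

lemma prod_Basis_vec: "(\<Prod>b\<in>Basis. f ((v :: real ^ 'n::finite) \<bullet> b)) = (\<Prod>j\<in>UNIV. f (v $ j))"
proof -
  have B: "Basis = (\<lambda>j. axis j 1 :: real ^ 'n) ` UNIV" by (auto simp: Basis_vec_def)
  have "inj (\<lambda>j. axis j 1 :: real ^ 'n)" by (auto simp: inj_on_def axis_eq_axis)
  then show ?thesis unfolding B by (subst prod.reindex) (auto simp: inner_axis)
qed

text \<open>Both measures give an open box the product of its side lengths, which determines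
  Lebesgue measure.\<close>

lemma lborel_vec: "lborel = distr (PiM UNIV (\<lambda>_. lborel)) borel (vec_lambda :: ('n::finite \<Rightarrow> real) \<Rightarrow> real ^ 'n)"
proof (rule lborel_eqI)
  fix l u :: "real ^ 'n" assume le: "\<And>b. b \<in> Basis \<Longrightarrow> l \<bullet> b \<le> u \<bullet> b"
  have lu: "l $ j \<le> u $ j" for j
    using le[of "axis j 1"] by (simp add: inner_axis)
  have pre: "vec_lambda -` box l u \<inter> space (PiM UNIV (\<lambda>_. lborel)) = PiE UNIV (\<lambda>j. {l $ j<..<u $ j})"
    by (auto simp: mem_box_cart space_PiM PiE_iff)
  have "emeasure (distr (PiM UNIV (\<lambda>_. lborel)) borel vec_lambda) (box l u)
      = emeasure (PiM UNIV (\<lambda>_. lborel)) (PiE UNIV (\<lambda>j. {l $ j<..<u $ j}))"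
    by (subst emeasure_distr[OF measurable_vec_lambda_PiM]) (auto simp: pre)
  also have "\<dots> = (\<Prod>j\<in>UNIV. emeasure lborel {l $ j<..<u $ j})"
    by (rule lb_prod.emeasure_PiM) auto
  also have "\<dots> = (\<Prod>j\<in>UNIV. ennreal ((u - l) $ j))"
    using lu by simp
  also have "\<dots> = ennreal (\<Prod>j\<in>UNIV. (u - l) $ j)"
    using lu by (subst prod_ennreal) auto
  also have "(\<Prod>j\<in>UNIV. (u - l) $ j) = (\<Prod>b\<in>Basis. (u - l) \<bullet> b)"
    using prod_Basis_vec[of "\<lambda>x. x" "u - l"] by simp
  finally show "emeasure (distr (PiM UNIV (\<lambda>_. lborel)) borel vec_lambda) (box l u) = (\<Prod>b\<in>Basis. (u - l) \<bullet> b)" .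
qed simp

lemma TM_density:
  "TM = density (PiM UNIV (\<lambda>_. lborel)) (\<lambda>x :: 'n::finite \<Rightarrow> real. \<Prod>j\<in>UNIV. indicator {0..<1} (x j) :: ennreal)"
  unfolding TM_def
proof (rule uni_prod.PiM_eqI[symmetric])
  have m: "(\<lambda>x. \<Prod>j\<in>UNIV. indicator {0..<1} (x j) :: ennreal) \<in> borel_measurable (PiM UNIV (\<lambda>_ :: 'n. lborel :: real measure))"
  proof (intro borel_measurable_prod_ennreal)
    fix i :: 'n
    show "(\<lambda>x. indicator {0..<1} (x i) :: ennreal) \<in> borel_measurable (PiM UNIV (\<lambda>_. lborel :: real measure))"
      by (rule measurable_compose[where f = "\<lambda>x. x i" and g = "indicator {0..<1::real}" and N = lborel]) (auto intro!: borel_measurable_indicator)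
  qed
  fix A :: "'n \<Rightarrow> real set" assume A: "\<And>i. i \<in> UNIV \<Longrightarrow> A i \<in> sets uni"
  have "PiE UNIV A \<in> sets (PiM UNIV (\<lambda>_ :: 'n. lborel :: real measure))"
    using A by (intro sets_PiM_I_finite) auto
  then have "emeasure (density (PiM UNIV (\<lambda>_. lborel)) (\<lambda>x. \<Prod>j\<in>UNIV. indicator {0..<1} (x j))) (PiE UNIV A)
     = (\<integral>\<^sup>+x. (\<Prod>j\<in>UNIV. indicator {0..<1} (x j)) * indicator (PiE UNIV A) x \<partial>PiM UNIV (\<lambda>_. lborel))"
    by (rule emeasure_density[OF m])
  also have "\<dots> = (\<integral>\<^sup>+x. (\<Prod>j\<in>UNIV. indicator {0..<1} (x j) * indicator (A j) (x j)) \<partial>PiM UNIV (\<lambda>_. lborel))"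
  proof (rule nn_integral_cong)
    fix x :: "'n \<Rightarrow> real"
    have "(indicator (PiE UNIV A) x :: ennreal) = (\<Prod>j\<in>UNIV. indicator (A j) (x j))"
      by (auto simp: indicator_def PiE_iff prod.neutral intro!: prod_zero)
    then show "(\<Prod>j\<in>UNIV. indicator {0..<1} (x j)) * indicator (PiE UNIV A) x
        = (\<Prod>j\<in>UNIV. (indicator {0..<1} (x j) * indicator (A j) (x j) :: ennreal))"
      by (simp add: prod.distrib)
  qed
  also have "\<dots> = (\<Prod>j\<in>UNIV. \<integral>\<^sup>+x. indicator {0..<1} x * indicator (A j) x \<partial>lborel)"
    using A by (intro lb_prod.product_nn_integral_prod) auto
  also have "\<dots> = (\<Prod>j\<in>UNIV. emeasure uni (A j))"
    using A by (intro prod.cong refl) (simp add: uni_def emeasure_density)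
  finally show "emeasure (density (PiM UNIV (\<lambda>_. lborel)) (\<lambda>x. \<Prod>j\<in>UNIV. indicator {0..<1} (x j))) (PiE UNIV A)
     = (\<Prod>j\<in>UNIV. emeasure uni (A j))" .
qed (auto intro!: sets_PiM_cong)

lemma indicator_unit_cube: "(indicator unit_cube (vec_lambda x) :: ennreal) = (\<Prod>j\<in>UNIV. indicator {0..<1} (x j))"
  by (auto simp: indicator_def unit_cube_def prod.neutral intro!: prod_zero)

lemma nn_integral_torus:
  fixes \<phi> :: "complex ^ 'n::finite \<Rightarrow> ennreal"
  assumes \<phi>: "\<phi> \<in> borel_measurable borel"
  shows "(\<integral>\<^sup>+\<xi>. \<phi> \<xi> \<partial>torus_measure) = (\<integral>\<^sup>+a. \<phi> (tor a) \<partial>TM)"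
proof -
  have ct: "continuous_on UNIV (torus_param :: real ^ 'n \<Rightarrow> complex ^ 'n)"
    unfolding torus_param_def by (intro continuous_intros)
  have \<phi>t: "(\<lambda>x :: real ^ 'n. \<phi> (torus_param x)) \<in> borel_measurable borel"
    by (rule measurable_compose[OF borel_measurable_continuous_onI[OF ct] \<phi>])
  have [measurable]: "unit_cube \<in> sets (borel :: (real ^ 'n) measure)"
    using sets_unit_cube by simp
  have tp: "torus_param (vec_lambda x) = tor x" for x :: "'n \<Rightarrow> real"
    by (simp add: torus_param_def tor_def)
  have pm: "(\<lambda>x. \<Prod>j\<in>UNIV. indicator {0..<1} (x j) :: ennreal) \<in> borel_measurable (PiM UNIV (\<lambda>_ :: 'n. lborel :: real measure))"
  proof (intro borel_measurable_prod_ennreal)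
    fix i :: 'n
    show "(\<lambda>x. indicator {0..<1} (x i) :: ennreal) \<in> borel_measurable (PiM UNIV (\<lambda>_. lborel :: real measure))"
      by (rule measurable_compose[where f = "\<lambda>x. x i" and g = "indicator {0..<1::real}" and N = lborel]) (auto intro!: borel_measurable_indicator)
  qed
  have \<phi>m: "(\<lambda>x. \<phi> (tor x)) \<in> borel_measurable (PiM UNIV (\<lambda>_ :: 'n. lborel :: real measure))"
    using measurable_compose[OF measurable_vec_lambda_PiM \<phi>t] by (simp add: tp)
  have "(\<integral>\<^sup>+\<xi>. \<phi> \<xi> \<partial>torus_measure) = (\<integral>\<^sup>+\<theta>. \<phi> (torus_param \<theta>) \<partial>restrict_space lborel unit_cube)"
    unfolding torus_measure_def
    by (rule nn_integral_distr[OF torus_param_measurable]) (use \<phi> in \<open>auto intro: measurable_restrict_space1\<close>)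
  also have "\<dots> = (\<integral>\<^sup>+\<theta>. \<phi> (torus_param \<theta>) * indicator unit_cube \<theta> \<partial>lborel)"
    by (rule nn_integral_restrict_space) simp
  also have "\<dots> = (\<integral>\<^sup>+x. \<phi> (tor x) * indicator unit_cube (vec_lambda x) \<partial>PiM UNIV (\<lambda>_ :: 'n. lborel))"
    unfolding lborel_vec
    by (subst nn_integral_distr[OF measurable_vec_lambda_PiM]) (use \<phi>t in \<open>auto simp: tp\<close>)
  also have "\<dots> = (\<integral>\<^sup>+x. \<phi> (tor x) \<partial>TM)"
    unfolding TM_density indicator_unit_cube
    by (subst nn_integral_density[OF pm \<phi>m]) (simp add: mult.commute)
  finally show ?thesis .
qed

section \<open>Rotation invariance on the circle and on the torus\<close>

lemma unit_exp_periodic: "unit_exp (x + of_int k) = unit_exp x"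
proof -
  have "unit_exp (x + of_int k) = unit_exp x * cis (2 * pi * of_int k)"
    by (simp only: cis_mult distrib_left)
  moreover have "cis (2 * pi * of_int k) = 1" by (rule cis_multiple_2pi) auto
  ultimately show ?thesis by (simp only: mult_1_right)
qed

text \<open>After reducing \<open>b\<close> modulo 1 to \<open>c\<close>, the translated interval is
  \<open>[-c, 1 - c)\<close>; its negative piece is moved right by one period.\<close>

lemma nn_integral_rotate:
  assumes [measurable]: "\<phi> \<in> borel_measurable borel"
  shows "(\<integral>\<^sup>+x. \<phi> (unit_exp (x - b)) \<partial>uni) = (\<integral>\<^sup>+x. \<phi> (unit_exp x) \<partial>uni)"
proof -
  define c where "c = frac b"
  have c: "0 \<le> c" "c < 1" by (auto simp: c_def frac_lt_1)
  define \<psi> where "\<psi> = (\<lambda>x. \<phi> (unit_exp x))"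
  have [measurable]: "\<psi> \<in> borel_measurable borel" unfolding \<psi>_def by measurable
  have per: "\<psi> (x - 1) = \<psi> x" for x
    using unit_exp_periodic[of x "-1"] by (simp add: \<psi>_def)
  have "unit_exp (x - b) = unit_exp (x - c)" for x
    using unit_exp_periodic[of "x - c" "- floor b"] by (simp add: c_def frac_def algebra_simps)
  then have "(\<integral>\<^sup>+x. \<phi> (unit_exp (x - b)) \<partial>uni) = (\<integral>\<^sup>+x. \<psi> (x - c) \<partial>uni)"
    by (simp add: \<psi>_def)
  also have "\<dots> = (\<integral>\<^sup>+x. \<psi> (x - c) * indicator {0..<1} x \<partial>lborel)"
    unfolding uni_def by (subst nn_integral_density) (auto simp: mult.commute)
  also have "\<dots> = (\<integral>\<^sup>+x. \<psi> x * indicator {-c..<1-c} x \<partial>lborel)"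
    by (subst nn_integral_real_affine[where c = 1 and t = "c" and f = "\<lambda>x. \<psi> (x - c) * indicator {0..<1} x"])
       (auto intro!: nn_integral_cong simp: indicator_def)
  also have "\<dots> = (\<integral>\<^sup>+x. \<psi> x * indicator {-c..<0} x + \<psi> x * indicator {0..<1-c} x \<partial>lborel)"
    using c by (intro nn_integral_cong) (auto simp: indicator_def)
  also have "\<dots> = (\<integral>\<^sup>+x. \<psi> x * indicator {-c..<0} x \<partial>lborel) + (\<integral>\<^sup>+x. \<psi> x * indicator {0..<1-c} x \<partial>lborel)"
    by (rule nn_integral_add) auto
  also have "(\<integral>\<^sup>+x. \<psi> x * indicator {-c..<0} x \<partial>lborel) = (\<integral>\<^sup>+x. \<psi> x * indicator {1-c..<1} x \<partial>lborel)"
    by (subst nn_integral_real_affine[where c = 1 and t = "-1" and f = "\<lambda>x. \<psi> x * indicator {-c..<0} x"])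
       (auto intro!: nn_integral_cong simp: indicator_def per)
  also have "\<dots> + (\<integral>\<^sup>+x. \<psi> x * indicator {0..<1-c} x \<partial>lborel)
      = (\<integral>\<^sup>+x. \<psi> x * indicator {1-c..<1} x + \<psi> x * indicator {0..<1-c} x \<partial>lborel)"
    by (rule nn_integral_add[symmetric]) auto
  also have "\<dots> = (\<integral>\<^sup>+x. \<psi> x * indicator {0..<1} x \<partial>lborel)"
    using c by (intro nn_integral_cong) (auto simp: indicator_def)
  also have "\<dots> = (\<integral>\<^sup>+x. \<psi> x \<partial>uni)"
    unfolding uni_def by (subst nn_integral_density) (auto simp: mult.commute)
  finally show ?thesis by (simp add: \<psi>_def)
qed

text \<open>A shift of angles does not preserve \<open>uni\<close>, only its image on the circle;
  invariance is therefore stated for this image and its products.\<close>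

definition circ :: "complex measure" where "circ = distr uni borel unit_exp"

lemma sigma_finite_circ: "sigma_finite_measure circ"
proof -
  have "finite_measure circ" unfolding circ_def by (rule uni.finite_measure_distr) simp
  then interpret finite_measure circ .
  show ?thesis by standard
qed

interpretation circ_prod: product_sigma_finite "\<lambda>_. circ"
  by (rule product_sigma_finite.intro) (rule sigma_finite_circ)

lemma distr_rotate: "distr uni borel (\<lambda>x. unit_exp (x - b)) = circ"
proof (rule measure_eqI)
  fix A assume "A \<in> sets (distr uni borel (\<lambda>x. unit_exp (x - b)))"
  then have A [measurable]: "A \<in> sets borel" by simp
  have "emeasure (distr uni borel (\<lambda>x. unit_exp (x - b))) A = (\<integral>\<^sup>+x. indicator A (unit_exp (x - b)) \<partial>uni)"
    by (subst nn_integral_indicator[symmetric], simp, subst nn_integral_distr) auto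
  also have "\<dots> = (\<integral>\<^sup>+x. indicator A (unit_exp x) \<partial>uni)"
    by (rule nn_integral_rotate) simp
  also have "\<dots> = emeasure circ A"
    unfolding circ_def by (subst nn_integral_indicator[symmetric], simp, subst nn_integral_distr) auto
  finally show "emeasure (distr uni borel (\<lambda>x. unit_exp (x - b))) A = emeasure circ A" .
qed (simp add: circ_def)

lemma distr_TM_rotate:
  "distr TM (PiM UNIV (\<lambda>_. borel)) (\<lambda>a j. unit_exp (a j - b j)) = PiM (UNIV :: 'n::finite set) (\<lambda>_. circ)"
proof (rule circ_prod.PiM_eqI)
  have m: "(\<lambda>a j. unit_exp (a j - b j)) \<in> TM \<rightarrow>\<^sub>M PiM (UNIV :: 'n set) (\<lambda>_. borel)"
  proof (rule measurable_PiM_single')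
    fix i :: 'n
    show "(\<lambda>a. unit_exp (a i - b i)) \<in> borel_measurable TM"
      using measurable_TM_component[of i] by (intro measurable_unit_exp') simp
  qed auto
  fix A :: "'n \<Rightarrow> complex set" assume "\<And>i. i \<in> UNIV \<Longrightarrow> A i \<in> sets circ"
  then have A: "A i \<in> sets borel" for i by (simp add: circ_def)
  have pre: "(\<lambda>a j. unit_exp (a j - b j)) -` PiE UNIV A = PiE UNIV (\<lambda>j. (\<lambda>x. unit_exp (x - b j)) -` A j)"
    by (auto simp: PiE_iff)
  have mj: "(\<lambda>x. unit_exp (x - y)) \<in> borel_measurable uni" for y
    by measurable
  have pj: "(\<lambda>x. unit_exp (x - b j)) -` A j \<in> sets uni" for j
    using measurable_sets[OF mj A, of "b j" j] by simp
  have "emeasure (distr TM (PiM UNIV (\<lambda>_. borel)) (\<lambda>a j. unit_exp (a j - b j))) (PiE UNIV A)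
     = emeasure TM (PiE UNIV (\<lambda>j. (\<lambda>x. unit_exp (x - b j)) -` A j))"
    by (subst emeasure_distr[OF m]) (auto simp: pre intro!: sets_PiM_I_finite A)
  also have "\<dots> = (\<Prod>j\<in>UNIV. emeasure uni ((\<lambda>x. unit_exp (x - b j)) -` A j))"
    unfolding TM_def by (rule uni_prod.emeasure_PiM) (auto simp: pj[simplified])
  also have "\<dots> = (\<Prod>j\<in>UNIV. emeasure circ (A j))"
  proof (intro prod.cong refl)
    fix j
    show "emeasure uni ((\<lambda>x. unit_exp (x - b j)) -` A j) = emeasure circ (A j)"
      unfolding distr_rotate[of "b j", symmetric] by (subst emeasure_distr[OF mj A]) simp
  qed
  finally show "emeasure (distr TM (PiM UNIV (\<lambda>_. borel)) (\<lambda>a j. unit_exp (a j - b j))) (PiE UNIV A)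
     = (\<Prod>j\<in>UNIV. emeasure circ (A j))" .
qed (auto intro!: sets_PiM_cong simp: circ_def)

lemma nn_integral_TM_rotate:
  fixes \<phi> :: "complex ^ 'n::finite \<Rightarrow> ennreal"
  assumes \<phi>: "\<phi> \<in> borel_measurable borel"
  shows "(\<integral>\<^sup>+a. \<phi> (tor (\<lambda>j. a j - b j)) \<partial>TM) = (\<integral>\<^sup>+a. \<phi> (tor a) \<partial>TM)"
proof -
  have *: "(\<integral>\<^sup>+a. \<phi> (tor (\<lambda>j. a j - b j)) \<partial>TM) = (\<integral>\<^sup>+x. \<phi> (\<chi> j. x j) \<partial>PiM (UNIV :: 'n set) (\<lambda>_. circ))" for b
  proof -
    have m: "(\<lambda>a j. unit_exp (a j - b j)) \<in> TM \<rightarrow>\<^sub>M PiM (UNIV :: 'n set) (\<lambda>_. borel)"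
    proof (rule measurable_PiM_single')
      fix i :: 'n
      show "(\<lambda>a. unit_exp (a i - b i)) \<in> borel_measurable TM"
        using measurable_TM_component[of i] by (intro measurable_unit_exp') simp
    qed auto
    have "(\<lambda>x. x i) \<in> borel_measurable (PiM (UNIV :: 'n set) (\<lambda>_. borel :: complex measure))" for i
      using measurable_component_singleton[of i "UNIV :: 'n set" "\<lambda>_. borel :: complex measure"] by simp
    then have "(\<lambda>x. \<chi> i. x i) \<in> borel_measurable (PiM (UNIV :: 'n set) (\<lambda>_. borel :: complex measure))"
      by (rule measurable_vec_lambda)
    then have "(\<lambda>x. \<phi> (\<chi> i. x i)) \<in> borel_measurable (PiM (UNIV :: 'n set) (\<lambda>_. borel :: complex measure))"
      by (rule measurable_compose[OF _ \<phi>])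
    then show ?thesis
      unfolding distr_TM_rotate[of b, symmetric] by (subst nn_integral_distr[OF m]) (auto simp: tor_def)
  qed
  show ?thesis using *[of b] *[of "\<lambda>_. 0"] by simp
qed

section \<open>Averages over Whitney boxes\<close>

text \<open>Chosen so that at a dyadic radius the box is exactly the next dyadic shell
  (\<open>wbox_dr\<close>); boxes at different dyadic radii are then disjoint.\<close>

definition wbox :: "real ^ 'n \<Rightarrow> (real ^ 'n) set" where
  "wbox r = {x. \<forall>j. 1 - (1 - r $ j) / 2 \<le> x $ j \<and> x $ j < 1 - (1 - r $ j) / 4}"

text \<open>Half-open, so that dyadic boxes partition the cube without overlap.\<close>

definition cbx :: "('n \<Rightarrow> real) \<Rightarrow> ('n \<Rightarrow> real) \<Rightarrow> (real ^ 'n) set" where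
  "cbx l u = {x. \<forall>j. l j \<le> x $ j \<and> x $ j < u j}"

lemma wbox_cbx: "wbox r = cbx (\<lambda>j. 1 - (1 - r $ j) / 2) (\<lambda>j. 1 - (1 - r $ j) / 4)"
  by (simp add: wbox_def cbx_def)

lemma unit_cube_cbx: "unit_cube = cbx (\<lambda>_. 0) (\<lambda>_. 1)"
  by (simp add: unit_cube_def cbx_def)

lemma nn_integral_prod_vec:
  fixes f :: "'n::finite \<Rightarrow> real \<Rightarrow> ennreal"
  assumes f: "\<And>j. f j \<in> borel_measurable borel"
  shows "(\<integral>\<^sup>+x. (\<Prod>j\<in>UNIV. f j (x $ j)) \<partial>lborel) = (\<Prod>j\<in>UNIV. \<integral>\<^sup>+y. f j y \<partial>lborel)"
proof -
  have m: "(\<lambda>x :: real ^ 'n. \<Prod>j\<in>UNIV. f j (x $ j)) \<in> borel_measurable borel"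
    by (intro borel_measurable_prod_ennreal measurable_compose[OF _ f] measurable_vec_nth) simp
  show ?thesis
    unfolding lborel_vec
    using m by (subst nn_integral_distr[OF measurable_vec_lambda_PiM])
      (use f in \<open>auto intro!: lb_prod.product_nn_integral_prod\<close>)
qed

lemma indicator_cbx:
  fixes x :: "real ^ 'n::finite"
  shows "(indicator (cbx l u) x :: ennreal) = (\<Prod>j\<in>UNIV. indicator {l j..<u j} (x $ j))"
  by (auto simp: indicator_def cbx_def prod.neutral intro!: prod_zero)

lemma sets_cbx [measurable]: "cbx l u \<in> sets (borel :: (real ^ 'n::finite) measure)"
proof -
  have "cbx l u = (\<Inter>j. {x :: real ^ 'n. l j \<le> x $ j} \<inter> {x. x $ j < u j})"
    by (auto simp: cbx_def)
  also have "\<dots> \<in> sets borel"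
    by (intro sets.finite_INT) (auto intro!: borel_open borel_closed closed_Collect_le open_Collect_less continuous_intros)
  finally show ?thesis .
qed

lemma nn_integral_cbx_prod:
  fixes f :: "'n::finite \<Rightarrow> real \<Rightarrow> ennreal"
  assumes f [measurable]: "\<And>j. f j \<in> borel_measurable borel"
  shows "(\<integral>\<^sup>+x\<in>cbx l u. (\<Prod>j\<in>UNIV. f j (x $ j)) \<partial>lborel) = (\<Prod>j\<in>UNIV. \<integral>\<^sup>+y\<in>{l j..<u j}. f j y \<partial>lborel)"
  unfolding indicator_cbx prod.distrib[symmetric]
  by (rule nn_integral_prod_vec[where f = "\<lambda>j y. f j y * indicator {l j..<u j} y"]) measurable

lemma emeasure_cbx:
  fixes l u :: "'n::finite \<Rightarrow> real"
  assumes "\<And>j. l j \<le> u j"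
  shows "emeasure lborel (cbx l u :: (real ^ 'n::finite) set) = ennreal (\<Prod>j\<in>UNIV. u j - l j)"
proof -
  have "emeasure lborel (cbx l u :: (real ^ 'n) set) = (\<integral>\<^sup>+x. (\<Prod>j\<in>UNIV. indicator {l j..<u j} (x $ j)) \<partial>(lborel :: (real ^ 'n) measure))"
    by (simp add: indicator_cbx[symmetric])
  also have "\<dots> = (\<Prod>j\<in>UNIV. ennreal (u j - l j))"
    using assms by (subst nn_integral_prod_vec) auto
  also have "\<dots> = ennreal (\<Prod>j\<in>UNIV. u j - l j)"
    using assms by (subst prod_ennreal) auto
  finally show ?thesis .
qed

text \<open>Moving the point from radius \<open>r\<close> to \<open>\<rho>\<close> changes its
  distance to \<open>w\<close> by \<open>\<rho> - r \<le> 1 - \<rho> \<le> d\<close>, so the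
  distance shrinks by a factor of at most 3; squared, this is the constant 9.\<close>

lemma poisson_harnack:
  assumes r: "0 \<le> r" "r < 1" and \<rho>: "r \<le> \<rho>" "\<rho> < 1" "(1 - r) / 2 \<le> 1 - \<rho>" and w: "norm w = 1"
  shows "poisson (of_real \<rho> * unit_exp a) w \<le> 9 * poisson (of_real r * unit_exp a) w"
proof -
  define d where "d = norm (w - of_real \<rho> * unit_exp a)"
  define e where "e = norm (w - of_real r * unit_exp a)"
  have "norm w - norm (of_real \<rho> * unit_exp a) \<le> d"
    unfolding d_def by (rule norm_triangle_ineq2)
  then have d: "1 - \<rho> \<le> d" using w r \<rho> by (simp add: norm_mult)
  have "norm w - norm (of_real r * unit_exp a) \<le> e"
    unfolding e_def by (rule norm_triangle_ineq2)
  then have e: "1 - r \<le> e" using w r by (simp add: norm_mult)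
  have "e \<le> d + norm (of_real \<rho> * unit_exp a - of_real r * unit_exp a)"
    unfolding d_def e_def using norm_triangle_ineq[of "w - of_real \<rho> * unit_exp a" "of_real \<rho> * unit_exp a - of_real r * unit_exp a"] by simp
  also have "norm (of_real \<rho> * unit_exp a - of_real r * unit_exp a) = \<rho> - r"
    using \<rho> r by (simp add: left_diff_distrib[symmetric] norm_mult of_real_diff[symmetric] del: of_real_diff)
  finally have "e \<le> 3 * d" using d \<rho> by (simp add: field_simps)
  then have "e\<^sup>2 \<le> (3 * d)\<^sup>2" using e r by (intro power_mono) auto
  then have ed: "e\<^sup>2 \<le> 9 * d\<^sup>2" by (simp add: power_mult_distrib)
  have pos: "d > 0" "e > 0" using d e \<rho> r by linarith+
  have "1 - \<rho>\<^sup>2 \<le> 1 - r\<^sup>2" using r \<rho> by (simp add: power_mono)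
  moreover have "0 \<le> 1 - r\<^sup>2" using r by (simp add: power_le_one)
  ultimately have "(1 - \<rho>\<^sup>2) / d\<^sup>2 \<le> (1 - r\<^sup>2) / (e\<^sup>2 / 9)"
    using ed pos by (intro frac_le) auto
  then show ?thesis
    using r \<rho> unfolding poisson_def d_def e_def by (simp add: norm_mult mult.commute)
qed

lemma wbox_nth:
  assumes "r \<in> unit_cube" "x \<in> wbox r"
  shows "0 \<le> x $ j" "x $ j < 1" "r $ j < x $ j"
proof -
  have "1 - (1 - r $ j) / 2 \<le> x $ j \<and> x $ j < 1 - (1 - r $ j) / 4" "0 \<le> r $ j" "r $ j < 1"
    using assms by (auto simp: wbox_def unit_cube_def)
  then show "0 \<le> x $ j" "x $ j < 1" "r $ j < x $ j" by (auto simp: field_simps)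
qed

lemma wbox_subset: "r \<in> unit_cube \<Longrightarrow> wbox r \<subseteq> unit_cube"
  unfolding subset_iff unit_cube_def mem_Collect_eq by (blast intro: wbox_nth(1,2)[unfolded unit_cube_def mem_Collect_eq])

lemma wbox_vless: "r \<in> unit_cube \<Longrightarrow> x \<in> wbox r \<Longrightarrow> vless r x"
  unfolding vless_def by (blast intro: wbox_nth(3))

text \<open>The ratio \<open>r / x\<close> falls in the range of \<open>poisson_harnack\<close>, so
  the kernels relative to all tori in the box are dominated by one kernel that does not depend on
  \<open>x\<close>.\<close>

lemma PK_harnack:
  assumes r: "r \<in> unit_cube" and x: "x \<in> wbox r"
  shows "PK (vdiv r x) a b \<le> 9 ^ CARD('n) * PK (r :: real ^ 'n::finite) a b"
proof -
  have 1: "0 \<le> r $ j" "r $ j < 1" "(1 + r $ j) / 2 \<le> x $ j" "x $ j < 1" for j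
  proof -
    show "0 \<le> r $ j" "r $ j < 1" using r by (auto simp: unit_cube_def)
    have "1 - (1 - r $ j) / 2 \<le> x $ j \<and> x $ j < 1 - (1 - r $ j) / 4" using x by (auto simp: wbox_def)
    then show "(1 + r $ j) / 2 \<le> x $ j" "x $ j < 1" using \<open>r $ j < 1\<close> by (auto simp: field_simps)
  qed
  have "poisson (of_real (vdiv r x $ j) * unit_exp (a j)) (unit_exp (b j))
      \<le> 9 * poisson (of_real (r $ j) * unit_exp (a j)) (unit_exp (b j))" for j
  proof (rule poisson_harnack)
    have xp: "0 < x $ j" using 1[of j] by (simp add: field_simps)
    show "r $ j \<le> vdiv r x $ j"
      using 1[of j] xp by (simp add: vdiv_def pos_le_divide_eq mult_left_le)
    have "r $ j < x $ j" using 1[of j] by (simp add: field_simps)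
    then show "vdiv r x $ j < 1" using xp by (simp add: vdiv_def)
    have "r $ j / x $ j \<le> r $ j / ((1 + r $ j) / 2)"
      using 1[of j] by (intro divide_left_mono mult_pos_pos) auto
    also have "\<dots> \<le> 1 - (1 - r $ j) / 2"
    proof -
      \<comment> \<open>Both factors are \<open>(1 + r) / 2\<close>, so this is the inequality of
        arithmetic and geometric means for 1 and \<open>r\<close>.\<close>
      have "r $ j \<le> (1 - (1 - r $ j) / 2) * ((1 + r $ j) / 2)"
        using zero_le_square[of "1 - r $ j"] by (simp add: field_simps)
      moreover have "0 < (1 + r $ j) / 2" using 1[of j] by simp
      ultimately show ?thesis by (simp only: pos_divide_le_eq)
    qed
    finally show "(1 - r $ j) / 2 \<le> 1 - vdiv r x $ j" unfolding vdiv_def vec_lambda_beta by linarith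
  qed (use 1 in auto)
  moreover have "vdiv r x \<in> unit_cube"
    by (rule vdiv_cube[OF r wbox_vless[OF r x]])
  ultimately have "PK (vdiv r x) a b \<le> (\<Prod>j\<in>UNIV. 9 * poisson (of_real (r $ j) * unit_exp (a j)) (unit_exp (b j)))"
    unfolding PK_def by (intro prod_mono conjI poisson_rho_nonneg) auto
  also have "\<dots> = 9 ^ CARD('n) * PK r a b"
    by (simp add: prod.distrib PK_def)
  finally show ?thesis .
qed

text \<open>The radial average is taken before the power \<open>a\<close>: the Poisson inequality is
  averaged over the box with the common kernel \<open>PK r\<close>, then Jensen is applied to that
  kernel, then the inner angle is integrated. The result has the radial integral under the power
  \<open>a\<close>, as in the \<open>F\<close> norm.\<close>

lemma Jm_le_wbox:
  fixes f :: "complex ^ 'n::finite \<Rightarrow> complex"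
  assumes f: "sep_hol f" and q: "q > 0" and a: "a \<ge> 1" and r: "r \<in> unit_cube"
  shows "ennpowr (ennreal (\<Prod>j\<in>UNIV. (1 - r $ j) / 4)) a * Jm (a * q) f r \<le>
    ennpowr (ennreal (9 ^ CARD('n))) a *
      (\<integral>\<^sup>+b. ennpowr (\<integral>\<^sup>+x\<in>wbox r. ennreal (norm (f (rmult x (tor b))) powr q) \<partial>lborel) a \<partial>TM)"
proof -
  interpret T: sigma_finite_measure "TM :: ('n \<Rightarrow> real) measure" by (rule sigma_finite_TM)
  interpret LT: pair_sigma_finite "lborel :: (real ^ 'n) measure" "TM :: ('n \<Rightarrow> real) measure" ..
  interpret TT: pair_sigma_finite "TM :: ('n \<Rightarrow> real) measure" "TM :: ('n \<Rightarrow> real) measure" ..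
  have [measurable]: "f \<in> borel_measurable borel" using f by (rule sep_hol_measurable)
  have [measurable]: "wbox r \<in> sets borel" unfolding wbox_cbx by measurable
  define D where "D = ennreal (\<Prod>j\<in>UNIV. (1 - r $ j) / 4)"
  define N where "N = ennreal (9 ^ CARD('n))"
  define \<Psi> where "\<Psi> = (\<lambda>b. \<integral>\<^sup>+x\<in>wbox r. ennreal (norm (f (rmult x (tor b))) powr q) \<partial>lborel)"
  have [measurable]: "\<Psi> \<in> borel_measurable TM" unfolding \<Psi>_def by measurable
  have "emeasure lborel (wbox r) = ennreal (\<Prod>j\<in>UNIV. (1 - (1 - r $ j) / 4) - (1 - (1 - r $ j) / 2))"
    unfolding wbox_cbx using r by (intro emeasure_cbx) (auto simp: unit_cube_def less_imp_le)
  also have "\<dots> = D"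
    unfolding D_def by (intro arg_cong[of _ _ ennreal] prod.cong refl) (simp add: field_simps)
  finally have D: "emeasure lborel (wbox r) = D" .
  have pt: "ennpowr D a * ennreal (norm (f (rmult r (tor c))) powr (a * q)) \<le>
      ennpowr N a * (\<integral>\<^sup>+b. ennreal (PK r c b) * ennpowr (\<Psi> b) a \<partial>TM)" for c
  proof -
    define F where "F = ennreal (norm (f (rmult r (tor c))) powr q)"
    have "D * F = (\<integral>\<^sup>+x\<in>wbox r. F \<partial>lborel)"
      by (subst nn_integral_cmult_indicator) (auto simp: D mult.commute)
    also have "\<dots> \<le> (\<integral>\<^sup>+x\<in>wbox r. (\<integral>\<^sup>+b. N * (ennreal (PK r c b) * ennreal (norm (f (rmult x (tor b))) powr q)) \<partial>TM) \<partial>lborel)"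
    proof (intro nn_integral_mono)
      fix x :: "real ^ 'n"
      have "F \<le> (\<integral>\<^sup>+b. N * (ennreal (PK r c b) * ennreal (norm (f (rmult x (tor b))) powr q)) \<partial>TM)" if x: "x \<in> wbox r"
      proof -
        have "F \<le> (\<integral>\<^sup>+b. ennreal (PK (vdiv r x) c b * norm (f (rmult x (tor b))) powr q) \<partial>TM)"
          unfolding F_def using x wbox_subset[OF r] wbox_vless[OF r x] by (intro sub_poisson_polydisc f q r) auto
        also have "\<dots> \<le> (\<integral>\<^sup>+b. ennreal (9 ^ CARD('n) * PK r c b * norm (f (rmult x (tor b))) powr q) \<partial>TM)"
          by (intro nn_integral_mono ennreal_leI mult_right_mono PK_harnack[OF r x]) simp
        also have "\<dots> = (\<integral>\<^sup>+b. N * (ennreal (PK r c b) * ennreal (norm (f (rmult x (tor b))) powr q)) \<partial>TM)"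
          unfolding N_def using PK_nonneg[OF r] by (simp add: ennreal_mult[symmetric] mult.assoc)
        finally show ?thesis .
      qed
      then show "F * indicator (wbox r) x \<le> (\<integral>\<^sup>+b. N * (ennreal (PK r c b) * ennreal (norm (f (rmult x (tor b))) powr q)) \<partial>TM) * indicator (wbox r) x"
        by (auto simp: indicator_def)
    qed
    also have "\<dots> = (\<integral>\<^sup>+x. \<integral>\<^sup>+b. N * ennreal (PK r c b) * (ennreal (norm (f (rmult x (tor b))) powr q) * indicator (wbox r) x) \<partial>TM \<partial>lborel)"
      by (subst nn_integral_multc[symmetric]) (auto simp: mult_ac)
    also have "\<dots> = (\<integral>\<^sup>+b. \<integral>\<^sup>+x. N * ennreal (PK r c b) * (ennreal (norm (f (rmult x (tor b))) powr q) * indicator (wbox r) x) \<partial>lborel \<partial>TM)"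
      by (rule LT.Fubini'[symmetric]) measurable
    also have "\<dots> = (\<integral>\<^sup>+b. N * (ennreal (PK r c b) * \<Psi> b) \<partial>TM)"
      unfolding \<Psi>_def by (subst nn_integral_cmult) (auto simp: mult.assoc)
    also have "\<dots> = N * (\<integral>\<^sup>+b. ennreal (PK r c b) * \<Psi> b \<partial>TM)"
      by (rule nn_integral_cmult) measurable
    finally have "ennpowr (D * F) a \<le> ennpowr (N * (\<integral>\<^sup>+b. ennreal (PK r c b) * \<Psi> b \<partial>TM)) a"
      using a by (intro ennpowr_mono) auto
    also have "\<dots> \<le> ennpowr N a * (\<integral>\<^sup>+b. ennreal (PK r c b) * ennpowr (\<Psi> b) a \<partial>TM)"
      unfolding ennpowr_mult using nn_integral_PK[OF r]
      by (intro mult_left_mono jensen_ennpowr a) (auto simp: measurable_compose)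
    finally show ?thesis
      by (simp add: F_def ennpowr_mult ennpowr_ennreal powr_powr mult.commute)
  qed
  have "ennpowr D a * Jm (a * q) f r = (\<integral>\<^sup>+c. ennpowr D a * ennreal (norm (f (rmult r (tor c))) powr (a * q)) \<partial>TM)"
    unfolding Jm_def by (rule nn_integral_cmult[symmetric]) measurable
  also have "\<dots> \<le> (\<integral>\<^sup>+c. ennpowr N a * (\<integral>\<^sup>+b. ennreal (PK r c b) * ennpowr (\<Psi> b) a \<partial>TM) \<partial>TM)"
    by (intro nn_integral_mono pt)
  also have "\<dots> = ennpowr N a * (\<integral>\<^sup>+c. \<integral>\<^sup>+b. ennreal (PK r c b) * ennpowr (\<Psi> b) a \<partial>TM \<partial>TM)"
    by (rule nn_integral_cmult) measurable
  also have "(\<integral>\<^sup>+c. \<integral>\<^sup>+b. ennreal (PK r c b) * ennpowr (\<Psi> b) a \<partial>TM \<partial>TM)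
      = (\<integral>\<^sup>+b. \<integral>\<^sup>+c. ennreal (PK r c b) * ennpowr (\<Psi> b) a \<partial>TM \<partial>TM)"
    by (rule TT.Fubini'[symmetric]) measurable
  also have "\<dots> = (\<integral>\<^sup>+b. ennpowr (\<Psi> b) a \<partial>TM)"
  proof (rule nn_integral_cong)
    fix b :: "'n \<Rightarrow> real"
    have "(\<lambda>c. PK r c b) \<in> borel_measurable TM"
      using measurable_PK'[of r b] by (subst PK_commute)
    then show "(\<integral>\<^sup>+c. ennreal (PK r c b) * ennpowr (\<Psi> b) a \<partial>TM) = ennpowr (\<Psi> b) a"
      using nn_integral_PK'[OF r, of b] by (subst nn_integral_multc) auto
  qed
  finally show ?thesis by (simp add: D_def N_def \<Psi>_def)
qed

lemma powr_between:
  assumes "0 < y" "y / 4 \<le> z" "z \<le> y"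
  shows "z powr g \<le> 4 powr \<bar>g\<bar> * y powr g" "y powr g \<le> 4 powr \<bar>g\<bar> * (z :: real) powr g"
proof -
  have z: "z > 0" using assms by linarith
  have 4: "(1::real) \<le> 4 powr \<bar>g\<bar>" by (rule ge_one_powr_ge_zero) auto
  show "z powr g \<le> 4 powr \<bar>g\<bar> * y powr g"
  proof (cases "g \<ge> 0")
    case True
    then have "z powr g \<le> 1 * y powr g" using assms z by (simp add: powr_mono2)
    also have "\<dots> \<le> 4 powr \<bar>g\<bar> * y powr g" using 4 by (intro mult_right_mono) auto
    finally show ?thesis .
  next
    case False
    then have "z powr g \<le> (y / 4) powr g" using assms by (intro powr_mono2') auto
    also have "\<dots> = 4 powr \<bar>g\<bar> * y powr g" using False assms by (simp add: powr_divide powr_minus divide_simps)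
    finally show ?thesis .
  qed
  show "y powr g \<le> 4 powr \<bar>g\<bar> * z powr g"
  proof (cases "g \<ge> 0")
    case True
    then have "y powr g \<le> (4 * z) powr g" using assms by (intro powr_mono2) auto
    then show ?thesis using True z by (simp add: powr_mult)
  next
    case False
    then have "y powr g \<le> 1 * z powr g" using assms z by (simp add: powr_mono2')
    also have "\<dots> \<le> 4 powr \<bar>g\<bar> * z powr g" using 4 by (intro mult_right_mono) auto
    finally show ?thesis .
  qed
qed

lemma cube_weight_between:
  fixes r x :: "real ^ 'n::finite"
  assumes "\<And>j. r $ j < 1" "\<And>j. (1 - r $ j) / 4 \<le> 1 - x $ j" "\<And>j. 1 - x $ j \<le> 1 - r $ j"
  shows "cube_weight x g \<le> (4 powr \<bar>g\<bar>) ^ CARD('n) * cube_weight r g"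
    and "cube_weight r g \<le> (4 powr \<bar>g\<bar>) ^ CARD('n) * cube_weight x g"
proof -
  have "cube_weight x g \<le> (\<Prod>j\<in>UNIV. 4 powr \<bar>g\<bar> * (1 - r $ j) powr g)"
    unfolding cube_weight_def using assms by (intro prod_mono conjI powr_between) auto
  then show "cube_weight x g \<le> (4 powr \<bar>g\<bar>) ^ CARD('n) * cube_weight r g"
    by (simp add: prod.distrib cube_weight_def)
  have "cube_weight r g \<le> (\<Prod>j\<in>UNIV. 4 powr \<bar>g\<bar> * (1 - x $ j) powr g)"
    unfolding cube_weight_def using assms by (intro prod_mono conjI powr_between) auto
  then show "cube_weight r g \<le> (4 powr \<bar>g\<bar>) ^ CARD('n) * cube_weight x g"
    by (simp add: prod.distrib cube_weight_def)
qed

lemma cube_weight_nonneg: "cube_weight r g \<ge> 0"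
  by (simp add: cube_weight_def prod_nonneg)

lemma cube_weight_add: "cube_weight r (g + h) = cube_weight r g * cube_weight r h"
  by (simp add: cube_weight_def powr_add prod.distrib)

lemma cube_weight_powr: "cube_weight r g powr a = cube_weight r (g * a)"
  unfolding cube_weight_def by (subst prod_powr_distrib) (auto simp: powr_powr)

lemma measurable_cube_weight [measurable]: "(\<lambda>r. cube_weight r g) \<in> borel_measurable borel"
  unfolding cube_weight_def by measurable

text \<open>The volume of the box contributes the exponent 1 and the weight contributes
  \<open>g * q - 1\<close>; they add up to \<open>g * q\<close>, and the power \<open>a\<close>
  makes it \<open>a * q * g\<close>. The constant is uniform in \<open>f\<close> and
  \<open>r\<close>.\<close>

lemma Jm_le_wbox_weight:
  assumes q: "q > 0" and a: "a \<ge> 1"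
  shows "\<exists>C::real. C \<ge> 0 \<and> (\<forall>f::complex ^ 'n::finite \<Rightarrow> complex. \<forall>r\<in>unit_cube. sep_hol f \<longrightarrow>
    ennreal (cube_weight r (a * q * g)) * Jm (a * q) f r \<le>
    ennreal C * (\<integral>\<^sup>+b. ennpowr (\<integral>\<^sup>+x\<in>wbox r. ennreal (norm (f (rmult x (tor b))) powr q * cube_weight x (g * q - 1)) \<partial>lborel) a \<partial>TM))"
proof -
  define K where "K = (4 powr \<bar>g * q - 1\<bar>) ^ CARD('n)"
  have K: "K > 0" by (simp add: K_def)
  define C where "C = (9 ^ CARD('n) * 4 ^ CARD('n) * K) powr a"
  have "ennreal (cube_weight r (a * q * g)) * Jm (a * q) f r \<le>
    ennreal C * (\<integral>\<^sup>+b. ennpowr (\<integral>\<^sup>+x\<in>wbox r. ennreal (norm (f (rmult x (tor b))) powr q * cube_weight x (g * q - 1)) \<partial>lborel) a \<partial>TM)"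
    if f: "sep_hol f" and r: "r \<in> unit_cube" for f and r :: "real ^ 'n"
  proof -
    have [measurable]: "f \<in> borel_measurable borel" using f by (rule sep_hol_measurable)
    have [measurable]: "wbox r \<in> sets borel" unfolding wbox_cbx by measurable
    interpret T: sigma_finite_measure "TM :: ('n \<Rightarrow> real) measure" by (rule sigma_finite_TM)
    let ?W = "\<lambda>b. \<integral>\<^sup>+x\<in>wbox r. ennreal (norm (f (rmult x (tor b))) powr q * cube_weight x (g * q - 1)) \<partial>lborel"
    let ?U = "\<lambda>b. \<integral>\<^sup>+x\<in>wbox r. ennreal (norm (f (rmult x (tor b))) powr q) \<partial>lborel"
    let ?D = "\<Prod>j\<in>UNIV. (1 - r $ j) / 4"
    have rj: "r $ j < 1" for j using r by (auto simp: unit_cube_def)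
    have UW: "ennreal (cube_weight r (g * q - 1)) * ?U b \<le> ennreal K * ?W b" for b
    proof -
      have "ennreal (cube_weight r (g * q - 1)) * ?U b
        = (\<integral>\<^sup>+x. ennreal (cube_weight r (g * q - 1)) * (ennreal (norm (f (rmult x (tor b))) powr q) * indicator (wbox r) x) \<partial>lborel)"
        by (rule nn_integral_cmult[symmetric]) measurable
      also have "\<dots> \<le> (\<integral>\<^sup>+x. ennreal K * (ennreal (norm (f (rmult x (tor b))) powr q * cube_weight x (g * q - 1)) * indicator (wbox r) x) \<partial>lborel)"
      proof (rule nn_integral_mono)
        fix x :: "real ^ 'n"
        have "cube_weight r (g * q - 1) * norm (f (rmult x (tor b))) powr q
            \<le> K * (norm (f (rmult x (tor b))) powr q * cube_weight x (g * q - 1))" if x: "x \<in> wbox r"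
        proof -
          have x1: "1 - (1 - r $ j) / 2 \<le> x $ j" and x2: "x $ j < 1 - (1 - r $ j) / 4" for j
            using x by (auto simp: wbox_def)
          have x': "(1 - r $ j) / 4 \<le> 1 - x $ j" "1 - x $ j \<le> 1 - r $ j" for j
          proof -
            show "(1 - r $ j) / 4 \<le> 1 - x $ j" using x2[of j] by linarith
            have "(1 - r $ j) / 2 \<le> 1 - r $ j" using rj[of j] by simp
            then show "1 - x $ j \<le> 1 - r $ j" using x1[of j] by linarith
          qed
          have "cube_weight r (g * q - 1) \<le> K * cube_weight x (g * q - 1)"
            unfolding K_def using rj x' by (intro cube_weight_between) auto
          then have "cube_weight r (g * q - 1) * norm (f (rmult x (tor b))) powr q \<le> K * cube_weight x (g * q - 1) * norm (f (rmult x (tor b))) powr q"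
            by (rule mult_right_mono) simp
          then show ?thesis by (simp add: mult_ac)
        qed
        then show "ennreal (cube_weight r (g * q - 1)) * (ennreal (norm (f (rmult x (tor b))) powr q) * indicator (wbox r) x)
           \<le> ennreal K * (ennreal (norm (f (rmult x (tor b))) powr q * cube_weight x (g * q - 1)) * indicator (wbox r) x)"
          using K by (auto simp: indicator_def ennreal_mult[symmetric] cube_weight_nonneg intro!: ennreal_leI)
      qed
      also have "\<dots> = ennreal K * ?W b"
        by (rule nn_integral_cmult) measurable
      finally show ?thesis .
    qed
    have Dp: "?D > 0" using rj by (intro prod_pos) auto
    have Deq: "4 ^ CARD('n) * ?D = cube_weight r 1"
      using rj by (simp add: cube_weight_def prod_dividef less_imp_le)
    have w: "cube_weight r (a * q * g) = (4 ^ CARD('n) * ?D * cube_weight r (g * q - 1)) powr a"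
      unfolding Deq cube_weight_add[symmetric] cube_weight_powr by (simp add: mult_ac)
    have "ennreal (cube_weight r (a * q * g)) * Jm (a * q) f r
      = ennreal ((4 ^ CARD('n)) powr a) * ennreal (cube_weight r (g * q - 1) powr a) * (ennpowr (ennreal ?D) a * Jm (a * q) f r)"
      unfolding w using Dp by (simp add: powr_mult cube_weight_nonneg ennreal_mult ennpowr_ennreal less_imp_le mult_ac)
    also have "\<dots> \<le> ennreal ((4 ^ CARD('n)) powr a) * ennreal (cube_weight r (g * q - 1) powr a) *
        (ennpowr (ennreal (9 ^ CARD('n))) a * (\<integral>\<^sup>+b. ennpowr (?U b) a \<partial>TM))"
      by (intro mult_left_mono Jm_le_wbox f q a r) auto
    also have "\<dots> = ennreal ((4 ^ CARD('n) * 9 ^ CARD('n)) powr a) * (\<integral>\<^sup>+b. ennpowr (ennreal (cube_weight r (g * q - 1)) * ?U b) a \<partial>TM)"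
      unfolding ennpowr_mult
      by (subst nn_integral_cmult) (auto simp: ennpowr_ennreal cube_weight_nonneg powr_mult ennreal_mult mult_ac)
    also have "\<dots> \<le> ennreal ((4 ^ CARD('n) * 9 ^ CARD('n)) powr a) * (\<integral>\<^sup>+b. ennpowr (ennreal K * ?W b) a \<partial>TM)"
      using a by (intro mult_left_mono nn_integral_mono ennpowr_mono UW) auto
    also have "\<dots> = ennreal C * (\<integral>\<^sup>+b. ennpowr (?W b) a \<partial>TM)"
      unfolding ennpowr_mult C_def using K
      by (subst nn_integral_cmult) (auto simp: ennpowr_ennreal less_imp_le powr_mult ennreal_mult mult_ac)
    finally show ?thesis .
  qed
  then show ?thesis by (intro exI[of _ C]) (auto simp: C_def)
qed

section \<open>Power series on the polydisc\<close>

lemma ex_bij_multiindex: "\<exists>e :: nat \<Rightarrow> ('n::finite \<Rightarrow> nat). bij e"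
proof -
  have "inj (\<lambda>i :: nat. (\<lambda>_ :: 'n. i))" by (auto simp: inj_def fun_eq_iff)
  then have "infinite (range (\<lambda>i :: nat. (\<lambda>_ :: 'n. i)))" by (simp add: finite_image_iff)
  then have "infinite (UNIV :: ('n \<Rightarrow> nat) set)" using finite_subset subset_UNIV by blast
  then have "bij_betw (from_nat_into UNIV) (UNIV :: nat set) (UNIV :: ('n \<Rightarrow> nat) set)"
    by (intro bij_betw_from_nat_into) auto
  then show ?thesis by blast
qed

text \<open>A fixed enumeration of multi-indices, used to pass from unordered sums to sequences of
  partial sums, where the limit theorems apply.\<close>

definition enum_mi :: "nat \<Rightarrow> ('n::finite \<Rightarrow> nat)" where
  "enum_mi = (SOME e. bij e)"

lemma bij_enum_mi: "bij enum_mi"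
  unfolding enum_mi_def by (rule someI_ex[OF ex_bij_multiindex])

lemma has_sum_enum_mi: "(f has_sum s) UNIV \<Longrightarrow> (\<lambda>i. f (enum_mi i)) sums s"
  using has_sum_reindex_bij_betw[OF bij_enum_mi, of f s] by (intro has_sum_imp_sums) simp

lemma summable_enum_mi: "f summable_on UNIV \<Longrightarrow> summable (\<lambda>i. f (enum_mi i))"
  using summable_on_reindex_bij_betw[OF bij_enum_mi, of f] by (intro summable_on_imp_summable) simp

definition mdeg :: "('n::finite \<Rightarrow> nat) \<Rightarrow> nat" where
  "mdeg k = (\<Sum>j\<in>UNIV. k j)"

text \<open>Convergence on the whole polydisc, read off the coefficients: by
  \<open>polydisc_bound\<close> every point is dominated by a diagonal radius
  \<open>(\<rho>, ..., \<rho>)\<close>.\<close>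

definition psum :: "(('n::finite \<Rightarrow> nat) \<Rightarrow> complex) \<Rightarrow> bool" where
  "psum a \<longleftrightarrow> (\<forall>\<rho>. 0 < \<rho> \<longrightarrow> \<rho> < 1 \<longrightarrow> (\<lambda>k. norm (a k) * \<rho> ^ mdeg k) summable_on UNIV)"

lemma vmonom_of_real: "norm (vmonom k (\<chi> j. of_real (r j))) = (\<Prod>j\<in>UNIV. \<bar>r j\<bar> ^ k j)"
  by (simp add: vmonom_def prod_norm[symmetric] norm_power)

lemma norm_vmonom_le:
  assumes "\<And>j. norm (z $ j) \<le> \<rho>"
  shows "norm (vmonom k z) \<le> \<rho> ^ mdeg k"
proof -
  have "norm (vmonom k z) \<le> (\<Prod>j\<in>UNIV. \<rho> ^ k j)"
    unfolding vmonom_def prod_norm[symmetric] norm_power using assms by (intro prod_mono) (auto intro: power_mono)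
  then show ?thesis by (simp add: mdeg_def power_sum)
qed

lemma polydisc_bound:
  assumes "z \<in> (polydisc :: (complex ^ 'n::finite) set)"
  obtains \<rho> where "0 < \<rho>" "\<rho> < 1" "\<And>j. norm (z $ j) < \<rho>"
proof -
  define M where "M = Max (range (\<lambda>j. norm (z $ j)))"
  have le: "norm (z $ j) \<le> M" for j unfolding M_def by (intro Max_ge) auto
  have "M \<in> range (\<lambda>j. norm (z $ j))" unfolding M_def by (intro Max_in) auto
  then have M: "0 \<le> M" "M < 1" using assms by (auto simp: polydisc_def)
  show ?thesis
  proof (rule that[of "(1 + M) / 2"])
    fix j show "norm (z $ j) < (1 + M) / 2" using le[of j] M by (simp add: field_simps)
  qed (use M in auto)
qed

lemma psum_summable_on:
  assumes a: "psum a" and z: "z \<in> polydisc"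
  shows "(\<lambda>k. norm (a k * vmonom k z)) summable_on UNIV"
proof -
  obtain \<rho> where \<rho>: "0 < \<rho>" "\<rho> < 1" "\<And>j. norm (z $ j) < \<rho>" by (rule polydisc_bound[OF z]) auto
  have "(\<lambda>k. norm (a k) * \<rho> ^ mdeg k) summable_on UNIV" using a \<rho> by (auto simp: psum_def)
  then show ?thesis
    by (rule summable_on_comparison_test)
       (use \<rho>(3) in \<open>auto simp: norm_mult less_imp_le intro!: mult_left_mono norm_vmonom_le\<close>)
qed

lemma psum_imp_has_expansion: "psum a \<Longrightarrow> has_expansion (\<lambda>z. \<Sum>\<^sub>\<infinity>k. a k * vmonom k z) a"
  unfolding has_expansion_def
  using psum_summable_on[of a] abs_summable_summable[of "\<lambda>k. a k * vmonom k _" UNIV] by auto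

lemma has_expansion_imp_psum:
  fixes a :: "('n::finite \<Rightarrow> nat) \<Rightarrow> complex"
  assumes "has_expansion f a"
  shows "psum a"
  unfolding psum_def
proof (intro allI impI)
  fix \<rho> :: real assume \<rho>: "0 < \<rho>" "\<rho> < 1"
  define z where "z = (\<chi> j :: 'n. complex_of_real \<rho>)"
  have "z \<in> polydisc" using \<rho> by (simp add: z_def polydisc_def)
  then have "(\<lambda>k. a k * vmonom k z) summable_on UNIV"
    using assms unfolding has_expansion_def summable_on_def by blast
  then have "(\<lambda>k. norm (a k * vmonom k z)) summable_on UNIV"
    by (simp add: summable_on_iff_abs_summable_on_complex)
  moreover have "norm (a k * vmonom k z) = norm (a k) * \<rho> ^ mdeg k" for k
    unfolding z_def norm_mult vmonom_of_real using \<rho> by (simp add: mdeg_def power_sum)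
  ultimately show "(\<lambda>k. norm (a k) * \<rho> ^ mdeg k) summable_on UNIV" by simp
qed

lemma psum_bounded:
  fixes a :: "('n::finite \<Rightarrow> nat) \<Rightarrow> complex"
  assumes "psum a" "0 < \<rho>" "\<rho> < 1"
  obtains B where "\<And>k. norm (a k) * \<rho> ^ mdeg k \<le> B" "B \<ge> 0"
proof (rule that)
  let ?f = "\<lambda>k. norm (a k) * \<rho> ^ mdeg k"
  have s: "?f summable_on UNIV" using assms by (auto simp: psum_def)
  show "?f k \<le> infsum ?f UNIV" for k
  proof -
    have "infsum ?f {k} \<le> infsum ?f UNIV"
      using assms by (intro infsum_mono_neutral s) auto
    then show ?thesis by simp
  qed
  show "infsum ?f UNIV \<ge> 0" using assms by (intro infsum_nonneg) auto
qed

lemma psum_comparison: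
  assumes "psum a" and le: "\<And>\<rho>. 0 < \<rho> \<Longrightarrow> \<rho> < 1 \<Longrightarrow> \<exists>B \<sigma>. 0 < \<sigma> \<and> \<sigma> < 1 \<and> (\<forall>k. norm (b k) * \<rho> ^ mdeg k \<le> B * (norm (a k) * \<sigma> ^ mdeg k))"
  shows "psum b"
  unfolding psum_def
proof (intro allI impI)
  fix \<rho> :: real assume "0 < \<rho>" "\<rho> < 1"
  then obtain B \<sigma> where \<sigma>: "0 < \<sigma>" "\<sigma> < 1" and le: "\<And>k. norm (b k) * \<rho> ^ mdeg k \<le> B * (norm (a k) * \<sigma> ^ mdeg k)"
    using le by blast
  have "(\<lambda>k. B * (norm (a k) * \<sigma> ^ mdeg k)) summable_on UNIV"
    using assms(1) \<sigma> by (intro summable_on_cmult_right) (auto simp: psum_def)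
  then show "(\<lambda>k. norm (b k) * \<rho> ^ mdeg k) summable_on UNIV"
    by (rule summable_on_comparison_test) (use le \<open>0 < \<rho>\<close> in auto)
qed

text \<open>Split \<open>\<rho>\<close> as \<open>sqrt \<rho> * sqrt \<rho>\<close>: one factor
  keeps the coefficients \<open>c\<close> bounded, the other keeps those of \<open>a\<close>
  summable.\<close>

lemma psum_mult:
  assumes a: "psum a" and c: "psum c"
  shows "psum (\<lambda>k. c k * a k)"
proof (rule psum_comparison[OF a])
  fix \<rho> :: real assume \<rho>: "0 < \<rho>" "\<rho> < 1"
  define \<sigma> where "\<sigma> = sqrt \<rho>"
  have \<sigma>: "0 < \<sigma>" "\<sigma> < 1" "\<sigma> * \<sigma> = \<rho>" using \<rho> by (auto simp: \<sigma>_def)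
  obtain B where B: "\<And>k. norm (c k) * \<sigma> ^ mdeg k \<le> B" by (rule psum_bounded[OF c \<sigma>(1,2)]) auto
  have "norm (c k * a k) * \<rho> ^ mdeg k \<le> B * (norm (a k) * \<sigma> ^ mdeg k)" for k
  proof -
    have "norm (c k * a k) * \<rho> ^ mdeg k = (norm (c k) * \<sigma> ^ mdeg k) * (norm (a k) * \<sigma> ^ mdeg k)"
      unfolding \<sigma>(3)[symmetric] by (simp add: norm_mult power_mult_distrib mult_ac)
    also have "\<dots> \<le> B * (norm (a k) * \<sigma> ^ mdeg k)" using \<sigma> by (intro mult_right_mono B) auto
    finally show ?thesis .
  qed
  then show "\<exists>B \<sigma>. 0 < \<sigma> \<and> \<sigma> < 1 \<and> (\<forall>k. norm (c k * a k) * \<rho> ^ mdeg k \<le> B * (norm (a k) * \<sigma> ^ mdeg k))"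
    using \<sigma> by blast
qed

text \<open>The coefficient factor of \<open>frac_deriv\<close> at integer order \<open>m\<close>,
  where the Gamma quotient is a binomial coefficient.\<close>

definition dcoeff :: "nat \<Rightarrow> ('n::finite \<Rightarrow> nat) \<Rightarrow> real" where
  "dcoeff m k = (\<Prod>j\<in>UNIV. real ((k j + m) choose m))"

text \<open>The left side times \<open>(1 - x)^m\<close> is one term of the binomial expansion of
  \<open>((1 - x) + x)^(k + m) = 1\<close>.\<close>

lemma binomial_add_le:
  assumes "0 < x" "x < (1::real)"
  shows "real ((k + m) choose m) * x ^ k \<le> inverse ((1 - x) ^ m)"
proof -
  have "real ((k + m) choose m) * (1 - x) ^ m * x ^ (k + m - m) \<le> (\<Sum>i\<le>k + m. real ((k + m) choose i) * (1 - x) ^ i * x ^ (k + m - i))"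
    using assms by (intro member_le_sum) auto
  also have "\<dots> = ((1 - x) + x) ^ (k + m)" by (rule binomial_ring[symmetric])
  finally have "real ((k + m) choose m) * x ^ k * (1 - x) ^ m \<le> 1" by (simp add: mult_ac)
  then show ?thesis using assms by (simp add: field_simps)
qed

lemma dcoeff_le:
  assumes "0 < x" "x < (1::real)"
  shows "dcoeff m (k :: 'n::finite \<Rightarrow> nat) * x ^ mdeg k \<le> inverse ((1 - x) ^ m) ^ CARD('n)"
proof -
  have "dcoeff m k * x ^ mdeg k = (\<Prod>j\<in>UNIV. real ((k j + m) choose m) * x ^ k j)"
    by (simp add: dcoeff_def mdeg_def power_sum prod.distrib)
  also have "\<dots> \<le> (\<Prod>j\<in>(UNIV :: 'n set). inverse ((1 - x) ^ m))"
    using assms by (intro prod_mono conjI binomial_add_le) auto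
  finally show ?thesis by simp
qed

lemma dcoeff_pos: "dcoeff m k > 0"
  unfolding dcoeff_def by (intro prod_pos) (simp add: zero_less_binomial_iff)

lemma psum_dcoeff:
  fixes a :: "('n::finite \<Rightarrow> nat) \<Rightarrow> complex"
  assumes a: "psum a"
  shows "psum (\<lambda>k. of_real (dcoeff m k) * a k)"
proof (rule psum_comparison[OF a])
  fix \<rho> :: real assume \<rho>: "0 < \<rho>" "\<rho> < 1"
  define \<sigma> where "\<sigma> = sqrt \<rho>"
  have \<sigma>: "0 < \<sigma>" "\<sigma> < 1" "\<sigma> * \<sigma> = \<rho>" using \<rho> by (auto simp: \<sigma>_def)
  have "norm (of_real (dcoeff m k) * a k) * \<rho> ^ mdeg k \<le> inverse ((1 - \<sigma>) ^ m) ^ CARD('n) * (norm (a k) * \<sigma> ^ mdeg k)" for k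
  proof -
    have "norm (of_real (dcoeff m k) * a k) * \<rho> ^ mdeg k = (dcoeff m k * \<sigma> ^ mdeg k) * (norm (a k) * \<sigma> ^ mdeg k)"
      unfolding \<sigma>(3)[symmetric] using dcoeff_pos[of m k] by (simp add: norm_mult power_mult_distrib mult_ac)
    also have "\<dots> \<le> inverse ((1 - \<sigma>) ^ m) ^ CARD('n) * (norm (a k) * \<sigma> ^ mdeg k)"
      using \<sigma> by (intro mult_right_mono dcoeff_le) auto
    finally show ?thesis .
  qed
  then show "\<exists>B \<sigma>. 0 < \<sigma> \<and> \<sigma> < 1 \<and> (\<forall>k. norm (of_real (dcoeff m k) * a k) * \<rho> ^ mdeg k \<le> B * (norm (a k) * \<sigma> ^ mdeg k))"
    using \<sigma> by blast
qed

section \<open>Holomorphy of power series, and extension by zero off the polydisc\<close>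

definition dmonom :: "('n::finite \<Rightarrow> nat) \<Rightarrow> complex ^ 'n \<Rightarrow> complex ^ 'n \<Rightarrow> complex" where
  "dmonom k z h = (\<Sum>j\<in>UNIV. of_nat (k j) * h $ j * (z $ j) ^ (k j - 1) * (\<Prod>i\<in>UNIV - {j}. (z $ i) ^ k i))"

lemma has_derivative_vmonom: "(vmonom k has_derivative dmonom k z) (at z within S)"
proof -
  have "((\<lambda>z. \<Prod>j\<in>UNIV. (z $ j) ^ k j) has_derivative
      (\<lambda>h. \<Sum>j\<in>UNIV. (of_nat (k j) * h $ j * (z $ j) ^ (k j - 1)) * (\<Prod>i\<in>UNIV - {j}. (z $ i) ^ k i))) (at z within S)"
    by (intro has_derivative_prod has_derivative_power bounded_linear.has_derivative[OF bounded_linear_vec_nth] has_derivative_ident)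
  moreover have "vmonom k = (\<lambda>z. \<Prod>j\<in>UNIV. (z $ j) ^ k j)" by (simp add: vmonom_def fun_eq_iff)
  ultimately show ?thesis by (simp add: dmonom_def[abs_def])
qed

lemma norm_dmonom_le:
  assumes z: "\<And>j. norm (z $ j) \<le> \<rho>" and \<rho>: "\<rho> > 0"
  shows "norm (dmonom k z h) \<le> real (mdeg k) * \<rho> ^ mdeg k / \<rho> * norm h"
proof -
  have "norm (dmonom k z h) \<le> (\<Sum>j\<in>UNIV. real (k j) * (\<rho> ^ mdeg k / \<rho>) * norm h)"
    unfolding dmonom_def
  proof (rule sum_norm_le)
    fix j
    have "norm (\<Prod>i\<in>UNIV - {j}. (z $ i) ^ k i) \<le> (\<Prod>i\<in>UNIV - {j}. \<rho> ^ k i)"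
      unfolding prod_norm[symmetric] norm_power using z by (intro prod_mono) (auto intro: power_mono)
    moreover have "norm ((z $ j) ^ (k j - 1)) \<le> \<rho> ^ (k j - 1)"
      unfolding norm_power using z by (intro power_mono) auto
    ultimately have "norm ((z $ j) ^ (k j - 1)) * norm (\<Prod>i\<in>UNIV - {j}. (z $ i) ^ k i) \<le> \<rho> ^ (k j - 1) * (\<Prod>i\<in>UNIV - {j}. \<rho> ^ k i)"
      using \<rho> by (intro mult_mono) auto
    then have "real (k j) * norm h * (norm ((z $ j) ^ (k j - 1)) * norm (\<Prod>i\<in>UNIV - {j}. (z $ i) ^ k i))
        \<le> real (k j) * norm h * (\<rho> ^ (k j - 1) * (\<Prod>i\<in>UNIV - {j}. \<rho> ^ k i))"
      by (intro mult_left_mono) auto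
    moreover have "real (k j) * norm (h $ j) * (norm ((z $ j) ^ (k j - 1)) * norm (\<Prod>i\<in>UNIV - {j}. (z $ i) ^ k i))
        \<le> real (k j) * norm h * (norm ((z $ j) ^ (k j - 1)) * norm (\<Prod>i\<in>UNIV - {j}. (z $ i) ^ k i))"
      by (intro mult_right_mono mult_left_mono Finite_Cartesian_Product.norm_nth_le) auto
    moreover have "real (k j) * (\<rho> ^ (k j - 1) * (\<Prod>i\<in>UNIV - {j}. \<rho> ^ k i)) = real (k j) * (\<rho> ^ mdeg k / \<rho>)"
    proof (cases "k j = 0")
      case False
      have "\<rho> ^ mdeg k = (\<Prod>i\<in>UNIV. \<rho> ^ k i)" by (simp add: mdeg_def power_sum)
      also have "\<dots> = \<rho> ^ k j * (\<Prod>i\<in>UNIV - {j}. \<rho> ^ k i)" by (subst prod.remove[of _ j]) auto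
      also have "\<rho> ^ k j = \<rho> * \<rho> ^ (k j - 1)" using False by (metis power_eq_if)
      finally show ?thesis using \<rho> by simp
    qed simp
    ultimately show "norm (of_nat (k j) * h $ j * (z $ j) ^ (k j - 1) * (\<Prod>i\<in>UNIV - {j}. (z $ i) ^ k i))
        \<le> real (k j) * (\<rho> ^ mdeg k / \<rho>) * norm h"
      by (simp only: norm_mult norm_of_nat mult_ac)
  qed
  also have "\<dots> = real (mdeg k) * \<rho> ^ mdeg k / \<rho> * norm h"
    by (simp add: mdeg_def sum_distrib_right sum_divide_distrib)
  finally show ?thesis .
qed

lemma dmonom_scale: "dmonom k z (c *s h) = c * dmonom k z h"
  by (simp add: dmonom_def sum_distrib_left mult_ac)

text \<open>Termwise differentiation on a smaller polydisc \<open>S\<close>, where the derivatives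
  are dominated by a summable sequence. The factor \<open>mdeg k\<close> which they bring is
  absorbed by widening the radius from \<open>\<rho>\<close> to \<open>\<sigma>\<close>.\<close>

lemma has_expansion_imp_hol_polydisc:
  fixes f :: "complex ^ 'n::finite \<Rightarrow> complex"
  assumes f: "has_expansion f a"
  shows "f \<in> hol_polydisc"
  unfolding hol_polydisc_def
proof (intro CollectI ballI)
  fix z0 :: "complex ^ 'n" assume z0: "z0 \<in> polydisc"
  obtain \<rho> where \<rho>: "0 < \<rho>" "\<rho> < 1" "\<And>j. norm (z0 $ j) < \<rho>" by (rule polydisc_bound[OF z0]) auto
  define \<sigma> where "\<sigma> = (1 + \<rho>) / 2"
  have \<sigma>: "\<rho> < \<sigma>" "0 < \<sigma>" "\<sigma> < 1" using \<rho> by (auto simp: \<sigma>_def field_simps)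
  define S where "S = {z :: complex ^ 'n. \<forall>j. norm (z $ j) < \<rho>}"
  have Sd: "S \<subseteq> polydisc" using \<rho> unfolding S_def polydisc_def by (auto intro: less_trans)
  have e: "S = (\<Inter>j. {z. norm (z $ j) < \<rho>})" by (auto simp: S_def)
  have oS: "open S"
    by (subst e) (intro open_INT ballI open_Collect_less continuous_intros, auto)
  have cS: "convex S"
  proof -
    have "convex ((\<lambda>z. z $ j) -` ball 0 \<rho> :: (complex ^ 'n) set)" for j
      by (intro convex_linear_vimage bounded_linear.linear[OF bounded_linear_vec_nth] convex_ball)
    then have "convex (\<Inter>j. (\<lambda>z. z $ j) -` ball 0 \<rho> :: (complex ^ 'n) set)"
      by (intro convex_INT)
    moreover have "S = (\<Inter>j. (\<lambda>z. z $ j) -` ball 0 \<rho>)" by (auto simp: S_def)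
    ultimately show ?thesis by simp
  qed
  have zS: "z0 \<in> S" using \<rho> by (simp add: S_def)
  have pa: "psum a" by (rule has_expansion_imp_psum[OF f])
  define M where "M = (\<lambda>k. norm (a k) * (real (mdeg k) * \<rho> ^ mdeg k / \<rho>))"
  have "(\<lambda>n. of_nat n * (\<rho> / \<sigma>) ^ n) \<longlonglongrightarrow> 0"
    using \<rho> \<sigma> by (intro powser_times_n_limit_0) auto
  then obtain B where B: "\<And>n :: nat. norm (of_nat n * (\<rho> / \<sigma>) ^ n) \<le> B"
    using convergentI convergent_imp_Bseq BseqE by metis
  have Mle: "M k \<le> B / \<rho> * (norm (a k) * \<sigma> ^ mdeg k)" for k
  proof -
    have "real (mdeg k) * (\<rho> ^ mdeg k / \<sigma> ^ mdeg k) \<le> B"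
      using B[of "mdeg k"] \<rho> \<sigma> by (simp add: power_divide)
    then have "real (mdeg k) * \<rho> ^ mdeg k \<le> B * \<sigma> ^ mdeg k"
      using \<sigma> by (simp add: pos_divide_le_eq)
    then have "norm (a k) * (real (mdeg k) * \<rho> ^ mdeg k / \<rho>) \<le> norm (a k) * (B * \<sigma> ^ mdeg k / \<rho>)"
      using \<rho> by (intro mult_left_mono divide_right_mono) auto
    then show ?thesis by (simp add: M_def mult_ac)
  qed
  have M0: "M k \<ge> 0" for k using \<rho> by (simp add: M_def)
  have "(\<lambda>k. B / \<rho> * (norm (a k) * \<sigma> ^ mdeg k)) summable_on UNIV"
    using pa \<sigma> by (intro summable_on_cmult_right) (auto simp: psum_def)
  then have "M summable_on UNIV"
    by (rule summable_on_comparison_test) (use Mle M0 in auto)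
  then have sM: "summable (\<lambda>i. M (enum_mi i))" by (rule summable_enum_mi)
  define D where "D = (\<lambda>i (z :: complex ^ 'n) (h :: complex ^ 'n). a (enum_mi i) * dmonom (enum_mi i) z h)"
  have Dle: "norm (D i z h) \<le> M (enum_mi i) * norm h" if "z \<in> S" for i z h
  proof -
    have "norm (dmonom (enum_mi i) z h) \<le> real (mdeg (enum_mi i :: 'n \<Rightarrow> nat)) * \<rho> ^ mdeg (enum_mi i :: 'n \<Rightarrow> nat) / \<rho> * norm h"
      using that \<rho>(1) by (intro norm_dmonom_le) (auto simp: S_def less_imp_le)
    then have "norm (a (enum_mi i)) * norm (dmonom (enum_mi i) z h) \<le> norm (a (enum_mi i)) * (real (mdeg (enum_mi i :: 'n \<Rightarrow> nat)) * \<rho> ^ mdeg (enum_mi i :: 'n \<Rightarrow> nat) / \<rho> * norm h)"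
      by (rule mult_left_mono) simp
    then show ?thesis by (simp add: D_def M_def norm_mult mult_ac)
  qed
  have sD: "summable (\<lambda>i. norm (D i z h))" if "z \<in> S" for z h
    by (rule summable_comparison_test'[OF summable_mult2[OF sM, of "norm h"]]) (use Dle[OF that] in auto)
  define G where "G = (\<lambda>z h. \<Sum>i. D i z h)"
  have "\<exists>g. \<forall>x\<in>S. (\<lambda>n. a (enum_mi n) * vmonom (enum_mi n) x) sums g x \<and> (g has_derivative G x) (at x within S)"
  proof (rule has_derivative_series[OF cS _ _ zS, where f' = D])
    fix n x assume "x \<in> S"
    show "((\<lambda>x. a (enum_mi n) * vmonom (enum_mi n) x) has_derivative D n x) (at x within S)"
      unfolding D_def by (intro has_derivative_mult_right has_derivative_vmonom)
  next
    show "(\<lambda>n. a (enum_mi n) * vmonom (enum_mi n) z0) sums f z0"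
      using f z0 unfolding has_expansion_def by (intro has_sum_enum_mi[where f = "\<lambda>k. a k * vmonom k z0"]) auto
  next
    fix e :: real assume e: "e > 0"
    have "(\<lambda>n. \<Sum>i. M (enum_mi (i + n))) \<longlonglongrightarrow> 0" by (rule suminf_exist_split2[OF sM])
    then have "\<forall>\<^sub>F n in sequentially. (\<Sum>i. M (enum_mi (i + n))) < e"
      using e by (auto dest: order_tendstoD(2))
    then show "\<forall>\<^sub>F n in sequentially. \<forall>x\<in>S. \<forall>h. norm (sum (\<lambda>i. D i x h) {..<n} - G x h) \<le> e * norm h"
    proof eventually_elim
      case (elim n)
      show ?case
      proof (intro ballI allI)
        fix x h assume x: "x \<in> S"
        have sn: "summable (\<lambda>i. norm (D (i + n) x h))" using sD[OF x, of h] by (rule summable_ignore_initial_segment)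
        have "G x h = (\<Sum>i. D (i + n) x h) + sum (\<lambda>i. D i x h) {..<n}"
          unfolding G_def by (rule suminf_split_initial_segment[OF summable_norm_cancel[OF sD[OF x]]])
        then have "norm (sum (\<lambda>i. D i x h) {..<n} - G x h) = norm (\<Sum>i. D (i + n) x h)"
          by (simp add: norm_minus_commute)
        also have "\<dots> \<le> (\<Sum>i. norm (D (i + n) x h))" by (rule summable_norm[OF sn])
        also have "\<dots> \<le> (\<Sum>i. M (enum_mi (i + n)) * norm h)"
          by (intro suminf_le sn summable_mult2 summable_ignore_initial_segment[OF sM] Dle x)
        also have "\<dots> = (\<Sum>i. M (enum_mi (i + n))) * norm h"
          by (rule suminf_mult2[symmetric, OF summable_ignore_initial_segment[OF sM]])
        also have "\<dots> \<le> e * norm h" using elim by (intro mult_right_mono) auto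
        finally show "norm (sum (\<lambda>i. D i x h) {..<n} - G x h) \<le> e * norm h" .
      qed
    qed
  qed
  then obtain g where g: "\<And>x. x \<in> S \<Longrightarrow> (\<lambda>n. a (enum_mi n) * vmonom (enum_mi n) x) sums g x"
      and dg: "\<And>x. x \<in> S \<Longrightarrow> (g has_derivative G x) (at x within S)" by blast
  have fg: "f x = g x" if "x \<in> S" for x
  proof -
    have "(\<lambda>n. a (enum_mi n) * vmonom (enum_mi n) x) sums f x"
      using f Sd that unfolding has_expansion_def by (intro has_sum_enum_mi[where f = "\<lambda>k. a k * vmonom k x"]) auto
    then show ?thesis using g[OF that] by (rule sums_unique2)
  qed
  have "(f has_derivative G z0) (at z0 within S)"
    by (rule has_derivative_transform[OF zS _ dg[OF zS]]) (rule fg)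
  then have "(f has_derivative G z0) (at z0)"
    using at_within_open[OF zS oS] by simp
  moreover have "G z0 (c *s h) = c * G z0 h" for c h
    unfolding G_def D_def dmonom_scale
    using suminf_mult[OF summable_norm_cancel[OF sD[OF zS, of h]], of c]
    by (simp add: D_def mult_ac)
  ultimately show "\<exists>f'. (f has_derivative f') (at z0) \<and> (\<forall>c v. f' (c *s v) = c * f' v)" by blast
qed

text \<open>Elements of \<open>hol_polydisc\<close> are arbitrary outside the polydisc; extension by
  0 makes them Borel without changing any value that the norms see.\<close>

definition trunc :: "(complex ^ 'n \<Rightarrow> complex) \<Rightarrow> complex ^ 'n \<Rightarrow> complex" where
  "trunc f z = (if z \<in> polydisc then f z else 0)"

lemma open_polydisc: "open (polydisc :: (complex ^ 'n::finite) set)"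
proof -
  have e: "polydisc = (\<Inter>j. {z :: complex ^ 'n. norm (z $ j) < 1})" by (auto simp: polydisc_def)
  show ?thesis
    by (subst e) (intro open_INT ballI open_Collect_less continuous_intros, auto)
qed

lemma sep_hol_trunc:
  fixes f :: "complex ^ 'n::finite \<Rightarrow> complex"
  assumes f: "f \<in> hol_polydisc"
  shows "sep_hol (trunc f)"
  unfolding sep_hol_def
proof (intro conjI ballI allI)
  have "continuous_on polydisc f"
    using f unfolding hol_polydisc_def
    by (auto intro!: continuous_at_imp_continuous_on dest: has_derivative_continuous)
  then have "(\<lambda>z. if z \<in> polydisc then f z else 0) \<in> borel_measurable borel"
    by (intro borel_measurable_continuous_on_if) (auto intro: open_polydisc borel_open)
  then show "trunc f \<in> borel_measurable borel" by (simp add: trunc_def[abs_def])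
next
  fix z :: "complex ^ 'n" and j assume z: "z \<in> polydisc"
  let ?L = "\<lambda>w. (\<chi> i. if i = j then w else z $ i) :: complex ^ 'n"
  have L: "?L w \<in> polydisc" if "w \<in> ball 0 1" for w
    using z that by (auto simp: polydisc_def)
  have dL: "(?L has_derivative (\<lambda>h. h *s axis j 1)) (at w)" for w
  proof -
    have e: "?L v = v *s axis j 1 + ?L 0" for v by (auto simp: vec_eq_iff axis_def)
    have "bounded_linear (\<lambda>h :: complex. h *s (axis j 1 :: complex ^ 'n))"
      unfolding linear_conv_bounded_linear[symmetric]
      by (intro linearI) (auto simp: vec_eq_iff algebra_simps)
    then have "((\<lambda>v. v *s axis j 1 + ?L 0) has_derivative (\<lambda>h. h *s axis j 1)) (at w)"
      by (intro has_derivative_add_const bounded_linear_imp_has_derivative)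
    then show ?thesis by (subst e)
  qed
  have "(\<lambda>w. f (?L w)) holomorphic_on ball 0 1"
  proof (subst holomorphic_on_open[OF open_ball], intro ballI)
    fix w :: complex assume w: "w \<in> ball 0 1"
    obtain f' where f': "(f has_derivative f') (at (?L w))" "\<And>c v. f' (c *s v) = c * f' v"
      using f L[OF w] unfolding hol_polydisc_def by blast
    have "((f \<circ> ?L) has_derivative (f' \<circ> (\<lambda>h. h *s axis j 1))) (at w)"
      by (rule diff_chain_at[OF dL f'(1)])
    \<comment> \<open>Complex linearity of \<open>f'\<close> makes the derivative of the slice a
      multiplication by \<open>f' (axis j 1)\<close>.\<close>
    then have "((\<lambda>w. f (?L w)) has_derivative (\<lambda>h. f' (axis j 1) * h)) (at w)"
      by (simp add: o_def f'(2) mult.commute)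
    then show "\<exists>d. ((\<lambda>w. f (?L w)) has_field_derivative d) (at w)"
      unfolding has_field_derivative_def by (auto simp: fun_eq_iff)
  qed
  then show "(\<lambda>w. trunc f (?L w)) holomorphic_on ball 0 1"
    by (rule holomorphic_transform) (simp add: trunc_def L)
qed

section \<open>Hadamard products\<close>

lemma nn_integral_TM_const: "(\<integral>\<^sup>+a. c \<partial>TM) = c"
  by (simp add: emeasure_TM_space)

lemma finite_measure_TM: "finite_measure TM"
  by (rule finite_measureI) (simp add: emeasure_TM_space)

text \<open>For \<open>k \<noteq> l\<close>, rotation by \<open>b = 1 / (2 (k - l))\<close>
  multiplies the integrand by -1, while the measure is invariant; the integral equals its own
  negative.\<close>

lemma integral_unit_exp_power:
  "(\<integral>x. unit_exp x ^ k * cnj (unit_exp x) ^ l \<partial>uni) = (if k = l then 1 else 0)"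
proof (cases "k = l")
  case True
  have "unit_exp x ^ k * cnj (unit_exp x) ^ k = 1" for x
    unfolding power_mult_distrib[symmetric] by (simp add: cis_cnj cis_mult)
  then show ?thesis using True by (simp add: measure_def emeasure_uni_space)
next
  case False
  define b where "b = 1 / (2 * (real k - real l))"
  define \<phi> where "\<phi> = (\<lambda>w. w ^ k * cnj w ^ l)"
  have [measurable]: "\<phi> \<in> borel_measurable borel"
    unfolding \<phi>_def by (intro borel_measurable_continuous_onI continuous_intros)
  have mult: "\<phi> (v * w) = \<phi> v * \<phi> w" for v w by (simp add: \<phi>_def power_mult_distrib mult_ac)
  define I where "I = (\<integral>x. \<phi> (unit_exp x) \<partial>uni)"
  have "I = (\<integral>w. \<phi> w \<partial>circ)"
    unfolding I_def circ_def by (subst integral_distr) auto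
  also have "\<dots> = (\<integral>x. \<phi> (unit_exp (x - b)) \<partial>uni)"
    unfolding distr_rotate[of b, symmetric] by (subst integral_distr) auto
  also have "\<dots> = (\<integral>x. \<phi> (unit_exp x) * \<phi> (unit_exp (- b)) \<partial>uni)"
    by (simp add: mult[symmetric] cis_mult right_diff_distrib)
  also have "\<dots> = I * \<phi> (unit_exp (- b))" by (simp add: I_def)
  also have "\<phi> (unit_exp (- b)) = -1"
  proof -
    have ne: "real k - real l \<noteq> 0" using False by simp
    have "\<phi> (unit_exp (- b)) = cis (2 * pi * (- b) * real k) * cis (- (2 * pi * (- b)) * real l)"
      unfolding \<phi>_def by (simp add: Complex.DeMoivre cis_cnj mult_ac)
    also have "\<dots> = cis (- (2 * pi) * (b * (real k - real l)))"
      unfolding cis_mult by (simp add: algebra_simps)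
    also have "b * (real k - real l) = 1 / 2" using ne by (simp add: b_def)
    finally show ?thesis by (simp add: complex_eq_iff)
  qed
  finally have "I = 0" by simp
  then show ?thesis using False by (simp add: I_def \<phi>_def)
qed

lemma vmonom_rmult: "vmonom k (rmult r z) = of_real (\<Prod>j\<in>UNIV. (r $ j) ^ k j) * vmonom k z"
  by (simp add: vmonom_def rmult_def power_mult_distrib prod.distrib)

lemma vmonom_tor_diff: "vmonom k (tor (\<lambda>j. a j - b j)) = vmonom k (tor a) * cnj (vmonom k (tor b))"
proof -
  have "unit_exp (x - y) = unit_exp x * cnj (unit_exp y)" for x y
    by (simp add: cis_cnj cis_mult right_diff_distrib)
  then show ?thesis by (simp add: vmonom_def tor_def power_mult_distrib prod.distrib)
qed

lemma norm_vmonom_tor [simp]: "norm (vmonom k (tor a)) = 1"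
  by (simp add: vmonom_def tor_def prod_norm[symmetric] norm_power)

lemma measurable_vmonom [measurable]: "vmonom k \<in> borel_measurable borel"
  unfolding vmonom_def[abs_def] by measurable

lemma integral_vmonom_tor:
  "(\<integral>b. vmonom k (tor b) * cnj (vmonom l (tor b)) \<partial>TM) = (if k = (l :: 'n::finite \<Rightarrow> nat) then 1 else 0)"
proof -
  have "(\<integral>b. vmonom k (tor b) * cnj (vmonom l (tor b)) \<partial>TM)
      = (\<integral>b. (\<Prod>j\<in>UNIV. unit_exp (b j) ^ k j * cnj (unit_exp (b j)) ^ l j) \<partial>PiM UNIV (\<lambda>_. uni))"
    by (simp add: vmonom_def tor_def prod.distrib TM_def)
  also have "\<dots> = (\<Prod>j\<in>UNIV. \<integral>x. unit_exp x ^ k j * cnj (unit_exp x) ^ l j \<partial>uni)"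
  proof (rule uni_prod.product_integral_prod)
    fix j
    show "integrable uni (\<lambda>x. unit_exp x ^ k j * cnj (unit_exp x) ^ l j)"
    proof (rule uni.integrable_const_bound[where B = 1])
      have "continuous_on UNIV (\<lambda>x. unit_exp x ^ k j * cnj (unit_exp x) ^ l j)"
        by (intro continuous_intros)
      then show "(\<lambda>x. unit_exp x ^ k j * cnj (unit_exp x) ^ l j) \<in> borel_measurable uni"
        using borel_measurable_continuous_onI by (simp add: measurable_cong_sets[OF sets_uni refl])
    qed (simp add: norm_mult norm_power)
  qed simp
  also have "\<dots> = (if k = l then 1 else 0)"
    by (auto simp: integral_unit_exp_power fun_eq_iff)
  finally show ?thesis .
qed

text \<open>At radii \<open>r^2\<close> and angle \<open>y\<close>, the Hadamard product is the mean
  over \<open>b\<close> of \<open>f(r e(b)) g(r e(y - b))\<close>: orthogonality leaves only the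
  diagonal terms, and each collects \<open>r\<close> once from either factor.\<close>

lemma hadamard_finite:
  fixes a c :: "('n::finite \<Rightarrow> nat) \<Rightarrow> complex"
  assumes F: "finite F"
  defines "f \<equiv> \<lambda>z. \<Sum>k\<in>F. a k * vmonom k z" and "g \<equiv> \<lambda>z. \<Sum>k\<in>F. c k * vmonom k z"
  shows "ennreal (norm (\<Sum>k\<in>F. c k * a k * vmonom k (rmult (\<chi> j. r $ j * r $ j) (tor y)))) \<le>
    (\<integral>\<^sup>+b. ennreal (norm (f (rmult r (tor b))) * norm (g (rmult r (tor (\<lambda>j. y j - b j))))) \<partial>TM)"
proof -
  interpret T: finite_measure "TM :: ('n \<Rightarrow> real) measure" by (rule finite_measure_TM)
  define R where "R = (\<lambda>k :: 'n \<Rightarrow> nat. complex_of_real (\<Prod>j\<in>UNIV. (r $ j) ^ k j))"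
  define d where "d = (\<lambda>k l. a k * c l * R k * R l * vmonom l (tor y))"
  have int: "integrable TM (\<lambda>b. d k l * (vmonom k (tor b) * cnj (vmonom l (tor b))))" for k l
  proof (intro integrable_mult_right T.integrable_const_bound[where B = 1])
    have "(\<lambda>w. cnj w) \<in> borel_measurable borel"
      by (intro borel_measurable_continuous_onI continuous_intros)
    then have "(\<lambda>b. cnj (vmonom l (tor b))) \<in> borel_measurable TM"
      by (rule measurable_compose[rotated]) measurable
    then show "(\<lambda>b. vmonom k (tor b) * cnj (vmonom l (tor b))) \<in> borel_measurable TM" by measurable
  qed (simp add: norm_mult)
  have fg: "f (rmult r (tor b)) * g (rmult r (tor (\<lambda>j. y j - b j)))
      = (\<Sum>k\<in>F. \<Sum>l\<in>F. d k l * (vmonom k (tor b) * cnj (vmonom l (tor b))))" for b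
    unfolding f_def g_def sum_product vmonom_rmult vmonom_tor_diff
    by (intro sum.cong refl) (simp add: d_def R_def mult_ac)
  have intfg: "integrable TM (\<lambda>b. f (rmult r (tor b)) * g (rmult r (tor (\<lambda>j. y j - b j))))"
    unfolding fg by (intro Bochner_Integration.integrable_sum int)
  have "(\<integral>b. f (rmult r (tor b)) * g (rmult r (tor (\<lambda>j. y j - b j))) \<partial>TM)
      = (\<Sum>k\<in>F. \<Sum>l\<in>F. \<integral>b. d k l * (vmonom k (tor b) * cnj (vmonom l (tor b))) \<partial>TM)"
    unfolding fg by (simp add: Bochner_Integration.integral_sum int Bochner_Integration.integrable_sum del: integral_mult_right_zero)
  also have "\<dots> = (\<Sum>k\<in>F. \<Sum>l\<in>F. d k l * (if k = l then 1 else 0))"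
    by (simp only: integral_mult_right_zero integral_vmonom_tor)
  also have "\<dots> = (\<Sum>k\<in>F. d k k)"
    using F by (simp add: if_distrib[of "\<lambda>x. _ * x"] cong: if_cong)
  also have "\<dots> = (\<Sum>k\<in>F. c k * a k * vmonom k (rmult (\<chi> j. r $ j * r $ j) (tor y)))"
    by (simp add: d_def R_def vmonom_rmult power_mult_distrib prod.distrib mult_ac)
  finally have "ennreal (norm (\<Sum>k\<in>F. c k * a k * vmonom k (rmult (\<chi> j. r $ j * r $ j) (tor y))))
      \<le> (\<integral>\<^sup>+b. ennreal (norm (f (rmult r (tor b)) * g (rmult r (tor (\<lambda>j. y j - b j))))) \<partial>TM)"
    using integral_norm_bound_ennreal[OF intfg] by simp
  then show ?thesis by (simp add: norm_mult)
qed

lemma expansion_partial_sums: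
  fixes a :: "('n::finite \<Rightarrow> nat) \<Rightarrow> complex"
  assumes f: "has_expansion f a" and z: "z \<in> polydisc"
  shows "(\<lambda>N. \<Sum>k\<in>enum_mi ` {..<N}. a k * vmonom k z) \<longlonglongrightarrow> f z"
proof -
  have "(\<lambda>i. a (enum_mi i) * vmonom (enum_mi i) z) sums f z"
    using f z unfolding has_expansion_def by (intro has_sum_enum_mi[where f = "\<lambda>k. a k * vmonom k z"]) auto
  moreover have "(\<Sum>k\<in>enum_mi ` {..<N}. a k * vmonom k z) = (\<Sum>i<N. a (enum_mi i) * vmonom (enum_mi i) z)" for N
    by (subst sum.reindex) (auto simp: bij_enum_mi bij_is_inj inj_on_subset[OF bij_is_inj[OF bij_enum_mi]])
  ultimately show ?thesis by (simp add: sums_def)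
qed

text \<open>Uniform over all finite index sets and over a closed polydisc, so that \<open>B\<close>
  can serve as the dominating constant in limit arguments.\<close>

lemma expansion_partial_sums_bound:
  fixes a :: "('n::finite \<Rightarrow> nat) \<Rightarrow> complex"
  assumes "psum a" and r: "\<And>j. 0 \<le> r j" "\<And>j. r j < 1"
  shows "\<exists>B\<ge>0. \<forall>z F. (\<forall>j. norm (z $ j) \<le> r j) \<longrightarrow> finite F \<longrightarrow> norm (\<Sum>k\<in>F. a k * vmonom k z) \<le> B"
proof -
  define w where "w = (\<chi> j. complex_of_real (r j))"
  have "w \<in> polydisc" using r by (simp add: w_def polydisc_def)
  then have s: "(\<lambda>k. norm (a k * vmonom k w)) summable_on UNIV" by (rule psum_summable_on[OF assms(1)])
  define B where "B = infsum (\<lambda>k. norm (a k * vmonom k w)) UNIV"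
  show ?thesis
  proof (intro exI[of _ B] conjI allI impI)
    show "B \<ge> 0" unfolding B_def by (rule infsum_nonneg) simp
    fix z :: "complex ^ 'n" and F :: "('n \<Rightarrow> nat) set" assume z: "\<forall>j. norm (z $ j) \<le> r j" and F: "finite F"
    have "norm (\<Sum>k\<in>F. a k * vmonom k z) \<le> (\<Sum>k\<in>F. norm (a k * vmonom k w))"
    proof (rule sum_norm_le)
      fix k
      have "norm (vmonom k z) \<le> norm (vmonom k w)"
        unfolding vmonom_def prod_norm[symmetric] norm_power w_def using z r
        by (intro prod_mono) (auto intro: power_mono)
      then show "norm (a k * vmonom k z) \<le> norm (a k * vmonom k w)"
        by (simp add: norm_mult mult_left_mono)
    qed
    also have "\<dots> \<le> B" unfolding B_def by (rule finite_sum_le_infsum[OF s F]) auto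
    finally show "norm (\<Sum>k\<in>F. a k * vmonom k z) \<le> B" .
  qed
qed

lemma rmult_tor_polydisc: "r \<in> unit_cube \<Longrightarrow> rmult r (tor a) \<in> polydisc"
  by (auto simp: polydisc_def rmult_def tor_def norm_mult unit_cube_def)

lemma norm_rmult_tor: "r \<in> unit_cube \<Longrightarrow> norm (rmult r (tor a) $ j) = r $ j"
  by (auto simp: rmult_def tor_def norm_mult unit_cube_def)

lemma square_cube: "r \<in> unit_cube \<Longrightarrow> (\<chi> j. r $ j * r $ j) \<in> unit_cube"
proof -
  assume r: "r \<in> unit_cube"
  have "0 \<le> r $ j * r $ j \<and> r $ j * r $ j < 1" for j
  proof -
    have "0 \<le> r $ j" "r $ j < 1" using r by (auto simp: unit_cube_def)
    then show ?thesis using mult_left_le[of "r $ j" "r $ j"] by auto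
  qed
  then show ?thesis by (simp add: unit_cube_def)
qed

lemma measurable_tor_diff [measurable]: "(\<lambda>b. tor (\<lambda>j. y j - b j)) \<in> borel_measurable TM"
  unfolding tor_def using measurable_TM_component by measurable

lemma hadamard_le:
  fixes a c :: "('n::finite \<Rightarrow> nat) \<Rightarrow> complex"
  assumes f: "has_expansion f a" and g: "has_expansion g c" and h: "has_expansion h (\<lambda>k. c k * a k)"
    and r: "r \<in> unit_cube"
    and [measurable]: "f \<in> borel_measurable borel" "g \<in> borel_measurable borel"
  shows "ennreal (norm (h (rmult (\<chi> j. r $ j * r $ j) (tor y)))) \<le>
    (\<integral>\<^sup>+b. ennreal (norm (f (rmult r (tor b))) * norm (g (rmult r (tor (\<lambda>j. y j - b j))))) \<partial>TM)"
proof (rule LIMSEQ_le)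
  let ?E = "\<lambda>N. enum_mi ` {..<N}"
  have r01: "0 \<le> r $ j" "r $ j < 1" for j using r by (auto simp: unit_cube_def)
  define fN where "fN = (\<lambda>N z. \<Sum>k\<in>?E N. a k * vmonom k z)"
  define gN where "gN = (\<lambda>N z. \<Sum>k\<in>?E N. c k * vmonom k z)"
  have [measurable]: "fN N \<in> borel_measurable borel" "gN N \<in> borel_measurable borel" for N
    unfolding fN_def gN_def by measurable
  obtain A where A: "A \<ge> 0" "\<And>z F. (\<forall>j. norm (z $ j) \<le> r $ j) \<Longrightarrow> finite F \<Longrightarrow> norm (\<Sum>k\<in>F. a k * vmonom k z) \<le> A"
    using expansion_partial_sums_bound[OF has_expansion_imp_psum[OF f], of "\<lambda>j. r $ j"] r01 by blast
  obtain C where C: "C \<ge> 0" "\<And>z F. (\<forall>j. norm (z $ j) \<le> r $ j) \<Longrightarrow> finite F \<Longrightarrow> norm (\<Sum>k\<in>F. c k * vmonom k z) \<le> C"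
    using expansion_partial_sums_bound[OF has_expansion_imp_psum[OF g], of "\<lambda>j. r $ j"] r01 by blast
  show "(\<lambda>N. ennreal (norm (\<Sum>k\<in>?E N. c k * a k * vmonom k (rmult (\<chi> j. r $ j * r $ j) (tor y)))))
      \<longlonglongrightarrow> ennreal (norm (h (rmult (\<chi> j. r $ j * r $ j) (tor y))))"
    by (intro tendsto_ennrealI tendsto_norm expansion_partial_sums[OF h] rmult_tor_polydisc square_cube r)
  show "\<exists>N. \<forall>n\<ge>N. ennreal (norm (\<Sum>k\<in>?E n. c k * a k * vmonom k (rmult (\<chi> j. r $ j * r $ j) (tor y)))) \<le>
      (\<integral>\<^sup>+b. ennreal (norm (fN n (rmult r (tor b))) * norm (gN n (rmult r (tor (\<lambda>j. y j - b j))))) \<partial>TM)"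
    unfolding fN_def gN_def by (intro exI allI impI hadamard_finite) auto
  show "(\<lambda>n. \<integral>\<^sup>+b. ennreal (norm (fN n (rmult r (tor b))) * norm (gN n (rmult r (tor (\<lambda>j. y j - b j))))) \<partial>TM)
      \<longlonglongrightarrow> (\<integral>\<^sup>+b. ennreal (norm (f (rmult r (tor b))) * norm (g (rmult r (tor (\<lambda>j. y j - b j))))) \<partial>TM)"
  proof (rule nn_integral_dominated_convergence[where w = "\<lambda>_. ennreal (A * C)"])
    show "(\<integral>\<^sup>+_. ennreal (A * C) \<partial>TM) < \<infinity>" unfolding nn_integral_TM_const by simp
    show "AE b in TM. ennreal (norm (fN n (rmult r (tor b))) * norm (gN n (rmult r (tor (\<lambda>j. y j - b j))))) \<le> ennreal (A * C)" for n
      unfolding fN_def gN_def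
      by (intro AE_I2 ennreal_leI mult_mono A C) (use r in \<open>auto simp: norm_rmult_tor A C\<close>)
    show "AE b in TM. (\<lambda>n. ennreal (norm (fN n (rmult r (tor b))) * norm (gN n (rmult r (tor (\<lambda>j. y j - b j))))))
        \<longlonglongrightarrow> ennreal (norm (f (rmult r (tor b))) * norm (g (rmult r (tor (\<lambda>j. y j - b j)))))"
      unfolding fN_def gN_def
      by (intro AE_I2 tendsto_ennrealI tendsto_mult tendsto_norm expansion_partial_sums[OF f] expansion_partial_sums[OF g] rmult_tor_polydisc r)
  qed measurable
qed

text \<open>The Hadamard inequality extracts coefficients: applied to the zero function with
  coefficients \<open>a - b\<close> and to the monomial \<open>vmonom k\<close>, it forces the
  \<open>k\<close>-th difference to vanish.\<close>

lemma has_expansion_unique: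
  fixes a b :: "('n::finite \<Rightarrow> nat) \<Rightarrow> complex"
  assumes a: "has_expansion f a" and b: "has_expansion f b"
  shows "a = b"
proof
  fix k :: "'n \<Rightarrow> nat"
  define d where "d = (\<lambda>k. a k - b k)"
  have "((\<lambda>k. d k * vmonom k z) has_sum 0) UNIV" if "z \<in> polydisc" for z
  proof -
    have "((\<lambda>k. - 1 * (b k * vmonom k z)) has_sum (- 1 * f z)) UNIV"
      using b that unfolding has_expansion_def by (intro has_sum_cmult_right) blast
    moreover have "((\<lambda>k. a k * vmonom k z) has_sum f z) UNIV"
      using a that unfolding has_expansion_def by blast
    ultimately have "((\<lambda>k. a k * vmonom k z + - 1 * (b k * vmonom k z)) has_sum (f z + - 1 * f z)) UNIV"
      by (intro has_sum_add)
    then show ?thesis by (simp add: d_def left_diff_distrib)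
  qed
  then have d: "has_expansion (\<lambda>_. 0) d" by (simp add: has_expansion_def)
  have single: "((\<lambda>l. (if l = k then \<phi> else 0) * vmonom l z) has_sum \<phi> * vmonom k z) UNIV" for \<phi> and z :: "complex ^ 'n"
    by (rule has_sum_finite_neutralI[of "{k}"]) auto
  have g: "has_expansion (vmonom k) (\<lambda>l. if l = k then 1 else 0)"
    using single[of 1] by (simp add: has_expansion_def)
  have "has_expansion (\<lambda>z. d k * vmonom k z) (\<lambda>l. if l = k then d k else 0)"
    using single[of "d k"] by (simp add: has_expansion_def)
  moreover have "(\<lambda>l. if l = k then d k else 0) = (\<lambda>l. (if l = k then 1 else 0) * d l)" by auto
  ultimately have h: "has_expansion (\<lambda>z. d k * vmonom k z) (\<lambda>l. (if l = k then 1 else 0) * d l)" by simp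
  define r :: "real ^ 'n" where "r = (\<chi> j. 1 / 2)"
  have "r \<in> unit_cube" by (simp add: r_def unit_cube_def)
  from hadamard_le[OF d g h this, of "\<lambda>_. 0"]
  have "d k * vmonom k (rmult (\<chi> j. r $ j * r $ j) (tor (\<lambda>_. 0))) = 0" by simp
  then have "d k = 0" by (simp add: vmonom_def rmult_def tor_def r_def)
  then show "a k = b k" by (simp add: d_def)
qed

lemma taylor_coeff_eq: "has_expansion g c \<Longrightarrow> taylor_coeff g = c"
  unfolding taylor_coeff_def by (rule the_equality) (auto intro: has_expansion_unique)

section \<open>Fractional derivatives of integer order\<close>

lemma frac_deriv_expansion:
  assumes "has_expansion g c"
  shows "has_expansion (frac_deriv (real m) g) (\<lambda>k. of_real (dcoeff m k) * c k)"
proof -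
  have G: "Gamma (real i + real m + 1) / (Gamma (real m + 1) * Gamma (real i + 1)) = real ((i + m) choose m)" for i
  proof -
    have "Gamma (real i + real m + 1) = fact (i + m)" using Gamma_fact[of "i + m", where 'a = real] by (simp add: add_ac)
    moreover have "Gamma (real m + 1) = fact m" "Gamma (real i + 1) = fact i"
      using Gamma_fact[of m, where 'a = real] Gamma_fact[of i, where 'a = real] by (simp_all add: add_ac)
    ultimately show ?thesis by (simp add: binomial_fact)
  qed
  have "frac_deriv (real m) g = (\<lambda>z. \<Sum>\<^sub>\<infinity>k. of_real (dcoeff m k) * c k * vmonom k z)"
    by (intro ext) (simp add: frac_deriv_def taylor_coeff_eq[OF assms] G dcoeff_def)
  then show ?thesis
    using psum_imp_has_expansion[OF psum_dcoeff[OF has_expansion_imp_psum[OF assms]]] by simp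
qed

text \<open>The integral is \<open>B(k + 1, m)\<close>. It shows that averaging against
  \<open>(1 - x)^(m - 1)\<close> undoes the coefficient factor \<open>dcoeff m\<close>, up to powers
  of \<open>m\<close>.\<close>

lemma nn_integral_beta:
  assumes m: "m \<ge> 1"
  shows "(\<integral>\<^sup>+x\<in>{0..<1}. ennreal (x ^ k * (1 - x) powr (real m - 1)) \<partial>lborel) = ennreal (1 / (real m * real ((k + m) choose m)))"
proof -
  have B: "Beta (real k + 1) (real m) = 1 / (real m * real ((k + m) choose m))"
  proof -
    obtain n where n: "m = Suc n" using m by (cases m) auto
    have "Gamma (real k + 1) = fact k" using Gamma_fact[of k, where 'a = real] by (simp add: add_ac)
    moreover have "Gamma (real m) = fact n" using Gamma_fact[of n, where 'a = real] by (simp add: n add_ac)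
    moreover have "Gamma (real k + 1 + real m) = fact (k + m)" using Gamma_fact[of "k + m", where 'a = real] by (simp add: add_ac)
    moreover have "fact m = real m * fact n" by (simp add: n)
    moreover have "real ((k + m) choose m) = fact (k + m) / (fact m * fact k)" by (simp add: binomial_fact)
    ultimately show ?thesis using m by (simp add: Beta_def)
  qed
  have "((\<lambda>t. t powr (real k + 1 - 1) * (1 - t) powr (real m - 1)) has_integral Beta (real k + 1) (real m)) {0..1}"
    using m by (intro has_integral_Beta_real) auto
  then have "((\<lambda>t. t ^ k * (1 - t) powr (real m - 1)) has_integral Beta (real k + 1) (real m)) {0..1}"
    by (rule has_integral_spike[of "{0}", rotated 2]) (auto simp: powr_realpow)
  then have "(\<integral>\<^sup>+x\<in>{0..1}. ennreal (x ^ k * (1 - x) powr (real m - 1)) \<partial>lborel) = ennreal (Beta (real k + 1) (real m))"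
    by (intro nn_integral_has_integral_lebesgue') auto
  moreover have "(\<integral>\<^sup>+x\<in>{0..<1}. ennreal (x ^ k * (1 - x) powr (real m - 1)) \<partial>lborel)
      = (\<integral>\<^sup>+x\<in>{0..1}. ennreal (x ^ k * (1 - x) powr (real m - 1)) \<partial>lborel)"
  proof (rule nn_integral_cong_AE)
    have "AE x in lborel. x \<noteq> (1::real)" by (rule AE_lborel_singleton)
    then show "AE x in lborel. ennreal (x ^ k * (1 - x) powr (real m - 1)) * indicator {0..<1} x
        = ennreal (x ^ k * (1 - x) powr (real m - 1)) * indicator {0..1} x"
      by eventually_elim (auto simp: indicator_def)
  qed
  ultimately show ?thesis by (simp add: B)
qed

lemma nn_integral_beta_cube:
  fixes k :: "'n::finite \<Rightarrow> nat"
  assumes m: "m \<ge> 1"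
  shows "(\<integral>\<^sup>+x\<in>unit_cube. ennreal ((\<Prod>j\<in>UNIV. (x $ j) ^ k j) * cube_weight x (real m - 1)) \<partial>lborel)
    = ennreal (1 / (real m ^ CARD('n) * dcoeff m k))"
proof -
  have "(\<integral>\<^sup>+x\<in>unit_cube. ennreal ((\<Prod>j\<in>UNIV. (x $ j) ^ k j) * cube_weight x (real m - 1)) \<partial>lborel)
      = (\<integral>\<^sup>+x\<in>unit_cube. (\<Prod>j\<in>UNIV. ennreal ((x $ j) ^ k j * (1 - x $ j) powr (real m - 1))) \<partial>lborel)"
  proof (rule nn_integral_cong)
    fix x :: "real ^ 'n"
    show "ennreal ((\<Prod>j\<in>UNIV. (x $ j) ^ k j) * cube_weight x (real m - 1)) * indicator unit_cube x =
        (\<Prod>j\<in>UNIV. ennreal ((x $ j) ^ k j * (1 - x $ j) powr (real m - 1))) * indicator unit_cube x"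
    proof (cases "x \<in> unit_cube")
      case True
      then show ?thesis
        by (subst prod_ennreal) (auto simp: unit_cube_def prod.distrib cube_weight_def)
    qed simp
  qed
  also have "\<dots> = (\<Prod>j\<in>UNIV. \<integral>\<^sup>+y\<in>{0..<1}. ennreal (y ^ k j * (1 - y) powr (real m - 1)) \<partial>lborel)"
    unfolding unit_cube_cbx by (rule nn_integral_cbx_prod[where f = "\<lambda>j y. ennreal (y ^ k j * (1 - y) powr (real m - 1))"]) measurable
  also have "\<dots> = (\<Prod>j\<in>UNIV. ennreal (1 / (real m * real ((k j + m) choose m))))"
    by (simp add: nn_integral_beta[OF m])
  also have "\<dots> = ennreal (\<Prod>j\<in>UNIV. 1 / (real m * real ((k j + m) choose m)))"
    by (subst prod_ennreal) auto
  finally show ?thesis by (simp add: prod_dividef prod.distrib dcoeff_def)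
qed

text \<open>Integrating back: \<open>h(z)\<close> is \<open>m^n\<close> times the integral of
  \<open>H(x z) (1 - x)^(m - 1)\<close> over the cube. For finite sums this is the Beta integral
  term by term; dominated convergence in \<open>x\<close> then reaches the series.\<close>

lemma le_integral_frac_deriv:
  fixes b :: "('n::finite \<Rightarrow> nat) \<Rightarrow> complex"
  assumes h: "has_expansion h b" and H: "has_expansion H (\<lambda>k. of_real (dcoeff m k) * b k)"
    and m: "m \<ge> 1" and z: "z \<in> polydisc" and [measurable]: "H \<in> borel_measurable borel"
  shows "ennreal (norm (h z)) \<le> ennreal (real m ^ CARD('n)) *
    (\<integral>\<^sup>+x\<in>unit_cube. ennreal (norm (H (rmult x z)) * cube_weight x (real m - 1)) \<partial>lborel)"
proof -
  let ?E = "\<lambda>N. enum_mi ` {..<N}"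
  have z1: "norm (z $ j) < 1" for j using z by (simp add: polydisc_def)
  have [measurable]: "unit_cube \<in> sets (borel :: (real ^ 'n) measure)"
    using sets_unit_cube by simp
  define HN where "HN = (\<lambda>N z. \<Sum>k\<in>?E N. of_real (dcoeff m k) * b k * vmonom k z)"
  have [measurable]: "HN N \<in> borel_measurable borel" for N unfolding HN_def by measurable
  have [measurable]: "(\<lambda>x. rmult x z) \<in> borel_measurable borel"
    by (rule measurable_rmult) auto
  obtain B where B: "B \<ge> 0" "\<And>w F. (\<forall>j. norm (w $ j) \<le> norm (z $ j)) \<Longrightarrow> finite F \<Longrightarrow> norm (\<Sum>k\<in>F. of_real (dcoeff m k) * b k * vmonom k w) \<le> B"
    using expansion_partial_sums_bound[OF has_expansion_imp_psum[OF H], of "\<lambda>j. norm (z $ j)"] z1 by auto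
  define W where "W = (\<lambda>(k :: 'n \<Rightarrow> nat) (x :: real ^ 'n). (\<Prod>j\<in>UNIV. (x $ j) ^ k j) * cube_weight x (real m - 1) * indicator unit_cube x)"
  have W: "has_bochner_integral lborel (W k) (1 / (real m ^ CARD('n) * dcoeff m k))" for k
  proof (rule has_bochner_integral_nn_integral)
    show "W k \<in> borel_measurable lborel" unfolding W_def by measurable
    show "AE x in lborel. 0 \<le> W k x"
      by (intro AE_I2) (auto simp: W_def indicator_def unit_cube_def intro!: mult_nonneg_nonneg prod_nonneg cube_weight_nonneg)
    show "0 \<le> 1 / (real m ^ CARD('n) * dcoeff m k)" using dcoeff_pos[of m k] by simp
    have "(\<integral>\<^sup>+x. ennreal (W k x) \<partial>lborel) = (\<integral>\<^sup>+x\<in>unit_cube. ennreal ((\<Prod>j\<in>UNIV. (x $ j) ^ k j) * cube_weight x (real m - 1)) \<partial>lborel)"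
      by (intro nn_integral_cong) (auto simp: W_def indicator_def)
    then show "(\<integral>\<^sup>+x. ennreal (W k x) \<partial>lborel) = ennreal (1 / (real m ^ CARD('n) * dcoeff m k))"
      by (simp only: nn_integral_beta_cube[OF m])
  qed
  have fin: "ennreal (norm (\<Sum>k\<in>?E N. b k * vmonom k z)) \<le> ennreal (real m ^ CARD('n)) *
      (\<integral>\<^sup>+x. ennreal (norm (HN N (rmult x z)) * cube_weight x (real m - 1) * indicator unit_cube x) \<partial>lborel)" for N
  proof -
    define \<Phi> where "\<Phi> = (\<lambda>x. \<Sum>k\<in>?E N. of_real (W k x) * (of_real (dcoeff m k) * b k * vmonom k z))"
    have \<Phi>: "\<Phi> x = HN N (rmult x z) * of_real (cube_weight x (real m - 1) * indicator unit_cube x)" for x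
      unfolding \<Phi>_def HN_def sum_distrib_right vmonom_rmult
      by (intro sum.cong refl) (simp add: W_def mult_ac)
    have "has_bochner_integral lborel \<Phi> (\<Sum>k\<in>?E N. of_real (1 / (real m ^ CARD('n) * dcoeff m k)) * (of_real (dcoeff m k) * b k * vmonom k z))"
      unfolding \<Phi>_def by (intro has_bochner_integral_sum has_bochner_integral_mult_left has_bochner_integral_of_real W)
    moreover have "(\<Sum>k\<in>?E N. of_real (1 / (real m ^ CARD('n) * dcoeff m k)) * (of_real (dcoeff m k) * b k * vmonom k z))
        = (\<Sum>k\<in>?E N. b k * vmonom k z) / of_real (real m ^ CARD('n))"
    proof (unfold sum_divide_distrib, intro sum.cong refl)
      fix k :: "'n \<Rightarrow> nat"
      have "complex_of_real (dcoeff m k) \<noteq> 0" using dcoeff_pos[of m k] by simp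
      then show "of_real (1 / (real m ^ CARD('n) * dcoeff m k)) * (of_real (dcoeff m k) * b k * vmonom k z) = b k * vmonom k z / of_real (real m ^ CARD('n))"
        by simp
    qed
    ultimately have "has_bochner_integral lborel \<Phi> ((\<Sum>k\<in>?E N. b k * vmonom k z) / of_real (real m ^ CARD('n)))" by simp
    then have "ennreal (norm ((\<Sum>k\<in>?E N. b k * vmonom k z) / of_real (real m ^ CARD('n)))) \<le> (\<integral>\<^sup>+x. ennreal (norm (\<Phi> x)) \<partial>lborel)"
      by (rule has_bochner_integral_norm_bound)
    also have "\<dots> = (\<integral>\<^sup>+x. ennreal (norm (HN N (rmult x z)) * cube_weight x (real m - 1) * indicator unit_cube x) \<partial>lborel)"
      unfolding \<Phi> by (intro nn_integral_cong) (auto simp: norm_mult cube_weight_nonneg indicator_def)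
    finally have "ennreal (real m ^ CARD('n)) * ennreal (norm ((\<Sum>k\<in>?E N. b k * vmonom k z) / of_real (real m ^ CARD('n))))
       \<le> ennreal (real m ^ CARD('n)) * (\<integral>\<^sup>+x. ennreal (norm (HN N (rmult x z)) * cube_weight x (real m - 1) * indicator unit_cube x) \<partial>lborel)"
      by (rule mult_left_mono) simp
    moreover have "real m ^ CARD('n) * norm ((\<Sum>k\<in>?E N. b k * vmonom k z) / of_real (real m ^ CARD('n))) = norm (\<Sum>k\<in>?E N. b k * vmonom k z)"
      using m by (simp add: norm_divide norm_power)
    ultimately show ?thesis by (simp add: ennreal_mult[symmetric])
  qed
  have lim: "(\<lambda>N. \<integral>\<^sup>+x. ennreal (norm (HN N (rmult x z)) * cube_weight x (real m - 1) * indicator unit_cube x) \<partial>lborel)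
     \<longlonglongrightarrow> (\<integral>\<^sup>+x. ennreal (norm (H (rmult x z)) * cube_weight x (real m - 1) * indicator unit_cube x) \<partial>lborel)"
  proof (rule nn_integral_dominated_convergence[where w = "\<lambda>x. ennreal B * ennreal (W (\<lambda>_. 0) x)"])
    have "integrable lborel (W (\<lambda>_. 0))" using W by (rule integrable.intros)
    then have "(\<integral>\<^sup>+x. ennreal (norm (W (\<lambda>_. 0) x)) \<partial>lborel) < \<infinity>" by (simp add: integrable_iff_bounded)
    moreover have "norm (W (\<lambda>_. 0) x) = W (\<lambda>_. 0) x" for x by (simp add: W_def cube_weight_nonneg)
    moreover have [measurable]: "W (\<lambda>_. 0) \<in> borel_measurable borel" unfolding W_def by measurable
    ultimately show "(\<integral>\<^sup>+x. ennreal B * ennreal (W (\<lambda>_. 0) x) \<partial>lborel) < \<infinity>"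
      by (subst nn_integral_cmult) (auto simp: ennreal_mult_less_top)
    have xz: "\<forall>j. norm (rmult x z $ j) \<le> norm (z $ j)" if "x \<in> unit_cube" for x
    proof
      fix j
      have "0 \<le> x $ j" "x $ j \<le> 1" using that by (auto simp: unit_cube_def less_imp_le)
      then show "norm (rmult x z $ j) \<le> norm (z $ j)"
        by (simp add: rmult_def norm_mult mult_left_le_one_le)
    qed
    show "AE x in lborel. ennreal (norm (HN N (rmult x z)) * cube_weight x (real m - 1) * indicator unit_cube x) \<le> ennreal B * ennreal (W (\<lambda>_. 0) x)" for N
      unfolding HN_def using B xz
      by (intro AE_I2) (auto simp: W_def indicator_def ennreal_mult[symmetric] cube_weight_nonneg intro!: ennreal_leI mult_right_mono)
    show "AE x in lborel. (\<lambda>N. ennreal (norm (HN N (rmult x z)) * cube_weight x (real m - 1) * indicator unit_cube x))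
       \<longlonglongrightarrow> ennreal (norm (H (rmult x z)) * cube_weight x (real m - 1) * indicator unit_cube x)"
    proof (rule AE_I2)
      fix x :: "real ^ 'n"
      show "(\<lambda>N. ennreal (norm (HN N (rmult x z)) * cube_weight x (real m - 1) * indicator unit_cube x))
       \<longlonglongrightarrow> ennreal (norm (H (rmult x z)) * cube_weight x (real m - 1) * indicator unit_cube x)"
      proof (cases "x \<in> unit_cube")
        case True
        then have "rmult x z \<in> polydisc" using xz[OF True] z1 by (auto simp: polydisc_def intro: le_less_trans)
        then show ?thesis unfolding HN_def
          by (intro tendsto_ennrealI tendsto_mult tendsto_const tendsto_norm expansion_partial_sums[OF H])
      qed simp
    qed
  qed (unfold W_def, measurable)
  have "ennreal (norm (h z)) \<le> ennreal (real m ^ CARD('n)) * (\<integral>\<^sup>+x. ennreal (norm (H (rmult x z)) * cube_weight x (real m - 1) * indicator unit_cube x) \<partial>lborel)"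
  proof (rule LIMSEQ_le[OF tendsto_ennrealI[OF tendsto_norm[OF expansion_partial_sums[OF h z]]] ennreal_tendsto_cmult[OF _ lim]])
    show "\<exists>M. \<forall>N\<ge>M. ennreal (norm (\<Sum>k\<in>?E N. b k * vmonom k z)) \<le> ennreal (real m ^ CARD('n)) *
      (\<integral>\<^sup>+x. ennreal (norm (HN N (rmult x z)) * cube_weight x (real m - 1) * indicator unit_cube x) \<partial>lborel)"
      using fin by blast
  qed simp
  also have "(\<integral>\<^sup>+x. ennreal (norm (H (rmult x z)) * cube_weight x (real m - 1) * indicator unit_cube x) \<partial>lborel)
     = (\<integral>\<^sup>+x\<in>unit_cube. ennreal (norm (H (rmult x z)) * cube_weight x (real m - 1)) \<partial>lborel)"
    by (intro nn_integral_cong) (auto simp: indicator_def)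
  finally show ?thesis .
qed

section \<open>Dyadic shells\<close>

abbreviation Sm :: "(('n::finite \<Rightarrow> nat) \<Rightarrow> ennreal) \<Rightarrow> ennreal" where
  "Sm \<phi> \<equiv> \<integral>\<^sup>+k. \<phi> k \<partial>count_space UNIV"

text \<open>The weight \<open>(1 - r)^(-c)\<close> at the dyadic radius \<open>r = dr k\<close>; see
  \<open>cube_weight_dr\<close>.\<close>

definition dw :: "real \<Rightarrow> ('n::finite \<Rightarrow> nat) \<Rightarrow> real" where
  "dw c k = 2 powr (c * real (mdeg k))"

lemma dw_nonneg [simp]: "dw c k \<ge> 0"
  by (simp add: dw_def)

lemma dw_prod: "dw c k = (\<Prod>j\<in>UNIV. 2 powr (c * real (k j)))"
  by (simp add: dw_def mdeg_def sum_distrib_left powr_sum)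

lemma dw_add: "dw (c + d) k = dw c k * dw d k"
  by (simp add: dw_def distrib_right powr_add)

lemma dw_plus: "dw c (\<lambda>j. k j + l j) = dw c k * dw c l"
  by (simp add: dw_def mdeg_def sum.distrib distrib_left powr_add)

lemma dw_shift: "dw c (\<lambda>j. k j + i) = 2 powr (c * real i * CARD('n)) * dw c (k :: 'n::finite \<Rightarrow> nat)"
  by (simp add: dw_def mdeg_def sum.distrib distrib_left powr_add mult_ac)

lemma dw_powr: "dw c k powr a = dw (c * a) k"
  by (simp add: dw_def powr_powr mult_ac)

text \<open>A finite set of multi-indices fits into a box, where the sum factors into one geometric
  series per coordinate.\<close>

lemma sum_dw_le:
  assumes c: "c > 0" and F: "finite F"
  shows "(\<Sum>k\<in>F. dw (- c) (k :: 'n::finite \<Rightarrow> nat)) \<le> (1 / (1 - 2 powr (- c))) ^ CARD('n)"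
proof -
  define x where "x = 2 powr (- c)"
  have x: "0 < x" "x < 1" using c by (auto simp: x_def powr_less_one)
  obtain N where N: "\<And>k j. k \<in> F \<Longrightarrow> k j \<le> N"
  proof
    fix k j assume "k \<in> F"
    then have "mdeg k \<le> Max (mdeg ` F)" using F by (intro Max_ge) auto
    moreover have "k j \<le> mdeg k" unfolding mdeg_def by (rule member_le_sum) auto
    ultimately show "k j \<le> Max (mdeg ` F)" by simp
  qed
  have d: "dw (- c) k = (\<Prod>j\<in>UNIV. x ^ k j)" for k :: "'n \<Rightarrow> nat"
    unfolding dw_prod x_def by (intro prod.cong refl) (simp add: powr_realpow[symmetric] powr_powr)
  have "(\<Sum>k\<in>F. dw (- c) k) \<le> (\<Sum>k\<in>PiE UNIV (\<lambda>_ :: 'n. {..N}). dw (- c) k)"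
    using N by (intro sum_mono2) (auto intro!: finite_PiE)
  also have "\<dots> = (\<Prod>j\<in>(UNIV :: 'n set). \<Sum>i\<le>N. x ^ i)"
    unfolding d by (rule prod_sum_PiE[symmetric]) auto
  also have "\<dots> \<le> (\<Prod>j\<in>(UNIV :: 'n set). 1 / (1 - x))"
  proof (intro prod_mono conjI)
    have "(\<Sum>i\<le>N. x ^ i) \<le> (\<Sum>i. x ^ i)" using x by (intro sum_le_suminf) (auto intro: summable_geometric)
    also have "\<dots> = 1 / (1 - x)" using x by (intro suminf_geometric) auto
    finally show "(\<Sum>i\<le>N. x ^ i) \<le> 1 / (1 - x)" .
  qed (use x in \<open>auto intro!: sum_nonneg\<close>)
  finally show ?thesis by (simp add: x_def)
qed

lemma countable_mi: "countable (UNIV :: ('n::finite \<Rightarrow> nat) set)"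
  by (rule countableI_type)

lemma Sm_dw_less_top:
  assumes c: "c > 0"
  shows "Sm (\<lambda>k :: 'n::finite \<Rightarrow> nat. ennreal (dw (- c) k)) < top"
proof -
  define B where "B = (1 / (1 - 2 powr (- c))) ^ CARD('n)"
  have "Sm (\<lambda>k :: 'n \<Rightarrow> nat. ennreal (dw (- c) k)) = (\<integral>\<^sup>+i. ennreal (dw (- c) (enum_mi i :: 'n \<Rightarrow> nat)) \<partial>count_space UNIV)"
    by (rule nn_integral_bij_count_space[OF bij_enum_mi, symmetric])
  also have "\<dots> = (\<Sum>i. ennreal (dw (- c) (enum_mi i :: 'n \<Rightarrow> nat)))"
    by (rule nn_integral_count_space_nat)
  also have "\<dots> \<le> ennreal B"
  proof (rule suminf_le_const[OF summableI])
    fix n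
    have "(\<Sum>i<n. dw (- c) (enum_mi i :: 'n \<Rightarrow> nat)) = (\<Sum>k\<in>enum_mi ` {..<n}. dw (- c) (k :: 'n \<Rightarrow> nat))"
      by (subst sum.reindex) (auto simp: inj_on_subset[OF bij_is_inj[OF bij_enum_mi]])
    also have "\<dots> \<le> B" unfolding B_def by (rule sum_dw_le[OF c]) simp
    finally have "ennreal (\<Sum>i<n. dw (- c) (enum_mi i :: 'n \<Rightarrow> nat)) \<le> ennreal B" by (rule ennreal_leI)
    then show "(\<Sum>i<n. ennreal (dw (- c) (enum_mi i :: 'n \<Rightarrow> nat))) \<le> ennreal B" by simp
  qed
  finally show ?thesis by (rule le_less_trans) simp
qed

lemma Sm_swap: "Sm (\<lambda>k. Sm (\<lambda>l. f k l)) = Sm (\<lambda>l. Sm (\<lambda>k. f k l))"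
  by (rule nn_integral_count_space_nn_integral[OF countable_mi]) auto

lemma Sm_integral:
  assumes "\<And>k. f k \<in> borel_measurable M"
  shows "(\<integral>\<^sup>+x. Sm (\<lambda>k. f k x) \<partial>M) = Sm (\<lambda>k. \<integral>\<^sup>+x. f k x \<partial>M)"
  by (rule nn_integral_count_space_nn_integral[OF countable_mi]) (use assms in auto)

lemma Sm_inj:
  fixes e :: "('n::finite \<Rightarrow> nat) \<Rightarrow> ('n \<Rightarrow> nat)"
  assumes "inj e"
  shows "Sm (\<lambda>k. \<phi> (e k)) \<le> Sm \<phi>"
proof -
  have "Sm (\<lambda>k. \<phi> (e k)) = (\<integral>\<^sup>+k. \<phi> k \<partial>count_space (range e))"
    by (rule nn_integral_bij_count_space) (use assms in \<open>simp add: inj_on_imp_bij_betw\<close>)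
  also have "\<dots> = (\<integral>\<^sup>+k. \<phi> k * indicator (range e) k \<partial>count_space UNIV)"
    by (rule nn_integral_count_space_indicator) simp
  also have "\<dots> \<le> Sm \<phi>" by (intro nn_integral_mono) (simp add: indicator_def)
  finally show ?thesis .
qed

lemma Sm_cmult: "Sm (\<lambda>k. c * f k) = c * Sm f"
  by (rule nn_integral_cmult) simp

lemma Sm_multc: "Sm (\<lambda>k. f k * c) = Sm f * c"
  by (rule nn_integral_multc) simp

lemma Sm_indicator: "Sm (\<lambda>k. if k = i then c else 0) = (c :: ennreal)"
proof -
  have "Sm (\<lambda>k. if k = i then c else 0) = (\<integral>\<^sup>+k. (\<lambda>_. c) k * indicator {i} k \<partial>count_space UNIV)"
    by (intro nn_integral_cong) (auto simp: indicator_def)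
  also have "\<dots> = c" by (subst nn_integral_count_space_indicator[symmetric]) (auto simp: nn_integral_count_space_finite)
  finally show ?thesis .
qed

text \<open>Parametrizing \<open>(k, l)\<close> by \<open>min k l\<close> and the two excesses turns the double sum into a
  product of geometric series.\<close>

lemma Sm_min_le:
  fixes \<psi> :: "('n::finite \<Rightarrow> nat) \<Rightarrow> ennreal"
  shows "Sm (\<lambda>k. Sm (\<lambda>l. \<psi> (\<lambda>j. min (k j) (l j)) * ennreal (dw (- b) k * dw (- c) l)))
    \<le> Sm (\<lambda>u :: 'n \<Rightarrow> nat. ennreal (dw (- b) u)) * Sm (\<lambda>v :: 'n \<Rightarrow> nat. ennreal (dw (- c) v)) * Sm (\<lambda>i. \<psi> i * ennreal (dw (- (b + c)) i))"
proof -
  define T where "T = (\<lambda>i (u :: 'n \<Rightarrow> nat) (v :: 'n \<Rightarrow> nat). \<psi> i * ennreal (dw (- (b + c)) i) * (ennreal (dw (- b) u) * ennreal (dw (- c) v)))"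
  \<comment> \<open>\<open>Q\<close> encodes the substitution \<open>k = i + u\<close>,
    \<open>l = i + v\<close> by point masses: every pair \<open>(k, l)\<close> is dominated by a sum
    containing its own term, and after exchanging the sums the masses collapse.\<close>
  define Q where "Q = (\<lambda>k l i u v. if k = (\<lambda>j. i j + u j) then if l = (\<lambda>j. i j + v j) then T i u v else 0 else 0)"
  have "\<psi> (\<lambda>j. min (k j) (l j)) * ennreal (dw (- b) k * dw (- c) l) \<le> Sm (\<lambda>i. Sm (\<lambda>u. Sm (\<lambda>v. Q k l i u v)))" for k l
  proof -
    define i where "i = (\<lambda>j. min (k j) (l j))"
    define u where "u = (\<lambda>j. k j - i j)"
    define v where "v = (\<lambda>j. l j - i j)"
    have k: "k = (\<lambda>j. i j + u j)" and l: "l = (\<lambda>j. i j + v j)" by (auto simp: i_def u_def v_def)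
    have "dw (- b) k * dw (- c) l = dw (- (b + c)) i * (dw (- b) u * dw (- c) v)"
      by (subst k, subst l) (simp add: dw_plus dw_add[of "- b" "- c", simplified] mult_ac)
    then have "\<psi> i * ennreal (dw (- b) k * dw (- c) l) = T i u v"
      by (simp add: T_def ennreal_mult mult_ac)
    also have "\<dots> = Q k l i u v" using k l by (simp add: Q_def)
    also have "\<dots> \<le> Sm (\<lambda>v. Q k l i u v)" by (rule nn_integral_ge_point) simp
    also have "\<dots> \<le> Sm (\<lambda>u. Sm (\<lambda>v. Q k l i u v))" by (rule nn_integral_ge_point) simp
    also have "\<dots> \<le> Sm (\<lambda>i. Sm (\<lambda>u. Sm (\<lambda>v. Q k l i u v)))" by (rule nn_integral_ge_point) simp
    finally show ?thesis by (simp add: i_def)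
  qed
  then have "Sm (\<lambda>k. Sm (\<lambda>l. \<psi> (\<lambda>j. min (k j) (l j)) * ennreal (dw (- b) k * dw (- c) l)))
    \<le> Sm (\<lambda>k. Sm (\<lambda>l. Sm (\<lambda>i. Sm (\<lambda>u. Sm (\<lambda>v. Q k l i u v)))))"
    by (intro nn_integral_mono)
  also have "\<dots> = Sm (\<lambda>k. Sm (\<lambda>i. Sm (\<lambda>u. Sm (\<lambda>v. Sm (\<lambda>l. Q k l i u v)))))"
  proof (rule nn_integral_cong)
    fix k :: "'n \<Rightarrow> nat"
    have "Sm (\<lambda>l. Sm (\<lambda>i. Sm (\<lambda>u. Sm (\<lambda>v. Q k l i u v)))) = Sm (\<lambda>i. Sm (\<lambda>l. Sm (\<lambda>u. Sm (\<lambda>v. Q k l i u v))))"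
      by (rule Sm_swap)
    also have "\<dots> = Sm (\<lambda>i. Sm (\<lambda>u. Sm (\<lambda>l. Sm (\<lambda>v. Q k l i u v))))"
      by (rule nn_integral_cong, rule Sm_swap)
    also have "\<dots> = Sm (\<lambda>i. Sm (\<lambda>u. Sm (\<lambda>v. Sm (\<lambda>l. Q k l i u v))))"
      by (rule nn_integral_cong, rule nn_integral_cong, rule Sm_swap)
    finally show "Sm (\<lambda>l. Sm (\<lambda>i. Sm (\<lambda>u. Sm (\<lambda>v. Q k l i u v)))) = Sm (\<lambda>i. Sm (\<lambda>u. Sm (\<lambda>v. Sm (\<lambda>l. Q k l i u v))))" .
  qed
  also have "\<dots> = Sm (\<lambda>k. Sm (\<lambda>i. Sm (\<lambda>u. Sm (\<lambda>v. if k = (\<lambda>j. i j + u j) then T i u v else 0))))"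
  proof (intro nn_integral_cong)
    fix k i u v
    show "Sm (\<lambda>l. Q k l i u v) = (if k = (\<lambda>j. i j + u j) then T i u v else 0)"
      by (cases "k = (\<lambda>j. i j + u j)") (auto simp: Q_def Sm_indicator)
  qed
  also have "\<dots> = Sm (\<lambda>i. Sm (\<lambda>u. Sm (\<lambda>v. Sm (\<lambda>k. if k = (\<lambda>j. i j + u j) then T i u v else 0))))"
  proof -
    have "Sm (\<lambda>k. Sm (\<lambda>i. Sm (\<lambda>u. Sm (\<lambda>v. if k = (\<lambda>j. i j + u j) then T i u v else 0))))
       = Sm (\<lambda>i. Sm (\<lambda>k. Sm (\<lambda>u. Sm (\<lambda>v. if k = (\<lambda>j. i j + u j) then T i u v else 0))))"
      by (rule Sm_swap)
    also have "\<dots> = Sm (\<lambda>i. Sm (\<lambda>u. Sm (\<lambda>k. Sm (\<lambda>v. if k = (\<lambda>j. i j + u j) then T i u v else 0))))"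
      by (rule nn_integral_cong, rule Sm_swap)
    also have "\<dots> = Sm (\<lambda>i. Sm (\<lambda>u. Sm (\<lambda>v. Sm (\<lambda>k. if k = (\<lambda>j. i j + u j) then T i u v else 0))))"
      by (rule nn_integral_cong, rule nn_integral_cong, rule Sm_swap)
    finally show ?thesis .
  qed
  also have "\<dots> = Sm (\<lambda>i. Sm (\<lambda>u. Sm (\<lambda>v. T i u v)))" by (simp only: Sm_indicator)
  also have "\<dots> = Sm (\<lambda>u :: 'n \<Rightarrow> nat. ennreal (dw (- b) u)) * Sm (\<lambda>v :: 'n \<Rightarrow> nat. ennreal (dw (- c) v)) * Sm (\<lambda>i. \<psi> i * ennreal (dw (- (b + c)) i))"
    unfolding T_def Sm_cmult Sm_multc by (rule mult.commute)
  finally show ?thesis .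
qed

section \<open>Dyadic radii, shells and their weights\<close>

definition dr :: "('n::finite \<Rightarrow> nat) \<Rightarrow> real ^ 'n" where
  "dr k = (\<chi> j. 1 - (1 / 2) ^ k j)"

definition shell :: "('n::finite \<Rightarrow> nat) \<Rightarrow> (real ^ 'n) set" where
  "shell k = cbx (\<lambda>j. 1 - (1 / 2) ^ k j) (\<lambda>j. 1 - (1 / 2) ^ (k j + 1))"

lemma dr_nth [simp]: "dr k $ j = 1 - (1 / 2) ^ k j"
  by (simp add: dr_def)

lemma dr_cube: "dr k \<in> unit_cube"
  by (simp add: unit_cube_def power_le_one)

lemma sets_shell [measurable]: "shell k \<in> sets borel"
  unfolding shell_def by measurable

lemma wbox_dr: "wbox (dr k) = shell (\<lambda>j. k j + 1)"
  by (simp add: wbox_cbx shell_def)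

lemma shell_subset: "shell k \<subseteq> unit_cube"
proof
  fix x assume x: "x \<in> shell k"
  have "0 \<le> x $ j \<and> x $ j < 1" for j
  proof -
    have "1 - (1 / 2) ^ k j \<le> x $ j" "x $ j < 1 - (1 / 2) ^ (k j + 1)" using x by (auto simp: shell_def cbx_def)
    moreover have "(1 / 2 :: real) ^ k j \<le> 1" "(1 / 2 :: real) ^ (k j + 1) > 0" by (auto simp: power_le_one)
    ultimately show ?thesis by linarith
  qed
  then show "x \<in> unit_cube" by (simp add: unit_cube_def)
qed

lemma shell_vless: "x \<in> shell k \<Longrightarrow> vless x (dr (\<lambda>j. k j + 1))"
  by (auto simp: shell_def cbx_def vless_def)

lemma ex_shell_1:
  assumes "0 \<le> y" "y < (1::real)"
  shows "\<exists>!k. 1 - (1 / 2) ^ k \<le> y \<and> y < 1 - (1 / 2) ^ (k + 1)"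
proof -
  have "\<exists>k. y < 1 - (1 / 2) ^ (k + 1)"
  proof -
    obtain k where "(1 / 2) ^ k < 1 - y" using assms real_arch_pow_inv[of "1 - y" "1 / 2"] by auto
    moreover have "(1 / 2 :: real) ^ (k + 1) \<le> (1 / 2) ^ k" by (intro power_decreasing) auto
    ultimately show ?thesis by (intro exI[of _ k]) linarith
  qed
  define k where "k = (LEAST k. y < 1 - (1 / 2) ^ (k + 1))"
  have k: "y < 1 - (1 / 2) ^ (k + 1)" unfolding k_def using \<open>\<exists>k. _ k\<close> by (rule LeastI_ex)
  have k': "1 - (1 / 2) ^ k \<le> y"
  proof (cases k)
    case (Suc i)
    then have "\<not> y < 1 - (1 / 2) ^ (i + 1)" using not_less_Least[of i "\<lambda>k. y < 1 - (1 / 2) ^ (k + 1)"] by (simp add: k_def)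
    then show ?thesis using Suc by simp
  qed (use assms in simp)
  show ?thesis
  proof (rule ex1I[of _ k], use k k' in simp)
    fix i assume i: "1 - (1 / 2) ^ i \<le> y \<and> y < 1 - (1 / 2) ^ (i + 1)"
    have *: "\<not> a + 1 \<le> b" if "y < 1 - (1 / 2) ^ (a + 1)" "1 - (1 / 2) ^ b \<le> y" for a b :: nat
    proof
      assume "a + 1 \<le> b"
      then have "(1 / 2 :: real) ^ b \<le> (1 / 2) ^ (a + 1)" by (intro power_decreasing) auto
      then show False using that by linarith
    qed
    have "\<not> k + 1 \<le> i" using k i by (intro *) auto
    moreover have "\<not> i + 1 \<le> k" using k' i by (intro *) auto
    ultimately show "i = k" by simp
  qed
qed

lemma Sm_indicator_shell: "Sm (\<lambda>k. indicator (shell k) x) = (indicator unit_cube x :: ennreal)"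
proof (cases "x \<in> unit_cube")
  case True
  have "\<exists>k. \<forall>i. (1 - (1 / 2) ^ i \<le> x $ j \<and> x $ j < 1 - (1 / 2) ^ (i + 1)) \<longleftrightarrow> i = k" for j
    using ex_shell_1[of "x $ j"] True unfolding unit_cube_def by blast
  then obtain k where k: "\<And>j i. (1 - (1 / 2) ^ i \<le> x $ j \<and> x $ j < 1 - (1 / 2) ^ (i + 1)) \<longleftrightarrow> i = k j" by metis
  have "x \<in> shell i \<longleftrightarrow> i = k" for i unfolding shell_def cbx_def mem_Collect_eq k by (simp add: fun_eq_iff)
  then have "indicator (shell i) x = (if i = k then 1 else 0 :: ennreal)" for i by (simp add: indicator_def)
  then show ?thesis using True by (simp add: Sm_indicator)
next
  case False
  then have "x \<notin> shell k" for k using shell_subset[of k] by blast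
  then show ?thesis using False by simp
qed

lemma nn_integral_cube_shells:
  assumes [measurable]: "\<phi> \<in> borel_measurable borel"
  shows "(\<integral>\<^sup>+x\<in>unit_cube. \<phi> x \<partial>lborel) = Sm (\<lambda>k. \<integral>\<^sup>+x\<in>shell k. \<phi> x \<partial>lborel)"
proof -
  have "(\<integral>\<^sup>+x\<in>unit_cube. \<phi> x \<partial>lborel) = (\<integral>\<^sup>+x. Sm (\<lambda>k. \<phi> x * indicator (shell k) x) \<partial>lborel)"
    by (simp only: Sm_cmult Sm_indicator_shell)
  also have "\<dots> = Sm (\<lambda>k. \<integral>\<^sup>+x\<in>shell k. \<phi> x \<partial>lborel)"
    by (rule Sm_integral) measurable
  finally show ?thesis .
qed

lemma half_powr: "((1 / 2) ^ k) powr g = (2::real) powr (- g * real k)"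
  by (simp add: powr_realpow[symmetric] powr_powr powr_divide powr_minus divide_simps mult.commute)

lemma cube_weight_dr: "cube_weight (dr k) g = dw (- g) k"
  by (simp add: cube_weight_def dw_prod half_powr)

lemma shell_weight:
  fixes x :: "real ^ 'n::finite"
  assumes "x \<in> shell k"
  shows "cube_weight x g \<le> (4 powr \<bar>g\<bar>) ^ CARD('n) * dw (- g) k"
    and "dw (- g) k \<le> (4 powr \<bar>g\<bar>) ^ CARD('n) * cube_weight x g"
proof -
  have 1: "dr k $ j < 1" for j by simp
  have 2: "(1 - dr k $ j) / 4 \<le> 1 - x $ j" "1 - x $ j \<le> 1 - dr k $ j" for j
  proof -
    have x: "1 - (1 / 2) ^ k j \<le> x $ j" "x $ j < 1 - (1 / 2) ^ (k j + 1)" using assms by (auto simp: shell_def cbx_def)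
    have "0 < (1 / 2 :: real) ^ k j" by simp
    then show "(1 - dr k $ j) / 4 \<le> 1 - x $ j" using x(2) by (simp add: field_simps)
    show "1 - x $ j \<le> 1 - dr k $ j" using x(1) by simp
  qed
  show "cube_weight x g \<le> (4 powr \<bar>g\<bar>) ^ CARD('n) * dw (- g) k"
    using cube_weight_between(1)[of "dr k" x g, OF 1 2] by (simp add: cube_weight_dr)
  show "dw (- g) k \<le> (4 powr \<bar>g\<bar>) ^ CARD('n) * cube_weight x g"
    using cube_weight_between(2)[of "dr k" x g, OF 1 2] by (simp add: cube_weight_dr)
qed

lemma emeasure_shell: "emeasure lborel (shell k :: (real ^ 'n::finite) set) = ennreal ((1 / 2) ^ CARD('n) * dw (- 1) k)"
proof -
  have "emeasure lborel (shell k :: (real ^ 'n) set) = ennreal (\<Prod>j\<in>UNIV. (1 - (1 / 2) ^ (k j + 1)) - (1 - (1 / 2) ^ k j))"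
    unfolding shell_def by (rule emeasure_cbx) simp
  also have "(\<Prod>j\<in>UNIV. (1 - (1 / 2) ^ (k j + 1)) - (1 - (1 / 2) ^ k j)) = (\<Prod>j\<in>(UNIV :: 'n set). (1 / 2) * 2 powr (- 1 * real (k j)))"
    using half_powr[of _ 1] by (intro prod.cong refl) simp
  finally show ?thesis by (simp only: prod.distrib prod_constant dw_prod)
qed

text \<open>On a shell the weight is comparable to its value at \<open>dr k\<close>, and the volume
  is comparable to \<open>2^(-|k|)\<close>; hence the exponent \<open>g + 1\<close>.\<close>

lemma nn_integral_shell_weight_le:
  "(\<integral>\<^sup>+x\<in>shell k. ennreal (cube_weight x g) \<partial>lborel) \<le> ennreal ((4 powr \<bar>g\<bar>) ^ CARD('n) * dw (- (g + 1)) (k :: 'n::finite \<Rightarrow> nat))"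
proof -
  have "(\<integral>\<^sup>+x\<in>shell k. ennreal (cube_weight x g) \<partial>lborel) \<le> (\<integral>\<^sup>+x. ennreal ((4 powr \<bar>g\<bar>) ^ CARD('n) * dw (- g) k) * indicator (shell k) x \<partial>lborel)"
    by (intro nn_integral_mono) (auto simp: indicator_def intro!: ennreal_leI shell_weight)
  also have "\<dots> = ennreal ((4 powr \<bar>g\<bar>) ^ CARD('n) * dw (- g) k) * ennreal ((1 / 2) ^ CARD('n) * dw (- 1) k)"
    by (subst nn_integral_cmult_indicator) (auto simp: emeasure_shell)
  also have "\<dots> = ennreal ((4 powr \<bar>g\<bar>) ^ CARD('n) * dw (- g) k * ((1 / 2) ^ CARD('n) * dw (- 1) k))"
    by (simp add: ennreal_mult)
  also have "\<dots> \<le> ennreal ((4 powr \<bar>g\<bar>) ^ CARD('n) * dw (- g) k * (1 * dw (- 1) k))"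
    by (intro ennreal_leI mult_left_mono mult_right_mono) (auto simp: power_le_one)
  also have "\<dots> = ennreal ((4 powr \<bar>g\<bar>) ^ CARD('n) * dw (- (g + 1)) k)"
    using dw_add[of "- g" "- 1" k] by (simp add: mult_ac)
  finally show ?thesis .
qed

lemma nn_integral_shell_weight_ge:
  "ennreal (dw (- (g + 1)) (k :: 'n::finite \<Rightarrow> nat)) \<le> ennreal ((2 * 4 powr \<bar>g\<bar>) ^ CARD('n)) * (\<integral>\<^sup>+x\<in>shell k. ennreal (cube_weight x g) \<partial>lborel)"
proof -
  have "ennreal (dw (- g) k) * ennreal ((1 / 2) ^ CARD('n) * dw (- 1) k) = (\<integral>\<^sup>+x. ennreal (dw (- g) k) * indicator (shell k) x \<partial>lborel)"
    by (subst nn_integral_cmult_indicator) (auto simp: emeasure_shell)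
  also have "\<dots> \<le> (\<integral>\<^sup>+x. ennreal ((4 powr \<bar>g\<bar>) ^ CARD('n)) * (ennreal (cube_weight x g) * indicator (shell k) x) \<partial>lborel)"
    using shell_weight(2)[of _ k g]
    by (intro nn_integral_mono) (auto simp: indicator_def ennreal_mult[symmetric] cube_weight_nonneg intro!: ennreal_leI)
  also have "\<dots> = ennreal ((4 powr \<bar>g\<bar>) ^ CARD('n)) * (\<integral>\<^sup>+x\<in>shell k. ennreal (cube_weight x g) \<partial>lborel)"
    by (rule nn_integral_cmult) measurable
  finally have "ennreal (2 ^ CARD('n)) * (ennreal (dw (- g) k) * ennreal ((1 / 2) ^ CARD('n) * dw (- 1) k)) \<le>
      ennreal (2 ^ CARD('n)) * (ennreal ((4 powr \<bar>g\<bar>) ^ CARD('n)) * (\<integral>\<^sup>+x\<in>shell k. ennreal (cube_weight x g) \<partial>lborel))"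
    by (rule mult_left_mono) simp
  moreover have "ennreal (2 ^ CARD('n)) * (ennreal (dw (- g) k) * ennreal ((1 / 2) ^ CARD('n) * dw (- 1) k)) = ennreal (dw (- (g + 1)) k)"
    using dw_add[of "- g" "- 1" k] by (simp add: ennreal_mult[symmetric] power_one_over)
  moreover have "ennreal (2 ^ CARD('n)) * ennreal ((4 powr \<bar>g\<bar>) ^ CARD('n)) = ennreal ((2 * 4 powr \<bar>g\<bar>) ^ CARD('n))"
    by (simp add: ennreal_mult[symmetric] power_mult_distrib)
  ultimately show ?thesis by (simp only: mult.assoc[symmetric])
qed

section \<open>The multiplier estimate\<close>

lemma sep_hol_mult:
  assumes "sep_hol f" "sep_hol g"
  shows "sep_hol (\<lambda>z. f z * g z)"
  using assms unfolding sep_hol_def by (auto intro!: holomorphic_on_mult)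

text \<open>Conjugating before and after \<open>g\<close> preserves holomorphy in each variable. It
  allows \<open>g\<close> at the angles \<open>a - b\<close> to be viewed as the conjugate of a
  holomorphic function of the point with angles \<open>b\<close>.\<close>

lemma sep_hol_reflect:
  fixes g :: "complex ^ 'n::finite \<Rightarrow> complex"
  assumes g: "sep_hol g" and c: "\<And>j. norm (c j) = 1"
  shows "sep_hol (\<lambda>w. cnj (g (\<chi> j. c j * cnj (w $ j))))"
  unfolding sep_hol_def
proof (intro conjI ballI allI)
  have [measurable]: "g \<in> borel_measurable borel" using g by (rule sep_hol_measurable)
  have [measurable]: "cnj \<in> borel_measurable borel"
    by (intro borel_measurable_continuous_onI continuous_intros)
  have "(\<lambda>w. \<chi> j. c j * cnj (w $ j)) \<in> borel_measurable borel"
    by (intro measurable_vec_lambda borel_measurable_times measurable_compose[OF measurable_vec_nth \<open>cnj \<in> _\<close>]) auto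
  then have "(\<lambda>w. g (\<chi> j. c j * cnj (w $ j))) \<in> borel_measurable borel"
    by (rule measurable_compose) measurable
  then show "(\<lambda>w. cnj (g (\<chi> j. c j * cnj (w $ j)))) \<in> borel_measurable borel"
    by (rule measurable_compose) measurable
next
  fix z :: "complex ^ 'n" and j assume z: "z \<in> polydisc"
  define z' where "z' = (\<chi> i. c i * cnj (z $ i))"
  have z': "z' \<in> polydisc" using z c by (simp add: polydisc_def z'_def norm_mult)
  define F where "F = (\<lambda>u. g (\<chi> i. if i = j then u else z' $ i))"
  have F: "F holomorphic_on ball 0 1" using g z' unfolding sep_hol_def F_def by blast
  have im: "cnj ` ball 0 1 = ball 0 1"
  proof
    show "ball 0 1 \<subseteq> cnj ` ball 0 1"
    proof
      fix x :: complex assume "x \<in> ball 0 1"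
      then show "x \<in> cnj ` ball 0 1" by (intro image_eqI[of _ _ "cnj x"]) auto
    qed
  qed auto
  have "(cnj \<circ> F \<circ> cnj) holomorphic_on ball 0 1"
    by (rule holomorphic_on_compose_cnj_cnj) (use F im in auto)
  then have "((cnj \<circ> F \<circ> cnj) \<circ> (\<lambda>w. cnj (c j) * w)) holomorphic_on ball 0 1"
    by (rule holomorphic_on_compose_gen[rotated]) (use c in \<open>auto intro!: holomorphic_intros simp: norm_mult\<close>)
  moreover have "((cnj \<circ> F \<circ> cnj) \<circ> (\<lambda>w. cnj (c j) * w)) = (\<lambda>w. cnj (g (\<chi> i. c i * cnj ((\<chi> i. if i = j then w else z $ i) $ i))))"
  proof
    fix w
    have "(\<chi> i. if i = j then c j * cnj w else z' $ i) = (\<chi> i. c i * cnj ((\<chi> i. if i = j then w else z $ i) $ i))"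
      by (auto simp: vec_eq_iff z'_def)
    then show "((cnj \<circ> F \<circ> cnj) \<circ> (\<lambda>w. cnj (c j) * w)) w = cnj (g (\<chi> i. c i * cnj ((\<chi> i. if i = j then w else z $ i) $ i)))"
      by (simp add: F_def)
  qed
  ultimately show "(\<lambda>w. cnj (g (\<chi> i. c i * cnj ((\<chi> i. if i = j then w else z $ i) $ i)))) holomorphic_on ball 0 1"
    by simp
qed

text \<open>On the torus of radii \<open>r\<close> its modulus is the integrand of
  \<open>hadamard_le\<close>, yet it is separately holomorphic in \<open>w\<close>; thus
  \<open>Jm_le_Jm\<close> can trade its mean of order 1 for a mean of order
  \<open>t\<close>.\<close>

definition had :: "(complex ^ 'n::finite \<Rightarrow> complex) \<Rightarrow> (complex ^ 'n \<Rightarrow> complex) \<Rightarrow> ('n \<Rightarrow> real) \<Rightarrow> complex ^ 'n \<Rightarrow> complex" where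
  "had f g a w = f w * cnj (g (\<chi> j. unit_exp (a j) * cnj (w $ j)))"

lemma sep_hol_had: "sep_hol f \<Longrightarrow> sep_hol g \<Longrightarrow> sep_hol (had f g a)"
  unfolding had_def[abs_def] by (intro sep_hol_mult sep_hol_reflect) auto

lemma norm_had: "norm (had f g a (rmult r (tor b))) = norm (f (rmult r (tor b))) * norm (g (rmult r (tor (\<lambda>j. a j - b j))))"
proof -
  have "(\<chi> j. unit_exp (a j) * cnj (rmult r (tor b) $ j)) = rmult r (tor (\<lambda>j. a j - b j))"
    by (simp add: vec_eq_iff rmult_def tor_def cis_cnj cis_mult right_diff_distrib)
  then show ?thesis by (simp add: had_def norm_mult)
qed

lemma measurable_tor_diff2: "(\<lambda>(a, b). tor (\<lambda>j. a j - b j)) \<in> borel_measurable (TM \<Otimes>\<^sub>M TM)"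
  using measurable_TM_component'[OF measurable_fst[of TM TM]] measurable_TM_component'[OF measurable_snd[of TM TM]]
  unfolding tor_def by measurable

text \<open>Rotation invariance removes \<open>b\<close> from the factor containing
  \<open>a - b\<close>, and the double integral separates.\<close>

lemma nn_integral_Jm_had:
  fixes f g :: "complex ^ 'n::finite \<Rightarrow> complex"
  assumes f: "sep_hol f" and g: "sep_hol g"
  shows "(\<lambda>a. Jm t (had f g a) r) \<in> borel_measurable TM"
    and "(\<integral>\<^sup>+a. Jm t (had f g a) r \<partial>TM) = Jm t f r * Jm t g r"
proof -
  have [measurable]: "f \<in> borel_measurable borel" "g \<in> borel_measurable borel"
    using f g by (auto intro: sep_hol_measurable)
  interpret T: sigma_finite_measure "TM :: ('n \<Rightarrow> real) measure" by (rule sigma_finite_TM)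
  interpret TT: pair_sigma_finite "TM :: ('n \<Rightarrow> real) measure" "TM :: ('n \<Rightarrow> real) measure" ..
  note [measurable] = measurable_tor_diff2
  have d [measurable]: "(\<lambda>p. tor (\<lambda>j. fst p j - snd p j)) \<in> borel_measurable (TM \<Otimes>\<^sub>M TM)"
    using measurable_tor_diff2 by (simp add: case_prod_beta')
  define Q where "Q = (\<lambda>a b. ennreal (norm (f (rmult r (tor b))) powr t) * ennreal (norm (g (rmult r (tor (\<lambda>j. a j - b j)))) powr t))"
  have Q [measurable]: "(\<lambda>(a, b). Q a b) \<in> borel_measurable (TM \<Otimes>\<^sub>M TM)"
    unfolding Q_def by (simp add: case_prod_beta') measurable
  have J: "Jm t (had f g a) r = (\<integral>\<^sup>+b. Q a b \<partial>TM)" for a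
    unfolding Jm_def norm_had Q_def by (simp add: powr_mult ennreal_mult)
  show "(\<lambda>a. Jm t (had f g a) r) \<in> borel_measurable TM" unfolding J by measurable
  have [measurable]: "(\<lambda>a. tor (\<lambda>j. a j - b j)) \<in> borel_measurable TM" for b :: "'n \<Rightarrow> real"
    unfolding tor_def using measurable_TM_component by measurable
  have "(\<integral>\<^sup>+a. Jm t (had f g a) r \<partial>TM) = (\<integral>\<^sup>+a. \<integral>\<^sup>+b. Q a b \<partial>TM \<partial>TM)" by (simp only: J)
  also have "\<dots> = (\<integral>\<^sup>+b. \<integral>\<^sup>+a. Q a b \<partial>TM \<partial>TM)" by (rule TT.Fubini'[symmetric]) (rule Q)
  also have "\<dots> = (\<integral>\<^sup>+b. ennreal (norm (f (rmult r (tor b))) powr t) * Jm t g r \<partial>TM)"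
  proof (rule nn_integral_cong)
    fix b :: "'n \<Rightarrow> real"
    have "(\<integral>\<^sup>+a. Q a b \<partial>TM) = ennreal (norm (f (rmult r (tor b))) powr t) * (\<integral>\<^sup>+a. ennreal (norm (g (rmult r (tor (\<lambda>j. a j - b j)))) powr t) \<partial>TM)"
      unfolding Q_def by (rule nn_integral_cmult) measurable
    also have "(\<integral>\<^sup>+a. ennreal (norm (g (rmult r (tor (\<lambda>j. a j - b j)))) powr t) \<partial>TM) = Jm t g r"
      unfolding Jm_def by (rule nn_integral_TM_rotate[where \<phi> = "\<lambda>z. ennreal (norm (g (rmult r z)) powr t)"]) measurable
    finally show "(\<integral>\<^sup>+a. Q a b \<partial>TM) = ennreal (norm (f (rmult r (tor b))) powr t) * Jm t g r" .
  qed
  also have "\<dots> = Jm t f r * Jm t g r" unfolding Jm_def[of t f] by (rule nn_integral_multc) measurable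
  finally show "(\<integral>\<^sup>+a. Jm t (had f g a) r \<partial>TM) = Jm t f r * Jm t g r" .
qed

text \<open>The geometric means of two dyadic radii, at which both factors of a Hadamard product are evaluated.\<close>

definition yy :: "('n::finite \<Rightarrow> nat) \<Rightarrow> ('n \<Rightarrow> nat) \<Rightarrow> real ^ 'n" where
  "yy k l = (\<chi> j. sqrt ((1 - (1 / 2) ^ (k j + 2)) * (1 - (1 / 2) ^ (l j + 1))))"

text \<open>With \<open>d = 2^(-(min + 3))\<close>, the square of the radius is at most
  \<open>1 - 2 d \<le> (1 - d)^2\<close>: the factor with the smaller index alone is already at most
  \<open>1 - 2 d\<close>.\<close>

lemma yy_bounds:
  fixes k l :: "'n::finite \<Rightarrow> nat"
  shows "0 < yy k l $ j" "(1 / 2) ^ (min (k j) (l j) + 3) \<le> 1 - yy k l $ j"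
proof -
  define d where "d = (1 / 2 :: real) ^ (min (k j) (l j) + 3)"
  have "d \<le> (1 / 2) ^ 3" unfolding d_def by (rule power_decreasing) auto
  also have "(1 / 2 :: real) ^ 3 = 1 / 2 * (1 / 2) * (1 / 2)" by (rule power3_eq_cube)
  finally have d: "d \<le> 1 / 8" "0 < d" by (simp, simp add: d_def)
  have d2: "2 * d = (1 / 2) ^ (min (k j) (l j) + 2)" by (simp add: d_def eval_nat_numeral)
  define A where "A = (1 / 2 :: real) ^ (k j + 2)"
  define B where "B = (1 / 2 :: real) ^ (l j + 1)"
  have A: "0 < A" "A \<le> 1 / 4" by (auto simp: A_def power_add power_le_one)
  have B: "0 < B" "B \<le> 1 / 2" by (auto simp: B_def power_add power_le_one)
  have AB: "2 * d \<le> A \<or> 2 * d \<le> B"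
  proof (cases "k j \<le> l j")
    case True
    then show ?thesis unfolding d2 A_def by (simp add: min_def)
  next
    case False
    then have "(1 / 2 :: real) ^ (l j + 2) \<le> (1 / 2) ^ (l j + 1)" by (intro power_decreasing) auto
    then show ?thesis using False unfolding d2 B_def by (simp add: min_def)
  qed
  have pos: "0 < (1 - A) * (1 - B)" using A B by (intro mult_pos_pos) auto
  then show "0 < yy k l $ j" by (simp add: yy_def A_def B_def)
  have "(1 - A) * (1 - B) \<le> 1 - 2 * d"
  proof (cases "2 * d \<le> A")
    case True
    have "(1 - A) * (1 - B) \<le> (1 - A) * 1" using A B by (intro mult_left_mono) auto
    also have "\<dots> \<le> 1 - 2 * d" using True by simp
    finally show ?thesis .
  next
    case False
    have "(1 - A) * (1 - B) \<le> 1 * (1 - B)" using A B by (intro mult_right_mono) auto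
    also have "\<dots> \<le> 1 - 2 * d" using False AB by simp
    finally show ?thesis .
  qed
  also have "\<dots> \<le> (1 - d)\<^sup>2" by (simp add: power2_eq_square algebra_simps)
  finally have "sqrt ((1 - A) * (1 - B)) \<le> sqrt ((1 - d)\<^sup>2)" by (rule real_sqrt_le_mono)
  also have "\<dots> = 1 - d" using d by simp
  finally show "(1 / 2) ^ (min (k j) (l j) + 3) \<le> 1 - yy k l $ j" by (simp add: yy_def A_def B_def d_def)
qed

lemma yy_cube: "yy k l \<in> unit_cube"
proof -
  have "0 \<le> yy k l $ j \<and> yy k l $ j < 1" for j
  proof -
    have "(1 / 2 :: real) ^ (min (k j) (l j) + 3) > 0" by simp
    then show ?thesis using yy_bounds[where k = k and l = l and j = j] by linarith
  qed
  then show ?thesis by (simp add: unit_cube_def)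
qed

lemma yy_vless: "vless (yy k l) (dr (\<lambda>j. min (k j) (l j) + 4))"
  unfolding vless_def
proof
  fix j
  have "(1 / 2 :: real) ^ (min (k j) (l j) + 4) < (1 / 2) ^ (min (k j) (l j) + 3)"
    by (rule power_strict_decreasing) auto
  then show "yy k l $ j < dr (\<lambda>j. min (k j) (l j) + 4) $ j"     using yy_bounds(2)[where k = k and l = l and j = j] unfolding dr_nth by linarith
qed

lemma one_minus_sqrt_ge:
  assumes "0 \<le> u" "u \<le> 1"
  shows "1 - u \<le> 2 * (1 - sqrt u)"
proof -
  have "0 \<le> (1 - sqrt u)\<^sup>2" by simp
  then have "2 * sqrt u \<le> 1 + (sqrt u)\<^sup>2" by (simp add: power2_diff)
  then show ?thesis using assms by (simp add: field_simps)
qed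

text \<open>The Hadamard product is evaluated at radii \<open>r\<close> with
  \<open>r^2 = x * R\<close>, \<open>R = dr (l + 1)\<close>. In the quotient
  \<open>r / yy k l\<close> the factor \<open>sqrt R\<close> cancels, so its gap to 1 is at least
  \<open>2^(-(k + 3))\<close> whatever \<open>l\<close> is, and passing from order 1 to order
  \<open>t\<close> costs only \<open>(16 * 2^k)^(1/t - 1)\<close> per coordinate. The index
  \<open>k + 2\<close> in \<open>yy\<close> leaves room beyond the shell, which ends at
  \<open>1 - 2^(-(k + 1))\<close>.\<close>

lemma norm_product_le_shell:
  fixes h f g :: "complex ^ 'n::finite \<Rightarrow> complex"
  assumes f: "sep_hol f" "has_expansion f a" and g: "sep_hol g" "has_expansion g c"
    and H: "has_expansion H (\<lambda>k. c k * a k)" and t: "0 < t" "t \<le> 1"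
    and x: "x \<in> shell k"
  shows "ennreal (norm (H (rmult x (rmult (dr (\<lambda>j. l j + 1)) (tor b))))) \<le>
    ennreal ((16 ^ CARD('n) * dw 1 k) powr (1 / t - 1)) * ennpowr (Jm t (had f g b) (yy k l)) (1 / t)"
proof -
  define r where "r = (\<chi> j. sqrt (x $ j * (1 - (1 / 2) ^ (l j + 1))))"
  have x0: "0 \<le> x $ j" "x $ j < 1 - (1 / 2) ^ (k j + 1)" for j
    using x shell_subset[of k] by (auto simp: shell_def cbx_def unit_cube_def)
  have L: "0 < 1 - (1 / 2 :: real) ^ (l j + 1)" for j
    using power_decreasing[of 1 "l j + 1" "1 / 2 :: real"] by simp
  have X: "(1 / 2 :: real) ^ (k j + 2) = (1 / 2) ^ (k j + 1) / 2" for j by simp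
  have X0: "0 < (1 / 2 :: real) ^ (k j + 2)" "(1 / 2 :: real) ^ (k j + 2) \<le> 1 / 4" for j by (auto simp: power_add power_le_one)
  have ry: "r $ j / yy k l $ j = sqrt (x $ j / (1 - (1 / 2) ^ (k j + 2)))" for j
    unfolding r_def yy_def using L[of j] by (simp add: real_sqrt_divide real_sqrt_mult)
  have u: "0 \<le> x $ j / (1 - (1 / 2) ^ (k j + 2))" "x $ j / (1 - (1 / 2) ^ (k j + 2)) \<le> 1 - (1 / 2) ^ (k j + 2)" for j
  proof -
    show "0 \<le> x $ j / (1 - (1 / 2) ^ (k j + 2))" using x0(1)[of j] X0[of j] by simp
    \<comment> \<open>With \<open>P = 2^(-(k + 2))\<close> this is
      \<open>x < 1 - 2 P \<le> (1 - P)^2\<close>.\<close>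
    have "x $ j \<le> (1 - (1 / 2) ^ (k j + 2)) * (1 - (1 / 2) ^ (k j + 2))"
      using x0(2)[of j] X[of j] zero_le_square[of "(1 / 2 :: real) ^ (k j + 2)"] by (simp only: left_diff_distrib right_diff_distrib)
    then show "x $ j / (1 - (1 / 2) ^ (k j + 2)) \<le> 1 - (1 / 2) ^ (k j + 2)"
      using X0[of j] by (simp add: pos_divide_le_eq)
  qed
  have gap: "(1 / 2) ^ (k j + 3) \<le> 1 - r $ j / yy k l $ j" for j
  proof -
    have "1 - x $ j / (1 - (1 / 2) ^ (k j + 2)) \<le> 2 * (1 - r $ j / yy k l $ j)"
      unfolding ry using u[of j] X0[of j] by (intro one_minus_sqrt_ge) linarith+
    moreover have "(1 / 2 :: real) ^ (k j + 3) = (1 / 2) ^ (k j + 2) / 2" by (simp add: eval_nat_numeral)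
    moreover have "q \<le> T" if "1 - U \<le> 2 * T" "q = P / 2" "U \<le> 1 - P" for q T U P :: real
      using that by simp
    ultimately show ?thesis using u(2)[of j] by blast
  qed
  have gap0: "0 < 1 - r $ j / yy k l $ j" for j
    by (rule less_le_trans[OF _ gap]) simp
  have rless: "vless r (yy k l)"
    unfolding vless_def using gap0 yy_bounds(1)[of k l] by (auto simp: field_simps)
  have r0: "0 \<le> r $ j" for j using x0(1)[of j] L[of j] by (simp add: r_def)
  have rc: "r \<in> unit_cube"
    using r0 rless yy_cube[of k l] unfolding unit_cube_def vless_def by (auto intro: less_trans)
  have sq: "rmult (\<chi> j. r $ j * r $ j) (tor b) = rmult x (rmult (dr (\<lambda>j. l j + 1)) (tor b))"
  proof -
    have "r $ j * r $ j = x $ j * (1 - (1 / 2) ^ (l j + 1))" for j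
      using x0(1)[of j] L[of j] by (simp add: r_def less_imp_le)
    then show ?thesis by (simp add: rmult_def vec_eq_iff)
  qed
  have "ennreal (norm (H (rmult x (rmult (dr (\<lambda>j. l j + 1)) (tor b))))) \<le> Jm 1 (had f g b) r"
    using hadamard_le[OF f(2) g(2) H rc sep_hol_measurable[OF f(1)] sep_hol_measurable[OF g(1)], of b]
    unfolding sq Jm_def norm_had by simp
  also have "\<dots> \<le> ennpowr (ennreal (\<Prod>j\<in>UNIV. 2 / (1 - r $ j / yy k l $ j))) (1 / t - 1) * ennpowr (Jm t (had f g b) (yy k l)) (1 / t)"
    using t by (intro Jm_le_Jm sep_hol_had f g rc yy_cube rless)
  also have "\<dots> \<le> ennpowr (ennreal (16 ^ CARD('n) * dw 1 k)) (1 / t - 1) * ennpowr (Jm t (had f g b) (yy k l)) (1 / t)"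
  proof (intro mult_right_mono ennpowr_mono ennreal_leI)
    have "(\<Prod>j\<in>UNIV. 2 / (1 - r $ j / yy k l $ j)) \<le> (\<Prod>j\<in>UNIV. 16 * 2 powr (1 * real (k j)))"
    proof (intro prod_mono conjI)
      fix j
      show "0 \<le> 2 / (1 - r $ j / yy k l $ j)" using gap0[of j] by simp
      have "2 / (1 - r $ j / yy k l $ j) \<le> 2 / (1 / 2) ^ (k j + 3)"
        using gap[of j] gap0[of j] by (intro divide_left_mono mult_pos_pos) auto
      also have "\<dots> = 16 * 2 powr (1 * real (k j))"
        by (simp add: power_add powr_realpow power_divide)
      finally show "2 / (1 - r $ j / yy k l $ j) \<le> 16 * 2 powr (1 * real (k j))" .
    qed
    also have "\<dots> = 16 ^ CARD('n) * dw 1 k"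
      by (simp only: prod.distrib prod_constant dw_prod)
    finally show "(\<Prod>j\<in>UNIV. 2 / (1 - r $ j / yy k l $ j)) \<le> 16 ^ CARD('n) * dw 1 k" .
  qed (use t in \<open>auto simp: field_simps\<close>)
  finally show ?thesis by (simp add: ennpowr_ennreal)
qed

text \<open>Here \<open>g\<close> already carries the factor \<open>dcoeff m\<close>, so the
  \<open>m\<close>-th derivative of \<open>h\<close> is the Hadamard product of \<open>f\<close> and
  \<open>g\<close>. On shell \<open>k\<close> the weight integrates to \<open>2^(-m |k|)\<close> and
  the pointwise loss is \<open>2^((1/t - 1) |k|)\<close>. The power \<open>t \<le> 1\<close> moves
  inside the sum over shells, and integrating over the angle turns each mean of \<open>had\<close>
  into a product of means.\<close>

lemma Jm_product_le:
  assumes t: "0 < t" "t \<le> 1" and m: "m \<ge> 1"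
  shows "\<exists>C::real. C \<ge> 0 \<and> (\<forall>(f :: complex ^ 'n::finite \<Rightarrow> complex) a g c h l. sep_hol f \<longrightarrow> has_expansion f a \<longrightarrow> sep_hol g \<longrightarrow>
      has_expansion g (\<lambda>k. of_real (dcoeff m k) * c k) \<longrightarrow> has_expansion h (\<lambda>k. c k * a k) \<longrightarrow>
    Jm t h (dr (\<lambda>j. l j + 1)) \<le> ennreal C * Sm (\<lambda>k. ennreal (dw (- ((real m + 1 - 1 / t) * t)) k) * (Jm t f (yy k l) * Jm t g (yy k l))))"
proof -
  define e where "e = 1 / t - 1"
  have e: "e \<ge> 0" using t by (simp add: e_def)
  define K where "K = (4 powr \<bar>real m - 1\<bar>) ^ CARD('n)"
  define B where "B = real m ^ CARD('n) * ((16 ^ CARD('n)) powr e * K)"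
  have K0: "K \<ge> 0" by (simp add: K_def)
  have B0: "B \<ge> 0" using K0 by (simp add: B_def)
  have "Jm t h (dr (\<lambda>j. l j + 1)) \<le> ennreal (B powr t) * Sm (\<lambda>k. ennreal (dw (- ((real m + 1 - 1 / t) * t)) k) * (Jm t f (yy k l) * Jm t g (yy k l)))"
    if f: "sep_hol f" "has_expansion f a" and g: "sep_hol g" "has_expansion g (\<lambda>k. of_real (dcoeff m k) * c k)"
      and h: "has_expansion h (\<lambda>k. c k * a k)"
    for f a g c h and l :: "'n \<Rightarrow> nat"
  proof -
    define H where "H = trunc (\<lambda>z. \<Sum>\<^sub>\<infinity>k. of_real (dcoeff m k) * (c k * a k) * vmonom k z)"
    have "psum (\<lambda>k. of_real (dcoeff m k) * (c k * a k))"
      by (intro psum_dcoeff has_expansion_imp_psum[OF h])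
    from psum_imp_has_expansion[OF this] have H0: "has_expansion (\<lambda>z. \<Sum>\<^sub>\<infinity>k. of_real (dcoeff m k) * (c k * a k) * vmonom k z) (\<lambda>k. of_real (dcoeff m k) * (c k * a k))" .
    then have H: "has_expansion H (\<lambda>k. of_real (dcoeff m k) * (c k * a k))"
      by (simp add: has_expansion_def H_def trunc_def)
    have Hs: "sep_hol H" unfolding H_def by (intro sep_hol_trunc has_expansion_imp_hol_polydisc[OF H0])
    have H': "has_expansion H (\<lambda>k. of_real (dcoeff m k) * c k * a k)" using H by (simp add: mult.assoc)
    have [measurable]: "H \<in> borel_measurable borel" using Hs by (rule sep_hol_measurable)
    define R where "R = dr (\<lambda>j. l j + 1)"
    have pt: "ennreal (norm (h (rmult R (tor b))) powr t) \<le>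
        ennreal (B powr t) * Sm (\<lambda>k. ennreal (dw (- ((real m + 1 - 1 / t) * t)) k) * Jm t (had f g b) (yy k l))" for b
    proof -
      have z: "rmult R (tor b) \<in> polydisc" unfolding R_def by (intro rmult_tor_polydisc dr_cube)
      have [measurable]: "(\<lambda>x. rmult x (rmult R (tor b))) \<in> borel_measurable borel"
        by (rule measurable_rmult) auto
      have "ennreal (norm (h (rmult R (tor b)))) \<le> ennreal (real m ^ CARD('n)) *
          (\<integral>\<^sup>+x\<in>unit_cube. ennreal (norm (H (rmult x (rmult R (tor b)))) * cube_weight x (real m - 1)) \<partial>lborel)"
        by (rule le_integral_frac_deriv[OF h H m z]) measurable
      also have "(\<integral>\<^sup>+x\<in>unit_cube. ennreal (norm (H (rmult x (rmult R (tor b)))) * cube_weight x (real m - 1)) \<partial>lborel)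
          = Sm (\<lambda>k. \<integral>\<^sup>+x\<in>shell k. ennreal (norm (H (rmult x (rmult R (tor b)))) * cube_weight x (real m - 1)) \<partial>lborel)"
        by (rule nn_integral_cube_shells) measurable
      also have "\<dots> \<le> Sm (\<lambda>k. ennreal ((16 ^ CARD('n)) powr e * K) * (ennreal (dw (e - real m) k) * ennpowr (Jm t (had f g b) (yy k l)) (1 / t)))"
      proof (rule nn_integral_mono)
        fix k :: "'n \<Rightarrow> nat"
        let ?V = "ennreal ((16 ^ CARD('n) * dw 1 k) powr e) * ennpowr (Jm t (had f g b) (yy k l)) (1 / t)"
        have "(\<integral>\<^sup>+x\<in>shell k. ennreal (norm (H (rmult x (rmult R (tor b)))) * cube_weight x (real m - 1)) \<partial>lborel)
            \<le> (\<integral>\<^sup>+x. ?V * (ennreal (cube_weight x (real m - 1)) * indicator (shell k) x) \<partial>lborel)"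
        proof (rule nn_integral_mono)
          fix x :: "real ^ 'n"
          show "ennreal (norm (H (rmult x (rmult R (tor b)))) * cube_weight x (real m - 1)) * indicator (shell k) x
            \<le> ?V * (ennreal (cube_weight x (real m - 1)) * indicator (shell k) x)"
          proof (cases "x \<in> shell k")
            case True
            have "ennreal (norm (H (rmult x (rmult R (tor b))))) \<le> ?V"
              unfolding R_def e_def by (rule norm_product_le_shell[OF f g H' t True])
            then have "ennreal (norm (H (rmult x (rmult R (tor b))))) * ennreal (cube_weight x (real m - 1)) \<le> ?V * ennreal (cube_weight x (real m - 1))"
              by (rule mult_right_mono) simp
            then show ?thesis using True by (simp add: ennreal_mult cube_weight_nonneg)
          qed simp
        qed
        also have "\<dots> = ?V * (\<integral>\<^sup>+x\<in>shell k. ennreal (cube_weight x (real m - 1)) \<partial>lborel)"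
          by (rule nn_integral_cmult) measurable
        also have "\<dots> \<le> ?V * ennreal (K * dw (- real m) k)"
          using nn_integral_shell_weight_le[where k = k and g = "real m - 1"] by (intro mult_left_mono) (auto simp: K_def)
        also have "\<dots> = ennreal ((16 ^ CARD('n)) powr e * K) * (ennreal (dw (e - real m) k) * ennpowr (Jm t (had f g b) (yy k l)) (1 / t))"
          using dw_add[of e "- real m" k] K0
          by (simp add: powr_mult dw_powr ennreal_mult mult_ac)
        finally show "(\<integral>\<^sup>+x\<in>shell k. ennreal (norm (H (rmult x (rmult R (tor b)))) * cube_weight x (real m - 1)) \<partial>lborel)
            \<le> ennreal ((16 ^ CARD('n)) powr e * K) * (ennreal (dw (e - real m) k) * ennpowr (Jm t (had f g b) (yy k l)) (1 / t))" .
      qed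
      finally have "ennreal (norm (h (rmult R (tor b)))) \<le> ennreal (real m ^ CARD('n)) *
          (ennreal ((16 ^ CARD('n)) powr e * K) * Sm (\<lambda>k. ennreal (dw (e - real m) k) * ennpowr (Jm t (had f g b) (yy k l)) (1 / t)))"
        by (simp add: Sm_cmult mult_left_mono)
      also have "\<dots> = ennreal B * Sm (\<lambda>k. ennreal (dw (e - real m) k) * ennpowr (Jm t (had f g b) (yy k l)) (1 / t))"
        unfolding B_def using K0 by (simp add: ennreal_mult mult.assoc)
      finally have "ennpowr (ennreal (norm (h (rmult R (tor b))))) t \<le>
          ennpowr (ennreal B * Sm (\<lambda>k. ennreal (dw (e - real m) k) * ennpowr (Jm t (had f g b) (yy k l)) (1 / t))) t"
        using t by (intro ennpowr_mono) auto
      also have "\<dots> \<le> ennreal (B powr t) * Sm (\<lambda>k. ennpowr (ennreal (dw (e - real m) k) * ennpowr (Jm t (had f g b) (yy k l)) (1 / t)) t)"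
        unfolding ennpowr_mult[of "ennreal B"] ennpowr_ennreal[OF B0]
        by (intro mult_left_mono ennpowr_nn_integral_count_space_le t) auto
      also have "(\<lambda>k. ennpowr (ennreal (dw (e - real m) k) * ennpowr (Jm t (had f g b) (yy k l)) (1 / t)) t)
         = (\<lambda>k. ennreal (dw (- ((real m + 1 - 1 / t) * t)) k) * Jm t (had f g b) (yy k l))"
      proof
        fix k :: "'n \<Rightarrow> nat"
        have "(e - real m) * t = - ((real m + 1 - 1 / t) * t)" by (simp add: e_def algebra_simps)
        then show "ennpowr (ennreal (dw (e - real m) k) * ennpowr (Jm t (had f g b) (yy k l)) (1 / t)) t
            = ennreal (dw (- ((real m + 1 - 1 / t) * t)) k) * Jm t (had f g b) (yy k l)"
          using t by (simp add: ennpowr_mult ennpowr_ennpowr ennpowr_ennreal dw_powr)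
      qed
      finally show ?thesis by (simp add: ennpowr_ennreal)
    qed
    have "Jm t h R \<le> (\<integral>\<^sup>+b. ennreal (B powr t) * Sm (\<lambda>k. ennreal (dw (- ((real m + 1 - 1 / t) * t)) k) * Jm t (had f g b) (yy k l)) \<partial>TM)"
      unfolding Jm_def[of t h] by (intro nn_integral_mono pt)
    also have "\<dots> = (\<integral>\<^sup>+b. Sm (\<lambda>k. ennreal (B powr t) * (ennreal (dw (- ((real m + 1 - 1 / t) * t)) k) * Jm t (had f g b) (yy k l))) \<partial>TM)"
      by (simp only: Sm_cmult)
    also have "\<dots> = Sm (\<lambda>k. \<integral>\<^sup>+b. ennreal (B powr t) * (ennreal (dw (- ((real m + 1 - 1 / t) * t)) k) * Jm t (had f g b) (yy k l)) \<partial>TM)"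
      by (rule Sm_integral) (intro borel_measurable_times_ennreal borel_measurable_const nn_integral_Jm_had(1)[OF f(1) g(1)])
    also have "\<dots> = Sm (\<lambda>k. ennreal (B powr t) * (ennreal (dw (- ((real m + 1 - 1 / t) * t)) k) * (Jm t f (yy k l) * Jm t g (yy k l))))"
    proof (rule nn_integral_cong)
      fix k :: "'n \<Rightarrow> nat"
      note [measurable] = nn_integral_Jm_had(1)[OF f(1) g(1), of t "yy k l"]
      show "(\<integral>\<^sup>+b. ennreal (B powr t) * (ennreal (dw (- ((real m + 1 - 1 / t) * t)) k) * Jm t (had f g b) (yy k l)) \<partial>TM)
          = ennreal (B powr t) * (ennreal (dw (- ((real m + 1 - 1 / t) * t)) k) * (Jm t f (yy k l) * Jm t g (yy k l)))"
        by (subst nn_integral_cmult, measurable, subst nn_integral_cmult, measurable) (simp only: nn_integral_Jm_had(2)[OF f(1) g(1)])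
    qed
    finally show ?thesis by (simp only: Sm_cmult R_def)
  qed
  then show ?thesis by (intro exI[of _ "B powr t"]) simp
qed

section \<open>Mixed norms in terms of integral means\<close>

lemma sets_cube [measurable]: "(unit_cube :: (real ^ 'n::finite) set) \<in> sets borel"
  using sets_unit_cube by simp

lemma measurable_Jm [measurable]:
  fixes f :: "complex ^ 'n::finite \<Rightarrow> complex"
  assumes [measurable]: "f \<in> borel_measurable borel"
  shows "Jm p f \<in> borel_measurable borel"
proof -
  interpret T: sigma_finite_measure "TM :: ('n \<Rightarrow> real) measure" by (rule sigma_finite_TM)
  show ?thesis unfolding Jm_def[abs_def] by measurable
qed

text \<open>\<open>An\<close> and \<open>Fn\<close> are the two norm functionals rewritten with
  \<open>TM\<close> and \<open>Jm\<close>; for holomorphic \<open>f\<close> their values at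
  \<open>trunc f\<close> are the original ones.\<close>

definition An :: "real \<Rightarrow> real \<Rightarrow> real \<Rightarrow> (complex ^ 'n::finite \<Rightarrow> complex) \<Rightarrow> ennreal" where
  "An p q \<alpha> f = (\<integral>\<^sup>+R\<in>unit_cube. (ennpowr (Jm p f R) (q / p) * ennreal (cube_weight R (\<alpha> * q - 1))) \<partial>lborel)"

definition Fn :: "real \<Rightarrow> real \<Rightarrow> real \<Rightarrow> (complex ^ 'n::finite \<Rightarrow> complex) \<Rightarrow> ennreal" where
  "Fn p q \<alpha> f = (\<integral>\<^sup>+a. ennpowr (\<integral>\<^sup>+R\<in>unit_cube. ennreal (norm (f (rmult R (tor a))) powr q * cube_weight R (\<alpha> * q - 1)) \<partial>lborel) (p / q) \<partial>TM)"

lemma space_torus_measure: "space torus_measure = torus"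
  by (simp add: torus_measure_def space_restrict_space)

lemma rmult_torus_polydisc: "r \<in> unit_cube \<Longrightarrow> \<xi> \<in> torus \<Longrightarrow> rmult r \<xi> \<in> polydisc"
  by (auto simp: polydisc_def rmult_def torus_def norm_mult unit_cube_def)

lemma int_mean_eq:
  fixes f :: "complex ^ 'n::finite \<Rightarrow> complex"
  assumes f: "f \<in> hol_polydisc" and r: "r \<in> unit_cube"
  shows "int_mean p f r = ennpowr (Jm p (trunc f) r) (1 / p)"
proof -
  have [measurable]: "trunc f \<in> borel_measurable borel" using sep_hol_trunc[OF f] by (rule sep_hol_measurable)
  have "(\<integral>\<^sup>+\<xi>. ennreal (norm (f (rmult r \<xi>)) powr p) \<partial>torus_measure) = (\<integral>\<^sup>+\<xi>. ennreal (norm (trunc f (rmult r \<xi>)) powr p) \<partial>torus_measure)"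
    by (intro nn_integral_cong) (simp add: space_torus_measure trunc_def rmult_torus_polydisc[OF r])
  also have "\<dots> = Jm p (trunc f) r"
    unfolding Jm_def by (rule nn_integral_torus[where \<phi> = "\<lambda>\<xi>. ennreal (norm (trunc f (rmult r \<xi>)) powr p)"]) measurable
  finally show ?thesis by (simp add: int_mean_def)
qed

lemma A_norm_pow_eq:
  assumes f: "f \<in> hol_polydisc"
  shows "A_norm_pow p q \<alpha> f = An p q \<alpha> (trunc f)"
  unfolding A_norm_pow_def An_def
  by (intro nn_integral_cong) (auto simp: indicator_def int_mean_eq[OF f] ennpowr_ennpowr)

lemma F_norm_pow_eq:
  fixes f :: "complex ^ 'n::finite \<Rightarrow> complex"
  assumes f: "f \<in> hol_polydisc"
  shows "F_norm_pow p q \<alpha> f = Fn p q \<alpha> (trunc f)"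
proof -
  have [measurable]: "trunc f \<in> borel_measurable borel" using sep_hol_trunc[OF f] by (rule sep_hol_measurable)
  interpret L: sigma_finite_measure "lborel :: (real ^ 'n) measure" ..
  have "F_norm_pow p q \<alpha> f = (\<integral>\<^sup>+\<xi>. ennpowr
        (\<integral>\<^sup>+R\<in>unit_cube. ennreal (norm (trunc f (rmult R \<xi>)) powr q * cube_weight R (\<alpha> * q - 1)) \<partial>lborel)
        (p / q) \<partial>torus_measure)"
    unfolding F_norm_pow_def
  proof (intro nn_integral_cong)
    fix \<xi> :: "complex ^ 'n" assume "\<xi> \<in> space torus_measure"
    then have \<xi>: "\<xi> \<in> torus" by (simp add: space_torus_measure)
    have "(\<integral>\<^sup>+R\<in>unit_cube. ennreal (norm (f (rmult R \<xi>)) powr q * cube_weight R (\<alpha> * q - 1)) \<partial>lborel)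
      = (\<integral>\<^sup>+R\<in>unit_cube. ennreal (norm (trunc f (rmult R \<xi>)) powr q * cube_weight R (\<alpha> * q - 1)) \<partial>lborel)"
      by (intro nn_integral_cong) (auto simp: indicator_def trunc_def rmult_torus_polydisc[OF _ \<xi>])
    then show "ennpowr (\<integral>\<^sup>+R\<in>unit_cube. ennreal (norm (f (rmult R \<xi>)) powr q * cube_weight R (\<alpha> * q - 1)) \<partial>lborel) (p / q)
      = ennpowr (\<integral>\<^sup>+R\<in>unit_cube. ennreal (norm (trunc f (rmult R \<xi>)) powr q * cube_weight R (\<alpha> * q - 1)) \<partial>lborel) (p / q)"
      by simp
  qed
  also have "\<dots> = Fn p q \<alpha> (trunc f)"
    unfolding Fn_def
    by (rule nn_integral_torus[where \<phi> = "\<lambda>\<xi>. ennpowr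
        (\<integral>\<^sup>+R\<in>unit_cube. ennreal (norm (trunc f (rmult R \<xi>)) powr q * cube_weight R (\<alpha> * q - 1)) \<partial>lborel)
        (p / q)"]) measurable
  finally show ?thesis .
qed

lemma sigma_finite_cube: "sigma_finite_measure (density lborel (indicator unit_cube :: real ^ 'n::finite \<Rightarrow> ennreal))"
proof -
  have "finite_measure (density lborel (indicator unit_cube :: real ^ 'n \<Rightarrow> ennreal))"
    by (rule finite_measureI) (simp add: emeasure_density emeasure_unit_cube)
  then interpret finite_measure "density lborel (indicator unit_cube :: real ^ 'n \<Rightarrow> ennreal)" .
  show ?thesis by standard
qed

lemma nn_integral_density_cube:
  fixes \<phi> :: "real ^ 'n::finite \<Rightarrow> ennreal"
  assumes [measurable]: "\<phi> \<in> borel_measurable borel"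
  shows "(\<integral>\<^sup>+x. \<phi> x \<partial>density lborel (indicator unit_cube)) = (\<integral>\<^sup>+x\<in>unit_cube. \<phi> x \<partial>lborel)"
  by (subst nn_integral_density) (auto simp: mult.commute)

text \<open>Minkowski with exponent \<open>t / s \<ge> 1\<close>: the cube, of measure 1, is the
  inner space and the torus the outer one. In \<open>An_le_minkowski\<close> the two change places,
  and so does the order of the exponents.\<close>

lemma Fn_le_minkowski:
  fixes h :: "complex ^ 'n::finite \<Rightarrow> complex"
  assumes [measurable]: "h \<in> borel_measurable borel" and s: "0 < s" "s \<le> t"
  shows "Fn t s \<beta> h \<le> ennpowr (An t s \<beta> h) (t / s)"
proof -
  let ?U = "density lborel (indicator unit_cube) :: (real ^ 'n) measure"
  interpret U: sigma_finite_measure ?U by (rule sigma_finite_cube)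
  interpret T: sigma_finite_measure "TM :: ('n \<Rightarrow> real) measure" by (rule sigma_finite_TM)
  define F where "F = (\<lambda>R a. ennreal (norm (h (rmult R (tor a))) powr s * cube_weight R (\<beta> * s - 1)))"
  have F [measurable]: "(\<lambda>(R, a). F R a) \<in> borel_measurable (borel \<Otimes>\<^sub>M TM)" unfolding F_def by measurable
  have F1 [measurable]: "(\<lambda>R. F R a) \<in> borel_measurable borel" for a unfolding F_def by measurable
  have F2 [measurable]: "(\<lambda>a. F R a) \<in> borel_measurable TM" for R unfolding F_def by measurable
  have "(\<lambda>(R, a). F R a) \<in> borel_measurable (?U \<Otimes>\<^sub>M TM)"
    using F by (simp add: measurable_cong_sets[OF sets_pair_measure_cong[of ?U borel TM TM] refl])
  then have "(\<integral>\<^sup>+a. ennpowr (\<integral>\<^sup>+R. F R a \<partial>?U) (t / s) \<partial>TM)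
      \<le> ennpowr (\<integral>\<^sup>+R. ennpowr (\<integral>\<^sup>+a. ennpowr (F R a) (t / s) \<partial>TM) (1 / (t / s)) \<partial>?U) (t / s)"
    using s by (intro minkowski_integral sigma_finite_cube sigma_finite_TM)
      (simp_all add: emeasure_density emeasure_unit_cube)
  also have "(\<integral>\<^sup>+R. ennpowr (\<integral>\<^sup>+a. ennpowr (F R a) (t / s) \<partial>TM) (1 / (t / s)) \<partial>?U) = An t s \<beta> h"
  proof -
    have "(\<integral>\<^sup>+a. ennpowr (F R a) (t / s) \<partial>TM) = ennreal (cube_weight R (\<beta> * s - 1) powr (t / s)) * Jm t h R" for R
    proof -
      have "ennpowr (F R a) (t / s) = ennreal (cube_weight R (\<beta> * s - 1) powr (t / s)) * ennreal (norm (h (rmult R (tor a))) powr t)" for a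
        unfolding F_def using s
        by (simp add: ennpowr_ennreal cube_weight_nonneg powr_mult powr_powr ennreal_mult[symmetric] mult.commute)
      then show ?thesis unfolding Jm_def by (simp only:) (rule nn_integral_cmult, measurable)
    qed
    then have "ennpowr (\<integral>\<^sup>+a. ennpowr (F R a) (t / s) \<partial>TM) (1 / (t / s)) = ennpowr (Jm t h R) (s / t) * ennreal (cube_weight R (\<beta> * s - 1))" for R
      using s by (simp add: ennpowr_mult ennpowr_ennreal powr_powr cube_weight_nonneg mult.commute)
    then show ?thesis unfolding An_def by (simp only:) (rule nn_integral_density_cube, measurable)
  qed
  also have "(\<lambda>a. \<integral>\<^sup>+R. F R a \<partial>?U) = (\<lambda>a. \<integral>\<^sup>+R\<in>unit_cube. F R a \<partial>lborel)"
    by (intro ext nn_integral_density_cube F1)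
  finally show ?thesis by (simp add: Fn_def F_def)
qed

lemma An_le_minkowski:
  fixes f :: "complex ^ 'n::finite \<Rightarrow> complex"
  assumes [measurable]: "f \<in> borel_measurable borel" and p: "0 < p" "p \<le> q"
  shows "An p q \<alpha> f \<le> ennpowr (Fn p q \<alpha> f) (q / p)"
proof -
  let ?U = "density lborel (indicator unit_cube) :: (real ^ 'n) measure"
  interpret U: sigma_finite_measure ?U by (rule sigma_finite_cube)
  interpret T: sigma_finite_measure "TM :: ('n \<Rightarrow> real) measure" by (rule sigma_finite_TM)
  define F where "F = (\<lambda>a R. ennreal (norm (f (rmult R (tor a))) powr p * cube_weight R (\<alpha> * q - 1) powr (p / q)))"
  have [measurable]: "(\<lambda>(a, R). rmult R (tor a)) \<in> borel_measurable (TM \<Otimes>\<^sub>M borel)" by measurable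
  have F [measurable]: "(\<lambda>(a, R). F a R) \<in> borel_measurable (TM \<Otimes>\<^sub>M borel)" unfolding F_def by measurable
  have F1 [measurable]: "(\<lambda>R. F a R) \<in> borel_measurable borel" for a unfolding F_def by measurable
  have F2 [measurable]: "(\<lambda>a. F a R) \<in> borel_measurable TM" for R unfolding F_def by measurable
  have "(\<lambda>(a, R). F a R) \<in> borel_measurable (TM \<Otimes>\<^sub>M ?U)"
    using F by (simp add: measurable_cong_sets[OF sets_pair_measure_cong[of TM TM ?U borel] refl])
  then have "(\<integral>\<^sup>+R. ennpowr (\<integral>\<^sup>+a. F a R \<partial>TM) (q / p) \<partial>?U)
      \<le> ennpowr (\<integral>\<^sup>+a. ennpowr (\<integral>\<^sup>+R. ennpowr (F a R) (q / p) \<partial>?U) (1 / (q / p)) \<partial>TM) (q / p)"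
    using p by (intro minkowski_integral sigma_finite_cube sigma_finite_TM) (simp_all add: emeasure_TM_space)
  also have "(\<integral>\<^sup>+a. ennpowr (\<integral>\<^sup>+R. ennpowr (F a R) (q / p) \<partial>?U) (1 / (q / p)) \<partial>TM) = Fn p q \<alpha> f"
  proof -
    have "ennpowr (F a R) (q / p) = ennreal (norm (f (rmult R (tor a))) powr q * cube_weight R (\<alpha> * q - 1))" for a R
      unfolding F_def using p by (simp add: ennpowr_ennreal cube_weight_nonneg powr_mult powr_powr)
    moreover have "(\<integral>\<^sup>+R. ennpowr (F a R) (q / p) \<partial>?U) = (\<integral>\<^sup>+R\<in>unit_cube. ennpowr (F a R) (q / p) \<partial>lborel)" for a
      by (rule nn_integral_density_cube) measurable
    ultimately show ?thesis unfolding Fn_def by simp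
  qed
  also have "(\<integral>\<^sup>+R. ennpowr (\<integral>\<^sup>+a. F a R \<partial>TM) (q / p) \<partial>?U) = An p q \<alpha> f"
  proof -
    have "(\<integral>\<^sup>+a. F a R \<partial>TM) = Jm p f R * ennreal (cube_weight R (\<alpha> * q - 1) powr (p / q))" for R
    proof -
      have "F a R = ennreal (norm (f (rmult R (tor a))) powr p) * ennreal (cube_weight R (\<alpha> * q - 1) powr (p / q))" for a
        unfolding F_def by (simp add: ennreal_mult)
      then show ?thesis unfolding Jm_def by (simp only:) (rule nn_integral_multc, measurable)
    qed
    then have "ennpowr (\<integral>\<^sup>+a. F a R \<partial>TM) (q / p) = ennpowr (Jm p f R) (q / p) * ennreal (cube_weight R (\<alpha> * q - 1))" for R
      using p by (simp add: ennpowr_mult ennpowr_ennreal powr_powr cube_weight_nonneg)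
    then show ?thesis unfolding An_def by (simp only:) (rule nn_integral_density_cube, measurable)
  qed
  finally show ?thesis .
qed

section \<open>Sufficiency\<close>

lemma vless_dr: "(\<And>j. k j < l j) \<Longrightarrow> vless (dr k) (dr l)"
  unfolding vless_def by (auto intro!: power_strict_decreasing)

lemma shell_subset_cube: "x \<in> shell k \<Longrightarrow> x \<in> unit_cube"
  using shell_subset by blast

text \<open>The mean at \<open>dr (i + 5)\<close> lies below all means on the shell
  \<open>i + 6\<close>, over which it is averaged. The offset 5 is fixed by later needs: the product
  radii lie below \<open>dr (min + 4)\<close> by \<open>yy_vless\<close>, and
  \<open>dyadic_embedding\<close> gives up one further index.\<close>

lemma An_imp_dyadic:
  fixes f :: "complex ^ 'n::finite \<Rightarrow> complex"
  assumes f: "sep_hol f" and p: "0 < p" "0 < q" and fin: "An p q \<alpha> f < top"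
  shows "Sm (\<lambda>i. ennpowr (Jm p f (dr (\<lambda>j. i j + 5))) (q / p) * ennreal (dw (- (\<alpha> * q)) i)) < top"
proof -
  have [measurable]: "f \<in> borel_measurable borel" using f by (rule sep_hol_measurable)
  let ?w = "\<lambda>R. ennreal (cube_weight R (\<alpha> * q - 1))"
  define K where "K = ennreal (2 powr (\<alpha> * q * real 6 * CARD('n))) * ennreal ((2 * 4 powr \<bar>\<alpha> * q - 1\<bar>) ^ CARD('n))"
  have "ennpowr (Jm p f (dr (\<lambda>j. i j + 5))) (q / p) * ennreal (dw (- (\<alpha> * q)) i) \<le>
      K * (\<integral>\<^sup>+R\<in>shell (\<lambda>j. i j + 6). (ennpowr (Jm p f R) (q / p) * ?w R) \<partial>lborel)" for i :: "'n \<Rightarrow> nat"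
  proof -
    have "dw (- (\<alpha> * q)) i = 2 powr (\<alpha> * q * real 6 * CARD('n)) * dw (- (\<alpha> * q - 1 + 1)) (\<lambda>j. i j + 6)"
      unfolding dw_shift by (simp add: powr_add[symmetric] mult.assoc[symmetric])
    then have "ennpowr (Jm p f (dr (\<lambda>j. i j + 5))) (q / p) * ennreal (dw (- (\<alpha> * q)) i)
       = ennreal (2 powr (\<alpha> * q * real 6 * CARD('n))) * (ennpowr (Jm p f (dr (\<lambda>j. i j + 5))) (q / p) * ennreal (dw (- (\<alpha> * q - 1 + 1)) (\<lambda>j. i j + 6)))"
      by (simp add: ennreal_mult mult_ac)
    also have "\<dots> \<le> ennreal (2 powr (\<alpha> * q * real 6 * CARD('n))) * (ennpowr (Jm p f (dr (\<lambda>j. i j + 5))) (q / p) *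
        (ennreal ((2 * 4 powr \<bar>\<alpha> * q - 1\<bar>) ^ CARD('n)) * (\<integral>\<^sup>+R\<in>shell (\<lambda>j. i j + 6). ?w R \<partial>lborel)))"
      by (intro mult_left_mono nn_integral_shell_weight_ge) auto
    also have "\<dots> = K * (ennpowr (Jm p f (dr (\<lambda>j. i j + 5))) (q / p) * (\<integral>\<^sup>+R\<in>shell (\<lambda>j. i j + 6). ?w R \<partial>lborel))"
      by (simp only: K_def mult_ac)
    also have "ennpowr (Jm p f (dr (\<lambda>j. i j + 5))) (q / p) * (\<integral>\<^sup>+R\<in>shell (\<lambda>j. i j + 6). ?w R \<partial>lborel)
       = (\<integral>\<^sup>+R. ennpowr (Jm p f (dr (\<lambda>j. i j + 5))) (q / p) * (?w R * indicator (shell (\<lambda>j. i j + 6)) R) \<partial>lborel)"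
      by (rule nn_integral_cmult[symmetric]) measurable
    also have "\<dots> \<le> (\<integral>\<^sup>+R\<in>shell (\<lambda>j. i j + 6). (ennpowr (Jm p f R) (q / p) * ?w R) \<partial>lborel)"
    proof (rule nn_integral_mono)
      fix R :: "real ^ 'n"
      show "ennpowr (Jm p f (dr (\<lambda>j. i j + 5))) (q / p) * (?w R * indicator (shell (\<lambda>j. i j + 6)) R)
        \<le> (ennpowr (Jm p f R) (q / p) * ?w R) * indicator (shell (\<lambda>j. i j + 6)) R"
      proof (cases "R \<in> shell (\<lambda>j. i j + 6)")
        case True
        have "vless (dr (\<lambda>j. i j + 5)) R"
          unfolding vless_def
        proof
          fix j
          have "(1 / 2 :: real) ^ (i j + 6) < (1 / 2) ^ (i j + 5)" by (rule power_strict_decreasing) auto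
          moreover have "1 - (1 / 2) ^ (i j + 6) \<le> R $ j" using True by (auto simp: shell_def cbx_def)
          ultimately show "dr (\<lambda>j. i j + 5) $ j < R $ j" unfolding dr_nth by linarith
        qed
        then have "Jm p f (dr (\<lambda>j. i j + 5)) \<le> Jm p f R"
          by (intro Jm_mono f p dr_cube shell_subset_cube[OF True])
        then show ?thesis using True p by (auto intro!: mult_right_mono ennpowr_mono)
      qed simp
    qed
    finally show ?thesis by (simp add: mult_left_mono)
  qed
  then have "Sm (\<lambda>i. ennpowr (Jm p f (dr (\<lambda>j. i j + 5))) (q / p) * ennreal (dw (- (\<alpha> * q)) i))
    \<le> Sm (\<lambda>i. K * (\<integral>\<^sup>+R\<in>shell (\<lambda>j. i j + 6). (ennpowr (Jm p f R) (q / p) * ?w R) \<partial>lborel))"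
    by (intro nn_integral_mono)
  also have "\<dots> = K * Sm (\<lambda>i :: 'n \<Rightarrow> nat. \<integral>\<^sup>+R\<in>shell (\<lambda>j. i j + 6). (ennpowr (Jm p f R) (q / p) * ?w R) \<partial>lborel)"
    by (rule Sm_cmult)
  also have "\<dots> \<le> K * Sm (\<lambda>i :: 'n \<Rightarrow> nat. \<integral>\<^sup>+R\<in>shell i. (ennpowr (Jm p f R) (q / p) * ?w R) \<partial>lborel)"
    by (intro mult_left_mono Sm_inj[where e = "\<lambda>i j. i j + 6" and \<phi> = "\<lambda>i. \<integral>\<^sup>+R\<in>shell i. (ennpowr (Jm p f R) (q / p) * ?w R) \<partial>lborel"])
       (auto simp: inj_def fun_eq_iff)
  also have "\<dots> = K * An p q \<alpha> f"
    unfolding An_def by (subst nn_integral_cube_shells) auto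
  also have "\<dots> < top" using fin by (auto simp: K_def ennreal_mult_less_top)
  finally show ?thesis .
qed

text \<open>In effect \<open>F^{p,q}\<close> embeds in \<open>A^{p,p}\<close> for
  \<open>q \<le> p\<close>: each mean is bounded by its Whitney box, and since
  \<open>p / q \<ge> 1\<close> the powers of the box integrals add up to at most the power of the
  whole radial integral. The exponent \<open>p / p\<close> is kept to fit
  \<open>dyadic_embedding\<close>.\<close>

lemma Fn_imp_dyadic:
  fixes f :: "complex ^ 'n::finite \<Rightarrow> complex"
  assumes f: "sep_hol f" and p: "0 < q" "q \<le> p" and fin: "Fn p q \<alpha> f < top"
  shows "Sm (\<lambda>i. ennpowr (Jm p f (dr (\<lambda>j. i j + 5))) (p / p) * ennreal (dw (- (\<alpha> * p)) i)) < top"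
proof -
  have [measurable]: "f \<in> borel_measurable borel" using f by (rule sep_hol_measurable)
  interpret L: sigma_finite_measure "lborel :: (real ^ 'n) measure" ..
  define a where "a = p / q"
  have a: "a \<ge> 1" "a * q = p" using p by (auto simp: a_def)
  obtain C :: real where C: "C \<ge> 0" "\<And>f :: complex ^ 'n \<Rightarrow> complex. \<And>r. r \<in> unit_cube \<Longrightarrow> sep_hol f \<Longrightarrow>
    ennreal (cube_weight r (a * q * \<alpha>)) * Jm (a * q) f r \<le>
    ennreal C * (\<integral>\<^sup>+b. ennpowr (\<integral>\<^sup>+x\<in>wbox r. ennreal (norm (f (rmult x (tor b))) powr q * cube_weight x (\<alpha> * q - 1)) \<partial>lborel) a \<partial>TM)"
    using Jm_le_wbox_weight[OF p(1) a(1), of \<alpha>] by blast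
  define V where "V = (\<lambda>k b. \<integral>\<^sup>+x\<in>shell k. ennreal (norm (f (rmult x (tor b))) powr q * cube_weight x (\<alpha> * q - 1)) \<partial>lborel)"
  have Vm [measurable]: "V k \<in> borel_measurable TM" for k unfolding V_def by measurable
  define K where "K = ennreal (2 powr (\<alpha> * p * real 5 * CARD('n))) * ennreal C"
  have "ennpowr (Jm p f (dr (\<lambda>j. i j + 5))) (p / p) * ennreal (dw (- (\<alpha> * p)) i) \<le> K * (\<integral>\<^sup>+b. ennpowr (V (\<lambda>j. i j + 6) b) a \<partial>TM)" for i :: "'n \<Rightarrow> nat"
  proof -
    have w: "wbox (dr (\<lambda>j. i j + 5)) = shell (\<lambda>j. i j + 6)"
    proof -
      have "(\<lambda>j. i j + 5 + 1) = (\<lambda>j. i j + 6)" by auto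
      then show ?thesis using wbox_dr[of "\<lambda>j. i j + 5"] by (simp only:)
    qed
    have "dw (- (\<alpha> * p)) i = 2 powr (\<alpha> * p * real 5 * CARD('n)) * dw (- (\<alpha> * p)) (\<lambda>j. i j + 5)"
      unfolding dw_shift by (simp add: powr_add[symmetric] mult.assoc[symmetric])
    also have "dw (- (\<alpha> * p)) (\<lambda>j. i j + 5) = cube_weight (dr (\<lambda>j. i j + 5)) (a * q * \<alpha>)"
      by (simp add: cube_weight_dr a mult.commute)
    finally have "ennpowr (Jm p f (dr (\<lambda>j. i j + 5))) (p / p) * ennreal (dw (- (\<alpha> * p)) i)
      = ennreal (2 powr (\<alpha> * p * real 5 * CARD('n))) * (ennreal (cube_weight (dr (\<lambda>j. i j + 5)) (a * q * \<alpha>)) * Jm (a * q) f (dr (\<lambda>j. i j + 5)))"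
      using p by (simp add: a ennreal_mult cube_weight_nonneg mult_ac)
    also have "\<dots> \<le> ennreal (2 powr (\<alpha> * p * real 5 * CARD('n))) * (ennreal C * (\<integral>\<^sup>+b. ennpowr (V (\<lambda>j. i j + 6) b) a \<partial>TM))"
      using C(2)[OF dr_cube f, of "\<lambda>j. i j + 5"] unfolding w V_def by (intro mult_left_mono) auto
    finally show ?thesis by (simp only: K_def mult.assoc)
  qed
  then have "Sm (\<lambda>i. ennpowr (Jm p f (dr (\<lambda>j. i j + 5))) (p / p) * ennreal (dw (- (\<alpha> * p)) i))
     \<le> Sm (\<lambda>i. K * (\<integral>\<^sup>+b. ennpowr (V (\<lambda>j. i j + 6) b) a \<partial>TM))"
    by (intro nn_integral_mono)
  also have "\<dots> = K * Sm (\<lambda>i :: 'n \<Rightarrow> nat. \<integral>\<^sup>+b. ennpowr (V (\<lambda>j. i j + 6) b) a \<partial>TM)"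
    by (rule Sm_cmult)
  also have "\<dots> \<le> K * Sm (\<lambda>i. \<integral>\<^sup>+b. ennpowr (V i b) a \<partial>TM)"
    by (intro mult_left_mono Sm_inj[where e = "\<lambda>i j. i j + 6" and \<phi> = "\<lambda>i. \<integral>\<^sup>+b. ennpowr (V i b) a \<partial>TM"])
       (auto simp: inj_def fun_eq_iff)
  also have "Sm (\<lambda>i. \<integral>\<^sup>+b. ennpowr (V i b) a \<partial>TM) = (\<integral>\<^sup>+b. Sm (\<lambda>i. ennpowr (V i b) a) \<partial>TM)"
    by (rule Sm_integral[symmetric]) measurable
  also have "\<dots> \<le> (\<integral>\<^sup>+b. ennpowr (Sm (\<lambda>i. V i b)) a \<partial>TM)"
    by (intro nn_integral_mono nn_integral_ennpowr_sum_le a)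
  also have "(\<lambda>b. Sm (\<lambda>i. V i b)) = (\<lambda>b. \<integral>\<^sup>+x\<in>unit_cube. ennreal (norm (f (rmult x (tor b))) powr q * cube_weight x (\<alpha> * q - 1)) \<partial>lborel)"
    unfolding V_def by (intro ext nn_integral_cube_shells[symmetric]) measurable
  also have "(\<integral>\<^sup>+b. ennpowr (\<integral>\<^sup>+x\<in>unit_cube. ennreal (norm (f (rmult x (tor b))) powr q * cube_weight x (\<alpha> * q - 1)) \<partial>lborel) a \<partial>TM) = Fn p q \<alpha> f"
    by (simp add: Fn_def a_def)
  finally have "Sm (\<lambda>i. ennpowr (Jm p f (dr (\<lambda>j. i j + 5))) (p / p) * ennreal (dw (- (\<alpha> * p)) i)) \<le> K * Fn p q \<alpha> f"
    by (simp add: mult_left_mono)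
  also have "\<dots> < top" using fin by (auto simp: K_def ennreal_mult_less_top)
  finally show ?thesis .
qed

text \<open>Two exponents are raised: the order from \<open>p\<close> to \<open>t\<close>, by moving
  in from \<open>dr (i + 5)\<close> to \<open>dr (i + 4)\<close>, and the summation exponent from
  \<open>q\<close> to \<open>s\<close>, since \<open>s / q \<ge> 1\<close>. The loss
  \<open>2^(|i| (t/p - 1))\<close> of the first, raised to \<open>s / t\<close>, is the shift
  \<open>1/p - 1/t\<close> of the weight.\<close>

lemma dyadic_embedding:
  fixes f :: "complex ^ 'n::finite \<Rightarrow> complex"
  assumes f: "sep_hol f" and p: "0 < p" "p \<le> t" and q: "0 < q" "q \<le> s"
    and fin: "Sm (\<lambda>i. ennpowr (Jm p f (dr (\<lambda>j. i j + 5))) (q / p) * ennreal (dw (- (\<alpha> * q)) i)) < top"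
  shows "Sm (\<lambda>i. ennpowr (Jm t f (dr (\<lambda>j. i j + 4))) (s / t) * ennreal (dw (- ((\<alpha> + 1 / p - 1 / t) * s)) i)) < top"
proof -
  define e where "e = (1 / p - 1 / t) * s"
  have t: "t > 0" "s > 0" using p q by auto
  define K where "K = ennreal ((64 ^ CARD('n)) powr e)"
  have "ennpowr (Jm t f (dr (\<lambda>j. i j + 4))) (s / t) * ennreal (dw (- ((\<alpha> + 1 / p - 1 / t) * s)) i)
     \<le> K * ennpowr (ennpowr (Jm p f (dr (\<lambda>j. i j + 5))) (q / p) * ennreal (dw (- (\<alpha> * q)) i)) (s / q)" for i
  proof -
    have ls: "vless (dr (\<lambda>j. i j + 4)) (dr (\<lambda>j. i j + 5))" by (rule vless_dr) simp
    let ?D = "\<Prod>j\<in>UNIV. 2 / (1 - dr (\<lambda>j. i j + 4) $ j / dr (\<lambda>j. i j + 5) $ j)"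
    have D: "?D \<le> 64 ^ CARD('n) * dw 1 i"
    proof -
      have "?D \<le> (\<Prod>j\<in>(UNIV :: 'n set). 64 * 2 powr (1 * real (i j)))"
      proof (intro prod_mono conjI)
        fix j
        \<comment> \<open>The radii are \<open>1 - 2 h\<close> and \<open>1 - h\<close>, whose
          quotient has gap at least \<open>h\<close>; \<open>2 / h\<close> is
          \<open>64 * 2^i\<close>.\<close>
        define h where "h = (1 / 2 :: real) ^ (i j + 5)"
        have h: "0 < h" "h \<le> 1 / 2"
          using power_decreasing[of 1 "i j + 5" "1 / 2 :: real"] by (auto simp: h_def)
        have X: "dr (\<lambda>j. i j + 4) $ j = 1 - 2 * h" "dr (\<lambda>j. i j + 5) $ j = 1 - h"
          by (auto simp: h_def eval_nat_numeral)
        have g: "h \<le> 1 - (1 - 2 * h) / (1 - h)" using h by (simp add: field_simps)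
        then show "0 \<le> 2 / (1 - dr (\<lambda>j. i j + 4) $ j / dr (\<lambda>j. i j + 5) $ j)" unfolding X using h by simp
        have "2 / (1 - (1 - 2 * h) / (1 - h)) \<le> 2 / h"
          using g h by (intro divide_left_mono mult_pos_pos) auto
        also have "\<dots> = 64 * 2 powr (1 * real (i j))"
          by (simp add: h_def power_add powr_realpow power_one_over field_simps)
        finally show "2 / (1 - dr (\<lambda>j. i j + 4) $ j / dr (\<lambda>j. i j + 5) $ j) \<le> 64 * 2 powr (1 * real (i j))" unfolding X .
      qed
      also have "\<dots> = 64 ^ CARD('n) * dw 1 i" by (simp only: prod.distrib prod_constant dw_prod)
      finally show ?thesis .
    qed
    have "Jm t f (dr (\<lambda>j. i j + 4)) \<le> ennpowr (ennreal ?D) (t / p - 1) * ennpowr (Jm p f (dr (\<lambda>j. i j + 5))) (t / p)"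
      by (intro Jm_le_Jm f p dr_cube ls)
    also have "\<dots> \<le> ennpowr (ennreal (64 ^ CARD('n) * dw 1 i)) (t / p - 1) * ennpowr (Jm p f (dr (\<lambda>j. i j + 5))) (t / p)"
      using p by (intro mult_right_mono ennpowr_mono ennreal_leI D) auto
    finally have "ennpowr (Jm t f (dr (\<lambda>j. i j + 4))) (s / t) \<le> ennpowr (ennpowr (ennreal (64 ^ CARD('n) * dw 1 i)) (t / p - 1) * ennpowr (Jm p f (dr (\<lambda>j. i j + 5))) (t / p)) (s / t)"
      using t by (intro ennpowr_mono) auto
    also have "\<dots> = K * ennreal (dw e i) * ennpowr (Jm p f (dr (\<lambda>j. i j + 5))) (s / p)"
    proof -
      have "(t / p - 1) * (s / t) = e" "t / p * (s / t) = s / p" using t p by (auto simp: e_def field_simps)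
      moreover have "ennpowr (ennreal (64 ^ CARD('n) * dw 1 i)) e = K * ennreal (dw e i)"
        by (subst ennpowr_ennreal) (simp_all add: K_def powr_mult dw_powr ennreal_mult)
      ultimately show ?thesis by (simp only: ennpowr_mult[of "ennpowr _ _"] ennpowr_ennpowr)
    qed
    finally have "ennpowr (Jm t f (dr (\<lambda>j. i j + 4))) (s / t) * ennreal (dw (- ((\<alpha> + 1 / p - 1 / t) * s)) i)
       \<le> K * ennreal (dw e i) * ennpowr (Jm p f (dr (\<lambda>j. i j + 5))) (s / p) * ennreal (dw (- ((\<alpha> + 1 / p - 1 / t) * s)) i)"
      by (rule mult_right_mono) simp
    also have "\<dots> = K * (ennpowr (Jm p f (dr (\<lambda>j. i j + 5))) (s / p) * ennreal (dw e i * dw (- ((\<alpha> + 1 / p - 1 / t) * s)) i))"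
      by (simp add: ennreal_mult mult_ac)
    also have "dw e i * dw (- ((\<alpha> + 1 / p - 1 / t) * s)) i = dw (- (\<alpha> * s)) i"
      unfolding dw_add[symmetric] by (intro arg_cong2[of _ _ _ _ dw] refl) (simp add: e_def algebra_simps)
    also have "ennpowr (Jm p f (dr (\<lambda>j. i j + 5))) (s / p) * ennreal (dw (- (\<alpha> * s)) i)
       = ennpowr (ennpowr (Jm p f (dr (\<lambda>j. i j + 5))) (q / p) * ennreal (dw (- (\<alpha> * q)) i)) (s / q)"
      using q p by (simp add: ennpowr_mult ennpowr_ennpowr ennpowr_ennreal dw_powr)
    finally show ?thesis .
  qed
  then have "Sm (\<lambda>i. ennpowr (Jm t f (dr (\<lambda>j. i j + 4))) (s / t) * ennreal (dw (- ((\<alpha> + 1 / p - 1 / t) * s)) i))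
    \<le> Sm (\<lambda>i. K * ennpowr (ennpowr (Jm p f (dr (\<lambda>j. i j + 5))) (q / p) * ennreal (dw (- (\<alpha> * q)) i)) (s / q))"
    by (intro nn_integral_mono)
  also have "\<dots> \<le> K * ennpowr (Sm (\<lambda>i. ennpowr (Jm p f (dr (\<lambda>j. i j + 5))) (q / p) * ennreal (dw (- (\<alpha> * q)) i))) (s / q)"
    unfolding Sm_cmult using q by (intro mult_left_mono nn_integral_ennpowr_sum_le) auto
  also have "\<dots> < top" using fin by (simp add: K_def ennreal_mult_less_top)
  finally show ?thesis .
qed

text \<open>At the product radii both factors are controlled by the index \<open>min k l\<close>.
  After the power \<open>s / t \<le> 1\<close> has moved inside the sum, the weights decay in
  \<open>k\<close> with exponent \<open>A * s\<close> and in \<open>l\<close> with exponent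
  \<open>\<beta> * s\<close>, so \<open>Sm_min_le\<close> leaves a single sum over the minimum; its
  exponent \<open>A + \<beta> - \<sigma>\<close> is the one in \<open>fin\<close>.\<close>

lemma dyadic_multiplier:
  fixes f g h :: "complex ^ 'n::finite \<Rightarrow> complex"
  assumes f: "sep_hol f" "has_expansion f a" and g: "sep_hol g" "has_expansion g (\<lambda>k. of_real (dcoeff m k) * c k)"
    and h: "has_expansion h (\<lambda>k. c k * a k)"
    and t: "0 < t" "t \<le> 1" and s: "0 < s" "s \<le> t" and m: "m \<ge> 1" "real m + 1 - 1 / t > 0" and \<beta>: "\<beta> > 0" and \<sigma>: "\<sigma> \<ge> 0"
    and L: "L \<ge> 0" "\<And>y. y \<in> unit_cube \<Longrightarrow> Jm t g y \<le> ennreal (L * cube_weight y (- (\<sigma> * t)))"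
    and fin: "Sm (\<lambda>i. ennpowr (Jm t f (dr (\<lambda>j. i j + 4))) (s / t) * ennreal (dw (- ((real m + 1 - 1 / t + \<beta> - \<sigma>) * s)) i)) < top"
  shows "Sm (\<lambda>l. ennpowr (Jm t h (dr (\<lambda>j. l j + 1))) (s / t) * ennreal (dw (- (\<beta> * s)) l)) < top"
proof -
  define A where "A = real m + 1 - 1 / t"
  have A: "A > 0" using m by (simp add: A_def)
  obtain C :: real where C: "C \<ge> 0" "\<And>l. Jm t h (dr (\<lambda>j. l j + 1)) \<le> ennreal C * Sm (\<lambda>k. ennreal (dw (- (A * t)) k) * (Jm t f (yy k l) * Jm t g (yy k l)))"
  proof -
    obtain C :: real where "C \<ge> 0" and C: "\<forall>(f :: complex ^ 'n \<Rightarrow> complex) a g c h l. sep_hol f \<longrightarrow> has_expansion f a \<longrightarrow> sep_hol g \<longrightarrow>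
      has_expansion g (\<lambda>k. of_real (dcoeff m k) * c k) \<longrightarrow> has_expansion h (\<lambda>k. c k * a k) \<longrightarrow>
      Jm t h (dr (\<lambda>j. l j + 1)) \<le> ennreal C * Sm (\<lambda>k. ennreal (dw (- ((real m + 1 - 1 / t) * t)) k) * (Jm t f (yy k l) * Jm t g (yy k l)))"
      using Jm_product_le[OF t m(1), where 'n = 'n] by blast
    show ?thesis
      by (rule that[OF \<open>C \<ge> 0\<close>], unfold A_def, rule C[rule_format, OF f g h])
  qed
  \<comment> \<open>The factor \<open>2^(3 \<sigma> t)\<close> per coordinate comes from the offset
    3 in \<open>yy_bounds\<close>.\<close>
  define M where "M = L * 2 powr (3 * \<sigma> * t * CARD('n))"
  have M: "M \<ge> 0" using L by (simp add: M_def)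
  let ?mn = "\<lambda>k l :: 'n \<Rightarrow> nat. \<lambda>j. min (k j) (l j)"
  have gy: "Jm t g (yy k l) \<le> ennreal (M * dw (\<sigma> * t) (?mn k l))" for k l
  proof -
    have "cube_weight (yy k l) (- (\<sigma> * t)) \<le> (\<Prod>j\<in>UNIV. 2 powr (3 * \<sigma> * t) * 2 powr ((\<sigma> * t) * real (min (k j) (l j))))"
      unfolding cube_weight_def
    proof (intro prod_mono conjI)
      fix j
      have y: "(1 / 2) ^ (min (k j) (l j) + 3) \<le> 1 - yy k l $ j" by (rule yy_bounds)
      have "(1 - yy k l $ j) powr (- (\<sigma> * t)) \<le> ((1 / 2) ^ (min (k j) (l j) + 3)) powr (- (\<sigma> * t))"
        using \<sigma> t by (intro powr_mono2' y) auto
      also have "\<dots> = 2 powr (\<sigma> * t * real (min (k j) (l j) + 3))" by (simp only: half_powr minus_minus)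
      also have "\<dots> = 2 powr (3 * \<sigma> * t) * 2 powr ((\<sigma> * t) * real (min (k j) (l j)))"
        unfolding powr_add[symmetric] by (simp add: algebra_simps)
      finally show "(1 - yy k l $ j) powr (- (\<sigma> * t)) \<le> 2 powr (3 * \<sigma> * t) * 2 powr ((\<sigma> * t) * real (min (k j) (l j)))" .
    qed simp
    also have "\<dots> = 2 powr (3 * \<sigma> * t * CARD('n)) * dw (\<sigma> * t) (?mn k l)"
      by (simp add: prod.distrib dw_prod powr_power mult_ac)
    finally have "L * cube_weight (yy k l) (- (\<sigma> * t)) \<le> M * dw (\<sigma> * t) (?mn k l)"
      using L by (simp add: M_def mult.assoc mult_left_mono)
    then show ?thesis using L(2)[OF yy_cube, of k l] by (meson ennreal_leI order_trans)
  qed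
  define \<psi> where "\<psi> = (\<lambda>i. ennpowr (Jm t f (dr (\<lambda>j. i j + 4))) (s / t) * ennreal (dw (\<sigma> * s) i))"
  define K where "K = ennreal (C powr (s / t)) * ennreal (M powr (s / t))"
  have step: "ennpowr (Jm t h (dr (\<lambda>j. l j + 1))) (s / t) \<le> K * Sm (\<lambda>k. \<psi> (?mn k l) * ennreal (dw (- (A * s)) k))" for l
  proof -
    have "Jm t h (dr (\<lambda>j. l j + 1)) \<le> ennreal C * Sm (\<lambda>k. ennreal M * (Jm t f (dr (\<lambda>j. ?mn k l j + 4)) * ennreal (dw (\<sigma> * t) (?mn k l)) * ennreal (dw (- (A * t)) k)))"
    proof (rule order_trans[OF C(2)], intro mult_left_mono nn_integral_mono)
      fix k :: "'n \<Rightarrow> nat"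
      have "Jm t f (yy k l) * Jm t g (yy k l) \<le> Jm t f (dr (\<lambda>j. ?mn k l j + 4)) * ennreal (M * dw (\<sigma> * t) (?mn k l))"
        by (intro mult_mono gy Jm_mono f t yy_cube dr_cube yy_vless) auto
      then have "ennreal (dw (- (A * t)) k) * (Jm t f (yy k l) * Jm t g (yy k l))
          \<le> ennreal (dw (- (A * t)) k) * (Jm t f (dr (\<lambda>j. ?mn k l j + 4)) * ennreal (M * dw (\<sigma> * t) (?mn k l)))"
        by (rule mult_left_mono) simp
      also have "\<dots> = ennreal M * (Jm t f (dr (\<lambda>j. ?mn k l j + 4)) * ennreal (dw (\<sigma> * t) (?mn k l)) * ennreal (dw (- (A * t)) k))"
        using M by (simp add: ennreal_mult mult_ac)
      finally show "ennreal (dw (- (A * t)) k) * (Jm t f (yy k l) * Jm t g (yy k l))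
          \<le> ennreal M * (Jm t f (dr (\<lambda>j. ?mn k l j + 4)) * ennreal (dw (\<sigma> * t) (?mn k l)) * ennreal (dw (- (A * t)) k))" .
    qed simp
    then have "ennpowr (Jm t h (dr (\<lambda>j. l j + 1))) (s / t) \<le> ennpowr (ennreal C * (ennreal M * Sm (\<lambda>k. Jm t f (dr (\<lambda>j. ?mn k l j + 4)) * ennreal (dw (\<sigma> * t) (?mn k l)) * ennreal (dw (- (A * t)) k)))) (s / t)"
      unfolding Sm_cmult using t s by (intro ennpowr_mono) auto
    also have "\<dots> = K * ennpowr (Sm (\<lambda>k. Jm t f (dr (\<lambda>j. ?mn k l j + 4)) * ennreal (dw (\<sigma> * t) (?mn k l)) * ennreal (dw (- (A * t)) k))) (s / t)"
      unfolding ennpowr_mult K_def using C M by (simp add: ennpowr_ennreal mult.assoc)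
    also have "\<dots> \<le> K * Sm (\<lambda>k. ennpowr (Jm t f (dr (\<lambda>j. ?mn k l j + 4)) * ennreal (dw (\<sigma> * t) (?mn k l)) * ennreal (dw (- (A * t)) k)) (s / t))"
      using s t by (intro mult_left_mono ennpowr_nn_integral_count_space_le) auto
    also have "(\<lambda>k. ennpowr (Jm t f (dr (\<lambda>j. ?mn k l j + 4)) * ennreal (dw (\<sigma> * t) (?mn k l)) * ennreal (dw (- (A * t)) k)) (s / t))
      = (\<lambda>k. \<psi> (?mn k l) * ennreal (dw (- (A * s)) k))"
      unfolding ennpowr_mult \<psi>_def using t by (simp add: ennpowr_ennreal dw_powr)
    finally show ?thesis .
  qed
  have "Sm (\<lambda>l. ennpowr (Jm t h (dr (\<lambda>j. l j + 1))) (s / t) * ennreal (dw (- (\<beta> * s)) l))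
     \<le> Sm (\<lambda>l. (K * Sm (\<lambda>k. \<psi> (?mn k l) * ennreal (dw (- (A * s)) k))) * ennreal (dw (- (\<beta> * s)) l))"
    by (intro nn_integral_mono mult_right_mono step) auto
  also have "\<dots> = K * Sm (\<lambda>l. Sm (\<lambda>k. \<psi> (?mn k l) * ennreal (dw (- (A * s)) k * dw (- (\<beta> * s)) l)))"
    by (simp only: mult.assoc Sm_cmult Sm_multc[symmetric] ennreal_mult dw_nonneg)
  also have "Sm (\<lambda>l. Sm (\<lambda>k. \<psi> (?mn k l) * ennreal (dw (- (A * s)) k * dw (- (\<beta> * s)) l)))
     = Sm (\<lambda>k. Sm (\<lambda>l. \<psi> (?mn k l) * ennreal (dw (- (A * s)) k * dw (- (\<beta> * s)) l)))"
    by (rule Sm_swap)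
  also have "K * \<dots> \<le> K * (Sm (\<lambda>u :: 'n \<Rightarrow> nat. ennreal (dw (- (A * s)) u)) * Sm (\<lambda>v :: 'n \<Rightarrow> nat. ennreal (dw (- (\<beta> * s)) v)) *
      Sm (\<lambda>i. \<psi> i * ennreal (dw (- (A * s + \<beta> * s)) i)))"
    by (intro mult_left_mono Sm_min_le) simp
  also have "\<dots> < top"
  proof -
    have "\<psi> i * ennreal (dw (- (A * s + \<beta> * s)) i) = ennpowr (Jm t f (dr (\<lambda>j. i j + 4))) (s / t) * ennreal (dw (- ((real m + 1 - 1 / t + \<beta> - \<sigma>) * s)) i)" for i
    proof -
      have "dw (\<sigma> * s) i * dw (- (A * s + \<beta> * s)) i = dw (- ((real m + 1 - 1 / t + \<beta> - \<sigma>) * s)) i"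
        unfolding dw_add[symmetric] by (intro arg_cong2[of _ _ _ _ dw] refl) (simp add: A_def algebra_simps)
      then show ?thesis unfolding \<psi>_def by (simp add: ennreal_mult[symmetric] mult.assoc)
    qed
    then have "Sm (\<lambda>i. \<psi> i * ennreal (dw (- (A * s + \<beta> * s)) i)) < top" using fin by simp
    moreover have "Sm (\<lambda>u :: 'n \<Rightarrow> nat. ennreal (dw (- (A * s)) u)) < top" "Sm (\<lambda>v :: 'n \<Rightarrow> nat. ennreal (dw (- (\<beta> * s)) v)) < top"
      using A \<beta> s by (auto intro!: Sm_dw_less_top)
    ultimately show ?thesis by (simp add: K_def ennreal_mult_less_top)
  qed
  finally show ?thesis .
qed

text \<open>By monotonicity the mean on a shell is at most its value at the outer corner
  \<open>dr (l + 1)\<close>.\<close>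

lemma dyadic_imp_An:
  fixes h :: "complex ^ 'n::finite \<Rightarrow> complex"
  assumes h: "sep_hol h" and t: "0 < t" "0 < s"
    and fin: "Sm (\<lambda>l. ennpowr (Jm t h (dr (\<lambda>j. l j + 1))) (s / t) * ennreal (dw (- (\<beta> * s)) l)) < top"
  shows "An t s \<beta> h < top"
proof -
  have [measurable]: "h \<in> borel_measurable borel" using h by (rule sep_hol_measurable)
  let ?w = "\<lambda>R. ennreal (cube_weight R (\<beta> * s - 1))"
  define K where "K = (4 powr \<bar>\<beta> * s - 1\<bar>) ^ CARD('n)"
  have "(\<integral>\<^sup>+R\<in>shell l. (ennpowr (Jm t h R) (s / t) * ?w R) \<partial>lborel) \<le> ennreal K * (ennpowr (Jm t h (dr (\<lambda>j. l j + 1))) (s / t) * ennreal (dw (- (\<beta> * s)) l))" for l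
  proof -
    have "(\<integral>\<^sup>+R\<in>shell l. (ennpowr (Jm t h R) (s / t) * ?w R) \<partial>lborel)
       \<le> (\<integral>\<^sup>+R. ennpowr (Jm t h (dr (\<lambda>j. l j + 1))) (s / t) * (?w R * indicator (shell l) R) \<partial>lborel)"
    proof (rule nn_integral_mono)
      fix R :: "real ^ 'n"
      show "ennpowr (Jm t h R) (s / t) * ?w R * indicator (shell l) R \<le> ennpowr (Jm t h (dr (\<lambda>j. l j + 1))) (s / t) * (?w R * indicator (shell l) R)"
      proof (cases "R \<in> shell l")
        case True
        have "Jm t h R \<le> Jm t h (dr (\<lambda>j. l j + 1))"
          by (intro Jm_mono h t dr_cube shell_subset_cube[OF True] shell_vless[OF True])
        then show ?thesis using True t by (auto intro!: mult_right_mono ennpowr_mono)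
      qed simp
    qed
    also have "\<dots> = ennpowr (Jm t h (dr (\<lambda>j. l j + 1))) (s / t) * (\<integral>\<^sup>+R\<in>shell l. ?w R \<partial>lborel)"
      by (rule nn_integral_cmult) measurable
    also have "\<dots> \<le> ennpowr (Jm t h (dr (\<lambda>j. l j + 1))) (s / t) * ennreal (K * dw (- (\<beta> * s)) l)"
      using nn_integral_shell_weight_le[where k = l and g = "\<beta> * s - 1"] by (intro mult_left_mono) (auto simp: K_def)
    finally show ?thesis by (simp add: K_def ennreal_mult mult_ac)
  qed
  then have "An t s \<beta> h \<le> Sm (\<lambda>l. ennreal K * (ennpowr (Jm t h (dr (\<lambda>j. l j + 1))) (s / t) * ennreal (dw (- (\<beta> * s)) l)))"
    unfolding An_def by (subst nn_integral_cube_shells) (auto intro!: nn_integral_mono)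
  also have "\<dots> < top" using fin unfolding Sm_cmult by (simp add: ennreal_mult_less_top)
  finally show ?thesis .
qed

section \<open>Test functions\<close>

text \<open>The norm is \<open>2 |sin (pi * x)|\<close>. The cubic Taylor bound gives
  \<open>sin u \<ge> u / 3\<close> on \<open>[0, 2]\<close>, which together with
  \<open>2 \<le> pi < 4\<close> is enough.\<close>

lemma norm_one_minus_unit_exp:
  assumes x: "0 \<le> x" "x \<le> 1"
  shows "min x (1 - x) \<le> norm (1 - unit_exp x)"
proof -
  have half: "y \<le> 2 * sin (pi * y)" if y: "0 \<le> y" "y \<le> 1 / 2" for y
  proof -
    define t where "t = pi * y"
    have t: "0 \<le> t" "t \<le> 2" using y pi_gt_zero pi_less_4 mult_mono[of pi 4 y "1 / 2"] by (auto simp: t_def)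
    have "\<bar>sin t - (\<Sum>m<3. sin_coeff m * t ^ m)\<bar> \<le> inverse (fact 3) * \<bar>t\<bar> ^ 3"
      by (rule Maclaurin_sin_bound)
    moreover have "(\<Sum>m<3. sin_coeff m * t ^ m) = t" by (simp add: eval_nat_numeral sin_coeff_def)
    ultimately have "\<bar>sin t - t\<bar> \<le> t ^ 3 / 6" using t by (simp add: fact_numeral)
    then have "t - t ^ 3 / 6 \<le> sin t" by linarith
    moreover have "t ^ 3 \<le> 4 * t"
    proof -
      have "t\<^sup>2 \<le> 2\<^sup>2" using t by (intro power_mono) auto
      then have "t * t\<^sup>2 \<le> t * 4" using t by (intro mult_left_mono) auto
      then show ?thesis by (simp add: power3_eq_cube power2_eq_square mult_ac)
    qed
    ultimately have "t / 3 \<le> sin t" by linarith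
    moreover have "2 * y \<le> t" unfolding t_def using pi_ge_two y by (intro mult_right_mono) auto
    ultimately show ?thesis unfolding t_def[symmetric] using y by linarith
  qed
  have "norm (1 - unit_exp x) = 2 * \<bar>sin (pi * x)\<bar>"
    using dist_exp_i_1[of "2 * pi * x"] by (simp add: cis_conv_exp norm_minus_commute)
  moreover have "min x (1 - x) \<le> 2 * sin (pi * x)"
  proof (cases "x \<le> 1 / 2")
    case True
    then show ?thesis using half[of x] x by simp
  next
    case False
    have "sin (pi * x) = sin (pi * (1 - x))" by (simp add: right_diff_distrib)
    then show ?thesis using half[of "1 - x"] x False by simp
  qed
  ultimately show ?thesis by linarith
qed

text \<open>Both \<open>1 - \<rho>\<close> and \<open>1 - R\<close> are at most
  \<open>1 - \<rho> * R\<close>, hence at most the norm on the right, and the angular distance is at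
  most twice that norm.\<close>

lemma norm_one_minus_ge:
  assumes \<rho>: "0 \<le> \<rho>" "\<rho> < 1" and R: "0 \<le> R" "R < 1" and x: "0 \<le> x" "x \<le> 1"
  shows "(1 - \<rho>) + (1 - R) + min x (1 - x) \<le> 4 * norm (1 - of_real (\<rho> * R) * unit_exp x)"
proof -
  define d where "d = norm (1 - of_real (\<rho> * R) * unit_exp x)"
  have u: "0 \<le> \<rho> * R" "\<rho> * R \<le> \<rho>" "\<rho> * R \<le> R" using \<rho> R by (auto simp: mult_left_le mult_left_le_one_le)
  have "norm (1 :: complex) - norm (of_real (\<rho> * R) * unit_exp x) \<le> d"
    unfolding d_def by (rule norm_triangle_ineq2)
  then have d: "1 - \<rho> * R \<le> d" using u(1) by (simp add: norm_mult abs_mult[symmetric] del: abs_mult)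
  have "norm (1 - unit_exp x) \<le> d + norm (of_real (\<rho> * R) * unit_exp x - unit_exp x)"
    unfolding d_def using norm_triangle_ineq[of "1 - of_real (\<rho> * R) * unit_exp x" "of_real (\<rho> * R) * unit_exp x - unit_exp x"] by simp
  also have "norm (of_real (\<rho> * R) * unit_exp x - unit_exp x) = 1 - \<rho> * R"
  proof -
    have "of_real (\<rho> * R) * unit_exp x - unit_exp x = of_real (\<rho> * R - 1) * unit_exp x" by (simp add: algebra_simps)
    also have "norm \<dots> = \<bar>\<rho> * R - 1\<bar>" by (simp only: norm_mult norm_of_real norm_cis mult_1_right)
    finally show ?thesis using u \<rho> by simp
  qed
  finally have "min x (1 - x) \<le> 2 * d" using norm_one_minus_unit_exp[OF x] d by linarith
  then show ?thesis using d u unfolding d_def[symmetric] by linarith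
qed

lemma nn_integral_powr_tail:
  assumes b: "b > 1" and \<delta>: "\<delta> > 0"
  shows "(\<integral>\<^sup>+y\<in>{\<delta>..}. ennreal (y powr (- b)) \<partial>lborel) = ennreal (\<delta> powr (1 - b) / (b - 1))"
proof -
  have "((\<lambda>x. x powr (- b)) has_integral - (\<delta> powr (- b + 1)) / (- b + 1)) {\<delta>..}"
    by (rule has_integral_powr_to_inf) (use b \<delta> in auto)
  then have "(\<integral>\<^sup>+y\<in>{\<delta>..}. ennreal (y powr (- b)) \<partial>lborel) = ennreal (- (\<delta> powr (- b + 1)) / (- b + 1))"
    by (intro nn_integral_has_integral_lebesgue') auto
  also have "- (\<delta> powr (- b + 1)) / (- b + 1) = \<delta> powr (1 - b) / (b - 1)"
    using b by (simp add: divide_simps) (simp add: algebra_simps)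
  finally show ?thesis .
qed

lemma nn_integral_powr_shift_le:
  assumes b: "b > 1" and \<delta>: "\<delta> > 0"
  shows "(\<integral>\<^sup>+x\<in>{0..}. ennreal ((\<delta> + x) powr (- b)) \<partial>lborel) \<le> ennreal (\<delta> powr (1 - b) / (b - 1))"
proof -
  have "(\<integral>\<^sup>+y\<in>{\<delta>..}. ennreal (y powr (- b)) \<partial>lborel) = (\<integral>\<^sup>+x\<in>{0..}. ennreal ((\<delta> + x) powr (- b)) \<partial>lborel)"
    by (subst nn_integral_real_affine[where c = 1 and t = \<delta> and f = "\<lambda>y. ennreal (y powr (- b)) * indicator {\<delta>..} y"])
       (auto intro!: nn_integral_cong simp: indicator_def)
  then show ?thesis using nn_integral_powr_tail[OF assms] by simp
qed

lemma nn_integral_circle_le: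
  assumes b: "b > 1" and \<delta>: "\<delta> > 0"
  shows "(\<integral>\<^sup>+x. ennreal ((\<delta> + min x (1 - x)) powr (- b)) * indicator {0..1} x \<partial>lborel) \<le> ennreal (2 / (b - 1) * \<delta> powr (1 - b))"
proof -
  let ?f = "\<lambda>x. ennreal ((\<delta> + x) powr (- b)) * indicator {0..} x"
  have "(\<integral>\<^sup>+x. ennreal ((\<delta> + min x (1 - x)) powr (- b)) * indicator {0..1} x \<partial>lborel) \<le> (\<integral>\<^sup>+x. ?f x + ?f (1 + (- 1) * x) \<partial>lborel)"
    by (intro nn_integral_mono) (auto simp: indicator_def min_def)
  also have "\<dots> = (\<integral>\<^sup>+x. ?f x \<partial>lborel) + (\<integral>\<^sup>+x. ?f (1 + (- 1) * x) \<partial>lborel)"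
    by (rule nn_integral_add) auto
  also have "(\<integral>\<^sup>+x. ?f (1 + (- 1) * x) \<partial>lborel) = (\<integral>\<^sup>+x. ?f x \<partial>lborel)"
    by (subst (2) nn_integral_real_affine[where c = "- 1" and t = 1]) auto
  also have "(\<integral>\<^sup>+x. ?f x \<partial>lborel) + (\<integral>\<^sup>+x. ?f x \<partial>lborel) \<le> ennreal (\<delta> powr (1 - b) / (b - 1)) + ennreal (\<delta> powr (1 - b) / (b - 1))"
    by (intro add_mono nn_integral_powr_shift_le assms)
  also have "\<dots> = ennreal (2 / (b - 1) * \<delta> powr (1 - b))"
    using b by (subst ennreal_plus[symmetric]) auto
  finally show ?thesis .
qed

text \<open>Split at distance \<open>\<delta>\<close> from the boundary: nearer, the weight
  \<open>(1 - R)^(c - 1)\<close> is integrable because \<open>c > 0\<close>; farther, the product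
  decays integrably because \<open>b > c\<close>.\<close>

lemma nn_integral_radial_le:
  assumes c: "0 < c" "c < b" and \<delta>: "\<delta> > 0"
  shows "(\<integral>\<^sup>+R. ennreal ((\<delta> + (1 - R)) powr (- b) * (1 - R) powr (c - 1)) * indicator {0..<1} R \<partial>lborel)
    \<le> ennreal ((1 / c + 1 / (b - c)) * \<delta> powr (c - b))"
proof -
  let ?f = "\<lambda>y. ennreal ((\<delta> + y) powr (- b) * y powr (c - 1)) * indicator {0<..} y"
  have "(\<integral>\<^sup>+R. ennreal ((\<delta> + (1 - R)) powr (- b) * (1 - R) powr (c - 1)) * indicator {0..<1} R \<partial>lborel)
     \<le> (\<integral>\<^sup>+R. ?f (1 + (- 1) * R) \<partial>lborel)"
    by (intro nn_integral_mono) (auto simp: indicator_def)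
  also have "\<dots> = (\<integral>\<^sup>+y. ?f y \<partial>lborel)"
    by (subst (2) nn_integral_real_affine[where c = "- 1" and t = 1]) auto
  also have "\<dots> \<le> (\<integral>\<^sup>+y. ennreal (\<delta> powr (- b)) * (ennreal (y powr (c - 1)) * indicator {0..\<delta>} y) + ennreal (y powr (- (b - c + 1))) * indicator {\<delta>..} y \<partial>lborel)"
  proof (rule nn_integral_mono)
    fix y :: real
    show "?f y \<le> ennreal (\<delta> powr (- b)) * (ennreal (y powr (c - 1)) * indicator {0..\<delta>} y) + ennreal (y powr (- (b - c + 1))) * indicator {\<delta>..} y"
    proof (cases "0 < y")
      case y: True
      show ?thesis
      proof (cases "y \<le> \<delta>")
        case True
        have "(\<delta> + y) powr (- b) \<le> \<delta> powr (- b)" using y \<delta> c by (intro powr_mono2') auto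
        then have "(\<delta> + y) powr (- b) * y powr (c - 1) \<le> \<delta> powr (- b) * y powr (c - 1)" by (intro mult_right_mono) auto
        then have "?f y \<le> ennreal (\<delta> powr (- b)) * (ennreal (y powr (c - 1)) * indicator {0..\<delta>} y)"
          using y True by (simp add: ennreal_mult[symmetric] ennreal_leI)
        then show ?thesis by (rule order_trans) simp
      next
        case False
        have "(\<delta> + y) powr (- b) \<le> y powr (- b)" using y \<delta> c by (intro powr_mono2') auto
        then have "(\<delta> + y) powr (- b) * y powr (c - 1) \<le> y powr (- b) * y powr (c - 1)" by (intro mult_right_mono) auto
        also have "\<dots> = y powr (- (b - c + 1))" unfolding powr_add[symmetric] by (simp add: algebra_simps)
        finally show ?thesis using False y by (simp add: ennreal_leI)
      qed
    qed simp
  qed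
  also have "\<dots> = ennreal (\<delta> powr (- b)) * (\<integral>\<^sup>+y\<in>{0..\<delta>}. ennreal (y powr (c - 1)) \<partial>lborel) + (\<integral>\<^sup>+y\<in>{\<delta>..}. ennreal (y powr (- (b - c + 1))) \<partial>lborel)"
    by (subst nn_integral_add) (auto simp: nn_integral_cmult)
  also have "(\<integral>\<^sup>+y\<in>{0..\<delta>}. ennreal (y powr (c - 1)) \<partial>lborel) = ennreal (\<delta> powr (c - 1 + 1) / (c - 1 + 1))"
    using has_integral_powr_from_0[of "c - 1" \<delta>] c \<delta> by (intro nn_integral_has_integral_lebesgue') auto
  also have "(\<integral>\<^sup>+y\<in>{\<delta>..}. ennreal (y powr (- (b - c + 1))) \<partial>lborel) = ennreal (\<delta> powr (1 - (b - c + 1)) / (b - c + 1 - 1))"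
    using c \<delta> by (intro nn_integral_powr_tail) auto
  also have "ennreal (\<delta> powr (- b)) * ennreal (\<delta> powr (c - 1 + 1) / (c - 1 + 1)) + ennreal (\<delta> powr (1 - (b - c + 1)) / (b - c + 1 - 1))
     = ennreal (\<delta> powr (- b) * (\<delta> powr c / c) + \<delta> powr (c - b) / (b - c))"
    using c by (simp add: ennreal_mult[symmetric] ennreal_plus[symmetric] del: ennreal_plus)
  also have "\<delta> powr (- b) * (\<delta> powr c / c) + \<delta> powr (c - b) / (b - c) = (1 / c + 1 / (b - c)) * \<delta> powr (c - b)"
  proof -
    have "\<delta> powr (- b) * \<delta> powr c = \<delta> powr (c - b)" by (simp add: powr_add[symmetric])
    then show ?thesis by (simp add: distrib_right)
  qed
  finally show ?thesis .
qed

section \<open>One-variable norms of the kernel \<open>|1 - \<rho> R e(x)|^(-M)\<close>\<close>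

definition kern :: "real \<Rightarrow> real \<Rightarrow> real \<Rightarrow> real \<Rightarrow> real" where
  "kern M \<rho> R x = norm (1 - of_real (\<rho> * R) * unit_exp x) powr (- M)"

lemma measurable_kern [measurable]: "(\<lambda>(R, x). kern M \<rho> R x) \<in> borel_measurable (borel \<Otimes>\<^sub>M borel)"
  unfolding kern_def by measurable

lemma kern_powr_le:
  assumes \<rho>: "0 \<le> \<rho>" "\<rho> < 1" and R: "0 \<le> R" "R < 1" and x: "0 \<le> x" "x \<le> 1" and M: "M * p \<ge> 0"
  shows "kern M \<rho> R x powr p \<le> 4 powr (M * p) * ((1 - \<rho>) + (1 - R) + min x (1 - x)) powr (- (M * p))"
proof -
  let ?s = "(1 - \<rho>) + (1 - R) + min x (1 - x)"
  have s: "?s > 0" using assms by (simp add: min_def)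
  have "kern M \<rho> R x powr p = norm (1 - of_real (\<rho> * R) * unit_exp x) powr (- (M * p))"
    by (simp add: kern_def powr_powr)
  also have "\<dots> \<le> (?s / 4) powr (- (M * p))"
    using norm_one_minus_ge[OF \<rho> R x] s M by (intro powr_mono2') auto
  also have "\<dots> = 4 powr (M * p) * ?s powr (- (M * p))"
    using s by (simp add: powr_divide powr_minus divide_simps)
  finally show ?thesis .
qed

text \<open>The angle is integrated first, which lowers the exponent \<open>M * p\<close> by 1; the
  radial integral then gains \<open>\<alpha> * q\<close>. Together they give
  \<open>1 - \<rho>\<close> the exponent predicted by scaling.\<close>

lemma kern_A_le:
  assumes p: "p > 0" "q > 0" and M: "M > \<alpha> + 1 / p" and \<alpha>: "\<alpha> > 0"
  shows "\<exists>C::real. C \<ge> 0 \<and> (\<forall>\<rho>. 0 \<le> \<rho> \<longrightarrow> \<rho> < 1 \<longrightarrow>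
    (\<integral>\<^sup>+R. (ennpowr (\<integral>\<^sup>+x. ennreal (kern M \<rho> R x powr p) \<partial>uni) (q / p) * ennreal ((1 - R) powr (\<alpha> * q - 1))) * indicator {0..<1} R \<partial>lborel)
    \<le> ennreal (C * (1 - \<rho>) powr ((\<alpha> + 1 / p - M) * q)))"
proof -
  have Mp: "M * p > 1"
  proof -
    have "1 / p < M" using M \<alpha> by linarith
    then show ?thesis using p by (simp add: pos_divide_less_eq)
  qed
  have Mp0: "M * p \<ge> 0" using Mp by linarith
  define K where "K = 4 powr (M * p) * (2 / (M * p - 1))"
  have K: "K \<ge> 0" using Mp by (simp add: K_def)
  define B where "B = (M - 1 / p) * q"
  have B: "0 < \<alpha> * q" "\<alpha> * q < B"
    using M \<alpha> p by (auto simp: B_def)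
  define C where "C = K powr (q / p) * (1 / (\<alpha> * q) + 1 / (B - \<alpha> * q))"
  have "(\<integral>\<^sup>+R. (ennpowr (\<integral>\<^sup>+x. ennreal (kern M \<rho> R x powr p) \<partial>uni) (q / p) * ennreal ((1 - R) powr (\<alpha> * q - 1))) * indicator {0..<1} R \<partial>lborel)
    \<le> ennreal (C * (1 - \<rho>) powr ((\<alpha> + 1 / p - M) * q))" if \<rho>: "0 \<le> \<rho>" "\<rho> < 1" for \<rho>
  proof -
    have inner: "ennpowr (\<integral>\<^sup>+x. ennreal (kern M \<rho> R x powr p) \<partial>uni) (q / p) \<le> ennreal (K powr (q / p) * ((1 - \<rho>) + (1 - R)) powr (- B))"
      if R: "0 \<le> R" "R < 1" for R
    proof -
      let ?d = "(1 - \<rho>) + (1 - R)"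
      have d: "?d > 0" using \<rho> R by simp
      have "(\<integral>\<^sup>+x. ennreal (kern M \<rho> R x powr p) \<partial>uni) = (\<integral>\<^sup>+x\<in>{0..1}. ennreal (kern M \<rho> R x powr p) \<partial>lborel)"
        by (rule nn_integral_uni) measurable
      also have "\<dots> \<le> (\<integral>\<^sup>+x. ennreal (4 powr (M * p)) * (ennreal ((?d + min x (1 - x)) powr (- (M * p))) * indicator {0..1} x) \<partial>lborel)"
        using kern_powr_le[OF \<rho> R _ _ Mp0]
        by (intro nn_integral_mono) (auto simp: indicator_def ennreal_mult[symmetric] intro!: ennreal_leI)
      also have "\<dots> = ennreal (4 powr (M * p)) * (\<integral>\<^sup>+x. ennreal ((?d + min x (1 - x)) powr (- (M * p))) * indicator {0..1} x \<partial>lborel)"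
        by (rule nn_integral_cmult) measurable
      also have "\<dots> \<le> ennreal (4 powr (M * p)) * ennreal (2 / (M * p - 1) * ?d powr (1 - M * p))"
        by (intro mult_left_mono nn_integral_circle_le Mp d) simp
      also have "\<dots> = ennreal (K * ?d powr (1 - M * p))"
        using Mp by (simp add: K_def ennreal_mult[symmetric] mult_ac)
      finally have "ennpowr (\<integral>\<^sup>+x. ennreal (kern M \<rho> R x powr p) \<partial>uni) (q / p) \<le> ennpowr (ennreal (K * ?d powr (1 - M * p))) (q / p)"
        using p by (intro ennpowr_mono) auto
      also have "\<dots> = ennreal (K powr (q / p) * ?d powr ((1 - M * p) * (q / p)))"
        using K by (simp add: ennpowr_ennreal powr_mult powr_powr)
      also have "(1 - M * p) * (q / p) = - B" using p by (simp add: B_def field_simps)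
      finally show ?thesis .
    qed
    have "(\<integral>\<^sup>+R. (ennpowr (\<integral>\<^sup>+x. ennreal (kern M \<rho> R x powr p) \<partial>uni) (q / p) * ennreal ((1 - R) powr (\<alpha> * q - 1))) * indicator {0..<1} R \<partial>lborel)
      \<le> (\<integral>\<^sup>+R. ennreal (K powr (q / p)) * (ennreal (((1 - \<rho>) + (1 - R)) powr (- B) * (1 - R) powr (\<alpha> * q - 1)) * indicator {0..<1} R) \<partial>lborel)"
    proof (rule nn_integral_mono)
      fix R :: real
      show "(ennpowr (\<integral>\<^sup>+x. ennreal (kern M \<rho> R x powr p) \<partial>uni) (q / p) * ennreal ((1 - R) powr (\<alpha> * q - 1))) * indicator {0..<1} R
        \<le> ennreal (K powr (q / p)) * (ennreal (((1 - \<rho>) + (1 - R)) powr (- B) * (1 - R) powr (\<alpha> * q - 1)) * indicator {0..<1} R)"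
      proof (cases "R \<in> {0..<1}")
        case True
        then have "ennpowr (\<integral>\<^sup>+x. ennreal (kern M \<rho> R x powr p) \<partial>uni) (q / p) * ennreal ((1 - R) powr (\<alpha> * q - 1))
          \<le> ennreal (K powr (q / p) * ((1 - \<rho>) + (1 - R)) powr (- B)) * ennreal ((1 - R) powr (\<alpha> * q - 1))"
          by (intro mult_right_mono inner) auto
        then show ?thesis using True by (simp add: ennreal_mult mult.assoc)
      qed simp
    qed
    also have "\<dots> = ennreal (K powr (q / p)) * (\<integral>\<^sup>+R. ennreal (((1 - \<rho>) + (1 - R)) powr (- B) * (1 - R) powr (\<alpha> * q - 1)) * indicator {0..<1} R \<partial>lborel)"
      by (rule nn_integral_cmult) measurable
    also have "\<dots> \<le> ennreal (K powr (q / p)) * ennreal ((1 / (\<alpha> * q) + 1 / (B - \<alpha> * q)) * (1 - \<rho>) powr (\<alpha> * q - B))"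
      using \<rho> by (intro mult_left_mono nn_integral_radial_le B) auto
    also have "\<dots> = ennreal (C * (1 - \<rho>) powr (\<alpha> * q - B))"
      using B by (simp add: C_def ennreal_mult[symmetric] mult.assoc)
    also have "\<alpha> * q - B = (\<alpha> + 1 / p - M) * q" by (simp add: B_def algebra_simps)
    finally show ?thesis .
  qed
  moreover have "C \<ge> 0" using B by (simp add: C_def)
  ultimately show ?thesis by blast
qed

text \<open>The same scaling in the reverse order: the radial integral at a fixed angle, then the
  angular one, which is dominated by small angles because
  \<open>(M - \<alpha>) * p > 1\<close>.\<close>

lemma kern_F_le:
  assumes p: "p > 0" "q > 0" and M: "M > \<alpha> + 1 / p" and \<alpha>: "\<alpha> > 0"
  shows "\<exists>C::real. C \<ge> 0 \<and> (\<forall>\<rho>. 0 \<le> \<rho> \<longrightarrow> \<rho> < 1 \<longrightarrow>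
    (\<integral>\<^sup>+x. ennpowr (\<integral>\<^sup>+R. ennreal (kern M \<rho> R x powr q * (1 - R) powr (\<alpha> * q - 1)) * indicator {0..<1} R \<partial>lborel) (p / q) \<partial>uni)
    \<le> ennreal (C * (1 - \<rho>) powr ((\<alpha> + 1 / p - M) * p)))"
proof -
  have Ma: "(M - \<alpha>) * p > 1"
  proof -
    have "1 / p < M - \<alpha>" using M by linarith
    then show ?thesis using p by (simp add: pos_divide_less_eq)
  qed
  have "M > \<alpha>" using M p by (smt (verit) divide_pos_pos zero_less_one)
  then have Mq: "\<alpha> * q > 0" "\<alpha> * q < M * q" using \<alpha> p by auto
  have Mq0: "M * q \<ge> 0" using Mq by linarith
  define K where "K = 4 powr (M * q) * (1 / (\<alpha> * q) + 1 / (M * q - \<alpha> * q))"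
  have K: "K \<ge> 0" using Mq by (simp add: K_def)
  define C where "C = K powr (p / q) * (2 / ((M - \<alpha>) * p - 1))"
  have "(\<integral>\<^sup>+x. ennpowr (\<integral>\<^sup>+R. ennreal (kern M \<rho> R x powr q * (1 - R) powr (\<alpha> * q - 1)) * indicator {0..<1} R \<partial>lborel) (p / q) \<partial>uni)
    \<le> ennreal (C * (1 - \<rho>) powr ((\<alpha> + 1 / p - M) * p))" if \<rho>: "0 \<le> \<rho>" "\<rho> < 1" for \<rho>
  proof -
    let ?I = "\<lambda>x. \<integral>\<^sup>+R. ennreal (kern M \<rho> R x powr q * (1 - R) powr (\<alpha> * q - 1)) * indicator {0..<1} R \<partial>lborel"
    have inner: "ennpowr (?I x) (p / q) \<le> ennreal (K powr (p / q) * ((1 - \<rho>) + min x (1 - x)) powr (- ((M - \<alpha>) * p)))" if x: "0 \<le> x" "x \<le> 1" for x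
    proof -
      let ?d = "(1 - \<rho>) + min x (1 - x)"
      have d: "?d > 0" using \<rho> x by (simp add: min_def)
      have "?I x \<le> (\<integral>\<^sup>+R. ennreal (4 powr (M * q)) * (ennreal ((?d + (1 - R)) powr (- (M * q)) * (1 - R) powr (\<alpha> * q - 1)) * indicator {0..<1} R) \<partial>lborel)"
      proof (rule nn_integral_mono)
        fix R :: real
        show "ennreal (kern M \<rho> R x powr q * (1 - R) powr (\<alpha> * q - 1)) * indicator {0..<1} R
          \<le> ennreal (4 powr (M * q)) * (ennreal ((?d + (1 - R)) powr (- (M * q)) * (1 - R) powr (\<alpha> * q - 1)) * indicator {0..<1} R)"
        proof (cases "R \<in> {0..<1}")
          case True
          then have "kern M \<rho> R x powr q * (1 - R) powr (\<alpha> * q - 1) \<le> 4 powr (M * q) * ((1 - \<rho>) + (1 - R) + min x (1 - x)) powr (- (M * q)) * (1 - R) powr (\<alpha> * q - 1)"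
            using x by (intro mult_right_mono kern_powr_le \<rho> Mq0) auto
          moreover have "(1 - \<rho>) + (1 - R) + min x (1 - x) = ?d + (1 - R)" by simp
          ultimately have "kern M \<rho> R x powr q * (1 - R) powr (\<alpha> * q - 1) \<le> 4 powr (M * q) * ((?d + (1 - R)) powr (- (M * q)) * (1 - R) powr (\<alpha> * q - 1))"
            by (simp only: mult.assoc)
          then have "ennreal (kern M \<rho> R x powr q * (1 - R) powr (\<alpha> * q - 1)) \<le> ennreal (4 powr (M * q)) * ennreal ((?d + (1 - R)) powr (- (M * q)) * (1 - R) powr (\<alpha> * q - 1))"
            by (subst ennreal_mult[symmetric]) (auto intro: ennreal_leI)
          then show ?thesis using True by simp
        qed simp
      qed
      also have "\<dots> = ennreal (4 powr (M * q)) * (\<integral>\<^sup>+R. ennreal ((?d + (1 - R)) powr (- (M * q)) * (1 - R) powr (\<alpha> * q - 1)) * indicator {0..<1} R \<partial>lborel)"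
        by (rule nn_integral_cmult) measurable
      also have "\<dots> \<le> ennreal (4 powr (M * q)) * ennreal ((1 / (\<alpha> * q) + 1 / (M * q - \<alpha> * q)) * ?d powr (\<alpha> * q - M * q))"
        by (intro mult_left_mono nn_integral_radial_le Mq d) simp
      also have "\<dots> = ennreal (K * ?d powr (\<alpha> * q - M * q))"
        using Mq by (simp add: K_def ennreal_mult[symmetric] mult.assoc)
      finally have "ennpowr (?I x) (p / q) \<le> ennpowr (ennreal (K * ?d powr (\<alpha> * q - M * q))) (p / q)"
        using p by (intro ennpowr_mono) auto
      also have "\<dots> = ennreal (K powr (p / q) * ?d powr ((\<alpha> * q - M * q) * (p / q)))"
        using K by (simp add: ennpowr_ennreal powr_mult powr_powr)
      also have "(\<alpha> * q - M * q) * (p / q) = - ((M - \<alpha>) * p)" using p by (simp add: field_simps)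
      finally show ?thesis .
    qed
    have "(\<integral>\<^sup>+x. ennpowr (?I x) (p / q) \<partial>uni) = (\<integral>\<^sup>+x\<in>{0..1}. ennpowr (?I x) (p / q) \<partial>lborel)"
      by (rule nn_integral_uni) measurable
    also have "\<dots> \<le> (\<integral>\<^sup>+x. ennreal (K powr (p / q)) * (ennreal (((1 - \<rho>) + min x (1 - x)) powr (- ((M - \<alpha>) * p))) * indicator {0..1} x) \<partial>lborel)"
      using inner by (intro nn_integral_mono) (auto simp: indicator_def ennreal_mult)
    also have "\<dots> = ennreal (K powr (p / q)) * (\<integral>\<^sup>+x. ennreal (((1 - \<rho>) + min x (1 - x)) powr (- ((M - \<alpha>) * p))) * indicator {0..1} x \<partial>lborel)"
      by (rule nn_integral_cmult) measurable
    also have "\<dots> \<le> ennreal (K powr (p / q)) * ennreal (2 / ((M - \<alpha>) * p - 1) * (1 - \<rho>) powr (1 - (M - \<alpha>) * p))"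
      using \<rho> by (intro mult_left_mono nn_integral_circle_le Ma) auto
    also have "\<dots> = ennreal (C * (1 - \<rho>) powr (1 - (M - \<alpha>) * p))"
      using Ma by (simp add: C_def ennreal_mult[symmetric] mult.assoc)
    also have "1 - (M - \<alpha>) * p = (\<alpha> + 1 / p - M) * p" using p by (simp add: field_simps)
    finally show ?thesis .
  qed
  moreover have "C \<ge> 0" using Ma by (simp add: C_def)
  ultimately show ?thesis by blast
qed

text \<open>The derivative \<open>D^m\<close> of the product Cauchy kernel. Its coefficients carry
  the factor \<open>dcoeff m\<close>, so the multiplier \<open>c\<close> turns it into
  \<open>D^m g\<close> dilated by \<open>\<rho>\<close>.\<close>

definition tfun :: "nat \<Rightarrow> real ^ 'n::finite \<Rightarrow> complex ^ 'n \<Rightarrow> complex" where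
  "tfun m \<rho> z = (\<Prod>j\<in>UNIV. 1 / (1 - of_real (\<rho> $ j) * z $ j) ^ (m + 1))"

lemma binomial_series:
  fixes w :: complex
  assumes w: "norm w < 1"
  shows "(\<lambda>k. of_nat ((k + m) choose m) * w ^ k) sums (1 / (1 - w) ^ (m + 1))"
proof -
  have "(\<lambda>n. ((- of_nat (m + 1)) gchoose n) * (- w) ^ n) sums (1 + (- w)) powr (- of_nat (m + 1))"
    using w by (intro gen_binomial_complex) simp
  moreover have "((- of_nat (m + 1)) gchoose n) * (- w) ^ n = of_nat ((n + m) choose m) * w ^ n" for n
  proof -
    have "((- of_nat (m + 1) :: complex) gchoose n) = (-1) ^ n * ((of_nat (m + 1) + of_nat n - 1) gchoose n)"
      by (rule gbinomial_minus)
    also have "of_nat (m + 1) + of_nat n - 1 = (of_nat (n + m) :: complex)" by simp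
    also have "(of_nat (n + m) gchoose n) = (of_nat ((n + m) choose n) :: complex)" by (rule binomial_gbinomial[symmetric])
    also have "(n + m) choose n = (n + m) choose m" using binomial_symmetric[of n "n + m"] by simp
    finally have e: "((- of_nat (m + 1) :: complex) gchoose n) = (-1) ^ n * of_nat ((n + m) choose m)" .
    have "((- of_nat (m + 1)) gchoose n) * (- w) ^ n = ((-1) ^ n * (-1) ^ n) * (of_nat ((n + m) choose m) * w ^ n)"
      unfolding e power_minus[of w] by (simp only: mult_ac)
    then show ?thesis by (simp only: minus_one_mult_self mult_1)
  qed
  moreover have "(1 + (- w)) powr (- of_nat (m + 1)) = 1 / (1 - w) ^ (m + 1)"
  proof -
    have "1 - w \<noteq> 0" using w by auto
    then have "(1 - w) powr of_nat (m + 1) = (1 - w) ^ (m + 1)" by (intro powr_nat') auto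
    moreover have "(1 + (- w)) powr (- of_nat (m + 1)) = inverse ((1 - w) powr of_nat (m + 1))"
    proof -
      have "v powr (- a) = inverse (v powr a)" for v a :: complex by (simp add: powr_def exp_minus)
      then show ?thesis by (simp only: diff_conv_add_uminus)
    qed
    ultimately show ?thesis by (simp only: divide_inverse mult_1)
  qed
  ultimately show ?thesis by simp
qed

text \<open>Radii equal to 1 are allowed because the case \<open>\<rho> = 1\<close> supplies the
  common coefficients from which \<open>expansion_superposition\<close> builds the hump.\<close>

lemma tfun_expansion:
  fixes \<rho> :: "real ^ 'n::finite"
  assumes \<rho>: "\<And>j. 0 \<le> \<rho> $ j" "\<And>j. \<rho> $ j \<le> 1"
  shows "has_expansion (tfun m \<rho>) (\<lambda>k. of_real (dcoeff m k * (\<Prod>j\<in>UNIV. (\<rho> $ j) ^ k j)))"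
  unfolding has_expansion_def
proof
  fix z :: "complex ^ 'n" assume z: "z \<in> polydisc"
  let ?w = "\<lambda>j. of_real (\<rho> $ j) * z $ j"
  have w: "norm (?w j) < 1" for j
  proof -
    have "norm (?w j) \<le> norm (z $ j)" using \<rho>[of j] by (simp add: norm_mult mult_left_le_one_le)
    also have "\<dots> < 1" using z by (simp add: polydisc_def)
    finally show ?thesis .
  qed
  have abs: "(\<lambda>k. norm (of_nat ((k + m) choose m) * ?w j ^ k)) summable_on UNIV" for j
  proof -
    have "(\<lambda>k. of_nat ((k + m) choose m) * of_real (norm (?w j)) ^ k :: complex) sums (1 / (1 - of_real (norm (?w j))) ^ (m + 1))"
      using w[of j] by (intro binomial_series) simp
    then have "summable (\<lambda>k. of_real (real ((k + m) choose m) * norm (?w j) ^ k) :: complex)"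
      by (simp add: sums_iff)
    then have "summable (\<lambda>k. real ((k + m) choose m) * norm (?w j) ^ k)"
      by (simp only: summable_of_real_iff)
    then show ?thesis
      by (subst summable_on_UNIV_nonneg_real_iff) (simp_all add: norm_mult norm_power)
  qed
  have one: "infsum (\<lambda>k. of_nat ((k + m) choose m) * ?w j ^ k) UNIV = 1 / (1 - ?w j) ^ (m + 1)" for j
    using has_sum_infsum[OF abs_summable_summable[OF abs[of j]], THEN has_sum_imp_sums] binomial_series[OF w[of j], of m]
    by (rule sums_unique2)
  have termk: "of_real (dcoeff m k * (\<Prod>j\<in>UNIV. (\<rho> $ j) ^ k j)) * vmonom k z = (\<Prod>j\<in>UNIV. of_nat ((k j + m) choose m) * ?w j ^ k j)" for k
    by (simp add: dcoeff_def vmonom_def prod.distrib power_mult_distrib)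
  have U: "PiE UNIV (\<lambda>_. UNIV) = (UNIV :: ('n \<Rightarrow> nat) set)" by auto
  have "infsum (\<lambda>k. \<Prod>j\<in>UNIV. of_nat ((k j + m) choose m) * ?w j ^ k j) (PiE UNIV (\<lambda>_. UNIV)) = (\<Prod>j\<in>UNIV. infsum (\<lambda>k. of_nat ((k + m) choose m) * ?w j ^ k) UNIV)"
    by (rule infsum_prod_PiE_abs) (use abs in auto)
  then have eq: "infsum (\<lambda>k. of_real (dcoeff m k * (\<Prod>j\<in>UNIV. (\<rho> $ j) ^ k j)) * vmonom k z) UNIV = tfun m \<rho> z"
    unfolding U by (simp only: termk one tfun_def)
  have rz: "rmult \<rho> z \<in> polydisc" using w by (simp add: polydisc_def rmult_def)
  \<comment> \<open>The identity above fixes the value only; unordered summability comes from the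
    coefficients. Constant coefficients are admissible by the bound on sums of \<open>dw\<close>,
    and \<open>psum_dcoeff\<close> adds the binomial factor.\<close>
  have "psum (\<lambda>k :: 'n \<Rightarrow> nat. 1)"
    unfolding psum_def
  proof (intro allI impI)
    fix x :: real assume x: "0 < x" "x < 1"
    have p: "x ^ mdeg k = (\<Prod>j\<in>UNIV. x ^ k j)" for k :: "'n \<Rightarrow> nat" by (simp add: mdeg_def power_sum)
    have "(\<lambda>k :: 'n \<Rightarrow> nat. x ^ mdeg k) summable_on UNIV"
    proof (rule nonneg_bounded_partial_sums_imp_summable_on)
      define c where "c = - log 2 x"
      have c: "c > 0" "2 powr (- c) = x" using x by (auto simp: c_def)
      have dwx: "dw (- c) k = x ^ mdeg k" for k :: "'n \<Rightarrow> nat"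
      proof -
        have "dw (- c) k = (2 powr (- c)) powr real (mdeg k)" by (simp add: dw_def powr_powr)
        then show ?thesis using c x by (simp add: powr_realpow)
      qed
      show "\<forall>\<^sub>F F in finite_subsets_at_top UNIV. (\<Sum>k\<in>F. x ^ mdeg (k :: 'n \<Rightarrow> nat)) \<le> (1 / (1 - 2 powr (- c))) ^ CARD('n)"
        using sum_dw_le[OF c(1), where 'n = 'n] by (intro eventually_finite_subsets_at_top_weakI) (simp add: dwx)
    qed (use x in auto)
    then show "(\<lambda>k :: 'n \<Rightarrow> nat. norm (1 :: complex) * x ^ mdeg k) summable_on UNIV" by simp
  qed
  then have "psum (\<lambda>k :: 'n \<Rightarrow> nat. of_real (dcoeff m k) * 1)" by (rule psum_dcoeff)
  from psum_summable_on[OF this rz]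
  have "(\<lambda>k. of_real (dcoeff m k) * 1 * vmonom k (rmult \<rho> z)) summable_on UNIV" by (rule abs_summable_summable)
  then have "(\<lambda>k. of_real (dcoeff m k * (\<Prod>j\<in>UNIV. (\<rho> $ j) ^ k j)) * vmonom k z) summable_on UNIV"
    by (simp add: vmonom_rmult mult.assoc)
  from has_sum_infsum[OF this] show "((\<lambda>k. of_real (dcoeff m k * (\<Prod>j\<in>UNIV. (\<rho> $ j) ^ k j)) * vmonom k z) has_sum tfun m \<rho> z) UNIV"
    by (simp only: eq)
qed

lemma norm_tfun: "norm (tfun m \<rho> (rmult R (tor a))) = (\<Prod>j\<in>UNIV. kern (real m + 1) (\<rho> $ j) (R $ j) (a j))"
proof -
  have k: "norm (1 / (1 - of_real (r * s) * unit_exp x) ^ (m + 1)) = kern (real m + 1) r s x" for r s x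
  proof (cases "1 - of_real (r * s) * unit_exp x = 0")
    case False
    then have "norm (1 - of_real (r * s) * unit_exp x) > 0" by simp
    then have "kern (real m + 1) r s x = inverse (norm (1 - of_real (r * s) * unit_exp x) ^ (m + 1))"
      unfolding kern_def using powr_realpow[of "norm (1 - of_real (r * s) * unit_exp x)" "m + 1"]
      by (simp only: powr_minus of_nat_add of_nat_1)
    then show ?thesis by (simp only: norm_divide norm_inverse norm_power norm_one divide_inverse mult_1)
  qed (simp add: kern_def)
  have "norm (tfun m \<rho> (rmult R (tor a))) = (\<Prod>j\<in>UNIV. norm (1 / (1 - of_real (\<rho> $ j * R $ j) * unit_exp (a j)) ^ (m + 1)))"
    unfolding tfun_def prod_norm[symmetric] by (simp add: rmult_def tor_def mult.assoc)
  then show ?thesis by (simp only: k)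
qed

lemma prod_le_prod_ennreal:
  fixes f g :: "'a \<Rightarrow> ennreal"
  shows "(\<And>j. f j \<le> g j) \<Longrightarrow> prod f A \<le> prod g A"
  by (induction A rule: infinite_finite_induct) (auto intro!: mult_mono)

lemma ennpowr_prod: "ennpowr (\<Prod>j\<in>A. f j) a = (\<Prod>j\<in>A. ennpowr (f j) a)"
  by (induction A rule: infinite_finite_induct) (auto simp: ennpowr_mult)

lemma Jm_tfun:
  "Jm p (tfun m \<rho>) R = (\<Prod>j\<in>UNIV. \<integral>\<^sup>+x. ennreal (kern (real m + 1) (\<rho> $ j) (R $ j) x powr p) \<partial>uni)"
proof -
  have "Jm p (tfun m \<rho>) R = (\<integral>\<^sup>+a. (\<Prod>j\<in>UNIV. ennreal (kern (real m + 1) (\<rho> $ j) (R $ j) (a j) powr p)) \<partial>PiM UNIV (\<lambda>_. uni))"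
    unfolding Jm_def norm_tfun TM_def by (subst prod_ennreal) (auto simp: prod_powr_distrib)
  also have "\<dots> = (\<Prod>j\<in>UNIV. \<integral>\<^sup>+x. ennreal (kern (real m + 1) (\<rho> $ j) (R $ j) x powr p) \<partial>uni)"
    by (rule uni_prod.product_nn_integral_prod) (simp, measurable)
  finally show ?thesis .
qed

lemma prod_C_weight: "(\<Prod>j\<in>(UNIV :: 'n::finite set). ennreal (C * (1 - \<rho> $ j) powr g)) = ennreal (C ^ CARD('n) * cube_weight \<rho> g)" if "C \<ge> 0"
  using that by (subst prod_ennreal) (auto simp: prod.distrib cube_weight_def)

text \<open>Kernel, weight and domain are products over the coordinates, so the functional is a
  product of one-variable ones.\<close>

lemma An_tfun_le:
  assumes p: "p > 0" "q > 0" and M: "real m + 1 > \<alpha> + 1 / p" and \<alpha>: "\<alpha> > 0"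
  shows "\<exists>C::real. C \<ge> 0 \<and> (\<forall>\<rho> :: real ^ 'n::finite. \<rho> \<in> unit_cube \<longrightarrow>
    An p q \<alpha> (tfun m \<rho>) \<le> ennreal (C * cube_weight \<rho> ((\<alpha> + 1 / p - (real m + 1)) * q)))"
proof -
  obtain C :: real where C: "C \<ge> 0" "\<And>\<rho>. 0 \<le> \<rho> \<Longrightarrow> \<rho> < 1 \<Longrightarrow>
    (\<integral>\<^sup>+R. (ennpowr (\<integral>\<^sup>+x. ennreal (kern (real m + 1) \<rho> R x powr p) \<partial>uni) (q / p) * ennreal ((1 - R) powr (\<alpha> * q - 1))) * indicator {0..<1} R \<partial>lborel)
    \<le> ennreal (C * (1 - \<rho>) powr ((\<alpha> + 1 / p - (real m + 1)) * q))"
    using kern_A_le[OF p M \<alpha>] by blast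
  have "An p q \<alpha> (tfun m \<rho>) \<le> ennreal (C ^ CARD('n) * cube_weight \<rho> ((\<alpha> + 1 / p - (real m + 1)) * q))" if \<rho>: "\<rho> \<in> unit_cube" for \<rho> :: "real ^ 'n"
  proof -
    let ?f = "\<lambda>j R. ennpowr (\<integral>\<^sup>+x. ennreal (kern (real m + 1) (\<rho> $ j) R x powr p) \<partial>uni) (q / p) * ennreal ((1 - R) powr (\<alpha> * q - 1))"
    have "An p q \<alpha> (tfun m \<rho>) = (\<integral>\<^sup>+R\<in>unit_cube. (\<Prod>j\<in>UNIV. ?f j (R $ j)) \<partial>lborel)"
      unfolding An_def Jm_tfun ennpowr_prod prod.distrib cube_weight_def
      by (subst prod_ennreal) auto
    also have "\<dots> = (\<Prod>j\<in>UNIV. \<integral>\<^sup>+R\<in>{0..<1}. ?f j R \<partial>lborel)"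
      unfolding unit_cube_cbx by (rule nn_integral_cbx_prod[where f = ?f]) measurable
    also have "\<dots> \<le> (\<Prod>j\<in>(UNIV :: 'n set). ennreal (C * (1 - \<rho> $ j) powr ((\<alpha> + 1 / p - (real m + 1)) * q)))"
      using \<rho> by (intro prod_le_prod_ennreal C) (auto simp: unit_cube_def)
    also have "\<dots> = ennreal (C ^ CARD('n) * cube_weight \<rho> ((\<alpha> + 1 / p - (real m + 1)) * q))"
      by (rule prod_C_weight[OF C(1)])
    finally show ?thesis .
  qed
  then show ?thesis using C(1) by (intro exI[of _ "C ^ CARD('n)"]) auto
qed

lemma Fn_tfun_le:
  assumes p: "p > 0" "q > 0" and M: "real m + 1 > \<alpha> + 1 / p" and \<alpha>: "\<alpha> > 0"
  shows "\<exists>C::real. C \<ge> 0 \<and> (\<forall>\<rho> :: real ^ 'n::finite. \<rho> \<in> unit_cube \<longrightarrow>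
    Fn p q \<alpha> (tfun m \<rho>) \<le> ennreal (C * cube_weight \<rho> ((\<alpha> + 1 / p - (real m + 1)) * p)))"
proof -
  obtain C :: real where C: "C \<ge> 0" "\<And>\<rho>. 0 \<le> \<rho> \<Longrightarrow> \<rho> < 1 \<Longrightarrow>
    (\<integral>\<^sup>+x. ennpowr (\<integral>\<^sup>+R. ennreal (kern (real m + 1) \<rho> R x powr q * (1 - R) powr (\<alpha> * q - 1)) * indicator {0..<1} R \<partial>lborel) (p / q) \<partial>uni)
    \<le> ennreal (C * (1 - \<rho>) powr ((\<alpha> + 1 / p - (real m + 1)) * p))"
    using kern_F_le[OF p M \<alpha>] by blast
  have "Fn p q \<alpha> (tfun m \<rho>) \<le> ennreal (C ^ CARD('n) * cube_weight \<rho> ((\<alpha> + 1 / p - (real m + 1)) * p))" if \<rho>: "\<rho> \<in> unit_cube" for \<rho> :: "real ^ 'n"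
  proof -
    let ?f = "\<lambda>x j R. ennreal (kern (real m + 1) (\<rho> $ j) R x powr q * (1 - R) powr (\<alpha> * q - 1))"
    have inner: "(\<integral>\<^sup>+R\<in>unit_cube. ennreal (norm (tfun m \<rho> (rmult R (tor a))) powr q * cube_weight R (\<alpha> * q - 1)) \<partial>lborel)
       = (\<Prod>j\<in>UNIV. \<integral>\<^sup>+R\<in>{0..<1}. ?f (a j) j R \<partial>lborel)" for a
    proof -
      have "(\<integral>\<^sup>+R\<in>unit_cube. ennreal (norm (tfun m \<rho> (rmult R (tor a))) powr q * cube_weight R (\<alpha> * q - 1)) \<partial>lborel)
         = (\<integral>\<^sup>+R\<in>unit_cube. (\<Prod>j\<in>UNIV. ?f (a j) j (R $ j)) \<partial>lborel)"
        unfolding norm_tfun cube_weight_def by (subst prod_ennreal) (auto simp: prod_powr_distrib prod.distrib)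
      also have "\<dots> = (\<Prod>j\<in>UNIV. \<integral>\<^sup>+R\<in>{0..<1}. ?f (a j) j R \<partial>lborel)"
        unfolding unit_cube_cbx by (rule nn_integral_cbx_prod[where f = "\<lambda>j. ?f (a j) j"]) measurable
      finally show ?thesis .
    qed
    have "Fn p q \<alpha> (tfun m \<rho>) = (\<integral>\<^sup>+a. (\<Prod>j\<in>UNIV. ennpowr (\<integral>\<^sup>+R\<in>{0..<1}. ?f (a j) j R \<partial>lborel) (p / q)) \<partial>PiM UNIV (\<lambda>_. uni))"
      unfolding Fn_def inner ennpowr_prod TM_def ..
    also have "\<dots> = (\<Prod>j\<in>UNIV. \<integral>\<^sup>+x. ennpowr (\<integral>\<^sup>+R\<in>{0..<1}. ?f x j R \<partial>lborel) (p / q) \<partial>uni)"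
      by (rule uni_prod.product_nn_integral_prod) (simp, measurable)
    also have "\<dots> \<le> (\<Prod>j\<in>(UNIV :: 'n set). ennreal (C * (1 - \<rho> $ j) powr ((\<alpha> + 1 / p - (real m + 1)) * p)))"
      using \<rho> by (intro prod_le_prod_ennreal C) (auto simp: unit_cube_def)
    also have "\<dots> = ennreal (C ^ CARD('n) * cube_weight \<rho> ((\<alpha> + 1 / p - (real m + 1)) * p))"
      by (rule prod_C_weight[OF C(1)])
    finally show ?thesis .
  qed
  then show ?thesis using C(1) by (intro exI[of _ "C ^ CARD('n)"]) auto
qed

section \<open>Countable sums in the quasi-norms\<close>

lemma ennpowr_suminf_le:
  assumes "0 < a" "a \<le> 1"
  shows "ennpowr (\<Sum>i. x i) a \<le> (\<Sum>i. ennpowr (x i) a)"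
  using ennpowr_nn_integral_count_space_le[OF assms, where x = x and A = UNIV] by (simp add: nn_integral_count_space_nat)

lemma suminf_half_ennreal: "(\<Sum>i. ennreal ((1 / 2) ^ Suc i)) = 1"
proof -
  have "(\<lambda>i. (1 / 2 :: real) ^ Suc i) sums 1" by (rule power_half_series)
  then show ?thesis by (subst suminf_ennreal2) (auto simp: sums_iff)
qed

text \<open>A quasi-triangle inequality for every \<open>a > 0\<close>: with \<open>B\<close> the
  right side, \<open>x i \<le> 2^(-(i + 1)) * B^(1/a)\<close>, and these bounds sum to
  \<open>B^(1/a)\<close>. The geometric weights do no harm, since the coefficients of the hump can
  be made to decay as fast as desired.\<close>

lemma ennpowr_suminf_weight_le:
  assumes a: "a > 0"
  shows "ennpowr (\<Sum>i. x i) a \<le> (\<Sum>i. ennreal (2 powr (a * real (i + 1))) * ennpowr (x i) a)"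
proof -
  define B where "B = (\<Sum>i. ennreal (2 powr (a * real (i + 1))) * ennpowr (x i) a)"
  have "x i \<le> ennreal ((1 / 2) ^ Suc i) * ennpowr B (1 / a)" for i
  proof -
    have "ennreal (2 powr (a * real (i + 1))) * ennpowr (x i) a \<le> B"
      unfolding B_def by (rule sum_le_suminf[of _ "{i}", simplified]) auto
    then have "ennpowr (ennreal (2 powr (a * real (i + 1))) * ennpowr (x i) a) (1 / a) \<le> ennpowr B (1 / a)"
      using a by (intro ennpowr_mono) auto
    then have le: "ennreal (2 powr real (i + 1)) * x i \<le> ennpowr B (1 / a)"
      using a by (simp add: ennpowr_mult ennpowr_ennpowr ennpowr_ennreal powr_powr)
    have p: "(2::real) powr real (i + 1) = 2 ^ Suc i" by (subst powr_realpow) auto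
    have one: "ennreal ((1 / 2) ^ Suc i) * ennreal (2 powr real (i + 1)) = 1"
      unfolding p by (subst ennreal_mult[symmetric]) (auto simp: power_mult_distrib[symmetric] simp del: power_Suc)
    have "x i = (ennreal ((1 / 2) ^ Suc i) * ennreal (2 powr real (i + 1))) * x i" by (simp only: one mult_1)
    also have "\<dots> \<le> ennreal ((1 / 2) ^ Suc i) * ennpowr B (1 / a)"
      unfolding mult.assoc by (rule mult_left_mono[OF le]) simp
    finally show ?thesis .
  qed
  then have "(\<Sum>i. x i) \<le> (\<Sum>i. ennreal ((1 / 2) ^ Suc i) * ennpowr B (1 / a))"
    by (intro suminf_le) auto
  also have "\<dots> = ennpowr B (1 / a)"
    by (simp only: ennreal_suminf_multc suminf_half_ennreal mult_1)
  finally have "ennpowr (\<Sum>i. x i) a \<le> ennpowr (ennpowr B (1 / a)) a"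
    using a by (intro ennpowr_mono) auto
  then show ?thesis using a by (simp add: ennpowr_ennpowr B_def)
qed

lemma suminf_collect_powers:
  "(\<Sum>i. ennreal (2 powr (a * real (i + 1))) * (ennreal (2 powr (b * real (i + 1)) * e i) * X i))
   = (\<Sum>i. ennreal (2 powr ((a + b) * real (i + 1)) * e i) * X i)" if "\<And>i. 0 \<le> e i"
proof (intro arg_cong[of _ _ suminf] ext)
  fix i
  have "2 powr (a * real (i + 1)) * (2 powr (b * real (i + 1)) * e i) = 2 powr ((a + b) * real (i + 1)) * e i"
    by (simp only: distrib_right powr_add mult.assoc)
  then show "ennreal (2 powr (a * real (i + 1))) * (ennreal (2 powr (b * real (i + 1)) * e i) * X i) = ennreal (2 powr ((a + b) * real (i + 1)) * e i) * X i"
    using that[of i] by (metis (no_types) ennreal_mult' mult.assoc powr_ge_zero)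
qed

lemma norm_powr_suminf_le:
  fixes f :: "complex ^ 'n::finite \<Rightarrow> complex"
  assumes p: "p > 0" and e: "\<And>i. 0 \<le> e i" and le: "ennreal (norm (f z)) \<le> (\<Sum>i. ennreal (e i) * ennreal (norm (F i z)))"
  shows "ennreal (norm (f z) powr p) \<le> (\<Sum>i. ennreal (2 powr (p * real (i + 1)) * e i powr p) * ennreal (norm (F i z) powr p))"
proof -
  have "ennreal (norm (f z) powr p) = ennpowr (ennreal (norm (f z))) p" by (simp add: ennpowr_ennreal)
  also have "\<dots> \<le> ennpowr (\<Sum>i. ennreal (e i) * ennreal (norm (F i z))) p" using p by (intro ennpowr_mono le) auto
  also have "\<dots> \<le> (\<Sum>i. ennreal (2 powr (p * real (i + 1))) * ennpowr (ennreal (e i) * ennreal (norm (F i z))) p)"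
    by (rule ennpowr_suminf_weight_le[OF p])
  also have "\<dots> = (\<Sum>i. ennreal (2 powr (p * real (i + 1)) * e i powr p) * ennreal (norm (F i z) powr p))"
    unfolding ennpowr_mult using e by (simp add: ennpowr_ennreal ennreal_mult mult.assoc)
  finally show ?thesis .
qed

text \<open>The weighted inequality is used at both powers: the inner power \<open>p\<close> costs
  \<open>2^(p (i + 1))\<close>, which the outer \<open>q / p\<close> turns into
  \<open>2^(q (i + 1))\<close>, and the outer power itself costs
  \<open>2^(q/p (i + 1))\<close>.\<close>

lemma An_suminf_le:
  fixes f :: "complex ^ 'n::finite \<Rightarrow> complex"
  assumes p: "p > 0" "q > 0" and F [measurable]: "\<And>i. F i \<in> borel_measurable borel" "f \<in> borel_measurable borel"
    and e: "\<And>i. 0 \<le> e i"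
    and le: "\<And>z. z \<in> polydisc \<Longrightarrow> ennreal (norm (f z)) \<le> (\<Sum>i. ennreal (e i) * ennreal (norm (F i z)))"
  shows "An p q \<alpha> f \<le> (\<Sum>i. ennreal (2 powr ((q / p + q) * real (i + 1)) * e i powr q) * An p q \<alpha> (F i))"
proof -
  have J: "ennpowr (Jm p f R) (q / p) \<le> (\<Sum>i. ennreal (2 powr ((q / p + q) * real (i + 1)) * e i powr q) * ennpowr (Jm p (F i) R) (q / p))"
    if R: "R \<in> unit_cube" for R
  proof -
    have "Jm p f R \<le> (\<integral>\<^sup>+a. (\<Sum>i. ennreal (2 powr (p * real (i + 1)) * e i powr p) * ennreal (norm (F i (rmult R (tor a))) powr p)) \<partial>TM)"
      unfolding Jm_def by (intro nn_integral_mono norm_powr_suminf_le p e le rmult_tor_polydisc R)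
    also have "\<dots> = (\<Sum>i. \<integral>\<^sup>+a. ennreal (2 powr (p * real (i + 1)) * e i powr p) * ennreal (norm (F i (rmult R (tor a))) powr p) \<partial>TM)"
      by (rule nn_integral_suminf) measurable
    also have "\<dots> = (\<Sum>i. ennreal (2 powr (p * real (i + 1)) * e i powr p) * Jm p (F i) R)"
      unfolding Jm_def by (intro arg_cong[of _ _ suminf] ext nn_integral_cmult) measurable
    finally have "ennpowr (Jm p f R) (q / p) \<le> ennpowr (\<Sum>i. ennreal (2 powr (p * real (i + 1)) * e i powr p) * Jm p (F i) R) (q / p)"
      using p by (intro ennpowr_mono) auto
    also have "\<dots> \<le> (\<Sum>i. ennreal (2 powr (q / p * real (i + 1))) * ennpowr (ennreal (2 powr (p * real (i + 1)) * e i powr p) * Jm p (F i) R) (q / p))"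
      using p by (intro ennpowr_suminf_weight_le) auto
    also have "\<dots> = (\<Sum>i. ennreal (2 powr (q / p * real (i + 1))) * (ennreal (2 powr (q * real (i + 1)) * e i powr q) * ennpowr (Jm p (F i) R) (q / p)))"
      unfolding ennpowr_mult using p e by (simp add: ennpowr_ennreal powr_mult powr_powr mult_ac)
    also have "\<dots> = (\<Sum>i. ennreal (2 powr ((q / p + q) * real (i + 1)) * e i powr q) * ennpowr (Jm p (F i) R) (q / p))"
      by (rule suminf_collect_powers) simp
    finally show ?thesis .
  qed
  have "An p q \<alpha> f \<le> (\<integral>\<^sup>+R. (\<Sum>i. ennreal (2 powr ((q / p + q) * real (i + 1)) * e i powr q) * (ennpowr (Jm p (F i) R) (q / p) * ennreal (cube_weight R (\<alpha> * q - 1)) * indicator unit_cube R)) \<partial>lborel)"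
    unfolding An_def
  proof (rule nn_integral_mono)
    fix R :: "real ^ 'n"
    show "ennpowr (Jm p f R) (q / p) * ennreal (cube_weight R (\<alpha> * q - 1)) * indicator unit_cube R
      \<le> (\<Sum>i. ennreal (2 powr ((q / p + q) * real (i + 1)) * e i powr q) * (ennpowr (Jm p (F i) R) (q / p) * ennreal (cube_weight R (\<alpha> * q - 1)) * indicator unit_cube R))"
    proof (cases "R \<in> unit_cube")
      case True
      have "ennpowr (Jm p f R) (q / p) * ennreal (cube_weight R (\<alpha> * q - 1)) \<le>
          (\<Sum>i. ennreal (2 powr ((q / p + q) * real (i + 1)) * e i powr q) * ennpowr (Jm p (F i) R) (q / p)) * ennreal (cube_weight R (\<alpha> * q - 1))"
        by (intro mult_right_mono J True) simp
      also have "\<dots> = (\<Sum>i. ennreal (2 powr ((q / p + q) * real (i + 1)) * e i powr q) * (ennpowr (Jm p (F i) R) (q / p) * ennreal (cube_weight R (\<alpha> * q - 1))))"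
        by (simp only: ennreal_suminf_multc[symmetric] mult.assoc)
      finally show ?thesis using True by simp
    qed simp
  qed
  also have "\<dots> = (\<Sum>i. \<integral>\<^sup>+R. ennreal (2 powr ((q / p + q) * real (i + 1)) * e i powr q) * (ennpowr (Jm p (F i) R) (q / p) * ennreal (cube_weight R (\<alpha> * q - 1)) * indicator unit_cube R) \<partial>lborel)"
    by (rule nn_integral_suminf) measurable
  also have "\<dots> = (\<Sum>i. ennreal (2 powr ((q / p + q) * real (i + 1)) * e i powr q) * An p q \<alpha> (F i))"
    unfolding An_def by (intro arg_cong[of _ _ suminf] ext nn_integral_cmult) measurable
  finally show ?thesis .
qed

lemma Fn_suminf_le:
  fixes f :: "complex ^ 'n::finite \<Rightarrow> complex"
  assumes p: "p > 0" "q > 0" and F [measurable]: "\<And>i. F i \<in> borel_measurable borel" "f \<in> borel_measurable borel"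
    and e: "\<And>i. 0 \<le> e i"
    and le: "\<And>z. z \<in> polydisc \<Longrightarrow> ennreal (norm (f z)) \<le> (\<Sum>i. ennreal (e i) * ennreal (norm (F i z)))"
  shows "Fn p q \<alpha> f \<le> (\<Sum>i. ennreal (2 powr ((p / q + p) * real (i + 1)) * e i powr p) * Fn p q \<alpha> (F i))"
proof -
  interpret L: sigma_finite_measure "lborel :: (real ^ 'n) measure" ..
  define I where "I = (\<lambda>(f :: complex ^ 'n \<Rightarrow> complex) (a :: 'n \<Rightarrow> real). \<integral>\<^sup>+R\<in>unit_cube. ennreal (norm (f (rmult R (tor a))) powr q * cube_weight R (\<alpha> * q - 1)) \<partial>lborel)"
  have [measurable]: "I (F i) \<in> borel_measurable TM" for i unfolding I_def by measurable
  let ?c = "\<lambda>i. ennreal (2 powr (q * real (i + 1)) * e i powr q)"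
  have I1: "I f a \<le> (\<Sum>i. ?c i * I (F i) a)" for a
  proof -
    have "I f a \<le> (\<integral>\<^sup>+R. (\<Sum>i. ?c i * (ennreal (norm (F i (rmult R (tor a))) powr q * cube_weight R (\<alpha> * q - 1)) * indicator unit_cube R)) \<partial>lborel)"
      unfolding I_def
    proof (rule nn_integral_mono)
      fix R :: "real ^ 'n"
      show "ennreal (norm (f (rmult R (tor a))) powr q * cube_weight R (\<alpha> * q - 1)) * indicator unit_cube R
        \<le> (\<Sum>i. ?c i * (ennreal (norm (F i (rmult R (tor a))) powr q * cube_weight R (\<alpha> * q - 1)) * indicator unit_cube R))"
      proof (cases "R \<in> unit_cube")
        case True
        have "ennreal (norm (f (rmult R (tor a))) powr q) * ennreal (cube_weight R (\<alpha> * q - 1))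
            \<le> (\<Sum>i. ?c i * ennreal (norm (F i (rmult R (tor a))) powr q)) * ennreal (cube_weight R (\<alpha> * q - 1))"
          by (intro mult_right_mono norm_powr_suminf_le p e le rmult_tor_polydisc True) simp
        also have "\<dots> = (\<Sum>i. ?c i * (ennreal (norm (F i (rmult R (tor a))) powr q) * ennreal (cube_weight R (\<alpha> * q - 1))))"
          by (simp only: ennreal_suminf_multc[symmetric] mult.assoc)
        finally show ?thesis using True by (simp add: ennreal_mult cube_weight_nonneg)
      qed simp
    qed
    also have "\<dots> = (\<Sum>i. \<integral>\<^sup>+R. ?c i * (ennreal (norm (F i (rmult R (tor a))) powr q * cube_weight R (\<alpha> * q - 1)) * indicator unit_cube R) \<partial>lborel)"
      by (rule nn_integral_suminf) measurable
    also have "\<dots> = (\<Sum>i. ?c i * I (F i) a)"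
      unfolding I_def by (intro arg_cong[of _ _ suminf] ext nn_integral_cmult) measurable
    finally show ?thesis .
  qed
  have I2: "ennpowr (I f a) (p / q) \<le> (\<Sum>i. ennreal (2 powr ((p / q + p) * real (i + 1)) * e i powr p) * ennpowr (I (F i) a) (p / q))" for a
  proof -
    have "ennpowr (I f a) (p / q) \<le> ennpowr (\<Sum>i. ?c i * I (F i) a) (p / q)"
      using p by (intro ennpowr_mono I1) auto
    also have "\<dots> \<le> (\<Sum>i. ennreal (2 powr (p / q * real (i + 1))) * ennpowr (?c i * I (F i) a) (p / q))"
      using p by (intro ennpowr_suminf_weight_le) auto
    also have "\<dots> = (\<Sum>i. ennreal (2 powr (p / q * real (i + 1))) * (ennreal (2 powr (p * real (i + 1)) * e i powr p) * ennpowr (I (F i) a) (p / q)))"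
      unfolding ennpowr_mult using p e by (simp add: ennpowr_ennreal powr_mult powr_powr mult_ac)
    also have "\<dots> = (\<Sum>i. ennreal (2 powr ((p / q + p) * real (i + 1)) * e i powr p) * ennpowr (I (F i) a) (p / q))"
      by (rule suminf_collect_powers) simp
    finally show ?thesis .
  qed
  have "Fn p q \<alpha> f = (\<integral>\<^sup>+a. ennpowr (I f a) (p / q) \<partial>TM)" by (simp add: Fn_def I_def)
  also have "\<dots> \<le> (\<integral>\<^sup>+a. (\<Sum>i. ennreal (2 powr ((p / q + p) * real (i + 1)) * e i powr p) * ennpowr (I (F i) a) (p / q)) \<partial>TM)"
    by (intro nn_integral_mono I2)
  also have "\<dots> = (\<Sum>i. \<integral>\<^sup>+a. ennreal (2 powr ((p / q + p) * real (i + 1)) * e i powr p) * ennpowr (I (F i) a) (p / q) \<partial>TM)"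
    by (rule nn_integral_suminf) measurable
  also have "\<dots> = (\<Sum>i. ennreal (2 powr ((p / q + p) * real (i + 1)) * e i powr p) * Fn p q \<alpha> (F i))"
  proof (intro arg_cong[of _ _ suminf] ext)
    fix i
    show "(\<integral>\<^sup>+a. ennreal (2 powr ((p / q + p) * real (i + 1)) * e i powr p) * ennpowr (I (F i) a) (p / q) \<partial>TM)
      = ennreal (2 powr ((p / q + p) * real (i + 1)) * e i powr p) * Fn p q \<alpha> (F i)"
      by (subst nn_integral_cmult) (simp_all add: Fn_def I_def)
  qed
  finally show ?thesis .
qed

section \<open>Necessity\<close>

lemma norm_sums_le_suminf:
  assumes "x sums (s :: complex)"
  shows "ennreal (norm s) \<le> (\<Sum>i. ennreal (norm (x i)))"
proof (rule LIMSEQ_le_const2)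
  show "(\<lambda>n. ennreal (norm (\<Sum>i<n. x i))) \<longlonglongrightarrow> ennreal (norm s)"
    using assms unfolding sums_def by (intro tendsto_ennrealI tendsto_norm)
  have "ennreal (norm (\<Sum>i<n. x i)) \<le> (\<Sum>i. ennreal (norm (x i)))" for n
  proof -
    have "ennreal (norm (\<Sum>i<n. x i)) \<le> ennreal (\<Sum>i<n. norm (x i))" by (intro ennreal_leI norm_sum)
    also have "\<dots> = (\<Sum>i<n. ennreal (norm (x i)))" by simp
    also have "\<dots> \<le> (\<Sum>i. ennreal (norm (x i)))" by (intro sum_le_suminf) auto
    finally show ?thesis .
  qed
  then show "\<exists>N. \<forall>n\<ge>N. ennreal (norm (\<Sum>i<n. x i)) \<le> (\<Sum>i. ennreal (norm (x i)))" by blast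
qed

lemma expansion_bounded:
  fixes f :: "complex ^ 'n::finite \<Rightarrow> complex"
  assumes f: "has_expansion f a" and r: "r \<in> unit_cube"
  shows "\<exists>B\<ge>0. \<forall>z. (\<forall>j. norm (z $ j) \<le> r $ j) \<longrightarrow> norm (f z) \<le> B"
proof -
  have r01: "0 \<le> r $ j" "r $ j < 1" for j using r by (auto simp: unit_cube_def)
  obtain B where B: "B \<ge> 0" "\<And>z F. (\<forall>j. norm (z $ j) \<le> r $ j) \<Longrightarrow> finite F \<Longrightarrow> norm (\<Sum>k\<in>F. a k * vmonom k z) \<le> B"
    using expansion_partial_sums_bound[OF has_expansion_imp_psum[OF f], of "\<lambda>j. r $ j"] r01 by blast
  have "norm (f z) \<le> B" if z: "\<forall>j. norm (z $ j) \<le> r $ j" for z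
  proof -
    have "z \<in> polydisc" using z r01 by (auto simp: polydisc_def intro: le_less_trans)
    from tendsto_norm[OF expansion_partial_sums[OF f this]]
    show ?thesis by (rule LIMSEQ_le_const2) (use B(2)[OF z] in auto)
  qed
  then show ?thesis using B(1) by blast
qed

text \<open>The remainder after \<open>N\<close> terms has coefficients bounded by a tail of
  \<open>d\<close> times \<open>|b k|\<close>, so it is at most that tail times the absolute sum
  \<open>W\<close>. Used twice: for the hump and, with the derivative of \<open>g\<close> as
  \<open>B\<close>, for its image.\<close>

lemma expansion_superposition:
  fixes B :: "complex ^ 'n::finite \<Rightarrow> complex" and \<rho> :: "nat \<Rightarrow> real ^ 'n"
  assumes B: "has_expansion B b" and \<rho>: "\<And>i. \<rho> i \<in> unit_cube"
    and d: "\<And>i. 0 \<le> d i" "summable d"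
    and f: "has_expansion f (\<lambda>k. b k * of_real (\<Sum>i. d i * (\<Prod>j\<in>UNIV. (\<rho> i $ j) ^ k j)))"
    and z: "z \<in> polydisc"
  shows "(\<lambda>i. of_real (d i) * B (rmult (\<rho> i) z)) sums f z"
proof -
  define P where "P = (\<lambda>i (k :: 'n \<Rightarrow> nat). \<Prod>j\<in>UNIV. (\<rho> i $ j) ^ k j)"
  have P: "0 \<le> P i k" "P i k \<le> 1" for i k
  proof -
    have "0 \<le> \<rho> i $ j" "\<rho> i $ j \<le> 1" for j using \<rho>[of i] by (auto simp: unit_cube_def less_imp_le)
    then show "0 \<le> P i k" "P i k \<le> 1" unfolding P_def by (auto intro!: prod_nonneg prod_le_1 power_le_one)
  qed
  have sP: "summable (\<lambda>i. d i * P i k)" for k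
    by (rule summable_comparison_test'[OF d(2)]) (use d P in \<open>auto simp: abs_mult mult_left_le\<close>)
  have rz: "rmult (\<rho> i) z \<in> polydisc" for i
  proof -
    have "norm (rmult (\<rho> i) z $ j) \<le> norm (z $ j)" for j
      using \<rho>[of i] by (auto simp: rmult_def norm_mult unit_cube_def less_imp_le mult_left_le_one_le)
    then show ?thesis using z unfolding polydisc_def by (auto intro: le_less_trans)
  qed
  have nb: "(\<lambda>k. norm (b k * vmonom k z)) summable_on UNIV"
    by (rule psum_summable_on[OF has_expansion_imp_psum[OF B] z])
  define W where "W = infsum (\<lambda>k. norm (b k * vmonom k z)) UNIV"
  have W: "W \<ge> 0" unfolding W_def by (intro infsum_nonneg) simp
  have tail: "norm (f z - (\<Sum>i<N. of_real (d i) * B (rmult (\<rho> i) z))) \<le> (\<Sum>i. d (i + N)) * W" for N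
  proof -
    define t where "t = (\<lambda>k. \<Sum>i. d (i + N) * P (i + N) k)"
    have split: "(\<Sum>i. d i * P i k) = t k + (\<Sum>i<N. d i * P i k)" for k
      unfolding t_def by (rule suminf_split_initial_segment[OF sP])
    have t0: "0 \<le> t k" "t k \<le> (\<Sum>i. d (i + N))" for k
    proof -
      have s1: "summable (\<lambda>i. d (i + N) * P (i + N) k)" by (rule summable_ignore_initial_segment[OF sP])
      show "0 \<le> t k" unfolding t_def using d P by (intro suminf_nonneg s1) auto
      show "t k \<le> (\<Sum>i. d (i + N))"
        unfolding t_def using d P by (intro suminf_le s1 summable_ignore_initial_segment[OF d(2)]) (auto simp: mult_left_le)
    qed
    have 1: "((\<lambda>k. b k * of_real (\<Sum>i. d i * P i k) * vmonom k z) has_sum f z) UNIV"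
      using f z unfolding has_expansion_def P_def by blast
    have single: "((\<lambda>k. of_real (d i) * (b k * vmonom k (rmult (\<rho> i) z))) has_sum (of_real (d i) * B (rmult (\<rho> i) z))) UNIV" for i
      using B rz[of i] unfolding has_expansion_def by (intro has_sum_cmult_right) blast
    have "((\<lambda>k. \<Sum>i<N. of_real (d i) * (b k * vmonom k (rmult (\<rho> i) z))) has_sum (\<Sum>i<N. of_real (d i) * B (rmult (\<rho> i) z))) UNIV"
      by (induction N) (simp_all add: has_sum_add single)
    then have 2: "((\<lambda>k. -1 * (\<Sum>i<N. of_real (d i) * (b k * vmonom k (rmult (\<rho> i) z)))) has_sum (-1 * (\<Sum>i<N. of_real (d i) * B (rmult (\<rho> i) z)))) UNIV"
      by (rule has_sum_cmult_right)
    have "b k * of_real (\<Sum>i. d i * P i k) * vmonom k z + -1 * (\<Sum>i<N. of_real (d i) * (b k * vmonom k (rmult (\<rho> i) z))) = of_real (t k) * (b k * vmonom k z)" for k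
    proof -
      have "(\<Sum>i<N. of_real (d i) * (b k * vmonom k (rmult (\<rho> i) z))) = of_real (\<Sum>i<N. d i * P i k) * (b k * vmonom k z)"
        by (simp add: vmonom_rmult P_def sum_distrib_left sum_distrib_right mult_ac)
      then show ?thesis unfolding split by (simp add: algebra_simps)
    qed
    with has_sum_add[OF 1 2] have hs: "((\<lambda>k. of_real (t k) * (b k * vmonom k z)) has_sum (f z - (\<Sum>i<N. of_real (d i) * B (rmult (\<rho> i) z)))) UNIV"
      by simp
    have le: "norm (of_real (t k) * (b k * vmonom k z)) \<le> (\<Sum>i. d (i + N)) * norm (b k * vmonom k z)" for k
      using t0[of k] by (simp only: norm_mult[of "of_real (t k)"] norm_of_real abs_of_nonneg) (rule mult_right_mono, auto)
    have sn: "(\<lambda>k. norm (of_real (t k) * (b k * vmonom k z))) summable_on UNIV"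
      by (rule summable_on_comparison_test[OF summable_on_cmult_right[OF nb, of "\<Sum>i. d (i + N)"]]) (use le in auto)
    have "norm (infsum (\<lambda>k. of_real (t k) * (b k * vmonom k z)) UNIV) \<le> infsum (\<lambda>k. norm (of_real (t k) * (b k * vmonom k z))) UNIV"
      by (rule norm_infsum_bound[OF sn])
    also have "\<dots> \<le> infsum (\<lambda>k. (\<Sum>i. d (i + N)) * norm (b k * vmonom k z)) UNIV"
      by (intro infsum_mono sn summable_on_cmult_right nb le)
    also have "\<dots> = (\<Sum>i. d (i + N)) * W" unfolding W_def by (rule infsum_cmult_right') 
    finally show ?thesis unfolding infsumI[OF hs] .
  qed
  have "(\<lambda>N. \<Sum>i. d (i + N)) \<longlonglongrightarrow> 0" by (rule suminf_exist_split2[OF d(2)])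
  then have "(\<lambda>N. (\<Sum>i. d (i + N)) * W) \<longlonglongrightarrow> 0" by (rule tendsto_mult_left_zero)
  then have "(\<lambda>N. f z - (\<Sum>i<N. of_real (d i) * B (rmult (\<rho> i) z))) \<longlonglongrightarrow> 0"
    by (rule Lim_null_comparison[rotated]) (use tail in auto)
  then have "(\<lambda>N. f z - (f z - (\<Sum>i<N. of_real (d i) * B (rmult (\<rho> i) z)))) \<longlonglongrightarrow> f z - 0"
    by (intro tendsto_diff tendsto_const)
  then show ?thesis by (simp add: sums_def)
qed

lemma cube_weight_le_1: "r \<in> unit_cube \<Longrightarrow> g \<ge> 0 \<Longrightarrow> cube_weight r g \<le> 1"
  unfolding cube_weight_def unit_cube_def by (rule prod_le_1) (simp add: powr_le1 less_imp_le)

definition vsq :: "real ^ 'n \<Rightarrow> real ^ 'n" where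
  "vsq r = (\<chi> j. r $ j * r $ j)"

text \<open>The hump sees \<open>G\<close> at squared radii only, because its \<open>i\<close>-th
  term carries a dilation by \<open>\<rho> i\<close> and is evaluated at radii
  \<open>\<rho> i\<close>. Since \<open>1 - sqrt y \<ge> (1 - y) / 2\<close>, this costs a constant
  factor.\<close>

lemma bounded_from_squares:
  fixes G :: "complex ^ 'n::finite \<Rightarrow> complex"
  assumes \<sigma>: "\<sigma> \<ge> 0" "t > 0" and K: "K \<ge> 0"
    and le: "\<And>\<rho>. \<rho> \<in> unit_cube \<Longrightarrow> ennreal (cube_weight \<rho> (\<sigma> * t)) * Jm t G (vsq \<rho>) \<le> ennreal K"
  shows "\<exists>L\<ge>0. \<forall>y\<in>unit_cube. Jm t G y \<le> ennreal (L * cube_weight y (- (\<sigma> * t)))"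
proof (intro exI[of _ "K * (2 powr (\<sigma> * t)) ^ CARD('n)"] conjI ballI)
  fix y :: "real ^ 'n" assume y: "y \<in> unit_cube"
  define \<rho> where "\<rho> = (\<chi> j. sqrt (y $ j))"
  have y01: "0 \<le> y $ j" "y $ j < 1" for j using y by (auto simp: unit_cube_def)
  have \<rho>: "\<rho> \<in> unit_cube" using y01 by (simp add: unit_cube_def \<rho>_def)
  have sq: "vsq \<rho> = y" using y01 by (simp add: vsq_def \<rho>_def vec_eq_iff)
  have w: "cube_weight \<rho> (- (\<sigma> * t)) \<le> (2 powr (\<sigma> * t)) ^ CARD('n) * cube_weight y (- (\<sigma> * t))"
  proof -
    have "cube_weight \<rho> (- (\<sigma> * t)) \<le> (\<Prod>j\<in>UNIV. 2 powr (\<sigma> * t) * (1 - y $ j) powr (- (\<sigma> * t)))"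
      unfolding cube_weight_def
    proof (intro prod_mono conjI)
      fix j
      have "(1 - y $ j) / 2 \<le> 1 - \<rho> $ j" using one_minus_sqrt_ge[of "y $ j"] y01[of j] by (simp add: \<rho>_def)
      then have "(1 - \<rho> $ j) powr (- (\<sigma> * t)) \<le> ((1 - y $ j) / 2) powr (- (\<sigma> * t))"
        using \<sigma> y01[of j] by (intro powr_mono2') auto
      also have "\<dots> = 2 powr (\<sigma> * t) * (1 - y $ j) powr (- (\<sigma> * t))"
        using y01[of j] by (simp add: powr_divide powr_minus divide_simps)
      finally show "(1 - \<rho> $ j) powr (- (\<sigma> * t)) \<le> 2 powr (\<sigma> * t) * (1 - y $ j) powr (- (\<sigma> * t))" .
    qed simp
    then show ?thesis by (simp add: prod.distrib cube_weight_def)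
  qed
  have one: "cube_weight \<rho> (- (\<sigma> * t)) * cube_weight \<rho> (\<sigma> * t) = 1"
    unfolding cube_weight_add[symmetric] using \<rho> by (simp add: cube_weight_def unit_cube_def less_imp_neq)
  have "Jm t G y = ennreal (cube_weight \<rho> (- (\<sigma> * t)) * cube_weight \<rho> (\<sigma> * t)) * Jm t G y"
    unfolding one by simp
  also have "\<dots> = ennreal (cube_weight \<rho> (- (\<sigma> * t))) * (ennreal (cube_weight \<rho> (\<sigma> * t)) * Jm t G (vsq \<rho>))"
    by (simp add: ennreal_mult cube_weight_nonneg mult.assoc sq)
  also have "\<dots> \<le> ennreal (cube_weight \<rho> (- (\<sigma> * t))) * ennreal K"
    by (intro mult_left_mono le \<rho>) simp
  also have "\<dots> = ennreal (K * cube_weight \<rho> (- (\<sigma> * t)))"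
    using K by (simp add: ennreal_mult[symmetric] cube_weight_nonneg mult.commute)
  also have "\<dots> \<le> ennreal (K * ((2 powr (\<sigma> * t)) ^ CARD('n) * cube_weight y (- (\<sigma> * t))))"
    using K w by (intro ennreal_leI mult_left_mono) auto
  finally show "Jm t G y \<le> ennreal (K * (2 powr (\<sigma> * t)) ^ CARD('n) * cube_weight y (- (\<sigma> * t)))"
    by (simp add: mult.assoc)
qed (use K in auto)

lemma measurable_tfun [measurable]: "tfun m \<rho> \<in> borel_measurable borel"
  unfolding tfun_def by measurable

lemma rmult_rmult: "rmult r (rmult r z) = rmult (vsq r) z"
  by (simp add: rmult_def vsq_def vec_eq_iff)

text \<open>The order of choices matters: \<open>\<eta> i\<close> is fixed from the sizes
  \<open>E\<close> of the earlier points, and only then is \<open>x i\<close> taken so that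
  \<open>\<Lambda> (x i)\<close> exceeds the required bound divided by
  \<open>\<eta> i\<close>.\<close>

lemma hump_sequence:
  fixes \<Lambda> :: "'a \<Rightarrow> ennreal" and E :: "'a \<Rightarrow> real"
  assumes E: "\<And>x. E x \<ge> 0" and un: "\<And>K. K \<ge> 0 \<Longrightarrow> \<exists>x\<in>X. \<Lambda> x > ennreal K"
  shows "\<exists>x \<eta>. \<forall>i::nat. x i \<in> X \<and> 0 < \<eta> i \<and> \<eta> i \<le> 2 powr (- (b * real (i + 1)))
     \<and> ennreal (real i + (\<Sum>j<i. E (x j)) + 2) < ennreal (\<eta> i) * \<Lambda> (x i)
     \<and> (\<forall>j<i. \<eta> i * E (x j) \<le> 2 powr (- (b * real (i + 1))))"
proof -
  have "\<forall>K. \<exists>x. K \<ge> 0 \<longrightarrow> x \<in> X \<and> \<Lambda> x > ennreal K" using un by blast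
  from choice[OF this] obtain pick where pick: "\<And>K. K \<ge> 0 \<Longrightarrow> pick K \<in> X" "\<And>K. K \<ge> 0 \<Longrightarrow> \<Lambda> (pick K) > ennreal K"
    by blast
  define e where "e = (\<lambda>(n::nat) S. 2 powr (- (b * real (n + 1))) / (1 + S))"
  \<comment> \<open>The recursion keeps only the running sum of \<open>E\<close> over the points
    chosen so far; both \<open>\<eta>\<close> and \<open>x\<close> are recovered from it.\<close>
  define S where "S = rec_nat 0 (\<lambda>n S. S + E (pick ((real n + S + 2) / e n S)))"
  define x where "x = (\<lambda>n. pick ((real n + S n + 2) / e n (S n)))"
  define \<eta> where "\<eta> = (\<lambda>n. e n (S n))"
  have S_Suc: "S (Suc n) = S n + E (x n)" "S 0 = 0" for n by (simp_all add: S_def x_def)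
  have S: "S n = (\<Sum>j<n. E (x j))" for n by (induction n) (simp_all add: S_Suc)
  have S0: "S n \<ge> 0" for n unfolding S by (intro sum_nonneg E)
  have \<eta>: "0 < \<eta> n" for n using S0[of n] by (simp add: \<eta>_def e_def)
  have \<eta>S: "\<eta> n * y \<le> 2 powr (- (b * real (n + 1)))" if "y \<le> 1 + S n" for n y
  proof -
    have "\<eta> n * y \<le> \<eta> n * (1 + S n)" using \<eta>[of n] that by (intro mult_left_mono) auto
    then show ?thesis using S0[of n] by (simp add: \<eta>_def e_def)
  qed
  have "x i \<in> X \<and> 0 < \<eta> i \<and> \<eta> i \<le> 2 powr (- (b * real (i + 1)))
     \<and> ennreal (real i + (\<Sum>j<i. E (x j)) + 2) < ennreal (\<eta> i) * \<Lambda> (x i)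
     \<and> (\<forall>j<i. \<eta> i * E (x j) \<le> 2 powr (- (b * real (i + 1))))" for i
  proof (intro conjI allI impI)
    have K: "0 \<le> (real i + S i + 2) / \<eta> i" using S0[of i] \<eta>[of i] by simp
    show "x i \<in> X" using pick(1)[OF K] by (simp add: x_def \<eta>_def)
    show "0 < \<eta> i" by (rule \<eta>)
    show "\<eta> i \<le> 2 powr (- (b * real (i + 1)))" using \<eta>S[of 1 i] S0[of i] by simp
    show "\<eta> i * E (x j) \<le> 2 powr (- (b * real (i + 1)))" if "j < i" for j
    proof (rule \<eta>S)
      have "E (x j) \<le> S i" unfolding S using that E by (intro member_le_sum) auto
      then show "E (x j) \<le> 1 + S i" by simp
    qed
    have lt: "ennreal ((real i + S i + 2) / \<eta> i) < \<Lambda> (x i)" using pick(2)[OF K] by (simp add: x_def \<eta>_def)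
    have "ennreal (real i + S i + 2) = ennreal (\<eta> i) * ennreal ((real i + S i + 2) / \<eta> i)"
      using \<eta>[of i] K by (subst ennreal_mult[symmetric]) auto
    also have "\<dots> < ennreal (\<eta> i) * \<Lambda> (x i)" using lt \<eta>[of i] by (intro ennreal_mult_strict_left_mono) auto
    finally show "ennreal (real i + (\<Sum>j<i. E (x j)) + 2) < ennreal (\<eta> i) * \<Lambda> (x i)" by (simp only: S)
  qed
  then show ?thesis by blast
qed

text \<open>The \<open>i\<close>-th term is isolated by the triangle inequality for
  \<open>t\<close>-th powers on the torus of radii \<open>\<rho> i\<close>. There the argument of
  the \<open>j\<close>-th term lies in the polydiscs of radii \<open>\<rho> j\<close> and
  \<open>\<rho> i\<close>: the first gives the bound \<open>E j\<close> for the earlier terms, the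
  second gives \<open>\<delta> j * E i\<close> for the later ones, whose \<open>t\<close>-th powers
  sum to at most 1.\<close>

lemma hump_estimate:
  fixes G h :: "complex ^ 'n::finite \<Rightarrow> complex" and \<rho> :: "nat \<Rightarrow> real ^ 'n"
  assumes t: "0 < t" "t \<le> 1" and [measurable]: "G \<in> borel_measurable borel" "h \<in> borel_measurable borel"
    and \<rho>: "\<And>i. \<rho> i \<in> unit_cube"
    and E: "\<And>i. 0 \<le> E i" "\<And>i z. (\<And>j. norm (z $ j) \<le> \<rho> i $ j) \<Longrightarrow> norm (G z) \<le> E i"
    and \<delta>: "\<And>i. 0 \<le> \<delta> i" "\<And>i. \<delta> i \<le> 1"
    and small: "\<And>i j. i < j \<Longrightarrow> \<delta> j powr t * E i powr t \<le> (1 / 2) ^ Suc j"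
    and h: "\<And>z. z \<in> polydisc \<Longrightarrow> (\<lambda>j. of_real (\<delta> j) * G (rmult (\<rho> j) z)) sums h z"
  shows "ennreal (\<delta> i powr t) * Jm t G (vsq (\<rho> i)) \<le> Jm t h (\<rho> i) + ennreal ((\<Sum>j<i. E j powr t) + 1)"
proof -
  have r01: "0 \<le> \<rho> j $ l" "\<rho> j $ l \<le> 1" for j l using \<rho>[of j] by (auto simp: unit_cube_def less_imp_le)
  have pt: "ennreal (\<delta> i powr t) * ennreal (norm (G (rmult (vsq (\<rho> i)) (tor a))) powr t)
      \<le> ennreal (norm (h (rmult (\<rho> i) (tor a))) powr t) + ennreal ((\<Sum>j<i. E j powr t) + 1)" for a
  proof -
    define z where "z = rmult (\<rho> i) (tor a)"
    have z: "z \<in> polydisc" unfolding z_def by (rule rmult_tor_polydisc[OF \<rho>])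
    have nz: "norm (z $ l) = \<rho> i $ l" for l unfolding z_def by (rule norm_rmult_tor[OF \<rho>])
    define x where "x = (\<lambda>j. of_real (\<delta> j) * G (rmult (\<rho> j) z))"
    have nx: "norm (x j) powr t = \<delta> j powr t * norm (G (rmult (\<rho> j) z)) powr t" for j
      using \<delta>[of j] by (simp add: x_def norm_mult powr_mult)
    have G1: "norm (G (rmult (\<rho> j) z)) \<le> E j" for j
      by (rule E(2)) (use r01 in \<open>simp add: rmult_def norm_mult nz mult_left_le\<close>)
    have G2: "norm (G (rmult (\<rho> j) z)) \<le> E i" for j
      by (rule E(2)) (use r01 in \<open>simp add: rmult_def norm_mult nz mult_left_le_one_le\<close>)
    have u: "ennreal (norm (if j = i then 0 else x j) powr t) \<le> ennreal (if j < i then E j powr t else 0) + ennreal ((1 / 2) ^ Suc j)" for j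
    proof -
      consider "j = i" | "j < i" | "i < j" by linarith
      then have "norm (if j = i then 0 else x j) powr t \<le> (if j < i then E j powr t else 0) + (1 / 2) ^ Suc j"
      proof cases
        case 2
        have "\<delta> j powr t \<le> 1" using \<delta>[of j] t by (intro powr_le1) auto
        moreover have "norm (G (rmult (\<rho> j) z)) powr t \<le> E j powr t" using G1 t by (intro powr_mono2) auto
        ultimately have "norm (x j) powr t \<le> 1 * E j powr t" unfolding nx by (intro mult_mono) auto
        then show ?thesis using 2 by (simp add: add_increasing2)
      next
        case 3
        have "norm (G (rmult (\<rho> j) z)) powr t \<le> E i powr t" using G2 t by (intro powr_mono2) auto
        then have "norm (x j) powr t \<le> \<delta> j powr t * E i powr t" unfolding nx by (intro mult_left_mono) auto
        then show ?thesis using 3 small[OF 3] by simp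
      qed simp
      then have "ennreal (norm (if j = i then 0 else x j) powr t) \<le> ennreal ((if j < i then E j powr t else 0) + (1 / 2) ^ Suc j)"
        by (rule ennreal_leI)
      then show ?thesis by (subst (asm) ennreal_plus) auto
    qed
    have fin: "(\<Sum>j. ennreal (if j < i then E j powr t else 0)) = ennreal (\<Sum>j<i. E j powr t)"
    proof -
      have "(\<Sum>j. ennreal (if j < i then E j powr t else 0)) = (\<Sum>j<i. ennreal (if j < i then E j powr t else 0))"
        by (rule suminf_finite) auto
      then show ?thesis by (simp add: sum_ennreal)
    qed
    have "(\<lambda>j. if j = i then 0 else x j) sums (h z - x i)"
    proof -
      have "(\<lambda>j. x j - (if j = i then x j else 0)) sums (h z - x i)"
        by (intro sums_diff h[OF z, folded x_def] sums_single)
      moreover have "(\<lambda>j. x j - (if j = i then x j else 0)) = (\<lambda>j. if j = i then 0 else x j)" by auto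
      ultimately show ?thesis by simp
    qed
    from norm_sums_le_suminf[OF this]
    have d: "ennreal (norm (h z - x i)) \<le> (\<Sum>j. ennreal (norm (if j = i then 0 else x j)))" .
    have "ennreal (norm (x i)) \<le> ennreal (norm (h z) + norm (h z - x i))"
      by (intro ennreal_leI) (metis add.commute norm_minus_commute norm_triangle_sub)
    also have "\<dots> \<le> ennreal (norm (h z)) + (\<Sum>j. ennreal (norm (if j = i then 0 else x j)))"
      using d by (simp add: add_left_mono)
    finally have "ennpowr (ennreal (norm (x i))) t \<le> ennpowr (ennreal (norm (h z)) + (\<Sum>j. ennreal (norm (if j = i then 0 else x j)))) t"
      using t by (intro ennpowr_mono) auto
    also have "\<dots> \<le> ennpowr (ennreal (norm (h z))) t + ennpowr (\<Sum>j. ennreal (norm (if j = i then 0 else x j))) t"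
      by (rule ennpowr_add_le[OF t])
    also have "\<dots> \<le> ennpowr (ennreal (norm (h z))) t + (\<Sum>j. ennpowr (ennreal (norm (if j = i then 0 else x j))) t)"
      by (intro add_left_mono ennpowr_suminf_le t)
    also have "\<dots> \<le> ennpowr (ennreal (norm (h z))) t + (\<Sum>j. ennreal (if j < i then E j powr t else 0) + ennreal ((1 / 2) ^ Suc j))"
      using u by (intro add_left_mono suminf_le) (auto simp: ennpowr_ennreal simp del: power_Suc)
    also have "(\<Sum>j. ennreal (if j < i then E j powr t else 0) + ennreal ((1 / 2) ^ Suc j)) = ennreal (\<Sum>j<i. E j powr t) + 1"
      by (subst suminf_add[symmetric]) (simp_all only: fin suminf_half_ennreal summableI)
    also have "\<dots> = ennreal ((\<Sum>j<i. E j powr t) + 1)"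
      by (subst ennreal_plus) (auto intro: sum_nonneg)
    finally have "ennreal (norm (x i) powr t) \<le> ennreal (norm (h z) powr t) + ennreal ((\<Sum>j<i. E j powr t) + 1)"
      by (simp add: ennpowr_ennreal)
    then show ?thesis unfolding nx by (simp add: ennreal_mult z_def rmult_rmult)
  qed
  have "ennreal (\<delta> i powr t) * Jm t G (vsq (\<rho> i)) = (\<integral>\<^sup>+a. ennreal (\<delta> i powr t) * ennreal (norm (G (rmult (vsq (\<rho> i)) (tor a))) powr t) \<partial>TM)"
    unfolding Jm_def by (rule nn_integral_cmult[symmetric]) measurable
  also have "\<dots> \<le> (\<integral>\<^sup>+a. ennreal (norm (h (rmult (\<rho> i) (tor a))) powr t) + ennreal ((\<Sum>j<i. E j powr t) + 1) \<partial>TM)"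
    by (intro nn_integral_mono pt)
  also have "\<dots> = Jm t h (\<rho> i) + ennreal ((\<Sum>j<i. E j powr t) + 1)"
    unfolding Jm_def by (subst nn_integral_add) (simp_all add: nn_integral_TM_const del: nn_integral_const)
  finally show ?thesis .
qed

text \<open>Growth of means in the target space: a Whitney box is part of the cube, so its integral
  is at most the full radial integral.\<close>

lemma Jm_le_Fn:
  assumes s: "0 < s" "s \<le> t"
  shows "\<exists>C::real. C \<ge> 0 \<and> (\<forall>f::complex ^ 'n::finite \<Rightarrow> complex. \<forall>r\<in>unit_cube. sep_hol f \<longrightarrow>
    ennreal (cube_weight r (t * \<beta>)) * Jm t f r \<le> ennreal C * Fn t s \<beta> f)"
proof -
  have a: "t / s \<ge> 1" "t / s * s = t" using s by auto
  obtain C :: real where C: "C \<ge> 0" "\<And>f :: complex ^ 'n \<Rightarrow> complex. \<And>r. r \<in> unit_cube \<Longrightarrow> sep_hol f \<Longrightarrow>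
     ennreal (cube_weight r (t * \<beta>)) * Jm t f r \<le>
    ennreal C * (\<integral>\<^sup>+b. ennpowr (\<integral>\<^sup>+x\<in>wbox r. ennreal (norm (f (rmult x (tor b))) powr s * cube_weight x (\<beta> * s - 1)) \<partial>lborel) (t / s) \<partial>TM)"
    using Jm_le_wbox_weight[OF s(1) a(1), where g = \<beta> and 'n = 'n, unfolded a(2)] by blast
  have "ennreal (cube_weight r (t * \<beta>)) * Jm t f r \<le> ennreal C * Fn t s \<beta> f" if r: "r \<in> unit_cube" and f: "sep_hol f" for f :: "complex ^ 'n \<Rightarrow> complex" and r
  proof -
    have "(\<integral>\<^sup>+b. ennpowr (\<integral>\<^sup>+x\<in>wbox r. ennreal (norm (f (rmult x (tor b))) powr s * cube_weight x (\<beta> * s - 1)) \<partial>lborel) (t / s) \<partial>TM) \<le> Fn t s \<beta> f"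
      unfolding Fn_def
    proof (intro nn_integral_mono ennpowr_mono)
      fix b and x :: "real ^ 'n"
      show "ennreal (norm (f (rmult x (tor b))) powr s * cube_weight x (\<beta> * s - 1)) * indicator (wbox r) x
        \<le> ennreal (norm (f (rmult x (tor b))) powr s * cube_weight x (\<beta> * s - 1)) * indicator unit_cube x"
        using wbox_subset[OF r] by (intro mult_left_mono) (auto split: split_indicator)
    qed (use s in auto)
    then show ?thesis using C(2)[OF r f] by (meson mult_left_mono order_trans zero_le)
  qed
  then show ?thesis using C(1) by blast
qed

text \<open>The source space enters only through \<open>Xn\<close>, so one argument serves both
  spaces: \<open>X1\<close> is the countable quasi-triangle inequality, \<open>X2\<close> the size
  of the test functions, \<open>X3\<close> the multiplier property, and \<open>\<tau>\<close> the
  power of the quasi-norm that \<open>Xn\<close> stands for.\<close>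

lemma gliding_hump:
  fixes G :: "complex ^ 'n::finite \<Rightarrow> complex" and Xn :: "(complex ^ 'n \<Rightarrow> complex) \<Rightarrow> ennreal"
  assumes G: "sep_hol G" "has_expansion G (\<lambda>k. of_real (dcoeff m k) * c k)"
    and t: "0 < s" "s \<le> t" "t \<le> 1" and \<beta>: "\<beta> > 0" and \<mu>: "\<mu> \<ge> 0" "\<sigma> = \<mu> + \<beta>" and \<tau>: "\<tau> > 0" and \<kappa>: "\<kappa> \<ge> 0"
    and X1: "\<And>F f e. (\<And>i. F i \<in> borel_measurable borel) \<Longrightarrow> f \<in> borel_measurable borel \<Longrightarrow> (\<And>i::nat. 0 \<le> e i) \<Longrightarrow>
      (\<And>z. z \<in> polydisc \<Longrightarrow> ennreal (norm (f z)) \<le> (\<Sum>i. ennreal (e i) * ennreal (norm (F i z)))) \<Longrightarrow>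
      Xn f \<le> (\<Sum>i. ennreal (2 powr (\<kappa> * real (i + 1)) * e i powr \<tau>) * Xn (F i))"
    and X2: "C0 \<ge> 0" "\<And>\<rho>. \<rho> \<in> unit_cube \<Longrightarrow> Xn (tfun m \<rho>) \<le> ennreal (C0 * cube_weight \<rho> (- (\<mu> * \<tau>)))"
    and X3: "\<And>f a. f \<in> hol_polydisc \<Longrightarrow> has_expansion f a \<Longrightarrow> Xn (trunc f) < top \<Longrightarrow>
      \<exists>h\<in>hol_polydisc. Fn t s \<beta> (trunc h) < top \<and> has_expansion h (\<lambda>k. c k * a k)"
  shows "\<exists>L\<ge>0. \<forall>y\<in>unit_cube. Jm t G y \<le> ennreal (L * cube_weight y (- (\<sigma> * t)))"
proof (rule ccontr)
  assume neg: "\<not> ?thesis"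
  have t0: "t > 0" and \<sigma>: "\<sigma> \<ge> 0" using t \<beta> \<mu> by auto
  have [measurable]: "G \<in> borel_measurable borel" using G(1) by (rule sep_hol_measurable)
  define \<Lambda> where "\<Lambda> = (\<lambda>\<rho>. ennreal (cube_weight \<rho> (\<sigma> * t)) * Jm t G (vsq \<rho>))"
  have un: "\<exists>\<rho>\<in>unit_cube. \<Lambda> \<rho> > ennreal K" if "K \<ge> 0" for K
  proof (rule ccontr)
    assume "\<not> ?thesis"
    then have "\<And>\<rho>. \<rho> \<in> unit_cube \<Longrightarrow> ennreal (cube_weight \<rho> (\<sigma> * t)) * Jm t G (vsq \<rho>) \<le> ennreal K"
      by (auto simp: \<Lambda>_def not_less)
    from bounded_from_squares[OF \<sigma> t0 that this] show False using neg by blast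
  qed
  have "\<forall>\<rho>. \<exists>B. B \<ge> 0 \<and> (\<rho> \<in> unit_cube \<longrightarrow> (\<forall>z. (\<forall>j. norm (z $ j) \<le> \<rho> $ j) \<longrightarrow> norm (G z) \<le> B))"
    using expansion_bounded[OF G(2)] by (metis order_refl)
  from choice[OF this] obtain Eb where Eb: "\<And>\<rho>. Eb \<rho> \<ge> 0"
    "\<And>\<rho> z. \<rho> \<in> unit_cube \<Longrightarrow> (\<And>j. norm (z $ j) \<le> \<rho> $ j) \<Longrightarrow> norm (G z) \<le> Eb \<rho>" by blast
  \<comment> \<open>Large enough that \<open>\<epsilon> i\<close> is at most
    \<open>2^(-(i + 1))\<close> and that \<open>\<epsilon> i ^ \<tau>\<close> beats the loss
    \<open>2^(\<kappa> (i + 1))\<close> of \<open>X1\<close> with another such factor to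
    spare.\<close>
  define b where "b = max 1 ((\<kappa> + 1) * t / \<tau>)"
  have b: "b \<ge> 1" "b * \<tau> / t \<ge> \<kappa> + 1" "b / t \<ge> 1"
  proof -
    show "b \<ge> 1" by (simp add: b_def)
    then show "b / t \<ge> 1" using t t0 by simp
    have "(\<kappa> + 1) * t / \<tau> \<le> b" by (simp add: b_def)
    then show "b * \<tau> / t \<ge> \<kappa> + 1" using t0 \<tau> by (simp add: field_simps)
  qed
  obtain \<rho> \<eta> where H: "\<forall>i::nat. \<rho> i \<in> unit_cube \<and> 0 < \<eta> i \<and> \<eta> i \<le> 2 powr (- (b * real (i + 1)))
     \<and> ennreal (real i + (\<Sum>j<i. Eb (\<rho> j) powr t) + 2) < ennreal (\<eta> i) * \<Lambda> (\<rho> i)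
     \<and> (\<forall>j<i. \<eta> i * Eb (\<rho> j) powr t \<le> 2 powr (- (b * real (i + 1))))"
    using hump_sequence[where E = "\<lambda>\<rho>. Eb \<rho> powr t" and X = unit_cube and \<Lambda> = \<Lambda> and b = b, OF powr_ge_zero un] by blast
  have hs: "\<And>i. \<rho> i \<in> unit_cube" "\<And>i. 0 < \<eta> i" "\<And>i. \<eta> i \<le> 2 powr (- (b * real (i + 1)))"
    "\<And>i. ennreal (real i + (\<Sum>j<i. Eb (\<rho> j) powr t) + 2) < ennreal (\<eta> i) * \<Lambda> (\<rho> i)"
    "\<And>i j. j < i \<Longrightarrow> \<eta> i * Eb (\<rho> j) powr t \<le> 2 powr (- (b * real (i + 1)))"
    using H by blast+
  define E where "E = (\<lambda>i. Eb (\<rho> i))"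
  define \<epsilon> where "\<epsilon> = (\<lambda>i. \<eta> i powr (1 / t))"
  \<comment> \<open>The factor \<open>cube_weight (\<rho> i) \<mu>\<close> normalizes the
    \<open>i\<close>-th test function, whose size is given by \<open>X2\<close>.\<close>
  define \<delta> where "\<delta> = (\<lambda>i. \<epsilon> i * cube_weight (\<rho> i) \<mu>)"
  have half: "2 powr (- (x * real (i + 1))) \<le> (1 / 2) ^ Suc i" if "x \<ge> 1" for x :: real and i
  proof -
    have "2 powr (- (x * real (i + 1))) \<le> 2 powr (- real (Suc i))"
      using mult_right_mono[OF that, of "real (i + 1)"] by (intro powr_mono) (simp_all add: algebra_simps)
    also have "\<dots> = (1 / 2) ^ Suc i"
      by (simp add: powr_minus powr_realpow power_one_over inverse_eq_divide del: of_nat_Suc power_Suc)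
    finally show ?thesis .
  qed
  have \<epsilon>a: "\<epsilon> i powr x \<le> 2 powr (- (b * x / t * real (i + 1)))" if "x \<ge> 0" for i x
  proof -
    have "\<epsilon> i powr x = \<eta> i powr (x / t)" by (simp add: \<epsilon>_def powr_powr)
    also have "\<dots> \<le> (2 powr (- (b * real (i + 1)))) powr (x / t)"
      using hs(2,3)[of i] that t0 by (intro powr_mono2) auto
    also have "\<dots> = 2 powr (- (b * x / t * real (i + 1)))" by (simp add: powr_powr algebra_simps add_divide_distrib)
    finally show ?thesis .
  qed
  have \<epsilon>0: "\<epsilon> i \<ge> 0" for i by (simp add: \<epsilon>_def)
  have \<epsilon>1: "\<epsilon> i \<le> (1 / 2) ^ Suc i" for i
    using \<epsilon>a[of 1 i] half[OF b(3), of i] \<epsilon>0[of i] by simp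
  have w1: "0 \<le> cube_weight (\<rho> i) x" "x \<ge> 0 \<Longrightarrow> cube_weight (\<rho> i) x \<le> 1" for i x
    using cube_weight_le_1[OF hs(1)] by (auto simp: cube_weight_nonneg)
  have \<delta>0: "0 \<le> \<delta> i" for i using \<epsilon>0 w1 by (simp add: \<delta>_def)
  have \<delta>\<epsilon>: "\<delta> i \<le> \<epsilon> i" for i using \<epsilon>0[of i] w1(2)[OF \<mu>(1), of i] by (simp add: \<delta>_def mult_left_le)
  have \<delta>h: "\<delta> i \<le> (1 / 2) ^ Suc i" for i using \<delta>\<epsilon> \<epsilon>1 by (rule order_trans)
  have \<delta>1: "\<delta> i \<le> 1" for i using \<delta>h by (rule order_trans) (simp add: power_le_one del: power_Suc)
  have sd: "summable \<delta>"
    by (rule summable_comparison_test'[where g = "\<lambda>i. (1 / 2) ^ Suc i"]) (use \<delta>0 \<delta>h in \<open>auto simp: summable_mult simp del: power_Suc intro: sums_summable[OF power_half_series]\<close>)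
  have \<delta>t: "\<delta> i powr t = \<eta> i * cube_weight (\<rho> i) (\<mu> * t)" for i
    using hs(2)[of i] t0 by (simp add: \<delta>_def \<epsilon>_def powr_mult powr_powr cube_weight_powr w1)
  define A where "A = (\<lambda>k :: 'n \<Rightarrow> nat. \<Sum>i. \<delta> i * (\<Prod>j\<in>UNIV. (\<rho> i $ j) ^ k j))"
  have A: "0 \<le> A k" "A k \<le> suminf \<delta>" for k
  proof -
    have P: "0 \<le> (\<Prod>j\<in>UNIV. (\<rho> i $ j) ^ k j)" "(\<Prod>j\<in>UNIV. (\<rho> i $ j) ^ k j) \<le> 1" for i
    proof -
      have "0 \<le> \<rho> i $ j" "\<rho> i $ j \<le> 1" for j using hs(1)[of i] by (auto simp: unit_cube_def less_imp_le)
      then show "0 \<le> (\<Prod>j\<in>UNIV. (\<rho> i $ j) ^ k j)" "(\<Prod>j\<in>UNIV. (\<rho> i $ j) ^ k j) \<le> 1"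
        by (auto intro!: prod_nonneg prod_le_1 power_le_one)
    qed
    have sP: "summable (\<lambda>i. \<delta> i * (\<Prod>j\<in>UNIV. (\<rho> i $ j) ^ k j))"
    proof (rule summable_comparison_test'[OF sd])
      show "norm (\<delta> n * (\<Prod>j\<in>UNIV. (\<rho> n $ j) ^ k j)) \<le> \<delta> n" for n
        using \<delta>0[of n] P[of n] by (simp only: real_norm_def abs_mult abs_of_nonneg mult_left_le)
    qed
    show "0 \<le> A k" unfolding A_def by (intro suminf_nonneg sP mult_nonneg_nonneg \<delta>0 P)
    show "A k \<le> suminf \<delta>" unfolding A_def by (intro suminf_le sP sd mult_left_le \<delta>0 P)
  qed
  define a where "a = (\<lambda>k. complex_of_real (dcoeff m k) * of_real (A k))"
  have B: "has_expansion (tfun m (\<chi> j. 1)) (\<lambda>k :: 'n \<Rightarrow> nat. of_real (dcoeff m k))"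
    using tfun_expansion[of "\<chi> j. 1" m] by simp
  have "psum a"
  proof (rule psum_comparison[OF has_expansion_imp_psum[OF B]])
    fix r :: real assume r: "0 < r" "r < 1"
    have "norm (a k) * r ^ mdeg k \<le> suminf \<delta> * (norm (complex_of_real (dcoeff m k)) * r ^ mdeg k)" for k
    proof -
      have "norm (a k) * r ^ mdeg k = A k * (norm (complex_of_real (dcoeff m k)) * r ^ mdeg k)"
        using A(1)[of k] by (simp add: a_def norm_mult)
      also have "\<dots> \<le> suminf \<delta> * (norm (complex_of_real (dcoeff m k)) * r ^ mdeg k)"
        using A(2)[of k] r by (intro mult_right_mono) auto
      finally show ?thesis .
    qed
    then show "\<exists>B \<sigma>. 0 < \<sigma> \<and> \<sigma> < 1 \<and> (\<forall>k. norm (a k) * r ^ mdeg k \<le> B * (norm (complex_of_real (dcoeff m k)) * \<sigma> ^ mdeg k))"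
      using r by blast
  qed
  define f where "f = (\<lambda>z. \<Sum>\<^sub>\<infinity>k. a k * vmonom k z)"
  have f: "has_expansion f a" unfolding f_def by (rule psum_imp_has_expansion) fact
  have fh: "f \<in> hol_polydisc" by (rule has_expansion_imp_hol_polydisc[OF f])
  have fs: "(\<lambda>i. of_real (\<delta> i) * tfun m (\<rho> i) z) sums f z" if z: "z \<in> polydisc" for z
  proof -
    have "tfun m (\<chi> j. 1) (rmult (\<rho> i) z) = tfun m (\<rho> i) z" for i by (simp add: tfun_def rmult_def)
    then show ?thesis
      using expansion_superposition[OF B hs(1) \<delta>0 sd f[unfolded a_def A_def] z] by simp
  qed
  have "Xn (trunc f) \<le> (\<Sum>i. ennreal (2 powr (\<kappa> * real (i + 1)) * \<delta> i powr \<tau>) * Xn (tfun m (\<rho> i)))"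
  proof (rule X1)
    show "trunc f \<in> borel_measurable borel" using sep_hol_trunc[OF fh] by (rule sep_hol_measurable)
    fix z :: "complex ^ 'n" assume z: "z \<in> polydisc"
    show "ennreal (norm (trunc f z)) \<le> (\<Sum>i. ennreal (\<delta> i) * ennreal (norm (tfun m (\<rho> i) z)))"
      using norm_sums_le_suminf[OF fs[OF z]] z \<delta>0 by (simp add: trunc_def norm_mult ennreal_mult)
  qed (use \<delta>0 in auto)
  also have "\<dots> \<le> (\<Sum>i. ennreal C0 * ennreal ((1 / 2) ^ Suc i))"
  proof (intro suminf_le summableI)
    fix i
    have "cube_weight (\<rho> i) (\<mu> * \<tau>) * cube_weight (\<rho> i) (- (\<mu> * \<tau>)) = 1"
      unfolding cube_weight_add[symmetric] using hs(1)[of i] by (simp add: cube_weight_def unit_cube_def less_imp_neq)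
    then have e: "2 powr (\<kappa> * real (i + 1)) * \<delta> i powr \<tau> * (C0 * cube_weight (\<rho> i) (- (\<mu> * \<tau>))) = C0 * (2 powr (\<kappa> * real (i + 1)) * \<epsilon> i powr \<tau>)"
      by (simp add: \<delta>_def powr_mult cube_weight_powr \<epsilon>0 w1)
    have "2 powr (\<kappa> * real (i + 1)) * \<epsilon> i powr \<tau> \<le> 2 powr (\<kappa> * real (i + 1)) * 2 powr (- (b * \<tau> / t * real (i + 1)))"
      using \<epsilon>a[of \<tau> i] \<tau> by (intro mult_left_mono) auto
    also have "\<dots> = 2 powr (- ((b * \<tau> / t - \<kappa>) * real (i + 1)))"
      by (simp add: powr_add[symmetric] algebra_simps)
    also have "\<dots> \<le> (1 / 2) ^ Suc i" using b(2) by (intro half) auto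
    finally have h: "2 powr (\<kappa> * real (i + 1)) * \<epsilon> i powr \<tau> \<le> (1 / 2) ^ Suc i" .
    have "ennreal (2 powr (\<kappa> * real (i + 1)) * \<delta> i powr \<tau>) * Xn (tfun m (\<rho> i))
      \<le> ennreal (2 powr (\<kappa> * real (i + 1)) * \<delta> i powr \<tau>) * ennreal (C0 * cube_weight (\<rho> i) (- (\<mu> * \<tau>)))"
      by (intro mult_left_mono X2 hs(1)) auto
    also have "\<dots> = ennreal (C0 * (2 powr (\<kappa> * real (i + 1)) * \<epsilon> i powr \<tau>))"
      using X2(1) by (subst ennreal_mult[symmetric]) (auto simp only: e w1 powr_ge_zero intro!: mult_nonneg_nonneg)
    also have "\<dots> \<le> ennreal (C0 * (1 / 2) ^ Suc i)" using h X2(1) by (intro ennreal_leI mult_left_mono)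
    also have "\<dots> = ennreal C0 * ennreal ((1 / 2) ^ Suc i)" using X2(1) by (subst ennreal_mult) auto
    finally show "ennreal (2 powr (\<kappa> * real (i + 1)) * \<delta> i powr \<tau>) * Xn (tfun m (\<rho> i)) \<le> ennreal C0 * ennreal ((1 / 2) ^ Suc i)" .
  qed
  also have "\<dots> = ennreal C0" by (simp only: ennreal_suminf_cmult suminf_half_ennreal mult_1_right)
  also have "\<dots> < top" by simp
  finally obtain h where h: "h \<in> hol_polydisc" "Fn t s \<beta> (trunc h) < top" "has_expansion h (\<lambda>k. c k * a k)"
    using X3[OF fh f] by blast
  have hst: "(\<lambda>i. of_real (\<delta> i) * G (rmult (\<rho> i) z)) sums trunc h z" if z: "z \<in> polydisc" for z
  proof -
    have "has_expansion h (\<lambda>k. (of_real (dcoeff m k) * c k) * of_real (\<Sum>i. \<delta> i * (\<Prod>j\<in>UNIV. (\<rho> i $ j) ^ k j)))"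
      using h(3) by (simp add: a_def A_def mult_ac)
    from expansion_superposition[OF G(2) hs(1) \<delta>0 sd this z] show ?thesis using z by (simp add: trunc_def)
  qed
  obtain C1 :: real where C1: "C1 \<ge> 0" "\<And>r. r \<in> unit_cube \<Longrightarrow>
    ennreal (cube_weight r (t * \<beta>)) * Jm t (trunc h) r \<le> ennreal C1 * Fn t s \<beta> (trunc h)"
    using Jm_le_Fn[OF t(1,2), where \<beta> = \<beta> and 'n = 'n] sep_hol_trunc[OF h(1)] by blast
  have "ennreal C1 * Fn t s \<beta> (trunc h) < top" using h(2) by (simp add: ennreal_mult_less_top)
  then obtain X where X: "X \<ge> 0" "ennreal C1 * Fn t s \<beta> (trunc h) = ennreal X" by (cases "ennreal C1 * Fn t s \<beta> (trunc h)") auto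
  have lt: "real i + 1 < X" for i
  proof -
    let ?S = "\<Sum>j<i. E j powr t"
    have S: "?S \<ge> 0" by (intro sum_nonneg) auto
    have "ennreal (\<delta> i powr t) * Jm t G (vsq (\<rho> i)) \<le> Jm t (trunc h) (\<rho> i) + ennreal (?S + 1)"
    proof (rule hump_estimate[OF t0 t(3)])
      show "trunc h \<in> borel_measurable borel" using sep_hol_trunc[OF h(1)] by (rule sep_hol_measurable)
      fix i j :: nat assume ij: "i < j"
      have "\<delta> j powr t \<le> \<eta> j" unfolding \<delta>t using hs(2)[of j] w1(2)[of "\<mu> * t" j] \<mu> t0 by (simp add: mult_left_le)
      then have "\<delta> j powr t * E i powr t \<le> \<eta> j * E i powr t" by (intro mult_right_mono) auto
      also have "\<dots> \<le> 2 powr (- (b * real (j + 1)))" using hs(5)[OF ij] by (simp add: E_def)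
      also have "\<dots> \<le> (1 / 2) ^ Suc j" by (rule half[OF b(1)])
      finally show "\<delta> j powr t * E i powr t \<le> (1 / 2) ^ Suc j" .
    qed (use hs(1) Eb \<delta>0 \<delta>1 hst in \<open>auto simp: E_def\<close>)
    then have "ennreal (cube_weight (\<rho> i) (t * \<beta>)) * (ennreal (\<delta> i powr t) * Jm t G (vsq (\<rho> i)))
      \<le> ennreal (cube_weight (\<rho> i) (t * \<beta>)) * (Jm t (trunc h) (\<rho> i) + ennreal (?S + 1))"
      by (intro mult_left_mono) auto
    also have "\<dots> = ennreal (cube_weight (\<rho> i) (t * \<beta>)) * Jm t (trunc h) (\<rho> i) + ennreal (cube_weight (\<rho> i) (t * \<beta>)) * ennreal (?S + 1)"
      by (rule distrib_left)
    also have "\<dots> \<le> ennreal X + 1 * ennreal (?S + 1)"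
    proof (intro add_mono mult_right_mono)
      show "ennreal (cube_weight (\<rho> i) (t * \<beta>)) * Jm t (trunc h) (\<rho> i) \<le> ennreal X" using C1(2)[OF hs(1)] X(2) by simp
      show "ennreal (cube_weight (\<rho> i) (t * \<beta>)) \<le> 1" using w1(2)[of "t * \<beta>" i] t0 \<beta> by simp
    qed simp
    also have "\<dots> = ennreal (X + (?S + 1))" using X(1) S by (simp del: ennreal_plus add: ennreal_plus[symmetric])
    finally have u: "ennreal (cube_weight (\<rho> i) (t * \<beta>)) * (ennreal (\<delta> i powr t) * Jm t G (vsq (\<rho> i))) \<le> ennreal (X + (?S + 1))" .
    \<comment> \<open>Here \<open>\<sigma> = \<mu> + \<beta>\<close> enters: the normalization and
      the growth weight of the target combine to the weight in \<open>\<Lambda>\<close>.\<close>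
    have w: "cube_weight (\<rho> i) (t * \<beta>) * \<delta> i powr t = \<eta> i * cube_weight (\<rho> i) (\<sigma> * t)"
      unfolding \<delta>t \<mu>(2) distrib_right cube_weight_add by (simp add: mult_ac)
    have "ennreal (cube_weight (\<rho> i) (t * \<beta>)) * (ennreal (\<delta> i powr t) * Jm t G (vsq (\<rho> i))) = ennreal (cube_weight (\<rho> i) (t * \<beta>) * \<delta> i powr t) * Jm t G (vsq (\<rho> i))"
      by (simp add: ennreal_mult w1 mult.assoc)
    also have "\<dots> = ennreal (\<eta> i) * \<Lambda> (\<rho> i)"
      unfolding w using hs(2)[of i] by (simp add: \<Lambda>_def ennreal_mult w1 mult.assoc)
    \<comment> \<open>The accumulated sizes \<open>?S\<close> of the earlier humps cancel, so
      \<open>i + 1 < X\<close> holds for every \<open>i\<close>.\<close>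
    finally have "ennreal (real i + ?S + 2) < ennreal (X + (?S + 1))"
      using u hs(4)[of i] unfolding E_def by simp
    then have "real i + ?S + 2 < X + (?S + 1)" using S by (subst (asm) ennreal_less_iff) auto
    then show ?thesis by simp
  qed
  obtain i where "X \<le> real i" using real_arch_simple by blast
  with lt[of i] show False by simp
qed

section \<open>Both directions for the two source spaces\<close>

lemma cube_weight_inverse: "r \<in> unit_cube \<Longrightarrow> cube_weight r (- g) * cube_weight r g = 1"
  unfolding cube_weight_add[symmetric] by (simp add: cube_weight_def unit_cube_def less_imp_neq)

lemma SUP_weight_finite_iff:
  fixes J :: "real ^ 'n::finite \<Rightarrow> ennreal"
  assumes t: "t > 0"
  shows "(SUP r\<in>unit_cube. ennpowr (J r) (1 / t) * ennreal (cube_weight r \<sigma>)) < \<infinity>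
    \<longleftrightarrow> (\<exists>L\<ge>0. \<forall>y\<in>unit_cube. J y \<le> ennreal (L * cube_weight y (- (\<sigma> * t))))"
    (is "?S < \<infinity> \<longleftrightarrow> ?R")
proof
  assume "?S < \<infinity>"
  then obtain M where M: "M \<ge> 0" "?S = ennreal M" by (cases ?S) auto
  have "J y \<le> ennreal (M powr t * cube_weight y (- (\<sigma> * t)))" if y: "y \<in> unit_cube" for y
  proof -
    have "ennpowr (J y) (1 / t) * ennreal (cube_weight y \<sigma>) \<le> ennreal M"
      unfolding M(2)[symmetric] by (rule SUP_upper[OF y])
    then have "ennpowr (ennpowr (J y) (1 / t) * ennreal (cube_weight y \<sigma>)) t \<le> ennpowr (ennreal M) t"
      using t by (intro ennpowr_mono) auto
    then have le: "J y * ennreal (cube_weight y (\<sigma> * t)) \<le> ennreal (M powr t)"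
      using t M(1) by (simp add: ennpowr_mult ennpowr_ennpowr ennpowr_ennreal cube_weight_nonneg cube_weight_powr)
    have "J y = ennreal (cube_weight y (- (\<sigma> * t)) * cube_weight y (\<sigma> * t)) * J y"
      by (simp add: cube_weight_inverse[OF y])
    also have "\<dots> = ennreal (cube_weight y (- (\<sigma> * t))) * (J y * ennreal (cube_weight y (\<sigma> * t)))"
      by (simp add: ennreal_mult cube_weight_nonneg mult_ac)
    also have "\<dots> \<le> ennreal (cube_weight y (- (\<sigma> * t))) * ennreal (M powr t)"
      by (intro mult_left_mono le) simp
    also have "\<dots> = ennreal (M powr t * cube_weight y (- (\<sigma> * t)))"
      by (simp add: ennreal_mult cube_weight_nonneg mult.commute)
    finally show ?thesis .
  qed
  then show ?R by (intro exI[of _ "M powr t"]) auto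
next
  assume ?R
  then obtain L where L: "L \<ge> 0" "\<And>y. y \<in> unit_cube \<Longrightarrow> J y \<le> ennreal (L * cube_weight y (- (\<sigma> * t)))" by blast
  have "?S \<le> ennreal (L powr (1 / t))"
  proof (rule SUP_least)
    fix y :: "real ^ 'n" assume y: "y \<in> unit_cube"
    have "ennpowr (J y) (1 / t) * ennreal (cube_weight y \<sigma>) \<le> ennpowr (ennreal (L * cube_weight y (- (\<sigma> * t)))) (1 / t) * ennreal (cube_weight y \<sigma>)"
      using t by (intro mult_right_mono ennpowr_mono L(2) y) auto
    also have "\<dots> = ennreal (L powr (1 / t) * cube_weight y (- \<sigma>)) * ennreal (cube_weight y \<sigma>)"
      using t L(1) by (simp add: ennpowr_ennreal cube_weight_nonneg powr_mult cube_weight_powr)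
    also have "\<dots> = ennreal (L powr (1 / t) * (cube_weight y (- \<sigma>) * cube_weight y \<sigma>))"
      by (simp add: ennreal_mult cube_weight_nonneg mult.assoc)
    finally show "ennpowr (J y) (1 / t) * ennreal (cube_weight y \<sigma>) \<le> ennreal (L powr (1 / t))"
      by (simp add: cube_weight_inverse[OF y])
  qed
  then show "?S < \<infinity>" using ennreal_less_top le_less_trans by fastforce
qed

text \<open>\<open>u\<close> is the summation exponent obtained from the source: \<open>q\<close>
  for \<open>A\<close>, and also for \<open>F\<close> when \<open>p \<le> q\<close>;
  \<open>p\<close> for \<open>F\<close> when \<open>q < p\<close>.\<close>

lemma multiplier_sufficiency:
  fixes G f :: "complex ^ 'n::finite \<Rightarrow> complex"
  assumes G: "sep_hol G" "has_expansion G (\<lambda>k. of_real (dcoeff m k) * c k)" and c: "psum c"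
    and f: "f \<in> hol_polydisc" "has_expansion f a"
    and t: "0 < t" "t \<le> 1" and s: "0 < s" "s \<le> t" and \<beta>: "\<beta> > 0"
    and p: "0 < p" "p \<le> t" and u: "0 < u" "u \<le> s" and m: "real m > 2 / t - 1"
    and \<sigma>: "\<sigma> = real m + 1 - 1 / p + \<beta> - \<alpha>" "\<sigma> \<ge> 0"
    and L: "L \<ge> 0" "\<And>y. y \<in> unit_cube \<Longrightarrow> Jm t G y \<le> ennreal (L * cube_weight y (- (\<sigma> * t)))"
    and fin: "Sm (\<lambda>i. ennpowr (Jm p (trunc f) (dr (\<lambda>j. i j + 5))) (u / p) * ennreal (dw (- (\<alpha> * u)) i)) < top"
  shows "\<exists>h\<in>hol_polydisc. Fn t s \<beta> (trunc h) < top \<and> has_expansion h (\<lambda>k. c k * a k)"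
proof -
  define h where "h = (\<lambda>z. \<Sum>\<^sub>\<infinity>k. (c k * a k) * vmonom k z)"
  have h: "has_expansion h (\<lambda>k. c k * a k)"
    unfolding h_def by (rule psum_imp_has_expansion[OF psum_mult[OF has_expansion_imp_psum[OF f(2)] c]])
  have hh: "h \<in> hol_polydisc" by (rule has_expansion_imp_hol_polydisc[OF h])
  note sh = sep_hol_trunc[OF hh]
  have "1 / t \<ge> 1" using t by simp
  then have m1: "m \<ge> 1" "real m + 1 - 1 / t > 0" using m by auto
  \<comment> \<open>The exponent \<open>\<sigma>\<close> is the one for which the weight required by
    \<open>dyadic_multiplier\<close> is the weight delivered by
    \<open>dyadic_embedding\<close>.\<close>
  have E: "real m + 1 - 1 / t + \<beta> - \<sigma> = \<alpha> + 1 / p - 1 / t" using \<sigma>(1) by simp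
  have "Sm (\<lambda>i. ennpowr (Jm t (trunc f) (dr (\<lambda>j. i j + 4))) (s / t) * ennreal (dw (- ((\<alpha> + 1 / p - 1 / t) * s)) i)) < top"
    by (rule dyadic_embedding[OF sep_hol_trunc[OF f(1)] p u fin])
  then have fin4: "Sm (\<lambda>i. ennpowr (Jm t (trunc f) (dr (\<lambda>j. i j + 4))) (s / t) * ennreal (dw (- ((real m + 1 - 1 / t + \<beta> - \<sigma>) * s)) i)) < top"
    by (simp only: E)
  have ft: "has_expansion (trunc f) a" using f(2) by (simp add: has_expansion_def trunc_def)
  have ht: "has_expansion (trunc h) (\<lambda>k. c k * a k)" using h by (simp add: has_expansion_def trunc_def)
  have "Sm (\<lambda>l. ennpowr (Jm t (trunc h) (dr (\<lambda>j. l j + 1))) (s / t) * ennreal (dw (- (\<beta> * s)) l)) < top"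
    by (rule dyadic_multiplier[OF sep_hol_trunc[OF f(1)] ft G ht t s m1 \<beta> \<sigma>(2) L fin4])
  then have "An t s \<beta> (trunc h) < top" by (rule dyadic_imp_An[OF sh t(1) s(1)])
  then have "ennpowr (An t s \<beta> (trunc h)) (t / s) < top" by simp
  with Fn_le_minkowski[OF sep_hol_measurable[OF sh] s] have "Fn t s \<beta> (trunc h) < top" by (rule le_less_trans)
  then show ?thesis using hh h by blast
qed

lemma multiplier_iff:
  fixes Xn :: "(complex ^ 'n::finite \<Rightarrow> complex) \<Rightarrow> ennreal"
  assumes X: "X = {f \<in> hol_polydisc. Xn (trunc f) < top}"
  shows "c \<in> coeff_multipliers X (F_space t s \<beta>) \<longleftrightarrow>
    (\<forall>f a. f \<in> hol_polydisc \<longrightarrow> has_expansion f a \<longrightarrow> Xn (trunc f) < top \<longrightarrow>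
      (\<exists>h\<in>hol_polydisc. Fn t s \<beta> (trunc h) < top \<and> has_expansion h (\<lambda>k. c k * a k)))"
  unfolding coeff_multipliers_def F_space_def X by (auto simp: F_norm_pow_eq) (metis F_norm_pow_eq)+

theorem theorem2:
  fixes g :: "complex ^ 'n::finite \<Rightarrow> complex"
    and c :: "('n \<Rightarrow> nat) \<Rightarrow> complex"
    and \<alpha> \<beta> p q s t :: real and m :: nat
  assumes "g \<in> hol_polydisc" and "has_expansion g c"
    and "\<alpha> > 0" and "\<beta> > 0"
    and "p > 0" and "q > 0" and "s > 0" and "t > 0"
    and "t \<le> 1" and "t / 2 < s" and "s \<le> t" and "max p q \<le> s"
    and "\<beta> + 1 / t < \<alpha> + 1 / p" and "\<alpha> + 1 / p < 2 / t"
    and "real m > 2 / t - 1"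
  shows
    "(c \<in> coeff_multipliers (F_space p q \<alpha>) (F_space t s \<beta>) \<longleftrightarrow>
        (SUP r\<in>unit_cube. int_mean t (frac_deriv (real m) g) r
           * ennreal (cube_weight r (real m + 1 - 1 / p + \<beta> - \<alpha>))) < \<infinity>)
     \<and>
     (c \<in> coeff_multipliers (A_space p q \<alpha>) (F_space t s \<beta>) \<longleftrightarrow>
        (SUP r\<in>unit_cube. int_mean t (frac_deriv (real m) g) r
           * ennreal (cube_weight r (real m + 1 - 1 / p + \<beta> - \<alpha>))) < \<infinity>)"
proof -
  define D where "D = frac_deriv (real m) g"
  define G where "G = trunc D"
  define \<mu> where "\<mu> = real m + 1 - \<alpha> - 1 / p"
  define \<sigma> where "\<sigma> = real m + 1 - 1 / p + \<beta> - \<alpha>"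
  note c = \<open>has_expansion g c\<close> and pos = \<open>\<alpha> > 0\<close> \<open>\<beta> > 0\<close> \<open>p > 0\<close> \<open>q > 0\<close> \<open>s > 0\<close> \<open>t > 0\<close>
  have pq: "p \<le> s" "q \<le> s" "p \<le> t" "q \<le> t" using assms by auto
  \<comment> \<open>Both \<open>m + 1 > 2 / t\<close> and \<open>2 / t > \<alpha> + 1 / p\<close>
    are used; the strict inequality is what the kernel estimates require.\<close>
  have M: "real m + 1 > \<alpha> + 1 / p" using assms by linarith
  have \<mu>: "\<mu> \<ge> 0" "\<sigma> = \<mu> + \<beta>" using M by (auto simp: \<mu>_def \<sigma>_def)
  then have \<sigma>0: "\<sigma> \<ge> 0" using pos by simp
  have D: "has_expansion D (\<lambda>k. of_real (dcoeff m k) * c k)" unfolding D_def by (rule frac_deriv_expansion[OF c])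
  have Dh: "D \<in> hol_polydisc" by (rule has_expansion_imp_hol_polydisc[OF D])
  have G: "sep_hol G" "has_expansion G (\<lambda>k. of_real (dcoeff m k) * c k)"
    using D sep_hol_trunc[OF Dh] by (simp_all add: G_def has_expansion_def trunc_def)
  define R where "R \<longleftrightarrow> (\<exists>L\<ge>0. \<forall>y\<in>unit_cube. Jm t G y \<le> ennreal (L * cube_weight y (- (\<sigma> * t))))"
  have sup: "(SUP r\<in>unit_cube. int_mean t (frac_deriv (real m) g) r
           * ennreal (cube_weight r (real m + 1 - 1 / p + \<beta> - \<alpha>))) < \<infinity> \<longleftrightarrow> R"
  proof -
    have "(SUP r\<in>unit_cube. int_mean t (frac_deriv (real m) g) r * ennreal (cube_weight r (real m + 1 - 1 / p + \<beta> - \<alpha>)))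
      = (SUP r\<in>unit_cube. ennpowr (Jm t G r) (1 / t) * ennreal (cube_weight r \<sigma>))"
      by (intro SUP_cong refl) (simp add: int_mean_eq[OF Dh, unfolded D_def] G_def D_def \<sigma>_def)
    then show ?thesis unfolding R_def by (simp only: SUP_weight_finite_iff[OF pos(6)])
  qed
  have FX: "F_space p q \<alpha> = {f \<in> hol_polydisc. Fn p q \<alpha> (trunc f) < top}"
    unfolding F_space_def by (auto simp: F_norm_pow_eq)
  have AX: "A_space p q \<alpha> = {f \<in> hol_polydisc. An p q \<alpha> (trunc f) < top}"
    unfolding A_space_def using pos by (auto simp: A_norm_pow_eq)
  have suff: "\<exists>h\<in>hol_polydisc. Fn t s \<beta> (trunc h) < top \<and> has_expansion h (\<lambda>k. c k * a k)"
    if R "f \<in> hol_polydisc" "has_expansion f a" "0 < u" "u \<le> s"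
      "Sm (\<lambda>i. ennpowr (Jm p (trunc f) (dr (\<lambda>j. i j + 5))) (u / p) * ennreal (dw (- (\<alpha> * u)) i)) < top" for f a u
    using \<open>R\<close> unfolding R_def
    by (elim exE conjE) (rule multiplier_sufficiency[OF G has_expansion_imp_psum[OF c] that(2,3) pos(6) \<open>t \<le> 1\<close> pos(5) \<open>s \<le> t\<close> pos(2,3) pq(3) that(4,5) assms(15) \<sigma>_def \<sigma>0 _ _ that(6)], auto)
  have suffA: "\<exists>h\<in>hol_polydisc. Fn t s \<beta> (trunc h) < top \<and> has_expansion h (\<lambda>k. c k * a k)"
    if "R" "f \<in> hol_polydisc" "has_expansion f a" "An p q \<alpha> (trunc f) < top" for f a
    by (rule suff[OF that(1-3) pos(4) pq(2) An_imp_dyadic[OF sep_hol_trunc[OF that(2)] pos(3,4) that(4)]])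
  have suffF: "\<exists>h\<in>hol_polydisc. Fn t s \<beta> (trunc h) < top \<and> has_expansion h (\<lambda>k. c k * a k)"
    if "R" "f \<in> hol_polydisc" "has_expansion f a" "Fn p q \<alpha> (trunc f) < top" for f a
  \<comment> \<open>For \<open>p \<le> q\<close> Minkowski embeds \<open>F^{p,q}\<close> in
    \<open>A^{p,q}\<close>; otherwise Minkowski points the other way, and the averages over Whitney
    boxes lead to \<open>A^{p,p}\<close> instead.\<close>
  proof (cases "p \<le> q")
    case True
    have "An p q \<alpha> (trunc f) \<le> ennpowr (Fn p q \<alpha> (trunc f)) (q / p)"
      by (rule An_le_minkowski[OF sep_hol_measurable[OF sep_hol_trunc[OF that(2)]] pos(3) True])
    also have "\<dots> < top" using that(4) by simp
    finally show ?thesis by (rule suffA[OF that(1-3)])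
  next
    case False
    then show ?thesis
      by (intro suff[OF that(1-3) pos(3) pq(1)] Fn_imp_dyadic[OF sep_hol_trunc[OF that(2)] pos(4) _ that(4)]) simp
  qed
  have \<mu>': "(\<alpha> + 1 / p - (real m + 1)) * x = - (\<mu> * x)" for x by (simp add: \<mu>_def algebra_simps)
  have necA: R if X3: "\<And>f a. f \<in> hol_polydisc \<Longrightarrow> has_expansion f a \<Longrightarrow> An p q \<alpha> (trunc f) < top \<Longrightarrow>
      \<exists>h\<in>hol_polydisc. Fn t s \<beta> (trunc h) < top \<and> has_expansion h (\<lambda>k. c k * a k)"
  proof -
    obtain C0 :: real where C0: "C0 \<ge> 0" "\<And>\<rho> :: real ^ 'n. \<rho> \<in> unit_cube \<Longrightarrow> An p q \<alpha> (tfun m \<rho>) \<le> ennreal (C0 * cube_weight \<rho> (- (\<mu> * q)))"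
      using An_tfun_le[OF pos(3,4) M pos(1), where 'n = 'n] unfolding \<mu>' by blast
    show ?thesis unfolding R_def
      by (rule gliding_hump[OF G pos(5) \<open>s \<le> t\<close> \<open>t \<le> 1\<close> pos(2) \<mu> pos(4) _ An_suminf_le[OF pos(3,4)] C0 X3]) (use pos in auto)
  qed
  have necF: R if X3: "\<And>f a. f \<in> hol_polydisc \<Longrightarrow> has_expansion f a \<Longrightarrow> Fn p q \<alpha> (trunc f) < top \<Longrightarrow>
      \<exists>h\<in>hol_polydisc. Fn t s \<beta> (trunc h) < top \<and> has_expansion h (\<lambda>k. c k * a k)"
  proof -
    obtain C0 :: real where C0: "C0 \<ge> 0" "\<And>\<rho> :: real ^ 'n. \<rho> \<in> unit_cube \<Longrightarrow> Fn p q \<alpha> (tfun m \<rho>) \<le> ennreal (C0 * cube_weight \<rho> (- (\<mu> * p)))"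
      using Fn_tfun_le[OF pos(3,4) M pos(1), where 'n = 'n] unfolding \<mu>' by blast
    show ?thesis unfolding R_def
      by (rule gliding_hump[OF G pos(5) \<open>s \<le> t\<close> \<open>t \<le> 1\<close> pos(2) \<mu> pos(3) _ Fn_suminf_le[OF pos(3,4)] C0 X3]) (use pos in auto)
  qed
  show ?thesis
    unfolding sup multiplier_iff[OF FX] multiplier_iff[OF AX]
    using suffA suffF necA necF by blast
qed

end
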